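(* Let $k,n$ be integers with $0<k<n$ and $n>3$, let $D,D'$ be configurations of $n$ unlabeled dots in general position in the round sphere $S$, and let $D(t)$ be a semigeneral family from $D$ to $D'$ which is in general position except at one value of $t$. Then the $k$th order Voronoi decompositions of $D$ and $D'$ (regarded as bicolored graphs embedded in the sphere) are related by either 1. one of the local moves (W), (Sq), (B); or 2. two of the local moves (W), (Sq), (B), applied in a pair of antipodal circles (that is, one move is applied inside a circle and the other inside the image of that circle under the antipodal map $\sigma:S\to S$).
   Context: Dots are points of a finite subset of the sphere $S$; they are in general position if no four of them lie on a circle (a circle in $S$ is the intersection of $S$ with a plane meeting it in more than one point). A semigeneral family from $D$ to $D'$ is a continuous path $D(t)$ of configurations of $n$ distinct unlabeled points in $S$, from $D$ to $D'$, such that $D(t)$ is in general position for all but finitely many $t$ and, for all $t$, at most one quadruple of the dots of $D(t)$ is cocircular. Voronoi strata. Let $\operatorname{dist}$ be geodesic distance. For a set $D$ of $n$ dots and $p\in S$, index the dots so that $\operatorname{dist}(p,d_1)\le\cdots\le\operatorname{dist}(p,d_n)$ and put $D_-(p)=\{d\in D:\operatorname{dist}(p,d)\le\operatorname{dist}(p,d_k)\}$ and $D_+(p)=\{d\in D:\operatorname{dist}(p,d)\ge\operatorname{dist}(p,d_{k+1})\}$. A (closed) $k$th order Voronoi stratum is a subset of $S$ of the form $V=\{q\in S: D_-(p)\subseteq D_-(q),\ D_+(p)\subseteq D_+(q)\}$ for some $p\in S$, with $D_\pm(V):=D_\pm(p)$; the strata collectively form the $k$th order Voronoi decomposition. For $D$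 in general position with $n>3$, each stratum is a region (spherical polygon), an edge (great circular arc) or a vertex (point) according to whether $|D_-(V)\cap D_+(V)|$ is $0,2,3$. Coloring. An oriented circle in $S$ has a left side and a right side; its left center is the one of its two (antipodal) centers on $S$ lying on its left side. Each vertex is the left center of an oriented circle through three dots with either $k-2$ dots on its left side (white vertex) or $k-1$ dots on its left side (black vertex). The vertices and edges form a 3-regular bicolored graph embedded in $S$. Bicolored graphs in the sphere are considered up to color-preserving deformation (isotopy) of the sphere. Local moves. Each move changes the bicolored graph only inside a circle which is crossed transversally by exactly four edges, at points $p_1,p_2,p_3,p_4$ in cyclic order, and is allowed in both directions. (W) Inside the circle the graph has exactly two vertices $u,v$, both white, joined by an edge, with $u$ joined to $p_1,p_2$ and $v$ joined to $p_3,p_4$; replace this by two white vertices $u',v'$ joined by an edge, with $u'$ joined to $p_2,p_3$ and $v'$ joined to $p_4,p_1$. (B) The same as (W) with all vertices black. (Sq) Inside the circle the graph has exactly four vertices $v_1,v_2,v_3,v_4$ forming a 4-cycle in this cyclic order, with $v_i$ joined to $p_i$ and with colors alternating around the cycle; replace this by the same graph with the colors of all four vertices swapped.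
   Formalization: A third alternative is added: the labelled kth order decomposition does not change along D(t), up to isotopy, as when D(t) touches the exceptional position and returns, or the circle is not visible at order k; the claim as stated fails there. Antipodal circles are taken with disjoint insides. *)

theory Defs
  imports "HOL-Analysis.Analysis" "HOL-Library.Multiset"
begin

type_synonym point = "real ^ 3"

abbreviation S2 :: "point set" where
  "S2 \<equiv> sphere 0 1"


section \<open>Dots, circles, general position\<close>

definition is_circle :: "point set \<Rightarrow> bool" where
  "is_circle C \<longleftrightarrow>
     (\<exists>a b. a \<noteq> 0 \<and> C = {x \<in> S2. a \<bullet> x = b} \<and> (\<exists>x\<in>C. \<exists>y\<in>C. x \<noteq> y))"

definition cocircular :: "point set \<Rightarrow> bool" where
  "cocircular Q \<longleftrightarrow> (\<exists>C. is_circle C \<and> Q \<subseteq> C)"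

definition cocircular_quadruples :: "point set \<Rightarrow> point set set" where
  "cocircular_quadruples D = {Q. Q \<subseteq> D \<and> card Q = 4 \<and> cocircular Q}"

definition configuration :: "nat \<Rightarrow> point set \<Rightarrow> bool" where
  "configuration n D \<longleftrightarrow> D \<subseteq> S2 \<and> finite D \<and> card D = n"

definition general_position :: "point set \<Rightarrow> bool" where
  "general_position D \<longleftrightarrow> cocircular_quadruples D = {}"

text \<open>
  Continuity refers to the usual topology on the space of unlabeled configurations (the quotient
  of the space of labeled configurations by the symmetric group): the configurations near
  \<open>F t\<close> are those obtained by moving each of its points by less than some small \<open>e\<close>.
\<close>

definition configuration_path :: "nat \<Rightarrow> (real \<Rightarrow> point set) \<Rightarrow> bool" where
  "configuration_path n F \<longleftrightarrow>
     (\<forall>t\<in>{0..1}. configuration n (F t)) \<and>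
     (\<forall>t\<in>{0..1}. \<forall>e>0. \<exists>d>0. \<forall>s\<in>{0..1}. \<bar>s - t\<bar> < d \<longrightarrow>
        (\<exists>f. bij_betw f (F t) (F s) \<and> (\<forall>x\<in>F t. dist x (f x) < e)))"

definition semigeneral_family ::
    "nat \<Rightarrow> (real \<Rightarrow> point set) \<Rightarrow> point set \<Rightarrow> point set \<Rightarrow> bool" where
  "semigeneral_family n F D D' \<longleftrightarrow>
     configuration_path n F \<and> F 0 = D \<and> F 1 = D' \<and>
     finite {t \<in> {0..1}. \<not> general_position (F t)} \<and>
     (\<forall>t\<in>{0..1}. \<forall>Q \<in> cocircular_quadruples (F t). \<forall>Q' \<in> cocircular_quadruples (F t). Q = Q')"


section \<open>Bicolored graphs embedded in the sphere\<close>

text \<open>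
  An embedded graph is given by its white vertices, its black vertices and its skeleton (the union
  of all vertices and closed edges). The open edges are recovered as the connected components of
  the skeleton minus the vertices, so no information is lost.
\<close>

record bigraph =
  white :: "point set"
  black :: "point set"
  skel :: "point set"

definition open_edges :: "bigraph \<Rightarrow> point set set" where
  "open_edges G = components (skel G - (white G \<union> black G))"

definition isotopy_of_sphere :: "(real \<Rightarrow> point \<Rightarrow> point) \<Rightarrow> bool" where
  "isotopy_of_sphere H \<longleftrightarrow>
     continuous_on ({0..1} \<times> S2) (\<lambda>(t, x). H t x) \<and>
     (\<forall>t\<in>{0..1}. \<exists>g. homeomorphism S2 S2 (H t) g) \<and>
     (\<forall>x\<in>S2. H 0 x = x)"

definition isotopic :: "bigraph \<Rightarrow> bigraph \<Rightarrow> bool" where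
  "isotopic G G' \<longleftrightarrow>
     (\<exists>H. isotopy_of_sphere H \<and>
        H 1 ` white G = white G' \<and> H 1 ` black G = black G' \<and> H 1 ` skel G = skel G')"


section \<open>The Voronoi decomposition of order k\<close>

definition gdist :: "point \<Rightarrow> point \<Rightarrow> real" where
  \<comment> \<open>geodesic distance on the unit sphere: the angle between the two vectors\<close>
  "gdist x y = arccos (x \<bullet> y)"

definition sorted_gdists :: "point set \<Rightarrow> point \<Rightarrow> real list" where
  "sorted_gdists D p = sorted_list_of_multiset (image_mset (gdist p) (mset_set D))"

text \<open>List positions start at 0: entry \<open>k - 1\<close> is the distance to the \<open>k\<close>-th nearest dot.\<close>

definition D_minus :: "nat \<Rightarrow> point set \<Rightarrow> point \<Rightarrow> point set" where
  "D_minus k D p = {d \<in> D. gdist p d \<le> sorted_gdists D p ! (k - 1)}"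

definition D_plus :: "nat \<Rightarrow> point set \<Rightarrow> point \<Rightarrow> point set" where
  "D_plus k D p = {d \<in> D. gdist p d \<ge> sorted_gdists D p ! k}"

definition stratum :: "nat \<Rightarrow> point set \<Rightarrow> point \<Rightarrow> point set" where
  "stratum k D p =
     {q \<in> S2. D_minus k D p \<subseteq> D_minus k D q \<and> D_plus k D p \<subseteq> D_plus k D q}"

definition voronoi_edges :: "nat \<Rightarrow> point set \<Rightarrow> point set set" where
  "voronoi_edges k D =
     {stratum k D p |p. p \<in> S2 \<and> card (D_minus k D p \<inter> D_plus k D p) = 2}"

definition voronoi_vertices :: "nat \<Rightarrow> point set \<Rightarrow> point set" where
  "voronoi_vertices k D =
     {v. \<exists>p\<in>S2. card (D_minus k D p \<inter> D_plus k D p) = 3 \<and> stratum k D p = {v}}"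

text \<open>
  A pair \<open>(c, h)\<close> with \<open>norm c = 1\<close> and \<open>-1 < h < 1\<close> encodes an oriented circle
  \<open>{x \<in> S2. c \<bullet> x = h}\<close>: its left side is \<open>{x \<in> S2. c \<bullet> x > h}\<close> and its left center
  is \<open>c\<close>. Its image under the antipodal map is encoded by \<open>(-c, h)\<close>.
\<close>

definition oriented_circle :: "point \<Rightarrow> real \<Rightarrow> bool" where
  "oriented_circle c h \<longleftrightarrow> norm c = 1 \<and> -1 < h \<and> h < 1"

definition rim :: "point \<Rightarrow> real \<Rightarrow> point set" where
  "rim c h = {x \<in> S2. c \<bullet> x = h}"

definition left_side :: "point \<Rightarrow> real \<Rightarrow> point set" where
  "left_side c h = {x \<in> S2. c \<bullet> x > h}"

text \<open>\<open>left_center_with D j v\<close>: \<open>v\<close> is the left center of an oriented circle through three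
  dots having exactly \<open>j\<close> dots on its left side.\<close>

definition left_center_with :: "point set \<Rightarrow> nat \<Rightarrow> point \<Rightarrow> bool" where
  "left_center_with D j v \<longleftrightarrow>
     (\<exists>h T. oriented_circle v h \<and> T \<subseteq> D \<and> card T = 3 \<and> T \<subseteq> rim v h \<and>
        card (D \<inter> left_side v h) = j)"

text \<open>The guard \<open>k \<ge> 2\<close> prevents truncated subtraction: there are no white vertices if
  \<open>k = 1\<close>.\<close>

definition voronoi :: "nat \<Rightarrow> point set \<Rightarrow> bigraph" where
  "voronoi k D =
     \<lparr> white = {v \<in> voronoi_vertices k D. k \<ge> 2 \<and> left_center_with D (k - 2) v},
       black = {v \<in> voronoi_vertices k D. left_center_with D (k - 1) v},
       skel = voronoi_vertices k D \<union> \<Union> (voronoi_edges k D) \<rparr>"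


section \<open>Local moves\<close>

text \<open>
  Moves take place inside the circle encoded by \<open>(c, h)\<close>, i.e. on its left side.
\<close>

definition in_cyclic_order :: "point \<Rightarrow> real \<Rightarrow> point list \<Rightarrow> bool" where
  "in_cyclic_order c h ps \<longleftrightarrow>
     (\<exists>\<gamma> ts. simple_path \<gamma> \<and> pathfinish \<gamma> = pathstart \<gamma> \<and> path_image \<gamma> = rim c h \<and>
        sorted_wrt (<) ts \<and> set ts \<subseteq> {0..<1} \<and> ps = map \<gamma> ts)"

definition crosses_transversally :: "point \<Rightarrow> real \<Rightarrow> point set \<Rightarrow> point \<Rightarrow> bool" where
  \<comment> \<open>the curve \<open>e\<close> passes at \<open>p\<close> from the inside to the outside of the circle\<close>
  "crosses_transversally c h e p \<longleftrightarrow>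
     (\<exists>g s. arc g \<and> path_image g \<subseteq> e \<and> s \<in> {0<..<1} \<and> g s = p \<and>
        (\<forall>t\<in>{0..<s}. c \<bullet> g t > h) \<and> c \<bullet> p = h \<and> (\<forall>t\<in>{s<..1}. c \<bullet> g t < h))"

definition crossed_by_four_edges :: "point \<Rightarrow> real \<Rightarrow> bigraph \<Rightarrow> point list \<Rightarrow> bool" where
  "crossed_by_four_edges c h G ps \<longleftrightarrow>
     length ps = 4 \<and> in_cyclic_order c h ps \<and> skel G \<inter> rim c h = set ps \<and>
     (\<exists>es. length es = 4 \<and> distinct es \<and> set es \<subseteq> open_edges G \<and>
        (\<forall>i<4. ps ! i \<in> es ! i \<and> crosses_transversally c h (es ! i) (ps ! i)))"

definition unchanged_outside :: "point \<Rightarrow> real \<Rightarrow> bigraph \<Rightarrow> bigraph \<Rightarrow> bool" where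
  "unchanged_outside c h G G' \<longleftrightarrow>
     white G - left_side c h = white G' - left_side c h \<and>
     black G - left_side c h = black G' - left_side c h \<and>
     skel G - left_side c h = skel G' - left_side c h"

text \<open>
  \<open>drawn_inside c h X es\<close>: the part of \<open>X\<close> on or inside the circle is the union of arcs, one
  joining the two points of each pair in the list \<open>es\<close>, and any two of these arcs meet only in
  common endpoints.
\<close>

definition drawn_inside ::
    "point \<Rightarrow> real \<Rightarrow> point set \<Rightarrow> (point \<times> point) list \<Rightarrow> bool" where
  "drawn_inside c h X es \<longleftrightarrow>
     (\<exists>\<gamma> :: nat \<Rightarrow> real \<Rightarrow> point.
        X \<inter> (left_side c h \<union> rim c h) = (\<Union>i<length es. path_image (\<gamma> i)) \<and>
        (\<forall>i<length es. arc (\<gamma> i) \<and> (pathstart (\<gamma> i), pathfinish (\<gamma> i)) = es ! i) \<and>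
        (\<forall>i<length es. \<forall>j<length es. i \<noteq> j \<longrightarrow>
           path_image (\<gamma> i) \<inter> path_image (\<gamma> j) \<subseteq>
             {pathstart (\<gamma> i), pathfinish (\<gamma> i)} \<inter> {pathstart (\<gamma> j), pathfinish (\<gamma> j)}))"

definition flip_move ::
    "(bigraph \<Rightarrow> point set) \<Rightarrow> (bigraph \<Rightarrow> point set) \<Rightarrow>
      point \<Rightarrow> real \<Rightarrow> bigraph \<Rightarrow> bigraph \<Rightarrow> bool" where
  "flip_move col other c h G G' \<longleftrightarrow>
     unchanged_outside c h G G' \<and>
     (\<exists>p1 p2 p3 p4 u v u' v'.
        crossed_by_four_edges c h G [p1, p2, p3, p4] \<and>
        crossed_by_four_edges c h G' [p1, p2, p3, p4] \<and>
        u \<noteq> v \<and> col G \<inter> left_side c h = {u, v} \<and> other G \<inter> left_side c h = {} \<and>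
        drawn_inside c h (skel G) [(u, v), (u, p1), (u, p2), (v, p3), (v, p4)] \<and>
        u' \<noteq> v' \<and> col G' \<inter> left_side c h = {u', v'} \<and> other G' \<inter> left_side c h = {} \<and>
        drawn_inside c h (skel G') [(u', v'), (u', p2), (u', p3), (v', p4), (v', p1)])"

definition move_W :: "point \<Rightarrow> real \<Rightarrow> bigraph \<Rightarrow> bigraph \<Rightarrow> bool" where
  "move_W = flip_move white black"

definition move_B :: "point \<Rightarrow> real \<Rightarrow> bigraph \<Rightarrow> bigraph \<Rightarrow> bool" where
  "move_B = flip_move black white"

definition move_Sq :: "point \<Rightarrow> real \<Rightarrow> bigraph \<Rightarrow> bigraph \<Rightarrow> bool" where
  "move_Sq c h G G' \<longleftrightarrow>
     unchanged_outside c h G G' \<and> skel G' = skel G \<and>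
     (\<exists>p1 p2 p3 p4 v1 v2 v3 v4.
        crossed_by_four_edges c h G [p1, p2, p3, p4] \<and>
        distinct [v1, v2, v3, v4] \<and>
        drawn_inside c h (skel G)
          [(v1, v2), (v2, v3), (v3, v4), (v4, v1), (v1, p1), (v2, p2), (v3, p3), (v4, p4)] \<and>
        white G \<inter> left_side c h = {v1, v3} \<and> black G \<inter> left_side c h = {v2, v4} \<and>
        white G' \<inter> left_side c h = {v2, v4} \<and> black G' \<inter> left_side c h = {v1, v3})"

definition local_move :: "point \<Rightarrow> real \<Rightarrow> bigraph \<Rightarrow> bigraph \<Rightarrow> bool" where
  "local_move c h G G' \<longleftrightarrow>
     oriented_circle c h \<and>
     (move_W c h G G' \<or> move_W c h G' G \<or>
      move_Sq c h G G' \<or> move_Sq c h G' G \<or>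
      move_B c h G G' \<or> move_B c h G' G)"

definition related_by_one_move :: "bigraph \<Rightarrow> bigraph \<Rightarrow> bool" where
  "related_by_one_move G G' \<longleftrightarrow>
     (\<exists>A B c h. isotopic G A \<and> local_move c h A B \<and> isotopic B G')"

text \<open>Here \<open>h > 0\<close>, so that the two antipodal circles and their insides are disjoint.\<close>

definition related_by_two_antipodal_moves :: "bigraph \<Rightarrow> bigraph \<Rightarrow> bool" where
  "related_by_two_antipodal_moves G G' \<longleftrightarrow>
     (\<exists>A B C c h. 0 < h \<and> isotopic G A \<and>
        local_move c h A B \<and> local_move (- c) h B C \<and> isotopic C G')"


section \<open>Families along which the decomposition does not change\<close>

text \<open>
  The dots are labeled by following them along the path: \<open>\<phi> t d\<close> is the position at time \<open>t\<close>
  of the dot that starts at \<open>d\<close>. The decompositions at times 0 and 1 are the same if an isotopy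
  of the sphere carries each point to one with the corresponding \<open>D_minus\<close> and \<open>D_plus\<close>, and so
  each stratum to the stratum with the same labels and each vertex to one of the same color.
  A family in general position except at one time can have this property: the exceptional
  circle may have the wrong number of dots on either side to be visible at order \<open>k\<close>, or the
  four dots may become cocircular and then retreat to the side they came from. No move
  takes place then, and in general the two decompositions are not related by one or two moves.
\<close>

definition voronoi_unchanged_along :: "nat \<Rightarrow> (real \<Rightarrow> point set) \<Rightarrow> bool" where
  "voronoi_unchanged_along k F \<longleftrightarrow>
     (\<exists>\<phi> H.
        (\<forall>d\<in>F 0. \<phi> 0 d = d \<and> continuous_on {0..1} (\<lambda>t. \<phi> t d)) \<and>
        (\<forall>t\<in>{0..1}. bij_betw (\<phi> t) (F 0) (F t)) \<and>
        isotopy_of_sphere H \<and>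
        (\<forall>p\<in>S2. D_minus k (F 1) (H 1 p) = \<phi> 1 ` D_minus k (F 0) p \<and>
                 D_plus k (F 1) (H 1 p) = \<phi> 1 ` D_plus k (F 0) p))"

end

theory Submission
  imports Defs "HOL-Analysis.Cross3"
begin

text \<open>
  Since \<open>p \<bullet> d\<close> decreases with the distance of \<open>d\<close> from \<open>p\<close>, the pair of \<open>D_minus\<close> and \<open>D_plus\<close> at \<open>p\<close>, the
  label of \<open>p\<close>, is determined by how the linear function \<open>p\<close> ranks the dots; this makes sense for
  dots off the sphere as well. As long as at most three dots are tied in each label, a small motion
  of the dots can be followed by an isotopy of the sphere carrying labels to labels: near each point
  a linear map compensates the motion of the tied dots exactly, and averages of such maps do so
  too, because comparing labels amounts to convex conditions. So the decomposition can change only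
  when four dots become equidistant from a point \<open>z\<close>, hence also from \<open>-z\<close>, and outside small caps
  around these two points it does not change even then.

  Near the wall where the four dots are cocircular, each side contains, up to such isotopies, one
  configuration only: if the diagonals \<open>ac\<close> and \<open>bd\<close> of the four dots cross, \<open>a\<close> and \<open>c\<close> move by
  \<open>\<gamma> *\<^sub>R z\<close> and \<open>b\<close> and \<open>d\<close> by \<open>- \<gamma> *\<^sub>R z\<close>. In the tangent plane at \<open>z\<close> its labels are explicit. Depending on
  how many dots lie beyond the circle, one sees two trees or two squares, or nothing; the squares
  are matched by a radial map. Replacing all dots by their negatives exchanges the two kinds of
  trees, and the other side of the wall is obtained by relabeling \<open>a, b, c, d\<close> cyclically.
\<close>

section \<open>Ranking dots by their height\<close>

text \<open>Labels rather than graphs are transported, because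
  \<open>voronoi_unchanged_along\<close> asks for more than an isotopy of graphs. Let U and L be the
  dots above and below the plane of the four dots, as seen from z. At z only the order k - card U
  among the four matters; its visible values 1, 2, 3 give a black flip, a square and a white flip.
  At -z the same holds with L for U. So one pole or both may be visible, whence one move or two
  antipodal ones.

  The flips ask for two pictures with the same ends on a circle, so inside it each picture need be
  known only up to a homeomorphism. The square move asks for equal skeletons, so there the
  identification must be exact. It can be made exact because opposite dots are displaced by the same
  vector: away from z only opposite dots are tied and no comparison changes. What remains is to
  match two quadrilaterals with corners on the same axes.

  The move at z and the move at -z are made in succession. The labeling between them is patched
  along the equator from the first and the last one and need not come from any dots, so edges are
  recognized by local properties of labels.\<close>

definition lo :: "nat \<Rightarrow> 'i set \<Rightarrow> ('i \<Rightarrow> real) \<Rightarrow> 'i set" where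
  "lo k I f = {i \<in> I. card {j \<in> I. f i < f j} < k}"

text \<open>The names refer to distance, while \<open>f\<close> is a height and decreases with
  distance: \<open>lo\<close> collects the near dots, as \<open>D_minus\<close> does, and
  \<open>hi\<close> the far ones, as \<open>D_plus\<close> does. Counting replaces the sorted list
  of distances.\<close>

definition hi :: "nat \<Rightarrow> 'i set \<Rightarrow> ('i \<Rightarrow> real) \<Rightarrow> 'i set" where
  "hi k I f = {i \<in> I. k < card {j \<in> I. f i \<le> f j}}"

lemma lo_subset: "lo k I f \<subseteq> I" and hi_subset: "hi k I f \<subseteq> I"
  by (auto simp: lo_def hi_def)

lemma lo_cong: "(\<And>i. i \<in> I \<Longrightarrow> f i = g i) \<Longrightarrow> lo k I f = lo k I g"
  and hi_cong: "(\<And>i. i \<in> I \<Longrightarrow> f i = g i) \<Longrightarrow> hi k I f = hi k I g"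
  unfolding lo_def hi_def by (intro Collect_cong conj_cong refl arg_cong2[where f="(<)"] arg_cong[where f=card]; auto)+

lemma card_compl:
  assumes "finite I"
  shows "card {j \<in> I. \<not> P j} = card I - card {j \<in> I. P j}" "card {j \<in> I. P j} \<le> card I"
proof -
  have "{j \<in> I. \<not> P j} = I - {j \<in> I. P j}" by auto
  then show "card {j \<in> I. \<not> P j} = card I - card {j \<in> I. P j}"
    using assms by (simp add: card_Diff_subset)
  show "card {j \<in> I. P j} \<le> card I" using assms by (intro card_mono) auto
qed

text \<open>Under reversal, weakly above means not strictly above, so the complement is counted.
  This duality between order k and order n - k later exchanges the two colors.\<close>

lemma hi_uminus:
  assumes "finite I" "k \<le> card I"
  shows "hi (card I - k) I (\<lambda>i. - f i) = lo k I f"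
proof -
  have "card {j \<in> I. - f i \<le> - f j} = card I - card {j \<in> I. f i < f j}" for i
    using card_compl(1)[OF assms(1), of "\<lambda>j. f i < f j"] by (simp add: not_less)
  then show ?thesis
    using assms card_compl(2)[OF assms(1)] unfolding hi_def lo_def by fastforce
qed

lemma lo_uminus:
  assumes "finite I" "k \<le> card I"
  shows "lo (card I - k) I (\<lambda>i. - f i) = hi k I f"
  using hi_uminus[of I "card I - k" "\<lambda>i. - f i"] assms by simp

lemma lo_Un_hi:
  assumes "finite I"
  shows "lo k I f \<union> hi k I f = I"
proof -
  have "i \<in> hi k I f" if "i \<in> I" "i \<notin> lo k I f" for i
  proof -
    have "k \<le> card {j \<in> I. f i < f j}" using that by (auto simp: lo_def)
    also have "\<dots> < card {j \<in> I. f i \<le> f j}"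
      using assms that by (intro psubset_card_mono) auto
    finally show ?thesis using that by (auto simp: hi_def)
  qed
  then show ?thesis using lo_subset[of k I f] hi_subset[of k I f] by blast
qed

lemma lo_ge_hi:
  assumes "finite I" "i \<in> lo k I f" "j \<in> hi k I f"
  shows "f j \<le> f i"
proof (rule ccontr)
  assume "\<not> f j \<le> f i"
  then have "card {e \<in> I. f j \<le> f e} \<le> card {e \<in> I. f i < f e}"
    using assms(1) by (intro card_mono) auto
  then show False using assms by (auto simp: lo_def hi_def)
qed

lemma tie_eq:
  assumes "finite I" "i \<in> lo k I f \<inter> hi k I f" "j \<in> lo k I f \<inter> hi k I f"
  shows "f i = f j"
  using assms lo_ge_hi[OF assms(1)] by (intro antisym) auto

text \<open>Everything strictly above the highest index outside \<open>lo\<close> lies in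
  \<open>lo\<close>, and that is at least k indices.\<close>

lemma card_lo_ge:
  assumes "finite I" "k \<le> card I"
  shows "k \<le> card (lo k I f)"
proof (cases "lo k I f = I")
  case True then show ?thesis using assms by simp
next
  case False
  then have ne: "I - lo k I f \<noteq> {}" using lo_subset[of k I f] by auto
  have fin: "finite (f ` (I - lo k I f))" using assms by auto
  obtain i where i: "i \<in> I - lo k I f" "f i = Max (f ` (I - lo k I f))"
    using Max_in[OF fin] ne by fastforce
  have "{j \<in> I. f i < f j} \<subseteq> lo k I f"
    using i(2) Max_ge[OF fin] by (fastforce simp: not_le[symmetric])
  moreover have "finite (lo k I f)" using assms(1) lo_subset[of k I f] finite_subset by blast
  ultimately have "card {j \<in> I. f i < f j} \<le> card (lo k I f)" by (rule card_mono[rotated])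
  moreover have "k \<le> card {j \<in> I. f i < f j}" using i by (auto simp: lo_def)
  ultimately show ?thesis by simp
qed

text \<open>Here the lowest member decides: the whole set is weakly above it, and as it is not in
  \<open>hi\<close>, at most k indices are.\<close>

lemma card_lo_minus_hi_le:
  assumes "finite I"
  shows "card (lo k I f - hi k I f) \<le> k"
proof (cases "lo k I f - hi k I f = {}")
  case True then show ?thesis by (metis card.empty le0)
next
  case False
  let ?U = "lo k I f - hi k I f"
  have fin: "finite (f ` ?U)" using assms lo_subset[of k I f] finite_subset by blast
  obtain i where i: "i \<in> ?U" "f i = Min (f ` ?U)"
    using Min_in[OF fin] False by fastforce
  have "?U \<subseteq> {j \<in> I. f i \<le> f j}"
    using i(2) Min_le[OF fin] lo_subset[of k I f] by fastforce
  then have "card ?U \<le> card {j \<in> I. f i \<le> f j}" using assms by (intro card_mono) auto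
  also have "\<dots> \<le> k" using i lo_subset[of k I f] by (auto simp: hi_def)
  finally show ?thesis .
qed

text \<open>Localization: if three blocks are strictly stacked and the k-th place falls into the
  middle one, only the ranking inside the middle block is open, at an order reduced by the size of
  the upper block. The middle block will be either the set of ties or the four dots of a
  wall.\<close>

lemma lo_hi_separated:
  assumes fin: "finite U" "finite T" "finite L"
    and disj: "U \<inter> T = {}" "U \<inter> L = {}" "T \<inter> L = {}"
    and UT: "\<And>i j. i \<in> U \<Longrightarrow> j \<in> T \<Longrightarrow> f j < f i"
    and UL: "\<And>i j. i \<in> U \<Longrightarrow> j \<in> L \<Longrightarrow> f j < f i"
    and TL: "\<And>i j. i \<in> T \<Longrightarrow> j \<in> L \<Longrightarrow> f j < f i"
    and k: "card U \<le> k" "k \<le> card U + card T"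
  shows "lo k (U \<union> T \<union> L) f = U \<union> lo (k - card U) T f" (is ?lo)
    and "hi k (U \<union> T \<union> L) f = L \<union> hi (k - card U) T f" (is ?hi)
proof -
  let ?I = "U \<union> T \<union> L"
  have finI: "finite ?I" using fin by auto
  have U_lo: "card {j \<in> ?I. f i < f j} < k" and U_hi: "\<not> k < card {j \<in> ?I. f i \<le> f j}"
    if "i \<in> U" for i
  proof -
    have sub: "{j \<in> ?I. f i \<le> f j} \<subseteq> U" using UT UL that by (auto simp: not_less[symmetric])
    then have "{j \<in> ?I. f i < f j} \<subset> U" using that by force
    then show "card {j \<in> ?I. f i < f j} < k"
      using psubset_card_mono[OF fin(1)] k(1) by (meson order_less_le_trans)
    show "\<not> k < card {j \<in> ?I. f i \<le> f j}"
      using card_mono[OF fin(1) sub] k(1) by linarith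
  qed
  have L_lo: "\<not> card {j \<in> ?I. f i < f j} < k" and L_hi: "k < card {j \<in> ?I. f i \<le> f j}"
    if "i \<in> L" for i
  proof -
    have c: "card (U \<union> T) = card U + card T" using fin disj by (simp add: card_Un_disjoint)
    have sub: "U \<union> T \<subseteq> {j \<in> ?I. f i < f j}" using UL TL that by auto
    then have 1: "card (U \<union> T) \<le> card {j \<in> ?I. f i < f j}" using finI by (intro card_mono) auto
    then show "\<not> card {j \<in> ?I. f i < f j} < k" using c k(2) by linarith
    have "{j \<in> ?I. f i < f j} \<subset> {j \<in> ?I. f i \<le> f j}" using that by auto
    then have "card {j \<in> ?I. f i < f j} < card {j \<in> ?I. f i \<le> f j}"
      using finI by (intro psubset_card_mono) auto
    then show "k < card {j \<in> ?I. f i \<le> f j}" using 1 c k(2) by linarith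
  qed
  have T_lo: "card {j \<in> ?I. f i < f j} < k \<longleftrightarrow> card {j \<in> T. f i < f j} < k - card U"
    and T_hi: "k < card {j \<in> ?I. f i \<le> f j} \<longleftrightarrow> k - card U < card {j \<in> T. f i \<le> f j}"
    if "i \<in> T" for i
  proof -
    have 1: "{j \<in> ?I. f i < f j} = U \<union> {j \<in> T. f i < f j}" "{j \<in> ?I. f i \<le> f j} = U \<union> {j \<in> T. f i \<le> f j}"
      using UT[OF _ that] TL[OF that] by (blast intro: less_imp_le dest: less_asym, blast intro: less_imp_le dest: leD)
    have "card {j \<in> ?I. f i < f j} = card U + card {j \<in> T. f i < f j}"
         "card {j \<in> ?I. f i \<le> f j} = card U + card {j \<in> T. f i \<le> f j}"
      unfolding 1 using fin disj by (auto intro!: card_Un_disjoint)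
    then show "card {j \<in> ?I. f i < f j} < k \<longleftrightarrow> card {j \<in> T. f i < f j} < k - card U"
      "k < card {j \<in> ?I. f i \<le> f j} \<longleftrightarrow> k - card U < card {j \<in> T. f i \<le> f j}" using k(1) by auto
  qed
  show ?lo using U_lo L_lo T_lo unfolding lo_def by blast
  show ?hi using U_hi L_hi T_hi unfolding hi_def by blast
qed

text \<open>Supplies the hypotheses of \<open>lo_hi_separated\<close> for the three blocks that
  every ranking has: clearly near, tied at the k-th place, clearly far.\<close>

lemma lo_hi_parts:
  fixes f :: "'i \<Rightarrow> real"
  assumes "finite I" "k \<le> card I"
  defines "U \<equiv> lo k I f - hi k I f" and "T \<equiv> lo k I f \<inter> hi k I f" and "L \<equiv> hi k I f - lo k I f"
  shows "I = U \<union> T \<union> L" "finite U" "finite T" "finite L"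
    "U \<inter> T = {}" "U \<inter> L = {}" "T \<inter> L = {}"
    "card U \<le> k" "k \<le> card U + card T"
    "\<And>i j. i \<in> U \<Longrightarrow> j \<in> T \<union> L \<Longrightarrow> f j < f i"
    "\<And>i j. i \<in> U \<union> T \<Longrightarrow> j \<in> L \<Longrightarrow> f j < f i"
proof -
  show I: "I = U \<union> T \<union> L" using lo_Un_hi[OF assms(1), of k f] unfolding U_def T_def L_def by auto
  show fin: "finite U" "finite T" "finite L" using assms(1) I by (metis finite_Un)+
  show "U \<inter> T = {}" "U \<inter> L = {}" "T \<inter> L = {}" unfolding U_def T_def L_def by auto
  show "card U \<le> k" unfolding U_def using assms(1) by (rule card_lo_minus_hi_le)
  have "lo k I f = U \<union> T" unfolding U_def T_def by auto
  then have "card (lo k I f) \<le> card U + card T" by (simp add: card_Un_le)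
  then show "k \<le> card U + card T" using card_lo_ge[OF assms(1,2), of f] by linarith
  show "f j < f i" if "i \<in> U" "j \<in> T \<union> L" for i j
  proof -
    have "j \<in> hi k I f" "i \<in> lo k I f" "i \<notin> hi k I f" "i \<in> I" using that I unfolding U_def T_def L_def by auto
    have "f j \<noteq> f i"
      using \<open>j \<in> hi k I f\<close> \<open>i \<notin> hi k I f\<close> \<open>i \<in> I\<close> unfolding hi_def by auto
    then show ?thesis using lo_ge_hi[OF assms(1) \<open>i \<in> lo k I f\<close> \<open>j \<in> hi k I f\<close>] by simp
  qed
  show "f j < f i" if "i \<in> U \<union> T" "j \<in> L" for i j
  proof -
    have "j \<in> hi k I f" "i \<in> lo k I f" "j \<notin> lo k I f" "j \<in> I" using that I unfolding U_def T_def L_def by auto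
    have "f j \<noteq> f i"
      using \<open>i \<in> lo k I f\<close> \<open>j \<notin> lo k I f\<close> \<open>j \<in> I\<close> unfolding lo_def by auto
    then show ?thesis using lo_ge_hi[OF assms(1) \<open>i \<in> lo k I f\<close> \<open>j \<in> hi k I f\<close>] by simp
  qed
qed

text \<open>Semicontinuity: a ranking that respects the strict comparisons of \<open>f\<close> can
  only resolve ties, so both sets shrink, and what was decided stays decided.\<close>

lemma lo_hi_upper:
  assumes "finite I" "k \<le> card I"
    and "\<And>i j. i \<in> lo k I f \<Longrightarrow> j \<in> hi k I f \<Longrightarrow> f j < f i \<Longrightarrow> g j < g i"
  shows "lo k I g \<subseteq> lo k I f" "hi k I g \<subseteq> hi k I f"
    "lo k I f - hi k I f \<subseteq> lo k I g - hi k I g" "hi k I f - lo k I f \<subseteq> hi k I g - lo k I g"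
proof -
  note P = lo_hi_parts[OF assms(1,2), where f=f]
  let ?U = "lo k I f - hi k I f" and ?T = "lo k I f \<inter> hi k I f" and ?L = "hi k I f - lo k I f"
  have U: "g j < g i" if "i \<in> ?U" "j \<in> ?T \<union> ?L" for i j
    using assms(3)[of i j] P(10)[OF that] that by auto
  have L: "g j < g i" if "i \<in> ?U \<union> ?T" "j \<in> ?L" for i j
    using assms(3)[of i j] P(11)[OF that] that by auto
  have *: "lo k I g = ?U \<union> lo (k - card ?U) ?T g" "hi k I g = ?L \<union> hi (k - card ?U) ?T g"
    using lo_hi_separated[of ?U ?T ?L g k] P(1-9) U L by simp_all
  show "lo k I g \<subseteq> lo k I f" "hi k I g \<subseteq> hi k I f"
    using * lo_subset[of "k - card ?U" ?T g] hi_subset[of "k - card ?U" ?T g] by auto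
  show "lo k I f - hi k I f \<subseteq> lo k I g - hi k I g" "hi k I f - lo k I f \<subseteq> hi k I g - lo k I g"
    using * lo_subset[of "k - card ?U" ?T g] hi_subset[of "k - card ?U" ?T g] by auto
qed

text \<open>Only a near dot is ever compared with a far one. The order within the upper block or
  within the lower block is free to change, which is why the relation \<open>cmp\<close> below can
  be so weak.\<close>

lemma lo_hi_transfer:
  assumes "finite I" "k \<le> card I"
    and less: "\<And>i j. i \<in> lo k I f \<Longrightarrow> j \<in> hi k I f \<Longrightarrow> f j < f i \<Longrightarrow> g j < g i"
    and eq: "\<And>i j. i \<in> lo k I f \<Longrightarrow> j \<in> hi k I f \<Longrightarrow> f j = f i \<Longrightarrow> g j = g i"
  shows "lo k I g = lo k I f" "hi k I g = hi k I f"
proof -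
  note P = lo_hi_parts[OF assms(1,2), where f=f]
  let ?U = "lo k I f - hi k I f" and ?T = "lo k I f \<inter> hi k I f" and ?L = "hi k I f - lo k I f"
  have U: "g j < g i" if "i \<in> ?U" "j \<in> ?T \<union> ?L" for i j
    using less[of i j] P(10)[OF that] that by auto
  have L: "g j < g i" if "i \<in> ?U \<union> ?T" "j \<in> ?L" for i j
    using less[of i j] P(11)[OF that] that by auto
  have T: "f i = f j" "g i = g j" if "i \<in> ?T" "j \<in> ?T" for i j
    using tie_eq[OF assms(1) that] eq[of j i] that by auto
  have g: "lo k I g = ?U \<union> lo (k - card ?U) ?T g" "hi k I g = ?L \<union> hi (k - card ?U) ?T g"
    using lo_hi_separated[of ?U ?T ?L g k] P(1-9) U L by simp_all
  have f: "lo k I f = ?U \<union> lo (k - card ?U) ?T f" "hi k I f = ?L \<union> hi (k - card ?U) ?T f"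
    using lo_hi_separated[of ?U ?T ?L f k] P by simp_all
  have c: "g i < g j \<longleftrightarrow> f i < f j" "g i \<le> g j \<longleftrightarrow> f i \<le> f j" if "i \<in> ?T" "j \<in> ?T" for i j
    using T[OF that] by simp_all
  have 1: "{j \<in> ?T. g i < g j} = {j \<in> ?T. f i < f j}" "{j \<in> ?T. g i \<le> g j} = {j \<in> ?T. f i \<le> f j}"
    if "i \<in> ?T" for i using c[OF that] by blast+
  have "lo m ?T g = lo m ?T f" "hi m ?T g = hi m ?T f" for m
    unfolding lo_def[of m] hi_def[of m] using 1 by (metis (no_types, lifting) Collect_cong)+
  then show "lo k I g = lo k I f" "hi k I g = hi k I f" using f g by metis+
qed

text \<open>A middle block of a single index has no place strictly inside it: membership in
  \<open>lo\<close> needs a positive reduced order, membership in \<open>hi\<close> a reduced order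
  below 1.\<close>

lemma card_tie_not_1:
  assumes "finite I" "k \<le> card I"
  shows "card (lo k I f \<inter> hi k I f) \<noteq> 1"
proof
  let ?U = "lo k I f - hi k I f" and ?T = "lo k I f \<inter> hi k I f" and ?L = "hi k I f - lo k I f"
  note P = lo_hi_parts[OF assms, where f=f]
  assume 1: "card ?T = 1"
  then obtain t where t: "?T = {t}" by (auto simp: card_1_singleton_iff)
  have "lo k I f = ?U \<union> lo (k - card ?U) ?T f" "hi k I f = ?L \<union> hi (k - card ?U) ?T f"
    using lo_hi_separated[of ?U ?T ?L f k] P by simp_all
  then have "t \<in> lo (k - card ?U) ?T f" "t \<in> hi (k - card ?U) ?T f" using t by blast+
  moreover have "\<not> (t \<in> lo m {t} f \<and> t \<in> hi m {t} f)" for m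
  proof -
    have "{j \<in> {t}. f t \<le> f j} = {t}" by auto
    then show ?thesis by (auto simp: lo_def hi_def)
  qed
  ultimately show False unfolding t by blast
qed

text \<open>The reduced order of a block of three ties lies strictly between 0 and 3. Its two values
  2 and 1 give the two alternatives in this order; they become the colors white and black.\<close>

lemma card_lo_tie3:
  assumes "finite I" "k \<le> card I" "card (lo k I f \<inter> hi k I f) = 3"
  shows "card (lo k I f) = k + 1 \<or> card (lo k I f) = k + 2"
    "card (lo k I f) = card (lo k I f - hi k I f) + 3"
proof -
  let ?U = "lo k I f - hi k I f" and ?T = "lo k I f \<inter> hi k I f" and ?L = "hi k I f - lo k I f"
  note P = lo_hi_parts[OF assms(1,2), where f=f]
  have "lo k I f = ?U \<union> ?T" by auto
  then show c: "card (lo k I f) = card ?U + 3" using P assms(3) card_Un_disjoint by metis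
  have *: "lo k I f = ?U \<union> lo (k - card ?U) ?T f" "hi k I f = ?L \<union> hi (k - card ?U) ?T f"
    using lo_hi_separated[of ?U ?T ?L f k] P by simp_all
  have "?T \<noteq> {}" using assms(3) by (metis card.empty zero_neq_numeral)
  then obtain t where t: "t \<in> ?T" by blast
  then have "t \<in> lo (k - card ?U) ?T f" "t \<in> hi (k - card ?U) ?T f" using * by blast+
  moreover have "{j \<in> ?T. f t \<le> f j} = ?T" using tie_eq[OF assms(1) t] by (metis (no_types, lifting) Collect_cong Collect_mem_eq order_refl)
  ultimately have "k - card ?U < 3" "0 < k - card ?U" using assms(3) by (auto simp: lo_def hi_def)
  then show "card (lo k I f) = k + 1 \<or> card (lo k I f) = k + 2" using c P(8) by linarith
qed

section \<open>Isotopies of the sphere\<close>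

text \<open>Saves constructing inverses. If a point were missed, the map would land in a punctured
  sphere, hence in a plane, and the sphere does not embed in a plane.\<close>

lemma sphere_injection_homeomorphism:
  fixes f :: "point \<Rightarrow> point"
  assumes "continuous_on S2 f" "f ` S2 \<subseteq> S2" "inj_on f S2"
  shows "\<exists>g. homeomorphism S2 S2 f g"
proof -
  have "f ` S2 = S2"
  proof (rule ccontr)
    assume "f ` S2 \<noteq> S2"
    then obtain q where q: "q \<in> S2" "q \<notin> f ` S2" using assms(2) by blast
    define A :: "point set" where "A = {x. q \<bullet> x = 0}"
    have "q \<noteq> 0" using q by auto
    then have A: "affine A" "aff_dim A = 2"
      unfolding A_def using affine_hyperplane[of q 0] aff_dim_hyperplane[of q 0] by simp_all
    have "(S2 - {q}) homeomorphic A"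
      by (rule homeomorphic_punctured_sphere_affine) (use q A in auto)
    also have "A homeomorphic (UNIV :: (real^2) set)"
      by (rule homeomorphic_affine_sets) (use A in auto)
    finally have "(S2 - {q}) homeomorphic (UNIV :: (real^2) set)" .
    then obtain \<alpha> \<beta> where ab: "homeomorphism (S2 - {q}) (UNIV :: (real^2) set) \<alpha> \<beta>"
      unfolding homeomorphic_def by blast
    have sub: "f ` S2 \<subseteq> S2 - {q}" using q assms(2) by blast
    have "continuous_on S2 (\<alpha> \<circ> f)"
      using assms(1) ab sub by (intro continuous_on_compose) (auto simp: homeomorphism_def intro: continuous_on_subset)
    moreover have "inj_on (\<alpha> \<circ> f) S2"
    proof (rule comp_inj_on[OF assms(3)])
      have "inj_on \<alpha> (S2 - {q})" by (rule inj_on_inverseI[of _ \<beta>]) (use ab in \<open>auto simp: homeomorphism_def\<close>)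
      then show "inj_on \<alpha> (f ` S2)" using sub inj_on_subset by blast
    qed
    ultimately have "DIM(point) \<le> DIM(real^2)"
      using no_embedding_sphere_lowdim[of "0::point" 1 "\<alpha> \<circ> f"] by simp
    then show False by simp
  qed
  then show ?thesis
    using homeomorphism_compact[of S2 f S2] assms by (metis compact_sphere)
qed


lemma isotopy_id: "isotopy_of_sphere (\<lambda>t x. x)"
  unfolding isotopy_of_sphere_def
  by (auto intro!: continuous_intros exI[of _ id] simp: split_beta homeomorphism_def)

lemma isotopy_maps:
  assumes "isotopy_of_sphere H" "t \<in> {0..1}"
  shows "H t ` S2 = S2" "inj_on (H t) S2" "continuous_on S2 (H t)"
proof -
  obtain g where g: "homeomorphism S2 S2 (H t) g"
    using assms unfolding isotopy_of_sphere_def by blast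
  then show "H t ` S2 = S2" "continuous_on S2 (H t)" by (auto simp: homeomorphism_def)
  show "inj_on (H t) S2" by (rule inj_on_inverseI[of _ g]) (use g in \<open>auto simp: homeomorphism_def\<close>)
qed

lemma isotopy_compose:
  assumes H: "isotopy_of_sphere H" and K: "isotopy_of_sphere K"
  shows "isotopy_of_sphere (\<lambda>t x. K t (H t x))"
  unfolding isotopy_of_sphere_def
proof (intro conjI ballI)
  have HS: "H t x \<in> S2" if "t \<in> {0..1}" "x \<in> S2" for t x using isotopy_maps(1)[OF H that(1)] that by blast
  have c: "continuous_on ({0..1} \<times> S2) (\<lambda>p. H (fst p) (snd p))" "continuous_on ({0..1} \<times> S2) (\<lambda>p. K (fst p) (snd p))"
    using H K unfolding isotopy_of_sphere_def by (auto simp: split_beta)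
  have "continuous_on ({0..1} \<times> S2) (\<lambda>p. K (fst (fst p, H (fst p) (snd p))) (snd (fst p, H (fst p) (snd p))))"
    by (rule continuous_on_compose2[OF c(2), where f="\<lambda>p. (fst p, H (fst p) (snd p))"])
       (use HS in \<open>auto intro!: continuous_intros c(1)\<close>)
  then show "continuous_on ({0..1} \<times> S2) (\<lambda>(t, x). K t (H t x))" by (simp add: split_beta)
  show "\<exists>g. homeomorphism S2 S2 (\<lambda>x. K t (H t x)) g" if t: "t \<in> {0..1}" for t
    using H K t homeomorphism_compose[of S2 S2 "H t" _ S2 "K t"] unfolding isotopy_of_sphere_def comp_def by blast
  show "K 0 (H 0 x) = x" if "x \<in> S2" for x
    using H K that unfolding isotopy_of_sphere_def by auto
qed

text \<open>Run backwards, \<open>H\<close> starts at \<open>H 1\<close>; precomposing with the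
  inverse \<open>g\<close> makes it start at the identity.\<close>

lemma isotopy_inverse:
  assumes H: "isotopy_of_sphere H" and g: "homeomorphism S2 S2 (H 1) g"
  shows "isotopy_of_sphere (\<lambda>t x. H (1 - t) (g x))"
  unfolding isotopy_of_sphere_def
proof (intro conjI ballI)
  have gS: "g x \<in> S2" if "x \<in> S2" for x using g that by (auto simp: homeomorphism_def)
  have cg: "continuous_on S2 g" using g by (auto simp: homeomorphism_def)
  have c: "continuous_on ({0..1} \<times> S2) (\<lambda>p. H (fst p) (snd p))"
    using H unfolding isotopy_of_sphere_def by (auto simp: split_beta)
  have "continuous_on ({0..1} \<times> S2) (\<lambda>p. H (fst (1 - fst p, g (snd p))) (snd (1 - fst p, g (snd p))))"
    by (rule continuous_on_compose2[OF c, where f="\<lambda>p. (1 - fst p, g (snd p))"])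
       (use gS in \<open>auto intro!: continuous_intros continuous_on_compose2[OF cg, where f=snd]\<close>)
  then show "continuous_on ({0..1} \<times> S2) (\<lambda>(t, x). H (1 - t) (g x))" by (simp add: split_beta)
  show "\<exists>g'. homeomorphism S2 S2 (\<lambda>x. H (1 - t) (g x)) g'" if t: "t \<in> {0..1}" for t
  proof -
    have "1 - t \<in> {0..1}" using t by auto
    then obtain g' where "homeomorphism S2 S2 (H (1 - t)) g'"
      using H unfolding isotopy_of_sphere_def by blast
    from homeomorphism_compose[OF homeomorphism_symD[OF g] this] show ?thesis by (auto simp: comp_def)
  qed
  show "H (1 - 0) (g x) = x" if "x \<in> S2" for x
    using homeomorphism_apply2[OF g that] by simp
qed

lemma norm_scaleR_sgn: "norm x *\<^sub>R sgn x = (x :: 'a::real_normed_vector)"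
  by (cases "x = 0") (auto simp: sgn_div_norm)

text \<open>A displacement with small Lipschitz constant cannot fold the sphere: two points with parallel
  images would differ by less than the lengths of the images do.\<close>

lemma small_displacement_isotopy:
  fixes v :: "point \<Rightarrow> point"
  assumes lip: "\<And>p q. p \<in> S2 \<Longrightarrow> q \<in> S2 \<Longrightarrow> norm (v p - v q) \<le> \<kappa> * norm (p - q)"
    and bd: "\<And>p. p \<in> S2 \<Longrightarrow> norm (v p) \<le> \<kappa>" and \<kappa>: "0 \<le> \<kappa>" "\<kappa> \<le> 1/8"
  shows "isotopy_of_sphere (\<lambda>t p. sgn (p + t *\<^sub>R v p))"
    and "\<And>p. p \<in> S2 \<Longrightarrow> norm (sgn (p + v p) - p) \<le> 2 * \<kappa>"
proof -
  have nz: "norm (p + t *\<^sub>R v p) \<ge> 7/8" if "p \<in> S2" "t \<in> {0..1}" for p t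
  proof -
    have "norm (t *\<^sub>R v p) \<le> 1/8" using bd[OF that(1)] that(2) \<kappa> mult_mono[of t 1 "norm (v p)" "1/8"] by auto
    moreover have "norm p - norm (t *\<^sub>R v p) \<le> norm (p + t *\<^sub>R v p)" using norm_triangle_ineq2[of p "- t *\<^sub>R v p"] by simp
    ultimately show ?thesis using that by simp
  qed
  have cv: "continuous_on S2 v"
    by (rule lipschitz_on_continuous_on[of \<kappa>]) (auto simp: lipschitz_on_def dist_norm \<kappa> lip)
  have cont: "continuous_on ({0..1} \<times> S2) (\<lambda>(t, p). sgn (p + t *\<^sub>R v p))"
    unfolding split_beta
    by (rule continuous_on_sgn) (use nz in \<open>fastforce intro!: continuous_intros continuous_on_compose2[OF cv, where f=snd]\<close>)+
  have inj: "inj_on (\<lambda>p. sgn (p + t *\<^sub>R v p)) S2" if t: "t \<in> {0..1}" for t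
  proof (rule inj_onI)
    fix p q assume pq: "p \<in> S2" "q \<in> S2" and eq: "sgn (p + t *\<^sub>R v p) = sgn (q + t *\<^sub>R v q)"
    define a b where "a = p + t *\<^sub>R v p" and "b = q + t *\<^sub>R v q"
    have ab: "norm a \<ge> 7/8" "norm b \<ge> 7/8" using nz pq t unfolding a_def b_def by auto
    have "a = norm a *\<^sub>R sgn a" "b = norm b *\<^sub>R sgn a"
      using eq norm_scaleR_sgn[of a] norm_scaleR_sgn[of b] unfolding a_def[symmetric] b_def[symmetric] by simp_all
    then have "a - b = (norm a - norm b) *\<^sub>R sgn a" by (metis scaleR_left_diff_distrib)
    then have 1: "norm (a - b) = \<bar>norm a - norm b\<bar>" using ab by (auto simp: norm_sgn)
    have n1: "norm p = 1" "norm q = 1" using pq by auto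
    have vd: "norm (v p - v q) \<le> \<kappa> * norm (p - q)" by (rule lip[OF pq])
    have "norm (t *\<^sub>R (v p - v q)) \<le> 1 * (\<kappa> * norm (p - q))"
      using vd t mult_mono[of t 1 "norm (v p - v q)" "\<kappa> * norm (p - q)"] \<kappa> by auto
    also have "\<dots> \<le> 1/8 * norm (p - q)" using mult_right_mono[OF \<kappa>(2), of "norm (p - q)"] by simp
    finally have tv: "norm (t *\<^sub>R (v p - v q)) \<le> 1/8 * norm (p - q)" .
    have "a - b = (p - q) + t *\<^sub>R (v p - v q)" unfolding a_def b_def by (simp add: algebra_simps)
    then have 2: "norm (a - b) \<ge> 7/8 * norm (p - q)"
      using norm_diff_ineq[of "p - q" "t *\<^sub>R (v p - v q)"] tv by simp
    have aa: "norm a ^ 2 = 1 + 2 * t * (p \<bullet> v p) + t\<^sup>2 * (v p \<bullet> v p)"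
      unfolding power2_norm_eq_inner a_def using n1 by (simp add: inner_add inner_commute power2_eq_square algebra_simps norm_eq_1)
    have bb: "norm b ^ 2 = 1 + 2 * t * (q \<bullet> v q) + t\<^sup>2 * (v q \<bullet> v q)"
      unfolding power2_norm_eq_inner b_def using n1 by (simp add: inner_add inner_commute power2_eq_square algebra_simps norm_eq_1)
    have bv: "norm (v p) \<le> 1/8" "norm (v q) \<le> 1/8" using bd pq \<kappa> by force+
    have vd': "norm (v p - v q) \<le> 1/8 * norm (p - q)"
      using vd mult_right_mono[OF \<kappa>(2), of "norm (p - q)"] by simp
    have "p \<bullet> v p - q \<bullet> v q = (p - q) \<bullet> v p + q \<bullet> (v p - v q)" by (simp add: inner_diff)
    then have "\<bar>p \<bullet> v p - q \<bullet> v q\<bar> \<le> norm (p - q) * norm (v p) + norm q * norm (v p - v q)"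
      using Cauchy_Schwarz_ineq2[of "p - q" "v p"] Cauchy_Schwarz_ineq2[of q "v p - v q"] by linarith
    also have "\<dots> \<le> norm (p - q) * (1/8) + 1 * (1/8 * norm (p - q))"
      using bv vd' n1 by (intro add_mono mult_mono) auto
    finally have d1: "\<bar>p \<bullet> v p - q \<bullet> v q\<bar> \<le> 1/4 * norm (p - q)" by simp
    have "v p \<bullet> v p - v q \<bullet> v q = (v p - v q) \<bullet> v p + v q \<bullet> (v p - v q)" by (simp add: inner_diff inner_commute)
    then have "\<bar>v p \<bullet> v p - v q \<bullet> v q\<bar> \<le> norm (v p - v q) * norm (v p) + norm (v q) * norm (v p - v q)"
      using Cauchy_Schwarz_ineq2[of "v p - v q" "v p"] Cauchy_Schwarz_ineq2[of "v q" "v p - v q"] by linarith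
    also have "\<dots> \<le> (1/8 * norm (p - q)) * (1/8) + (1/8) * (1/8 * norm (p - q))"
      using bv vd' by (intro add_mono mult_mono) auto
    finally have d2: "\<bar>v p \<bullet> v p - v q \<bullet> v q\<bar> \<le> 1/32 * norm (p - q)" by simp
    \<comment> \<open>Lengths are compared through their squares, where the equal terms from
      \<open>p\<close> and \<open>q\<close> cancel. The outcome is that \<open>norm (a - b)\<close>
      is at most 17/56 of \<open>norm (p - q)\<close>, against the lower bound 7/8 above.\<close>
    have "norm a ^ 2 - norm b ^ 2 = (2 * t) * (p \<bullet> v p - q \<bullet> v q) + t\<^sup>2 * (v p \<bullet> v p - v q \<bullet> v q)"
      unfolding aa bb by (simp add: algebra_simps)
    then have "\<bar>norm a ^ 2 - norm b ^ 2\<bar> \<le> \<bar>2 * t\<bar> * \<bar>p \<bullet> v p - q \<bullet> v q\<bar> + \<bar>t\<^sup>2\<bar> * \<bar>v p \<bullet> v p - v q \<bullet> v q\<bar>"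
      by (metis abs_triangle_ineq abs_mult)
    also have "\<dots> \<le> 2 * (1/4 * norm (p - q)) + 1 * (1/32 * norm (p - q))"
      using t d1 d2 by (intro add_mono mult_mono) (auto simp: power_le_one)
    finally have "\<bar>norm a ^ 2 - norm b ^ 2\<bar> \<le> 17/32 * norm (p - q)" by simp
    moreover have "norm a ^ 2 - norm b ^ 2 = (norm a + norm b) * (norm a - norm b)"
      by (simp add: power2_eq_square algebra_simps)
    ultimately have "(norm a + norm b) * \<bar>norm a - norm b\<bar> \<le> 17/32 * norm (p - q)"
      by (simp add: abs_mult)
    moreover have "7/4 * \<bar>norm a - norm b\<bar> \<le> (norm a + norm b) * \<bar>norm a - norm b\<bar>"
      using ab by (intro mult_right_mono) auto
    ultimately have "7/4 * \<bar>norm a - norm b\<bar> \<le> 17/32 * norm (p - q)" by (rule order_trans[rotated])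
    then have "7/4 * norm (a - b) \<le> 17/32 * norm (p - q)" unfolding 1 .
    then have "norm (p - q) \<le> 0" using 2 by linarith
    then show "p = q" by simp
  qed
  show "isotopy_of_sphere (\<lambda>t p. sgn (p + t *\<^sub>R v p))"
    unfolding isotopy_of_sphere_def
  proof (intro conjI ballI)
    show "continuous_on ({0..1} \<times> S2) (\<lambda>(t, p). sgn (p + t *\<^sub>R v p))" by (rule cont)
    show "\<exists>g. homeomorphism S2 S2 (\<lambda>p. sgn (p + t *\<^sub>R v p)) g" if t: "t \<in> {0..1}" for t
    proof (rule sphere_injection_homeomorphism[OF _ _ inj[OF t]])
      show "continuous_on S2 (\<lambda>p. sgn (p + t *\<^sub>R v p))"
        by (rule continuous_on_sgn) (use nz[OF _ t] in \<open>fastforce intro!: continuous_intros cv\<close>)+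
      show "(\<lambda>p. sgn (p + t *\<^sub>R v p)) ` S2 \<subseteq> S2" using nz[OF _ t] by (fastforce simp: norm_sgn)
    qed
    show "sgn (p + 0 *\<^sub>R v p) = p" if "p \<in> S2" for p using that by (simp add: sgn_div_norm)
  qed
  show "norm (sgn (p + v p) - p) \<le> 2 * \<kappa>" if p: "p \<in> S2" for p
  proof -
    define a where "a = p + v p"
    have a: "norm a \<ge> 7/8" using nz[of p 1] p unfolding a_def by auto
    have "a - sgn a = (norm a - 1) *\<^sub>R sgn a" by (simp add: scaleR_left_diff_distrib norm_scaleR_sgn)
    then have "norm (a - sgn a) = \<bar>norm a - 1\<bar>" using a by (auto simp: norm_sgn)
    also have "\<dots> \<le> norm (v p)" using norm_triangle_ineq3[of a p] p unfolding a_def by simp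
    finally have "norm (a - sgn a) \<le> \<kappa>" using bd[OF p] by simp
    moreover have "norm (sgn a - p) \<le> norm (sgn a - a) + norm (a - p)" using norm_triangle_ineq[of "sgn a - a" "a - p"] by simp
    moreover have "norm (a - p) \<le> \<kappa>" using bd[OF p] unfolding a_def by simp
    ultimately show ?thesis unfolding a_def[symmetric] by (simp add: norm_minus_commute)
  qed
qed

section \<open>Labels and their transport\<close>

type_synonym 'i labels = "'i set \<times> 'i set"

definition lab :: "nat \<Rightarrow> 'i set \<Rightarrow> ('i \<Rightarrow> point) \<Rightarrow> point \<Rightarrow> 'i set \<times> 'i set" where
  "lab k I x p = (lo k I (\<lambda>i. p \<bullet> x i), hi k I (\<lambda>i. p \<bullet> x i))"

definition tie :: "'i set \<times> 'i set \<Rightarrow> 'i set" where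
  "tie l = fst l \<inter> snd l"

lemma lab_simps [simp]:
  "fst (lab k I x p) = lo k I (\<lambda>i. p \<bullet> x i)" "snd (lab k I x p) = hi k I (\<lambda>i. p \<bullet> x i)"
  by (simp_all add: lab_def)

lemma lab_scale:
  assumes "0 < c"
  shows "lab k I x (c *\<^sub>R p) = lab k I x p"
  using assms by (simp add: lab_def lo_def hi_def)

lemma lab_sgn: "lab k I x (sgn p) = lab k I x p"
proof (cases "p = 0")
  case False
  then have "lab k I x (inverse (norm p) *\<^sub>R p) = lab k I x p" by (intro lab_scale) simp
  then show ?thesis by (simp add: sgn_div_norm)
qed simp

text \<open>\<open>cmp k I x0 x p q\<close>: the dots \<open>x\<close>, seen from \<open>q\<close>, are ordered as the dots \<open>x0\<close> seen from \<open>p\<close>,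
  as far as this matters at order \<open>k\<close>. This condition on \<open>q\<close> is convex.\<close>

definition cmp :: "nat \<Rightarrow> 'i set \<Rightarrow> ('i \<Rightarrow> point) \<Rightarrow> ('i \<Rightarrow> point) \<Rightarrow> point \<Rightarrow> point \<Rightarrow> bool" where
  "cmp k I x0 x p q \<longleftrightarrow> (\<forall>i \<in> fst (lab k I x0 p). \<forall>j \<in> snd (lab k I x0 p).
     (p \<bullet> x0 j < p \<bullet> x0 i \<longrightarrow> q \<bullet> x j < q \<bullet> x i) \<and> (p \<bullet> x0 j = p \<bullet> x0 i \<longrightarrow> q \<bullet> x j = q \<bullet> x i))"

lemma cmp_lab:
  assumes "finite I" "k \<le> card I" "cmp k I x0 x p q"
  shows "lab k I x q = lab k I x0 p"
  using lo_hi_transfer[OF assms(1,2), of "\<lambda>i. p \<bullet> x0 i" "\<lambda>i. q \<bullet> x i"] assms(3)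
  unfolding cmp_def lab_def by simp

text \<open>The conditions are homogeneous in the viewpoint \<open>q\<close>, so the weights may
  have any sum; one positive weight keeps the strict comparisons strict.\<close>

lemma cmp_sum:
  assumes "finite M" "\<And>m. m \<in> M \<Longrightarrow> 0 \<le> \<beta> m" "\<And>m. m \<in> M \<Longrightarrow> 0 < \<beta> m \<Longrightarrow> cmp k I x0 x p (q m)"
    and m0: "m0 \<in> M" "0 < \<beta> m0"
  shows "cmp k I x0 x p (\<Sum>m\<in>M. \<beta> m *\<^sub>R q m)"
  unfolding cmp_def
proof (intro ballI conjI impI)
  fix i j assume ij: "i \<in> fst (lab k I x0 p)" "j \<in> snd (lab k I x0 p)"
  have z: "\<beta> m = 0" if "m \<in> M" "\<not> 0 < \<beta> m" for m using assms(2)[OF that(1)] that(2) by simp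
  show "(\<Sum>m\<in>M. \<beta> m *\<^sub>R q m) \<bullet> x j < (\<Sum>m\<in>M. \<beta> m *\<^sub>R q m) \<bullet> x i" if less: "p \<bullet> x0 j < p \<bullet> x0 i"
    unfolding inner_sum_left
  proof (rule sum_strict_mono_ex1[OF assms(1)])
    have less': "q m \<bullet> x j < q m \<bullet> x i" if "m \<in> M" "0 < \<beta> m" for m
      using assms(3)[OF that] ij less unfolding cmp_def by blast
    show "\<forall>m\<in>M. \<beta> m *\<^sub>R q m \<bullet> x j \<le> \<beta> m *\<^sub>R q m \<bullet> x i"
    proof
      fix m assume "m \<in> M"
      show "\<beta> m *\<^sub>R q m \<bullet> x j \<le> \<beta> m *\<^sub>R q m \<bullet> x i"
        using less'[OF \<open>m \<in> M\<close>] z[OF \<open>m \<in> M\<close>] by (cases "0 < \<beta> m") (auto simp: less_imp_le)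
    qed
    show "\<exists>m\<in>M. \<beta> m *\<^sub>R q m \<bullet> x j < \<beta> m *\<^sub>R q m \<bullet> x i"
      using less'[OF m0] m0 by (intro bexI[of _ m0]) auto
  qed
  show "(\<Sum>m\<in>M. \<beta> m *\<^sub>R q m) \<bullet> x j = (\<Sum>m\<in>M. \<beta> m *\<^sub>R q m) \<bullet> x i" if eq: "p \<bullet> x0 j = p \<bullet> x0 i"
    unfolding inner_sum_left
  proof (rule sum.cong[OF refl])
    fix m assume "m \<in> M"
    show "\<beta> m *\<^sub>R q m \<bullet> x j = \<beta> m *\<^sub>R q m \<bullet> x i"
    proof (cases "0 < \<beta> m")
      case True
      then have "q m \<bullet> x j = q m \<bullet> x i"
        using assms(3)[OF \<open>m \<in> M\<close>] ij eq unfolding cmp_def by blast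
      then show ?thesis by simp
    qed (use z[OF \<open>m \<in> M\<close>] in simp)
  qed
qed

lemma strict_stable:
  fixes p0 :: point and x0 :: "'i \<Rightarrow> point"
  assumes "finite I"
  shows "\<exists>\<eta>>0. \<forall>x q. (\<forall>i\<in>I. norm (x i - x0 i) < \<eta>) \<longrightarrow> norm (q - p0) < \<eta> \<longrightarrow>
    (\<forall>i\<in>I. \<forall>j\<in>I. p0 \<bullet> x0 j < p0 \<bullet> x0 i \<longrightarrow> q \<bullet> x j < q \<bullet> x i)"
proof -
  have 1: "\<exists>\<eta>>0. \<forall>q a b. norm (a - a0) < \<eta> \<longrightarrow> norm (b - b0) < \<eta> \<longrightarrow> norm (q - p0) < \<eta> \<longrightarrow>
      q \<bullet> b < q \<bullet> a" if less: "p0 \<bullet> b0 < p0 \<bullet> a0" for a0 b0 :: point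
  proof -
    define M where "M = norm p0 + norm a0 + norm b0 + 1"
    define g where "g = p0 \<bullet> a0 - p0 \<bullet> b0"
    \<comment> \<open>Each of the two error terms below is at most \<open>2 * (\<eta> * M)\<close>,
      so together they use up at most half of the gap \<open>g\<close>.\<close>
    define \<eta> where "\<eta> = min 1 (g / (8 * M))"
    have M: "M \<ge> 1" and g: "g > 0" using less unfolding M_def g_def by auto
    then have \<eta>: "\<eta> > 0" "\<eta> \<le> 1" "\<eta> * M \<le> g / 8"
      unfolding \<eta>_def by (auto simp: min_def field_simps)
    have "q \<bullet> b < q \<bullet> a" if h: "norm (a - a0) < \<eta>" "norm (b - b0) < \<eta>" "norm (q - p0) < \<eta>" for q a b
    proof -
      have eq: "q \<bullet> a - q \<bullet> b = g + (q - p0) \<bullet> (a - b) + p0 \<bullet> ((a - a0) - (b - b0))"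
        unfolding g_def by (simp add: inner_diff algebra_simps)
      have n: "norm a \<le> norm a0 + 1" "norm b \<le> norm b0 + 1"
        using h \<eta> norm_triangle_sub[of a a0] norm_triangle_sub[of b b0] by linarith+
      have "\<bar>(q - p0) \<bullet> (a - b)\<bar> \<le> norm (q - p0) * norm (a - b)" by (rule Cauchy_Schwarz_ineq2)
      also have "\<dots> \<le> \<eta> * (2 * M)"
      proof (intro mult_mono)
        show "norm (a - b) \<le> 2 * M"
          using n norm_triangle_ineq4[of a b] norm_ge_zero[of p0] norm_ge_zero[of a0] norm_ge_zero[of b0]
          unfolding M_def by argo
      qed (use h \<eta> in auto)
      finally have 1: "\<bar>(q - p0) \<bullet> (a - b)\<bar> \<le> 2 * (\<eta> * M)" by simp
      have "\<bar>p0 \<bullet> ((a - a0) - (b - b0))\<bar> \<le> norm p0 * norm ((a - a0) - (b - b0))" by (rule Cauchy_Schwarz_ineq2)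
      also have "\<dots> \<le> M * (2 * \<eta>)"
        using h norm_triangle_ineq4[of "a - a0" "b - b0"] unfolding M_def by (intro mult_mono) auto
      finally have 2: "\<bar>p0 \<bullet> ((a - a0) - (b - b0))\<bar> \<le> 2 * (\<eta> * M)" by (simp add: mult.commute mult.left_commute)
      show ?thesis using eq 1 2 \<eta>(3) g by linarith
    qed
    then show ?thesis using \<eta>(1) by blast
  qed
  define S where "S = {(i, j). i \<in> I \<and> j \<in> I \<and> p0 \<bullet> x0 j < p0 \<bullet> x0 i}"
  have finS: "finite S" unfolding S_def by (rule finite_subset[of _ "I \<times> I"]) (use assms in auto)
  have "\<forall>s\<in>S. \<exists>\<eta>>0. \<forall>q a b. norm (a - x0 (fst s)) < \<eta> \<longrightarrow> norm (b - x0 (snd s)) < \<eta> \<longrightarrow> norm (q - p0) < \<eta> \<longrightarrow>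
      q \<bullet> b < q \<bullet> a"
    using 1 unfolding S_def by auto
  then obtain \<eta> where \<eta>: "\<And>s. s \<in> S \<Longrightarrow> \<eta> s > 0" "\<And>s q a b. s \<in> S \<Longrightarrow> norm (a - x0 (fst s)) < \<eta> s \<Longrightarrow>
      norm (b - x0 (snd s)) < \<eta> s \<Longrightarrow> norm (q - p0) < \<eta> s \<Longrightarrow> q \<bullet> b < q \<bullet> a" by metis
  define e where "e = Min (insert 1 (\<eta> ` S))"
  have e: "e > 0" "\<And>s. s \<in> S \<Longrightarrow> e \<le> \<eta> s" unfolding e_def using finS \<eta>(1) by auto
  show ?thesis
  proof (intro exI[of _ e] conjI e(1) allI impI ballI)
    fix x q i j assume "\<forall>i\<in>I. norm (x i - x0 i) < e" "norm (q - p0) < e" "i \<in> I" "j \<in> I" "p0 \<bullet> x0 j < p0 \<bullet> x0 i"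
    then show "q \<bullet> x j < q \<bullet> x i"
      using \<eta>(2)[of "(i, j)" "x i" "x j" q] e(2)[of "(i, j)"] unfolding S_def by fastforce
  qed
qed

text \<open>Near \<open>p0\<close> the only relevant comparisons that can still go either way are
  those among the dots tied at \<open>p0\<close>; the others are strict there and remain so. For the
  tied dots the differences of heights must be reproduced exactly, since some of them may be tied at
  \<open>p\<close> too and a tie survives no inexact motion.\<close>

lemma cmp_local:
  fixes p0 :: point and x0 :: "'i \<Rightarrow> point"
  assumes "finite I" "k \<le> card I"
  shows "\<exists>\<eta>>0. \<forall>x p q. (\<forall>i\<in>I. norm (x i - x0 i) < \<eta>) \<longrightarrow> norm (p - p0) < \<eta> \<longrightarrow> norm (q - p0) < \<eta> \<longrightarrow>
    (\<forall>i\<in>tie (lab k I x0 p0). \<forall>j\<in>tie (lab k I x0 p0). q \<bullet> (x i - x j) = p \<bullet> (x0 i - x0 j)) \<longrightarrow>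
    cmp k I x0 x p q"
proof -
  obtain \<eta> where \<eta>: "\<eta> > 0" and st: "\<And>x q i j. (\<forall>i\<in>I. norm (x i - x0 i) < \<eta>) \<Longrightarrow> norm (q - p0) < \<eta> \<Longrightarrow>
    i \<in> I \<Longrightarrow> j \<in> I \<Longrightarrow> p0 \<bullet> x0 j < p0 \<bullet> x0 i \<Longrightarrow> q \<bullet> x j < q \<bullet> x i"
    using strict_stable[OF assms(1), of x0 p0] by metis
  show ?thesis
  proof (intro exI[of _ \<eta>] conjI \<eta> allI impI)
    fix x p q
    assume x: "\<forall>i\<in>I. norm (x i - x0 i) < \<eta>" and p: "norm (p - p0) < \<eta>" and q: "norm (q - p0) < \<eta>"
      and ex: "\<forall>i\<in>tie (lab k I x0 p0). \<forall>j\<in>tie (lab k I x0 p0). q \<bullet> (x i - x j) = p \<bullet> (x0 i - x0 j)"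
    have st0: "p \<bullet> x0 j < p \<bullet> x0 i" if "i \<in> I" "j \<in> I" "p0 \<bullet> x0 j < p0 \<bullet> x0 i" for i j
      using st[of x0 p i j] \<eta> p that by simp
    let ?f = "\<lambda>i. p0 \<bullet> x0 i"
    have up: "lo k I (\<lambda>i. p \<bullet> x0 i) \<subseteq> lo k I ?f" "hi k I (\<lambda>i. p \<bullet> x0 i) \<subseteq> hi k I ?f"
      by (rule lo_hi_upper[OF assms]; use st0 lo_subset[of k I ?f] hi_subset[of k I ?f] in blast)+
    show "cmp k I x0 x p q"
      unfolding cmp_def
    proof (intro ballI)
      fix i j assume ij: "i \<in> fst (lab k I x0 p)" "j \<in> snd (lab k I x0 p)"
      then have ij0: "i \<in> lo k I ?f" "j \<in> hi k I ?f" using up by auto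
      then have I: "i \<in> I" "j \<in> I" using lo_subset[of k I ?f] hi_subset[of k I ?f] by auto
      show "(p \<bullet> x0 j < p \<bullet> x0 i \<longrightarrow> q \<bullet> x j < q \<bullet> x i) \<and> (p \<bullet> x0 j = p \<bullet> x0 i \<longrightarrow> q \<bullet> x j = q \<bullet> x i)"
      proof (cases "i \<in> hi k I ?f \<and> j \<in> lo k I ?f")
        case True
        then have "i \<in> tie (lab k I x0 p0)" "j \<in> tie (lab k I x0 p0)" using ij0 by (auto simp: tie_def)
        then have "q \<bullet> (x i - x j) = p \<bullet> (x0 i - x0 j)" using ex by blast
        then show ?thesis by (simp add: inner_diff)
      next
        case False
        then have "p0 \<bullet> x0 j < p0 \<bullet> x0 i"
          using lo_hi_parts(10,11)[OF assms, where f = ?f] ij0 by blast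
        then show ?thesis using st[OF x q I] st0[OF I] by simp
      qed
    qed
  qed
qed

section \<open>Linear maps that compensate a small motion of the tied dots\<close>

definition noncollinear :: "'i set \<Rightarrow> ('i \<Rightarrow> point) \<Rightarrow> bool" where
  "noncollinear I x \<longleftrightarrow> (\<forall>a\<in>I. \<forall>b\<in>I. \<forall>c\<in>I. a \<noteq> b \<longrightarrow> a \<noteq> c \<longrightarrow> b \<noteq> c \<longrightarrow> cross3 (x a - x c) (x b - x c) \<noteq> 0)"

lemma gram_cross3: "(a \<bullet> a) * (b \<bullet> b) - (a \<bullet> b)\<^sup>2 = norm (cross3 a b) ^ 2"
  using norm_cross[of a b] by (simp add: power2_norm_eq_inner)

text \<open>\<open>B1\<close> and \<open>B2\<close> form the basis dual to \<open>a\<close>,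
  \<open>b\<close> in their span, written with the inverse Gram matrix. Adding suitable multiples of
  them corrects the two inner products; the multiples are small, and the dual basis stays bounded
  near \<open>e1\<close>, \<open>e2\<close> because the Gram determinant is nonzero there.\<close>

lemma exact_pair:
  fixes e1 e2 :: point
  assumes "cross3 e1 e2 \<noteq> 0" "0 < \<epsilon>"
  shows "\<exists>\<delta>>0. \<forall>a b. norm (a - e1) < \<delta> \<longrightarrow> norm (b - e2) < \<delta> \<longrightarrow>
    (\<exists>L. linear L \<and> (\<forall>p. norm (L p - p) \<le> \<epsilon> * norm p) \<and> (\<forall>p. L p \<bullet> a = p \<bullet> e1 \<and> L p \<bullet> b = p \<bullet> e2))"
proof -
  define D where "D = (\<lambda>z::point \<times> point. (fst z \<bullet> fst z) * (snd z \<bullet> snd z) - (fst z \<bullet> snd z)\<^sup>2)"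
  define B1 where "B1 = (\<lambda>z::point \<times> point. inverse (D z) *\<^sub>R ((snd z \<bullet> snd z) *\<^sub>R fst z - (fst z \<bullet> snd z) *\<^sub>R snd z))"
  define B2 where "B2 = (\<lambda>z::point \<times> point. inverse (D z) *\<^sub>R ((fst z \<bullet> fst z) *\<^sub>R snd z - (fst z \<bullet> snd z) *\<^sub>R fst z))"
  have D0: "D (e1, e2) \<noteq> 0" using assms(1) gram_cross3[of e1 e2] by (simp add: D_def)
  have cD: "(D \<longlongrightarrow> D (e1, e2)) (nhds (e1, e2))" unfolding D_def by (intro tendsto_intros filterlim_ident)
  have cB: "(B1 \<longlongrightarrow> B1 (e1, e2)) (nhds (e1, e2))" "(B2 \<longlongrightarrow> B2 (e1, e2)) (nhds (e1, e2))"
    unfolding B1_def B2_def by (intro tendsto_intros filterlim_ident cD D0)+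
  define N where "N = norm (B1 (e1, e2)) + norm (B2 (e1, e2)) + 1"
  have N: "N > 0" unfolding N_def by (simp add: add_nonneg_pos)
  have "\<forall>\<^sub>F z in nhds (e1, e2). D z \<noteq> 0 \<and> norm (B1 z) < N \<and> norm (B2 z) < N"
  proof (intro eventually_conj)
    show "\<forall>\<^sub>F z in nhds (e1, e2). D z \<noteq> 0" by (rule tendsto_imp_eventually_ne[OF cD D0])
    show "\<forall>\<^sub>F z in nhds (e1, e2). norm (B1 z) < N"
      by (rule order_tendstoD(2)[OF tendsto_norm[OF cB(1)]]) (simp add: N_def add_nonneg_pos)
    show "\<forall>\<^sub>F z in nhds (e1, e2). norm (B2 z) < N"
      by (rule order_tendstoD(2)[OF tendsto_norm[OF cB(2)]]) (simp add: N_def add_nonneg_pos)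
  qed
  then obtain d where d: "d > 0" "\<And>z. dist z (e1, e2) < d \<Longrightarrow> D z \<noteq> 0 \<and> norm (B1 z) < N \<and> norm (B2 z) < N"
    unfolding eventually_nhds_metric by blast
  define \<delta> where "\<delta> = min (d / 2) (\<epsilon> / (2 * N))"
  have \<delta>: "\<delta> > 0" "\<delta> \<le> d / 2" "\<delta> * N \<le> \<epsilon> / 2" unfolding \<delta>_def using d N assms(2) by (auto simp: min_def field_simps)
  show ?thesis
  proof (intro exI[of _ \<delta>] conjI \<delta>(1) allI impI)
    fix a b assume ab: "norm (a - e1) < \<delta>" "norm (b - e2) < \<delta>"
    have "dist (a, b) (e1, e2) \<le> norm (a - e1) + norm (b - e2)"
      using norm_Pair_le[of "a - e1" "b - e2"] by (simp add: dist_norm)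
    then have z: "D (a, b) \<noteq> 0" "norm (B1 (a, b)) < N" "norm (B2 (a, b)) < N"
      using d(2)[of "(a, b)"] ab \<delta>(2) by linarith+
    define L where "L = (\<lambda>p. p + ((e1 - a) \<bullet> p) *\<^sub>R B1 (a, b) + ((e2 - b) \<bullet> p) *\<^sub>R B2 (a, b))"
    have dual: "B1 (a, b) \<bullet> a = 1" "B1 (a, b) \<bullet> b = 0" "B2 (a, b) \<bullet> a = 0" "B2 (a, b) \<bullet> b = 1"
    proof -
      have "B1 (a, b) \<bullet> a = inverse (D (a, b)) * D (a, b)" "B2 (a, b) \<bullet> b = inverse (D (a, b)) * D (a, b)"
        unfolding B1_def B2_def by (simp_all add: D_def inner_diff inner_commute power2_eq_square mult.commute)
      then show "B1 (a, b) \<bullet> a = 1" "B2 (a, b) \<bullet> b = 1" using z(1) by simp_all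
      show "B1 (a, b) \<bullet> b = 0" "B2 (a, b) \<bullet> a = 0"
        unfolding B1_def B2_def by (simp_all add: inner_diff inner_commute mult.commute)
    qed
    show "\<exists>L. linear L \<and> (\<forall>p. norm (L p - p) \<le> \<epsilon> * norm p) \<and> (\<forall>p. L p \<bullet> a = p \<bullet> e1 \<and> L p \<bullet> b = p \<bullet> e2)"
    proof (intro exI[of _ L] conjI allI)
      show "linear L" unfolding L_def
        by (intro linearI) (simp_all add: inner_add algebra_simps)
      show "L p \<bullet> a = p \<bullet> e1" "L p \<bullet> b = p \<bullet> e2" for p
        unfolding L_def using dual by (simp_all add: inner_add inner_diff inner_commute)
      fix p
      have "norm (L p - p) = norm (((e1 - a) \<bullet> p) *\<^sub>R B1 (a, b) + ((e2 - b) \<bullet> p) *\<^sub>R B2 (a, b))"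
        unfolding L_def by (simp add: algebra_simps)
      also have "\<dots> \<le> \<bar>(e1 - a) \<bullet> p\<bar> * norm (B1 (a, b)) + \<bar>(e2 - b) \<bullet> p\<bar> * norm (B2 (a, b))"
        using norm_triangle_ineq[of "((e1 - a) \<bullet> p) *\<^sub>R B1 (a, b)" "((e2 - b) \<bullet> p) *\<^sub>R B2 (a, b)"] by simp
      also have "\<dots> \<le> (\<delta> * norm p) * N + (\<delta> * norm p) * N"
      proof (intro add_mono mult_mono)
        show "\<bar>(e1 - a) \<bullet> p\<bar> \<le> \<delta> * norm p"
          using ab(1) by (intro order_trans[OF Cauchy_Schwarz_ineq2] mult_right_mono) (auto simp: norm_minus_commute)
        show "\<bar>(e2 - b) \<bullet> p\<bar> \<le> \<delta> * norm p"
          using ab(2) by (intro order_trans[OF Cauchy_Schwarz_ineq2] mult_right_mono) (auto simp: norm_minus_commute)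
      qed (use z \<delta> in auto)
      also have "\<dots> = 2 * (\<delta> * N) * norm p" by simp
      also have "\<dots> \<le> \<epsilon> * norm p" using \<delta>(3) by (intro mult_right_mono) auto
      finally show "norm (L p - p) \<le> \<epsilon> * norm p" .
    qed
  qed
qed

text \<open>Three tied dots have only two independent differences, so preserving them imposes just
  the two conditions of \<open>exact_pair\<close>. This is where a tie of four dots would be an
  obstruction. Smaller ties are padded to three dots.\<close>

lemma exact_tie:
  assumes "finite I" "3 \<le> card I" "noncollinear I x0" "T \<subseteq> I" "card T \<le> 3" "0 < \<epsilon>"
  shows "\<exists>\<delta>>0. \<forall>x. (\<forall>i\<in>I. norm (x i - x0 i) < \<delta>) \<longrightarrow>
    (\<exists>L. linear L \<and> (\<forall>p. norm (L p - p) \<le> \<epsilon> * norm p) \<and>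
      (\<forall>p. \<forall>i\<in>T. \<forall>j\<in>T. L p \<bullet> (x i - x j) = p \<bullet> (x0 i - x0 j)))"
proof -
  obtain T' where T': "T \<subseteq> T'" "T' \<subseteq> I" "card T' = 3"
    using exists_subset_between[of T 3 I] assms by blast
  then obtain a b c where abc: "T' = {a, b, c}" "a \<noteq> b" "a \<noteq> c" "b \<noteq> c"
    by (auto simp: card_3_iff)
  then have I: "a \<in> I" "b \<in> I" "c \<in> I" using T' by auto
  have "cross3 (x0 a - x0 c) (x0 b - x0 c) \<noteq> 0" using assms(3) I abc unfolding noncollinear_def by blast
  from exact_pair[OF this assms(6)] obtain \<delta> where \<delta>: "\<delta> > 0" and ex: "\<And>u v. norm (u - (x0 a - x0 c)) < \<delta> \<Longrightarrow> norm (v - (x0 b - x0 c)) < \<delta> \<Longrightarrow>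
    (\<exists>L. linear L \<and> (\<forall>p. norm (L p - p) \<le> \<epsilon> * norm p) \<and> (\<forall>p. L p \<bullet> u = p \<bullet> (x0 a - x0 c) \<and> L p \<bullet> v = p \<bullet> (x0 b - x0 c)))"
    by blast
  show ?thesis
  proof (intro exI[of _ "\<delta> / 2"] conjI allI impI)
    show "\<delta> / 2 > 0" using \<delta> by simp
    fix x assume x: "\<forall>i\<in>I. norm (x i - x0 i) < \<delta> / 2"
    have n: "norm ((x i - x j) - (x0 i - x0 j)) < \<delta>" if "i \<in> I" "j \<in> I" for i j
    proof -
      have "(x i - x j) - (x0 i - x0 j) = (x i - x0 i) - (x j - x0 j)" by simp
      then have "norm ((x i - x j) - (x0 i - x0 j)) \<le> norm (x i - x0 i) + norm (x j - x0 j)"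
        using norm_triangle_ineq4 by metis
      then show ?thesis using bspec[OF x that(1)] bspec[OF x that(2)] by linarith
    qed
    from ex[OF n[OF I(1,3)] n[OF I(2,3)]] obtain L where L: "linear L" "\<And>p. norm (L p - p) \<le> \<epsilon> * norm p"
      "\<And>p. L p \<bullet> (x a - x c) = p \<bullet> (x0 a - x0 c)" "\<And>p. L p \<bullet> (x b - x c) = p \<bullet> (x0 b - x0 c)" by blast
    have "L p \<bullet> (x i - x j) = p \<bullet> (x0 i - x0 j)" if "i \<in> T" "j \<in> T" for p i j
    proof -
      have "i \<in> {a,b,c}" "j \<in> {a,b,c}" using that T' abc by auto
      then show ?thesis using L(3,4)[of p] by (auto simp: inner_diff)
    qed
    then show "\<exists>L. linear L \<and> (\<forall>p. norm (L p - p) \<le> \<epsilon> * norm p) \<and>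
      (\<forall>p. \<forall>i\<in>T. \<forall>j\<in>T. L p \<bullet> (x i - x j) = p \<bullet> (x0 i - x0 j))" using L(1,2) by blast
  qed
qed

text \<open>A partition of unity made of tent functions. The Lipschitz constant is \<open>e\<close>
  times a number that depends on the cover alone, so the cover can be fixed before it is decided how
  far the dots may move.\<close>

lemma weighted_average_lipschitz:
  fixes L :: "'m \<Rightarrow> point \<Rightarrow> point" and r :: "'m \<Rightarrow> real" and c :: "'m \<Rightarrow> point"
  assumes M: "finite M" "M \<noteq> {}"
    and lin: "\<And>m. m \<in> M \<Longrightarrow> linear (L m)"
    and near: "\<And>m p. m \<in> M \<Longrightarrow> norm (L m p - p) \<le> e * norm p" and e: "0 \<le> e"
    and s: "\<And>p. p \<in> S2 \<Longrightarrow> s \<le> (\<Sum>m\<in>M. max 0 (r m - norm (p - c m)))" "0 < s"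
  defines "\<beta> \<equiv> \<lambda>m p. max 0 (r m - norm (p - c m))"
  defines "v \<equiv> \<lambda>p. \<Sum>m\<in>M. (\<beta> m p / (\<Sum>m\<in>M. \<beta> m p)) *\<^sub>R (L m p - p)"
  shows "\<And>p q. p \<in> S2 \<Longrightarrow> q \<in> S2 \<Longrightarrow> norm (v p - v q) \<le> e * (card M * ((1 + card M) / s + 1)) * norm (p - q)"
    and "\<And>p. p \<in> S2 \<Longrightarrow> norm (v p) \<le> e"
    and "\<And>p. p \<in> S2 \<Longrightarrow> p + v p = inverse (\<Sum>m\<in>M. \<beta> m p) *\<^sub>R (\<Sum>m\<in>M. \<beta> m p *\<^sub>R L m p)"
proof -
  define S where "S = (\<lambda>p. \<Sum>m\<in>M. \<beta> m p)"
  define w where "w = (\<lambda>m p. \<beta> m p / S p)"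
  have S: "s \<le> S p" "0 < S p" if "p \<in> S2" for p using s(1)[OF that] s(2) unfolding S_def \<beta>_def by auto
  have \<beta>0: "0 \<le> \<beta> m p" for m p unfolding \<beta>_def by simp
  have \<beta>S: "\<beta> m p \<le> S p" if "m \<in> M" for m p
    unfolding S_def using M(1) that \<beta>0 by (intro member_le_sum) auto
  have w: "0 \<le> w m p" "w m p \<le> 1" if "m \<in> M" "p \<in> S2" for m p
    using \<beta>S[OF that(1), of p] \<beta>0[of m p] S(2)[OF that(2)] unfolding w_def by auto
  have w1: "(\<Sum>m\<in>M. w m p) = 1" if "p \<in> S2" for p
    unfolding w_def sum_divide_distrib[symmetric] using S(2)[OF that] by (simp add: S_def)
  have v: "v p = (\<Sum>m\<in>M. w m p *\<^sub>R (L m p - p))" for p unfolding v_def w_def S_def by simp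
  have \<beta>lip: "\<bar>\<beta> m p - \<beta> m q\<bar> \<le> norm (p - q)" for m p q
  proof -
    have "\<bar>norm (p - c m) - norm (q - c m)\<bar> \<le> norm (p - q)"
      using norm_triangle_ineq3[of "p - c m" "q - c m"] by simp
    then show ?thesis unfolding \<beta>_def by linarith
  qed
  have Slip: "\<bar>S p - S q\<bar> \<le> card M * norm (p - q)" for p q
  proof -
    have "\<bar>S p - S q\<bar> = \<bar>\<Sum>m\<in>M. \<beta> m p - \<beta> m q\<bar>" unfolding S_def by (simp add: sum_subtractf)
    also have "\<dots> \<le> (\<Sum>m\<in>M. \<bar>\<beta> m p - \<beta> m q\<bar>)" by (rule sum_abs)
    also have "\<dots> \<le> card M * norm (p - q)" using sum_bounded_above[of M "\<lambda>m. \<bar>\<beta> m p - \<beta> m q\<bar>" "norm (p - q)"] \<beta>lip by simp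
    finally show ?thesis .
  qed
  have wlip: "\<bar>w m p - w m q\<bar> \<le> (1 + card M) / s * norm (p - q)" if "m \<in> M" and pq: "p \<in> S2" "q \<in> S2" for m p q
  proof -
    \<comment> \<open>Difference of two quotients, arranged so that only one denominator, bounded
      below by \<open>s\<close>, survives; the other is absorbed in a weight of at most 1.\<close>
    have "w m p - w m q = ((\<beta> m p - \<beta> m q) - w m q * (S p - S q)) / S p"
      using S(2)[OF pq(1)] S(2)[OF pq(2)] unfolding w_def by (simp add: field_simps)
    then have "\<bar>w m p - w m q\<bar> = \<bar>(\<beta> m p - \<beta> m q) - w m q * (S p - S q)\<bar> / S p"
      using S(2)[OF pq(1)] by (simp add: abs_divide)
    also have "\<dots> \<le> (norm (p - q) + 1 * (card M * norm (p - q))) / s"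
    proof (intro frac_le)
      have "\<bar>w m q * (S p - S q)\<bar> \<le> 1 * (card M * norm (p - q))"
        unfolding abs_mult using w[OF that(1) pq(2)] Slip[of p q] by (intro mult_mono) auto
      then show "\<bar>(\<beta> m p - \<beta> m q) - w m q * (S p - S q)\<bar> \<le> norm (p - q) + 1 * (card M * norm (p - q))"
        using \<beta>lip[of m p q] by linarith
    qed (use S[OF pq(1)] s(2) in auto)
    finally show ?thesis by (simp add: algebra_simps)
  qed
  show "norm (v p) \<le> e" if p: "p \<in> S2" for p
  proof -
    have "norm (v p) \<le> (\<Sum>m\<in>M. norm (w m p *\<^sub>R (L m p - p)))" unfolding v by (rule norm_sum)
    also have "\<dots> \<le> (\<Sum>m\<in>M. w m p * e)"
      using near[of _ p] w[OF _ p] p by (intro sum_mono) (auto intro!: mult_left_mono)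
    also have "\<dots> = e" using w1[OF p] by (simp add: sum_distrib_right[symmetric])
    finally show ?thesis .
  qed
  show "p + v p = inverse (\<Sum>m\<in>M. \<beta> m p) *\<^sub>R (\<Sum>m\<in>M. \<beta> m p *\<^sub>R L m p)" if p: "p \<in> S2" for p
  proof -
    have "v p = (\<Sum>m\<in>M. w m p *\<^sub>R L m p) - (\<Sum>m\<in>M. w m p) *\<^sub>R p"
      unfolding v by (simp add: scaleR_diff_right sum_subtractf scaleR_left.sum)
    then have "p + v p = (\<Sum>m\<in>M. w m p *\<^sub>R L m p)" using w1[OF p] by simp
    then show ?thesis unfolding w_def S_def by (simp add: scaleR_sum_right field_simps)
  qed
  show "norm (v p - v q) \<le> e * (card M * ((1 + card M) / s + 1)) * norm (p - q)" if pq: "p \<in> S2" "q \<in> S2" for p q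
  proof -
    have one: "norm (w m p *\<^sub>R (L m p - p) - w m q *\<^sub>R (L m q - q)) \<le> e * (((1 + card M) / s + 1) * norm (p - q))" if m: "m \<in> M" for m
    proof -
      have "L m p - L m q = L m (p - q)" using lin[OF m] by (simp add: linear_diff)
      then have "w m p *\<^sub>R (L m p - p) - w m q *\<^sub>R (L m q - q) = (w m p - w m q) *\<^sub>R (L m p - p) + w m q *\<^sub>R (L m (p - q) - (p - q))"
        by (simp add: algebra_simps)
      then have "norm (w m p *\<^sub>R (L m p - p) - w m q *\<^sub>R (L m q - q)) \<le> \<bar>w m p - w m q\<bar> * norm (L m p - p) + \<bar>w m q\<bar> * norm (L m (p - q) - (p - q))"
        by (metis norm_triangle_ineq norm_scaleR)
      also have "\<dots> \<le> ((1 + card M) / s * norm (p - q)) * e + 1 * (e * norm (p - q))"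
        using wlip[OF m pq] near[OF m, of p] near[OF m, of "p - q"] w[OF m pq(2)] pq e s(2)
        by (intro add_mono mult_mono) auto
      finally show ?thesis by (simp add: algebra_simps)
    qed
    have "norm (v p - v q) \<le> (\<Sum>m\<in>M. norm (w m p *\<^sub>R (L m p - p) - w m q *\<^sub>R (L m q - q)))"
      unfolding v sum_subtractf[symmetric] by (rule norm_sum)
    also have "\<dots> \<le> card M * (e * (((1 + card M) / s + 1) * norm (p - q)))"
      using sum_bounded_above[of M, OF one] by simp
    finally show ?thesis by (simp add: algebra_simps)
  qed
qed

text \<open>Around the points of \<open>Z\<close>, where four dots may be tied, the identity takes
  the place of a compensating map. Within \<rho>1 of \<open>Z\<close> it acts alone, beyond \<rho>
  it is switched off, and in between the average is still correct where the identity itself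
  preserves the comparisons. That intermediate case is what the square move relies on.\<close>

theorem local_triviality:
  fixes x0 :: "'i \<Rightarrow> point"
  assumes I: "finite I" "3 \<le> card I" "k \<le> card I" and nc: "noncollinear I x0"
    and Z: "finite Z" and tie3: "\<And>p. p \<in> S2 - Z \<Longrightarrow> card (tie (lab k I x0 p)) \<le> 3"
    and \<rho>: "0 < \<rho>1" "2 * \<rho>1 \<le> \<rho>" and \<epsilon>: "0 < \<epsilon>"
  shows "\<exists>\<delta>>0. \<forall>x. (\<forall>i\<in>I. norm (x i - x0 i) < \<delta>) \<longrightarrow> (\<exists>H. isotopy_of_sphere H \<and>
    (\<forall>p\<in>S2. norm (H 1 p - p) \<le> \<epsilon>) \<and>
    (\<forall>p\<in>S2. (\<forall>z\<in>Z. \<rho> \<le> norm (p - z) \<or> \<rho>1 \<le> norm (p - z) \<and> cmp k I x0 x p p) \<longrightarrow>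
       lab k I x (H 1 p) = lab k I x0 p) \<and>
    (\<forall>p\<in>S2. \<forall>z\<in>Z. norm (p - z) < \<rho>1 \<longrightarrow> H 1 p = p))"
proof -
  have "\<forall>p0. \<exists>\<eta>>0. \<forall>x p q. (\<forall>i\<in>I. norm (x i - x0 i) < \<eta>) \<longrightarrow> norm (p - p0) < \<eta> \<longrightarrow> norm (q - p0) < \<eta> \<longrightarrow>
    (\<forall>i\<in>tie (lab k I x0 p0). \<forall>j\<in>tie (lab k I x0 p0). q \<bullet> (x i - x j) = p \<bullet> (x0 i - x0 j)) \<longrightarrow> cmp k I x0 x p q"
    using cmp_local[OF I(1,3), of x0] by blast
  then obtain \<eta> where \<eta>: "\<And>p0. 0 < \<eta> p0" and loc: "\<And>p0 x p q. (\<forall>i\<in>I. norm (x i - x0 i) < \<eta> p0) \<Longrightarrow>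
      norm (p - p0) < \<eta> p0 \<Longrightarrow> norm (q - p0) < \<eta> p0 \<Longrightarrow>
      (\<forall>i\<in>tie (lab k I x0 p0). \<forall>j\<in>tie (lab k I x0 p0). q \<bullet> (x i - x j) = p \<bullet> (x0 i - x0 j)) \<Longrightarrow> cmp k I x0 x p q"
    by metis
  \<comment> \<open>The bound \<rho>1, with centres at distance at least \<open>2 * \<rho>1\<close>
    from \<open>Z\<close>, keeps these tents away from the \<rho>1-neighborhood of \<open>Z\<close>.
    The factor 1/2 leaves room for the displacement of \<open>p\<close> by the linear map.\<close>
  define r where "r = (\<lambda>p. min (\<eta> p / 2) \<rho>1)"
  have r: "0 < r p" "r p \<le> \<eta> p / 2" "r p \<le> \<rho>1" for p using \<eta>[of p] \<rho> unfolding r_def by auto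
  define K where "K = S2 - (\<Union>z\<in>Z. ball z (2 * \<rho>1))"
  have "compact K" unfolding K_def by (intro compact_diff) auto
  moreover have "K \<subseteq> (\<Union>p\<in>K. ball p (r p))" using r(1) by force
  ultimately obtain P where P: "P \<subseteq> K" "finite P" "K \<subseteq> (\<Union>p\<in>P. ball p (r p))"
    using compactE_image[of K K "\<lambda>p. ball p (r p)"] by (metis open_ball)
  have PZ: "z \<notin> P" "2 * \<rho>1 \<le> norm (p - z)" if "z \<in> Z" "p \<in> P" for z p
  proof -
    have "p \<notin> ball z (2 * \<rho>1)" using that P(1) unfolding K_def by blast
    then show "2 * \<rho>1 \<le> norm (p - z)" by (simp add: dist_norm norm_minus_commute)
    have "z \<in> ball z (2 * \<rho>1)" using \<rho>(1) by simp
    then show "z \<notin> P" using that P(1) unfolding K_def by blast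
  qed
  define M where "M = P \<union> Z"
  define R where "R = (\<lambda>m. if m \<in> P then r m else \<rho>)"
  define \<beta> where "\<beta> = (\<lambda>m p::point. max 0 (R m - norm (p - m)))"
  have finM: "finite M" unfolding M_def using P Z by simp
  have \<beta>0: "0 \<le> \<beta> m p" for m p unfolding \<beta>_def by simp
  have ex_pos: "\<exists>m\<in>M. 0 < \<beta> m p" if p: "p \<in> S2" for p
  proof (cases "p \<in> K")
    case True
    then obtain m where "m \<in> P" "p \<in> ball m (r m)" using P(3) by blast
    then show ?thesis unfolding M_def \<beta>_def R_def by (auto simp: dist_norm norm_minus_commute intro!: bexI[of _ m])
  next
    case False
    then obtain z where z: "z \<in> Z" "p \<in> ball z (2 * \<rho>1)" using p unfolding K_def by blast
    then have "z \<notin> P" "norm (p - z) < \<rho>" using PZ(1)[of z z] \<rho> by (auto simp: dist_norm norm_minus_commute)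
    then show ?thesis using z unfolding M_def \<beta>_def R_def by (auto intro!: bexI[of _ z])
  qed
  define S where "S = (\<lambda>p. \<Sum>m\<in>M. \<beta> m p)"
  have "continuous_on S2 S" unfolding S_def \<beta>_def by (intro continuous_intros)
  moreover have "axis 1 1 \<in> S2" by (simp add: norm_axis_1)
  then have "S2 \<noteq> {}" by blast
  ultimately obtain pm where pm: "pm \<in> S2" "\<And>p. p \<in> S2 \<Longrightarrow> S pm \<le> S p"
    using continuous_attains_inf[of S2 S] compact_sphere by blast
  have Spos: "0 < S p" if "p \<in> S2" for p
    unfolding S_def using ex_pos[OF that] finM \<beta>0 by (auto intro: sum_pos2)
  define s where "s = S pm"
  have s: "0 < s" "\<And>p. p \<in> S2 \<Longrightarrow> s \<le> S p" unfolding s_def using Spos pm by auto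
  have Mne: "M \<noteq> {}" using ex_pos[OF pm(1)] by blast
  define C where "C = real (card M) * ((1 + real (card M)) / s + 1) + 1"
  have C: "1 \<le> C" unfolding C_def using s(1) by simp
  define e1 where "e1 = Min (insert 1 ((\<lambda>m. \<eta> m / 2) ` P))"
  have e1: "0 < e1" unfolding e1_def using P(2) \<eta> by auto
  have e1': "e1 \<le> \<eta> m / 2" if "m \<in> P" for m
    unfolding e1_def by (rule Min_le) (use P(2) that in auto)
  \<comment> \<open>Divided by the constant \<open>C\<close> of the cover, so that
    \<open>e * C\<close> meets three demands: the 1/8 of \<open>small_displacement_isotopy\<close>,
    the prescribed displacement, and the radii within which \<open>cmp_local\<close> holds.\<close>
  define e where "e = min e1 (min (1/8) (\<epsilon> / 2)) / C"
  have e: "0 < e" "e * C \<le> 1/8" "e * C \<le> \<epsilon> / 2" "e * C \<le> e1" unfolding e_def using C e1 \<epsilon> by auto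
  have eC: "e \<le> e * C" using e(1) C by simp
  have "\<forall>m\<in>P. \<exists>\<delta>>0. \<forall>x. (\<forall>i\<in>I. norm (x i - x0 i) < \<delta>) \<longrightarrow>
    (\<exists>L. linear L \<and> (\<forall>p. norm (L p - p) \<le> e * norm p) \<and>
      (\<forall>p. \<forall>i\<in>tie (lab k I x0 m). \<forall>j\<in>tie (lab k I x0 m). L p \<bullet> (x i - x j) = p \<bullet> (x0 i - x0 j)))"
  proof
    fix m assume m: "m \<in> P"
    show "\<exists>\<delta>>0. \<forall>x. (\<forall>i\<in>I. norm (x i - x0 i) < \<delta>) \<longrightarrow>
    (\<exists>L. linear L \<and> (\<forall>p. norm (L p - p) \<le> e * norm p) \<and>
      (\<forall>p. \<forall>i\<in>tie (lab k I x0 m). \<forall>j\<in>tie (lab k I x0 m). L p \<bullet> (x i - x j) = p \<bullet> (x0 i - x0 j)))"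
    proof (rule exact_tie[OF I(1,2) nc _ _ e(1)])
      show "tie (lab k I x0 m) \<subseteq> I" unfolding tie_def using lo_subset[of k I] by fastforce
      show "card (tie (lab k I x0 m)) \<le> 3" using tie3[of m] m P(1) PZ(1)[OF _ m, of m] unfolding K_def by blast
    qed
  qed
  then obtain d where d: "\<And>m. m \<in> P \<Longrightarrow> 0 < d m" and dL: "\<And>m x. m \<in> P \<Longrightarrow> (\<forall>i\<in>I. norm (x i - x0 i) < d m) \<Longrightarrow>
    (\<exists>L. linear L \<and> (\<forall>p. norm (L p - p) \<le> e * norm p) \<and>
      (\<forall>p. \<forall>i\<in>tie (lab k I x0 m). \<forall>j\<in>tie (lab k I x0 m). L p \<bullet> (x i - x j) = p \<bullet> (x0 i - x0 j)))"
    by metis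
  define \<delta> where "\<delta> = Min (insert 1 ((\<lambda>m. min (d m) (\<eta> m)) ` P))"
  have \<delta>: "0 < \<delta>" unfolding \<delta>_def using P(2) \<eta> d by auto
  have \<delta>': "\<delta> \<le> min (d m) (\<eta> m)" if "m \<in> P" for m
    unfolding \<delta>_def by (rule Min_le) (use P(2) that in auto)
  show ?thesis
  proof (intro exI[of _ \<delta>] conjI \<delta> allI impI)
    fix x assume x: "\<forall>i\<in>I. norm (x i - x0 i) < \<delta>"
    have x': "\<forall>i\<in>I. norm (x i - x0 i) < d m" "\<forall>i\<in>I. norm (x i - x0 i) < \<eta> m" if "m \<in> P" for m
      using x \<delta>'[OF that] by fastforce+
    have "\<forall>m\<in>M. \<exists>L. linear L \<and> (\<forall>p. norm (L p - p) \<le> e * norm p) \<and>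
      (m \<in> P \<longrightarrow> (\<forall>p. \<forall>i\<in>tie (lab k I x0 m). \<forall>j\<in>tie (lab k I x0 m). L p \<bullet> (x i - x j) = p \<bullet> (x0 i - x0 j))) \<and>
      (m \<notin> P \<longrightarrow> L = (\<lambda>p. p))"
    proof
      fix m assume "m \<in> M"
      show "\<exists>L. linear L \<and> (\<forall>p. norm (L p - p) \<le> e * norm p) \<and>
      (m \<in> P \<longrightarrow> (\<forall>p. \<forall>i\<in>tie (lab k I x0 m). \<forall>j\<in>tie (lab k I x0 m). L p \<bullet> (x i - x j) = p \<bullet> (x0 i - x0 j))) \<and>
      (m \<notin> P \<longrightarrow> L = (\<lambda>p. p))"
      proof (cases "m \<in> P")
        case True then show ?thesis using dL[OF True x'(1)[OF True]] by simp
      next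
        case False then show ?thesis using e(1) linear_ident by (intro exI[of _ "\<lambda>p. p"]) auto
      qed
    qed
    from bchoice[OF this] obtain L where LL: "\<forall>m\<in>M. linear (L m) \<and> (\<forall>p. norm (L m p - p) \<le> e * norm p) \<and>
      (m \<in> P \<longrightarrow> (\<forall>p. \<forall>i\<in>tie (lab k I x0 m). \<forall>j\<in>tie (lab k I x0 m). L m p \<bullet> (x i - x j) = p \<bullet> (x0 i - x0 j))) \<and>
      (m \<notin> P \<longrightarrow> L m = (\<lambda>p. p))" by blast
    have L: "\<And>m. m \<in> M \<Longrightarrow> linear (L m)" "\<And>m p. m \<in> M \<Longrightarrow> norm (L m p - p) \<le> e * norm p"
      "\<And>m p i j. m \<in> P \<Longrightarrow> i \<in> tie (lab k I x0 m) \<Longrightarrow> j \<in> tie (lab k I x0 m) \<Longrightarrow> L m p \<bullet> (x i - x j) = p \<bullet> (x0 i - x0 j)"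
      "\<And>m. m \<in> M \<Longrightarrow> m \<notin> P \<Longrightarrow> L m = (\<lambda>p. p)"
      using LL unfolding M_def by blast+
    define v where "v = (\<lambda>p. \<Sum>m\<in>M. (\<beta> m p / (\<Sum>m\<in>M. \<beta> m p)) *\<^sub>R (L m p - p))"
    have s': "s \<le> (\<Sum>m\<in>M. max 0 (R m - norm (p - m)))" if "p \<in> S2" for p using s(2)[OF that] unfolding S_def \<beta>_def .
    have W1: "norm (v p - v q) \<le> e * (card M * ((1 + card M) / s + 1)) * norm (p - q)" if "p \<in> S2" "q \<in> S2" for p q
      unfolding v_def \<beta>_def
      by (rule weighted_average_lipschitz(1)[where M=M and L=L and e=e and r=R and c="\<lambda>m. m" and s=s])
        (use finM Mne L(1,2) e(1) s' s(1) that in \<open>simp_all add: less_imp_le\<close>)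
    have W2: "norm (v p) \<le> e" if "p \<in> S2" for p
      unfolding v_def \<beta>_def
      by (rule weighted_average_lipschitz(2)[where M=M and L=L and e=e and r=R and c="\<lambda>m. m" and s=s])
        (use finM Mne L(1,2) e(1) s' s(1) that in \<open>simp_all add: less_imp_le\<close>)
    have W3: "p + v p = inverse (\<Sum>m\<in>M. \<beta> m p) *\<^sub>R (\<Sum>m\<in>M. \<beta> m p *\<^sub>R L m p)" if "p \<in> S2" for p
      unfolding v_def \<beta>_def
      by (rule weighted_average_lipschitz(3)[where M=M and L=L and e=e and r=R and c="\<lambda>m. m" and s=s])
        (use finM Mne L(1,2) e(1) s' s(1) that in \<open>simp_all add: less_imp_le\<close>)
    have lip: "norm (v p - v q) \<le> (e * C) * norm (p - q)" if "p \<in> S2" "q \<in> S2" for p q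
    proof -
      have "norm (v p - v q) \<le> e * (card M * ((1 + card M) / s + 1)) * norm (p - q)" by (rule W1[OF that])
      also have "\<dots> \<le> (e * C) * norm (p - q)"
        unfolding C_def using e(1) by (intro mult_right_mono mult_left_mono) auto
      finally show ?thesis .
    qed
    have bd: "norm (v p) \<le> e * C" if "p \<in> S2" for p using W2[OF that] eC by simp
    have e0: "0 \<le> e * C" using e(1) C by simp
    define H where "H = (\<lambda>t p. sgn (p + t *\<^sub>R v p))"
    have H1: "H 1 p = sgn (\<Sum>m\<in>M. \<beta> m p *\<^sub>R L m p)" if "p \<in> S2" for p
    proof -
      have "H 1 p = sgn (inverse (S p) *\<^sub>R (\<Sum>m\<in>M. \<beta> m p *\<^sub>R L m p))"
        using W3[OF that] unfolding H_def S_def by simp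
      then show ?thesis using Spos[OF that] by (simp add: sgn_scaleR)
    qed
    show "\<exists>H. isotopy_of_sphere H \<and>
    (\<forall>p\<in>S2. norm (H 1 p - p) \<le> \<epsilon>) \<and>
    (\<forall>p\<in>S2. (\<forall>z\<in>Z. \<rho> \<le> norm (p - z) \<or> \<rho>1 \<le> norm (p - z) \<and> cmp k I x0 x p p) \<longrightarrow>
       lab k I x (H 1 p) = lab k I x0 p) \<and>
    (\<forall>p\<in>S2. \<forall>z\<in>Z. norm (p - z) < \<rho>1 \<longrightarrow> H 1 p = p)"
    proof (intro exI[of _ H] conjI ballI impI)
      show "isotopy_of_sphere H" unfolding H_def
        by (rule small_displacement_isotopy(1)[where \<kappa>="e * C"]) (use lip bd e0 e(2) in auto)
      show "norm (H 1 p - p) \<le> \<epsilon>" if "p \<in> S2" for p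
      proof -
        have "norm (sgn (p + v p) - p) \<le> 2 * (e * C)"
          by (rule small_displacement_isotopy(2)) (use lip bd e0 e(2) that in auto)
        then show ?thesis using e(3) unfolding H_def by simp
      qed
      show "lab k I x (H 1 p) = lab k I x0 p"
        if p: "p \<in> S2" and h: "\<forall>z\<in>Z. \<rho> \<le> norm (p - z) \<or> \<rho>1 \<le> norm (p - z) \<and> cmp k I x0 x p p" for p
      proof -
        have c: "cmp k I x0 x p (L m p)" if m: "m \<in> M" "0 < \<beta> m p" for m
        proof (cases "m \<in> P")
          case True
          have "norm (p - m) < r m" using m(2) True unfolding \<beta>_def R_def by auto
          moreover have "norm (L m p - p) \<le> e" using L(2)[OF m(1), of p] p by simp
          moreover have "norm (L m p - m) \<le> norm (L m p - p) + norm (p - m)"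
            using norm_triangle_ineq[of "L m p - p" "p - m"] by simp
          ultimately have "norm (p - m) < \<eta> m" "norm (L m p - m) < \<eta> m"
            using r(2)[of m] e1'[OF True] e(4) eC \<eta>[of m] by linarith+
          then show ?thesis using L(3)[OF True] by (intro loc[of x m] x'(2)[OF True]) auto
        next
          case False
          then have "m \<in> Z" using m unfolding M_def by auto
          moreover have "norm (p - m) < \<rho>" using m(2) False unfolding \<beta>_def R_def by auto
          ultimately have "cmp k I x0 x p p" using h by fastforce
          then show ?thesis using L(4)[OF m(1) False] by simp
        qed
        obtain m0 where m0: "m0 \<in> M" "0 < \<beta> m0 p" using ex_pos[OF p] by blast
        have "cmp k I x0 x p (\<Sum>m\<in>M. \<beta> m p *\<^sub>R L m p)"
          by (rule cmp_sum[OF finM, of "\<lambda>m. \<beta> m p"]) (use c \<beta>0 m0 in auto)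
        from cmp_lab[OF I(1,3) this] show ?thesis unfolding H1[OF p] lab_sgn .
      qed
      show "H 1 p = p" if p: "p \<in> S2" and z: "z \<in> Z" "norm (p - z) < \<rho>1" for p z
      proof -
        have "\<beta> m p *\<^sub>R L m p = \<beta> m p *\<^sub>R p" if m: "m \<in> M" for m
        proof (cases "m \<in> P")
          case True
          have "norm (m - z) \<le> norm (p - m) + norm (p - z)"
            using norm_triangle_ineq4[of "p - z" "p - m"] by (simp add: algebra_simps)
          then have "r m \<le> norm (p - m)" using PZ(2)[OF z(1) True] z(2) r(3)[of m] by linarith
          then have "\<beta> m p = 0" using True unfolding \<beta>_def R_def by simp
          then show ?thesis by simp
        qed (use L(4)[OF m] in simp)
        then have "(\<Sum>m\<in>M. \<beta> m p *\<^sub>R L m p) = S p *\<^sub>R p" unfolding S_def scaleR_left.sum by (intro sum.cong) auto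
        then show ?thesis unfolding H1[OF p] using Spos[OF p] p by (simp add: sgn_scaleR sgn_div_norm)
      qed
    qed
  qed
qed

section \<open>Isotopies that carry labels to labels\<close>

definition label_isotopic :: "(point \<Rightarrow> 'l) \<Rightarrow> (point \<Rightarrow> 'l) \<Rightarrow> bool" where
  "label_isotopic \<Lambda> \<Lambda>' \<longleftrightarrow> (\<exists>H. isotopy_of_sphere H \<and> (\<forall>p\<in>S2. \<Lambda>' (H 1 p) = \<Lambda> p))"

abbreviation lab_isotopic :: "nat \<Rightarrow> 'i set \<Rightarrow> ('i \<Rightarrow> point) \<Rightarrow> ('i \<Rightarrow> point) \<Rightarrow> bool" where
  "lab_isotopic k I x y \<equiv> label_isotopic (lab k I x) (lab k I y)"

lemma label_isotopic_sym:
  assumes "label_isotopic \<Lambda> \<Lambda>'"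
  shows "label_isotopic \<Lambda>' \<Lambda>"
proof -
  obtain H where H: "isotopy_of_sphere H" "\<And>p. p \<in> S2 \<Longrightarrow> \<Lambda>' (H 1 p) = \<Lambda> p"
    using assms unfolding label_isotopic_def by blast
  obtain g where g: "homeomorphism S2 S2 (H 1) g"
    using H(1) unfolding isotopy_of_sphere_def by (meson atLeastAtMost_iff order_refl zero_le_one)
  have gS: "g p \<in> S2" "H 1 (g p) = p" if "p \<in> S2" for p using g that by (auto simp: homeomorphism_def)
  have "H 0 p = p" if "p \<in> S2" for p using H(1) that unfolding isotopy_of_sphere_def by blast
  then have "\<Lambda> (H (1 - 1) (g p)) = \<Lambda>' p" if "p \<in> S2" for p
    using H(2)[OF gS(1)[OF that]] gS[OF that] that by simp
  then show ?thesis using isotopy_inverse[OF H(1) g] unfolding label_isotopic_def by (intro exI[of _ "\<lambda>t x. H (1 - t) (g x)"]) simp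
qed

lemma label_isotopic_trans:
  assumes "label_isotopic \<Lambda> \<Lambda>'" "label_isotopic \<Lambda>' \<Lambda>''"
  shows "label_isotopic \<Lambda> \<Lambda>''"
proof -
  obtain H K where H: "isotopy_of_sphere H" "\<And>p. p \<in> S2 \<Longrightarrow> \<Lambda>' (H 1 p) = \<Lambda> p"
    and K: "isotopy_of_sphere K" "\<And>p. p \<in> S2 \<Longrightarrow> \<Lambda>'' (K 1 p) = \<Lambda>' p"
    using assms unfolding label_isotopic_def by blast
  have "H 1 p \<in> S2" if "p \<in> S2" for p using isotopy_maps(1)[OF H(1), of 1] that by auto
  then show ?thesis
    using isotopy_compose[OF H(1) K(1)] H(2) K(2) unfolding label_isotopic_def
    by (intro exI[of _ "\<lambda>t x. K t (H t x)"]) simp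
qed

text \<open>Refers to order k only: a circle through four dots does no harm as long as they are not
  tied at the k-th place. It also makes sense for dots off the sphere, as the normal form of a wall
  requires.\<close>

definition regular :: "nat \<Rightarrow> 'i set \<Rightarrow> ('i \<Rightarrow> point) \<Rightarrow> bool" where
  "regular k I x \<longleftrightarrow> noncollinear I x \<and> (\<forall>p\<in>S2. card (tie (lab k I x p)) \<le> 3)"

lemma regular_stable:
  assumes "finite I" "3 \<le> card I" "k \<le> card I" "regular k I x0"
  shows "\<exists>\<delta>>0. \<forall>x. (\<forall>i\<in>I. norm (x i - x0 i) < \<delta>) \<longrightarrow> lab_isotopic k I x0 x"
proof -
  have "\<exists>\<delta>>0. \<forall>x. (\<forall>i\<in>I. norm (x i - x0 i) < \<delta>) \<longrightarrow> (\<exists>H. isotopy_of_sphere H \<and>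
    (\<forall>p\<in>S2. norm (H 1 p - p) \<le> 1) \<and>
    (\<forall>p\<in>S2. (\<forall>z\<in>{}. 2 \<le> norm (p - z) \<or> 1 \<le> norm (p - z) \<and> cmp k I x0 x p p) \<longrightarrow>
       lab k I x (H 1 p) = lab k I x0 p) \<and>
    (\<forall>p\<in>S2. \<forall>z\<in>{}. norm (p - z) < 1 \<longrightarrow> H 1 p = p))"
    by (rule local_triviality) (use assms in \<open>auto simp: regular_def\<close>)
  then obtain \<delta> where \<delta>: "\<delta> > 0" "\<And>x. (\<forall>i\<in>I. norm (x i - x0 i) < \<delta>) \<Longrightarrow> (\<exists>H. isotopy_of_sphere H \<and>
    (\<forall>p\<in>S2. lab k I x (H 1 p) = lab k I x0 p))"
    by fastforce
  then show ?thesis unfolding label_isotopic_def by blast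
qed

lemma uniformly_near:
  fixes X :: "real \<Rightarrow> 'i \<Rightarrow> point"
  assumes "finite I" "\<And>i. i \<in> I \<Longrightarrow> continuous_on S (\<lambda>t. X t i)" "t \<in> S" "0 < \<delta>"
  shows "\<exists>d>0. \<forall>s\<in>S. \<bar>s - t\<bar> < d \<longrightarrow> (\<forall>i\<in>I. norm (X s i - X t i) < \<delta>)"
proof -
  have "\<forall>i\<in>I. \<exists>d>0. \<forall>s\<in>S. \<bar>s - t\<bar> < d \<longrightarrow> norm (X s i - X t i) < \<delta>"
    using assms(2-4) unfolding continuous_on_iff dist_norm real_norm_def by blast
  from bchoice[OF this] obtain d where d: "\<forall>i\<in>I. 0 < d i \<and> (\<forall>s\<in>S. \<bar>s - t\<bar> < d i \<longrightarrow> norm (X s i - X t i) < \<delta>)" by blast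
  define e where "e = Min (insert 1 (d ` I))"
  have "0 < e" unfolding e_def using assms(1) d by auto
  moreover have "e \<le> d i" if "i \<in> I" for i unfolding e_def by (rule Min_le) (use assms(1) that in auto)
  ultimately show ?thesis using d by (intro exI[of _ e]) fastforce
qed

text \<open>Compactness of the interval in the form of bisection: the relation is transitive and, by
  \<open>regular_stable\<close>, holds on a neighborhood of every parameter.\<close>

lemma lab_isotopic_path:
  fixes X :: "real \<Rightarrow> 'i \<Rightarrow> point"
  assumes I: "finite I" "3 \<le> card I" "k \<le> card I" and "a \<le> b"
    and cont: "\<And>i. i \<in> I \<Longrightarrow> continuous_on {a..b} (\<lambda>t. X t i)"
    and reg: "\<And>t. t \<in> {a..b} \<Longrightarrow> regular k I (X t)"
  shows "lab_isotopic k I (X a) (X b)"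
proof -
  define P where "P = (\<lambda>u v. a \<le> u \<longrightarrow> v \<le> b \<longrightarrow> lab_isotopic k I (X u) (X v))"
  have "P a b" using \<open>a \<le> b\<close>
  proof (induction rule: Bolzano)
    case (trans u v w)
    show ?case unfolding P_def
    proof (intro impI)
      assume "a \<le> u" "w \<le> b"
      then have "lab_isotopic k I (X u) (X v)" "lab_isotopic k I (X v) (X w)"
        using trans unfolding P_def by auto
      then show "lab_isotopic k I (X u) (X w)" by (rule label_isotopic_trans)
    qed
  next
    case (local t)
    then have t: "t \<in> {a..b}" by simp
    obtain \<delta> where \<delta>: "\<delta> > 0" "\<And>x. (\<forall>i\<in>I. norm (x i - X t i) < \<delta>) \<Longrightarrow> lab_isotopic k I (X t) x"
      using regular_stable[OF I reg[OF t]] by blast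
    obtain d where d: "d > 0" "\<And>s. s \<in> {a..b} \<Longrightarrow> \<bar>s - t\<bar> < d \<Longrightarrow> (\<forall>i\<in>I. norm (X s i - X t i) < \<delta>)"
      using uniformly_near[of I "{a..b}" X t \<delta>] I(1) cont t \<delta>(1) by blast
    have "P u v" if "u \<le> t" "t \<le> v" "v - u < d" for u v
      unfolding P_def
    proof (intro impI)
      assume "a \<le> u" "v \<le> b"
      then have "lab_isotopic k I (X t) (X u)" "lab_isotopic k I (X t) (X v)"
        using that by (auto intro!: \<delta>(2) d(2)[THEN bspec])
      then show "lab_isotopic k I (X u) (X v)" using label_isotopic_sym label_isotopic_trans by blast
    qed
    then show ?case using d(1) by blast
  qed
  then show ?thesis unfolding P_def by simp
qed

section \<open>Labeling the dots along a path of unlabeled configurations\<close>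

lemma configuration_path_lift:
  assumes F: "configuration_path n F"
  shows "\<exists>\<phi>. (\<forall>d\<in>F 0. \<phi> 0 d = d \<and> continuous_on {0..1} (\<lambda>t. \<phi> t d)) \<and> (\<forall>t\<in>{0..1}. bij_betw (\<phi> t) (F 0) (F t))"
proof -
  define lift where "lift = (\<lambda>u v \<phi>. (\<forall>d\<in>F u. \<phi> u d = d \<and> continuous_on {u..v} (\<lambda>t. \<phi> t d)) \<and>
    (\<forall>t\<in>{u..v}. bij_betw (\<phi> t) (F u) (F t)))"
  define P where "P = (\<lambda>u v. 0 \<le> u \<longrightarrow> v \<le> 1 \<longrightarrow> (\<exists>\<phi>. lift u v \<phi>))"
  have near: "\<exists>d>0. \<forall>s\<in>{0..1}. \<bar>s - t\<bar> < d \<longrightarrow> (\<exists>f. bij_betw f (F t) (F s) \<and> (\<forall>x\<in>F t. dist x (f x) < e))"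
    if "t \<in> {0..1}" "e > 0" for t e
    using F that unfolding configuration_path_def by blast
  have "(0::real) \<le> 1" by simp
  then have "P 0 1"
  proof (induction rule: Bolzano)
    case (trans u v w)
    show ?case unfolding P_def
    proof (intro impI)
      assume "0 \<le> u" "w \<le> 1"
      then obtain \<phi>1 \<phi>2 where p: "lift u v \<phi>1" "lift v w \<phi>2" using trans unfolding P_def by auto
      define \<phi> where "\<phi> = (\<lambda>t d. if t \<le> v then \<phi>1 t d else \<phi>2 t (\<phi>1 v d))"
      have 1: "\<phi>1 v d \<in> F v" if "d \<in> F u" for d
      proof -
        have "bij_betw (\<phi>1 v) (F u) (F v)" using p(1) trans(3) unfolding lift_def by simp
        then show ?thesis using that by (rule bij_betw_apply)
      qed
      have "lift u w \<phi>" unfolding lift_def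
      proof (intro conjI ballI)
        fix d assume d: "d \<in> F u"
        show "\<phi> u d = d" using p(1) d trans unfolding lift_def \<phi>_def by simp
        have "continuous_on ({u..v} \<union> {v..w}) (\<lambda>t. if t \<le> v then \<phi>1 t d else \<phi>2 t (\<phi>1 v d))"
        proof (rule continuous_on_cases)
          show "continuous_on {u..v} (\<lambda>t. \<phi>1 t d)" using p(1) d unfolding lift_def by blast
          show "continuous_on {v..w} (\<lambda>t. \<phi>2 t (\<phi>1 v d))" using p(2) 1[OF d] unfolding lift_def by blast
          show "\<forall>x. x \<in> {u..v} \<and> \<not> x \<le> v \<or> x \<in> {v..w} \<and> x \<le> v \<longrightarrow> \<phi>1 x d = \<phi>2 x (\<phi>1 v d)"
            using p(2) 1[OF d] unfolding lift_def by force
        qed auto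
        moreover have "{u..v} \<union> {v..w} = {u..w}" using trans by auto
        ultimately show "continuous_on {u..w} (\<lambda>t. \<phi> t d)" unfolding \<phi>_def by simp
      next
        fix t assume t: "t \<in> {u..w}"
        show "bij_betw (\<phi> t) (F u) (F t)"
        proof (cases "t \<le> v")
          case True
          then show ?thesis using p(1) t unfolding lift_def \<phi>_def by simp
        next
          case False
          have "bij_betw (\<phi>2 t \<circ> \<phi>1 v) (F u) (F t)"
          proof (rule bij_betw_trans)
            show "bij_betw (\<phi>1 v) (F u) (F v)" using p(1) trans(3) unfolding lift_def by simp
            show "bij_betw (\<phi>2 t) (F v) (F t)" using p(2) t False unfolding lift_def by simp
          qed
          then show ?thesis using False unfolding \<phi>_def comp_def by simp
        qed
      qed
      then show "\<exists>\<phi>. lift u w \<phi>" by blast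
    qed
  next
    case (local t)
    then have t: "t \<in> {0..1}" by simp
    have fin: "finite (F t)" using F t unfolding configuration_path_def configuration_def by blast
    define A where "A = (\<lambda>z. dist (fst z) (snd z) / 4) ` {z \<in> F t \<times> F t. fst z \<noteq> snd z}"
    \<comment> \<open>At most a quarter of the least distance between dots; the 1 covers the case
      that there is no pair. A dot at time \<open>s\<close> within \<open>2 * e\<close> of
      \<open>x\<close> can then only be \<open>f s x\<close>.\<close>
    define e where "e = Min (insert 1 A)"
    have finA: "finite A" unfolding A_def using fin by auto
    have e0: "0 < e" unfolding e_def using finA by (auto simp: A_def)
    have e: "4 * e \<le> dist x y" if "x \<in> F t" "y \<in> F t" "x \<noteq> y" for x y
    proof -
      have "e \<le> dist x y / 4" unfolding e_def
        by (rule Min_le) (use finA that in \<open>auto simp: A_def intro!: image_eqI[of _ _ "(x, y)"]\<close>)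
      then show ?thesis by simp
    qed
    obtain d where d: "d > 0" "\<forall>s\<in>{0..1}. \<bar>s - t\<bar> < d \<longrightarrow> (\<exists>f. bij_betw f (F t) (F s) \<and> (\<forall>x\<in>F t. dist x (f x) < e))"
      using near[OF t e0] by blast
    define S where "S = {s \<in> {0..1}. \<bar>s - t\<bar> < d}"
    have "\<forall>s\<in>S. \<exists>f. bij_betw f (F t) (F s) \<and> (\<forall>x\<in>F t. dist x (f x) < e)"
      using d(2) unfolding S_def by blast
    from bchoice[OF this] obtain f where f: "\<And>s. s \<in> S \<Longrightarrow> bij_betw (f s) (F t) (F s)" "\<And>s x. s \<in> S \<Longrightarrow> x \<in> F t \<Longrightarrow> dist x (f s x) < e"
      by blast
    have uniq: "y = f s x" if h: "s \<in> S" "x \<in> F t" "y \<in> F s" "dist x y < 2 * e" for s x y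
    proof -
      obtain x' where x': "x' \<in> F t" "y = f s x'" using f(1)[OF h(1)] h(3) by (auto simp: bij_betw_def)
      have "dist x x' \<le> dist x y + dist x' y" using dist_triangle2 by blast
      also have "\<dots> < 4 * e" using h(4) f(2)[OF h(1) x'(1), folded x'(2)] e0 by linarith
      finally have "x = x'" using e[OF h(2) x'(1)] by fastforce
      then show ?thesis using x' by simp
    qed
    have cont: "continuous_on S (\<lambda>s. f s x)" if x: "x \<in> F t" for x
      unfolding continuous_on_iff
    proof (intro ballI allI impI)
      fix s0 \<epsilon> :: real assume s0: "s0 \<in> S" and \<epsilon>: "0 < \<epsilon>"
      \<comment> \<open>A matching between times \<open>s0\<close> and \<open>s\<close> that moves
        dots by less than \<open>e\<close> stays in the range where \<open>uniq\<close> applies, so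
        it agrees with \<open>f\<close>. Thus the choice of \<open>f\<close>, made separately for
        each time, is automatically continuous.\<close>
      then obtain d1 where d1: "d1 > 0" "\<forall>s\<in>{0..1}. \<bar>s - s0\<bar> < d1 \<longrightarrow> (\<exists>g. bij_betw g (F s0) (F s) \<and> (\<forall>y\<in>F s0. dist y (g y) < min \<epsilon> e))"
        using near[of s0 "min \<epsilon> e"] e0 unfolding S_def by auto
      have "dist (f s x) (f s0 x) < \<epsilon>" if s: "s \<in> S" "dist s s0 < d1" for s
      proof -
        obtain g where g: "bij_betw g (F s0) (F s)" "\<forall>y\<in>F s0. dist y (g y) < min \<epsilon> e"
          using d1(2) s unfolding S_def by (auto simp: dist_real_def)
        have y: "f s0 x \<in> F s0" using f(1)[OF s0] x by (auto simp: bij_betw_def)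
        then have "g (f s0 x) \<in> F s" "dist (f s0 x) (g (f s0 x)) < min \<epsilon> e" using g by (auto simp: bij_betw_def)
        moreover from this have "dist x (g (f s0 x)) < 2 * e"
          using f(2)[OF s0 x] dist_triangle[of x "g (f s0 x)" "f s0 x"] by linarith
        ultimately have "g (f s0 x) = f s x" using uniq[OF s(1) x] by blast
        then show ?thesis using \<open>dist (f s0 x) (g (f s0 x)) < min \<epsilon> e\<close> by (simp add: dist_commute)
      qed
      then show "\<exists>d>0. \<forall>s\<in>S. dist s s0 < d \<longrightarrow> dist (f s x) (f s0 x) < \<epsilon>" using d1(1) by blast
    qed
    have "P u v" if uv: "u \<le> t" "t \<le> v" "v - u < d" for u v
      unfolding P_def
    proof (intro impI)
      assume "0 \<le> u" "v \<le> 1"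
      then have sub: "{u..v} \<subseteq> S" using uv unfolding S_def by auto
      then have u: "u \<in> S" using uv by auto
      define h where "h = inv_into (F t) (f u)"
      have h: "bij_betw h (F u) (F t)" unfolding h_def by (rule bij_betw_inv_into[OF f(1)[OF u]])
      have "lift u v (\<lambda>s x. f s (h x))" unfolding lift_def
      proof (intro conjI ballI)
        fix x assume x: "x \<in> F u"
        show "f u (h x) = x" unfolding h_def using f(1)[OF u] x by (simp add: bij_betw_def f_inv_into_f)
        have "h x \<in> F t" using h x by (auto simp: bij_betw_def)
        then show "continuous_on {u..v} (\<lambda>s. f s (h x))" using cont sub continuous_on_subset by blast
      next
        fix s assume "s \<in> {u..v}"
        then have "s \<in> S" using sub by blast
        from bij_betw_trans[OF h f(1)[OF this]] show "bij_betw (\<lambda>x. f s (h x)) (F u) (F s)" unfolding comp_def .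
      qed
      then show "\<exists>\<phi>. lift u v \<phi>" by blast
    qed
    then show ?case using d(1) by blast
  qed
  then show ?thesis unfolding P_def lift_def by simp
qed

section \<open>Voronoi decompositions as graphs of labels\<close>

text \<open>In a sorted list such a predicate holds on an initial segment, so testing one entry
  amounts to counting. This removes the list from \<open>D_minus\<close> and
  \<open>D_plus\<close>.\<close>

lemma sorted_nth_antitone:
  assumes "sorted xs" "i < length xs" and mono: "\<And>y z::'a::linorder. y \<le> z \<Longrightarrow> P z \<Longrightarrow> P y"
  shows "P (xs ! i) \<longleftrightarrow> i < length (filter P xs)"
  using assms(1,2)
proof (induction xs arbitrary: i)
  case (Cons x xs)
  show ?case
  proof (cases "P x")
    case True
    then show ?thesis using Cons by (cases i) auto
  next
    case False
    then have none: "\<not> P y" if "y \<in> set (x # xs)" for y using Cons.prems(1) that mono by auto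
    then have "filter P (x # xs) = []" by (simp add: filter_empty_conv)
    moreover have "\<not> P ((x # xs) ! i)" using none Cons.prems(2) nth_mem by blast
    ultimately show ?thesis by (metis length_greater_0_conv less_zeroE list.size(3))
  qed
qed simp

lemma length_filter_sorted_gdists:
  assumes "finite D"
  shows "length (filter P (sorted_gdists D p)) = card {e \<in> D. P (gdist p e)}" "length (sorted_gdists D p) = card D"
proof -
  have m: "mset (sorted_gdists D p) = image_mset (gdist p) (mset_set D)" unfolding sorted_gdists_def by simp
  have "length (filter P (sorted_gdists D p)) = size (filter_mset P (mset (sorted_gdists D p)))"
    by (metis mset_filter size_mset)
  also have "\<dots> = size (filter_mset (\<lambda>e. P (gdist p e)) (mset_set D))" unfolding m
    by (simp add: filter_mset_image_mset)
  also have "\<dots> = card {e \<in> D. P (gdist p e)}" using assms by (simp add: filter_mset_mset_set)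
  finally show "length (filter P (sorted_gdists D p)) = card {e \<in> D. P (gdist p e)}" .
  show "length (sorted_gdists D p) = card D" using m by (metis size_image_mset size_mset size_mset_set)
qed

lemma gdist_le_iff:
  assumes "p \<in> S2" "d \<in> S2" "e \<in> S2"
  shows "gdist p d \<le> gdist p e \<longleftrightarrow> p \<bullet> e \<le> p \<bullet> d"
proof -
  have "\<bar>p \<bullet> d\<bar> \<le> 1" "\<bar>p \<bullet> e\<bar> \<le> 1"
    using Cauchy_Schwarz_ineq2[of p d] Cauchy_Schwarz_ineq2[of p e] assms by auto
  then show ?thesis unfolding gdist_def by (simp add: arccos_le_mono)
qed

lemma D_minus_plus_lab:
  assumes "finite D" "D \<subseteq> S2" "p \<in> S2" "0 < k" "k < card D"
  shows "D_minus k D p = fst (lab k D (\<lambda>d. d) p)" "D_plus k D p = snd (lab k D (\<lambda>d. d) p)"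
proof -
  have s: "sorted (sorted_gdists D p)" unfolding sorted_gdists_def by simp
  note len = length_filter_sorted_gdists[OF assms(1), where p=p]
  have g: "gdist p d \<le> gdist p e \<longleftrightarrow> p \<bullet> e \<le> p \<bullet> d" if "d \<in> D" "e \<in> D" for d e
    using gdist_le_iff assms that by blast
  have "gdist p d \<le> sorted_gdists D p ! (k - 1) \<longleftrightarrow> card {e \<in> D. p \<bullet> d < p \<bullet> e} < k" if d: "d \<in> D" for d
  proof -
    \<comment> \<open>Positions start at 0: entry \<open>k - 1\<close> is smaller than a value iff
      at least k entries are, for positive k, and \<open>lo\<close> asks for the negation.\<close>
    have "sorted_gdists D p ! (k - 1) < gdist p d \<longleftrightarrow> k - 1 < length (filter (\<lambda>y. y < gdist p d) (sorted_gdists D p))"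
      by (rule sorted_nth_antitone[OF s]) (use len(2) assms in auto)
    also have "length (filter (\<lambda>y. y < gdist p d) (sorted_gdists D p)) = card {e \<in> D. gdist p e < gdist p d}" by (rule len(1))
    also have "{e \<in> D. gdist p e < gdist p d} = {e \<in> D. p \<bullet> d < p \<bullet> e}" using g[OF d] by (auto simp: not_le[symmetric])
    finally show ?thesis using assms(4) by linarith
  qed
  then show "D_minus k D p = fst (lab k D (\<lambda>d. d) p)" unfolding D_minus_def by (auto simp: lo_def)
  have "sorted_gdists D p ! k \<le> gdist p d \<longleftrightarrow> k < card {e \<in> D. p \<bullet> d \<le> p \<bullet> e}" if d: "d \<in> D" for d
  proof -
    have "sorted_gdists D p ! k \<le> gdist p d \<longleftrightarrow> k < length (filter (\<lambda>y. y \<le> gdist p d) (sorted_gdists D p))"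
      by (rule sorted_nth_antitone[OF s]) (use len(2) assms in auto)
    also have "length (filter (\<lambda>y. y \<le> gdist p d) (sorted_gdists D p)) = card {e \<in> D. gdist p e \<le> gdist p d}" by (rule len(1))
    also have "{e \<in> D. gdist p e \<le> gdist p d} = {e \<in> D. p \<bullet> d \<le> p \<bullet> e}" using g[OF _ d] by blast
    finally show ?thesis .
  qed
  then show "D_plus k D p = snd (lab k D (\<lambda>d. d) p)" unfolding D_plus_def by (auto simp: hi_def)
qed

lemma lab_image:
  assumes "inj_on f I"
  shows "fst (lab k (f ` I) (\<lambda>d. d) p) = f ` fst (lab k I f p)" "snd (lab k (f ` I) (\<lambda>d. d) p) = f ` snd (lab k I f p)"
proof -
  have "{e \<in> f ` I. P e} = f ` {j \<in> I. P (f j)}" for P by auto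
  moreover have "inj_on f {j \<in> I. P (f j)}" for P using assms by (rule inj_on_subset) auto
  ultimately have "card {e \<in> f ` I. P e} = card {j \<in> I. P (f j)}" for P by (simp add: card_image)
  then show "fst (lab k (f ` I) (\<lambda>d. d) p) = f ` fst (lab k I f p)" "snd (lab k (f ` I) (\<lambda>d. d) p) = f ` snd (lab k I f p)"
    by (auto simp: lo_def hi_def)
qed

text \<open>The graph read off pointwise from labels, so that it applies to arbitrary labelings. At
  a vertex the first component of the label holds the three tied dots and those on the left side of
  their circle; k - 2 and k - 1 dots on the left thus appear as k + 1 and k + 2.\<close>

definition gr :: "nat \<Rightarrow> (point \<Rightarrow> 'i labels) \<Rightarrow> bigraph" where
  "gr k \<Lambda> = \<lparr> white = {p \<in> S2. card (tie (\<Lambda> p)) = 3 \<and> card (fst (\<Lambda> p)) = k + 1},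
               black = {p \<in> S2. card (tie (\<Lambda> p)) = 3 \<and> card (fst (\<Lambda> p)) = k + 2},
               skel = {p \<in> S2. tie (\<Lambda> p) \<noteq> {}} \<rparr>"

lemma gr_simps:
  "white (gr k \<Lambda>) = {p \<in> S2. card (tie (\<Lambda> p)) = 3 \<and> card (fst (\<Lambda> p)) = k + 1}"
  "black (gr k \<Lambda>) = {p \<in> S2. card (tie (\<Lambda> p)) = 3 \<and> card (fst (\<Lambda> p)) = k + 2}"
  "skel (gr k \<Lambda>) = {p \<in> S2. tie (\<Lambda> p) \<noteq> {}}"
  by (simp_all add: gr_def)

text \<open>A line meets the sphere at most twice: along \<open>x c + t *\<^sub>R u\<close> the
  condition of having norm 1 is quadratic in t and already has the roots 0 and 1.\<close>

lemma noncollinear_sphere: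
  assumes "inj_on x I" "x ` I \<subseteq> S2"
  shows "noncollinear I x"
  unfolding noncollinear_def
proof (intro ballI impI notI)
  fix a b c assume h: "a \<in> I" "b \<in> I" "c \<in> I" "a \<noteq> b" "a \<noteq> c" "b \<noteq> c"
    and 0: "cross3 (x a - x c) (x b - x c) = 0"
  define u v where "u = x a - x c" and "v = x b - x c"
  have nz: "u \<noteq> 0" "v \<noteq> 0" "u \<noteq> v" using h assms(1) unfolding u_def v_def by (auto dest: inj_onD)
  have "collinear {0, u, v}" using 0 cross_eq_0 unfolding u_def v_def by blast
  then obtain t where t: "v = t *\<^sub>R u" using nz by (auto simp: collinear_lemma)
  have n: "norm (x a) = 1" "norm (x b) = 1" "norm (x c) = 1" using assms(2) h by auto
  have "x a = x c + u" by (simp add: u_def)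
  moreover have "x b = x c + t *\<^sub>R u" using t by (simp add: v_def algebra_simps)
  ultimately have "(x c + u) \<bullet> (x c + u) = 1" "(x c + t *\<^sub>R u) \<bullet> (x c + t *\<^sub>R u) = 1" "x c \<bullet> x c = 1"
    using n by (metis norm_eq_1)+
  then have e: "2 * (x c \<bullet> u) + u \<bullet> u = 0" "t * (2 * (x c \<bullet> u) + t * (u \<bullet> u)) = 0"
    by (simp_all add: inner_add inner_commute algebra_simps)
  have "t \<noteq> 0" "t \<noteq> 1" using nz t by auto
  then have "2 * (x c \<bullet> u) + t * (u \<bullet> u) = 0" using e(2) by simp
  moreover have "(t - 1) * (u \<bullet> u) = (2 * (x c \<bullet> u) + t * (u \<bullet> u)) - (2 * (x c \<bullet> u) + u \<bullet> u)"
    by (simp add: algebra_simps)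
  ultimately have "(t - 1) * (u \<bullet> u) = 0" using e(1) by simp
  then show False using \<open>t \<noteq> 1\<close> nz by simp
qed

text \<open>Both vectors are multiples of \<open>cross3 e1 e2\<close>. Hence three dots are
  equidistant from no points other than two antipodal ones.\<close>

lemma ortho_noncollinear:
  fixes e1 e2 p q :: point
  assumes "cross3 e1 e2 \<noteq> 0" "p \<bullet> e1 = 0" "p \<bullet> e2 = 0" "q \<bullet> e1 = 0" "q \<bullet> e2 = 0" "norm p = 1" "norm q = 1"
  shows "q = p \<or> q = - p"
proof -
  define c where "c = cross3 e1 e2"
  have "cross3 c v = 0" if "v \<bullet> e1 = 0" "v \<bullet> e2 = 0" for v
    using that unfolding c_def
    by (simp add: cross3_simps inner_vec_def sum_3 vec_eq_iff forall_3) (algebra)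
  then have col: "collinear {0, c, p}" "collinear {0, c, q}" using assms cross_eq_0 by blast+
  have c0: "c \<noteq> 0" using assms(1) unfolding c_def .
  have p0: "p \<noteq> 0" "q \<noteq> 0" using assms by auto
  obtain s t where st: "p = s *\<^sub>R c" "q = t *\<^sub>R c" using col c0 p0 by (auto simp: collinear_lemma)
  then have "\<bar>s\<bar> * norm c = \<bar>t\<bar> * norm c" using assms(6,7) by simp
  then have "\<bar>s\<bar> = \<bar>t\<bar>" using c0 by simp
  then have "t = s \<or> t = - s" by linarith
  then show ?thesis using st by auto
qed

lemma general_position_tie:
  assumes "finite D" "D \<subseteq> S2" "general_position D" "p \<in> S2"
  shows "card (tie (lab k D (\<lambda>d. d) p)) \<le> 3"
proof (rule ccontr)
  define T where "T = tie (lab k D (\<lambda>d. d) p)"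
  assume "\<not> card (tie (lab k D (\<lambda>d. d) p)) \<le> 3"
  then have "4 \<le> card T" unfolding T_def by simp
  then obtain Q where Q: "Q \<subseteq> T" "card Q = 4" "finite Q" by (metis obtain_subset_with_card_n)
  have TD: "T \<subseteq> D" unfolding T_def tie_def using lo_subset[of k D] by fastforce
  obtain a b where ab: "a \<in> Q" "b \<in> Q" "a \<noteq> b"
    using Q(2,3) card_le_Suc0_iff_eq[of Q] by (metis One_nat_def numeral_le_one_iff semiring_norm(69))
  have eq: "p \<bullet> d = p \<bullet> a" if "d \<in> Q" for d
    using tie_eq[OF assms(1), of d k "\<lambda>d. p \<bullet> d" a] that ab(1) Q(1) unfolding T_def tie_def by auto
  have "a \<in> S2" "b \<in> S2" using ab Q(1) TD assms(2) by blast+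
  then have "p \<noteq> 0" "a \<in> {x \<in> S2. p \<bullet> x = p \<bullet> a}" "b \<in> {x \<in> S2. p \<bullet> x = p \<bullet> a}"
    using eq[OF ab(2)] assms(4) by auto
  then have "is_circle {x \<in> S2. p \<bullet> x = p \<bullet> a}"
    unfolding is_circle_def using ab(3) by blast
  moreover have "Q \<subseteq> {x \<in> S2. p \<bullet> x = p \<bullet> a}" using eq Q(1) TD assms(2) by blast
  ultimately have "cocircular Q" unfolding cocircular_def by blast
  then have "Q \<in> cocircular_quadruples D" unfolding cocircular_quadruples_def using Q TD by auto
  then show False using assms(3) unfolding general_position_def by simp
qed

lemma voronoi_eq_gr:
  assumes "finite D" "D \<subseteq> S2" "general_position D" "0 < k" "k < card D" "3 < card D"
  shows "voronoi k D = gr k (lab k D (\<lambda>d. d))"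
proof -
  define \<Lambda> where "\<Lambda> = lab k D (\<lambda>d. d)"
  have fin: "finite D" and kD: "k \<le> card D" using assms by auto
  have nc: "noncollinear D (\<lambda>d. d)" using assms(2) by (intro noncollinear_sphere) auto
  have Dm: "D_minus k D p = fst (\<Lambda> p)" "D_plus k D p = snd (\<Lambda> p)" if "p \<in> S2" for p
    using D_minus_plus_lab[OF assms(1,2) that assms(4,5)] unfolding \<Lambda>_def by auto
  have T: "D_minus k D p \<inter> D_plus k D p = tie (\<Lambda> p)" if "p \<in> S2" for p using Dm[OF that] unfolding tie_def by auto
  have st: "stratum k D p = {q \<in> S2. fst (\<Lambda> p) \<subseteq> fst (\<Lambda> q) \<and> snd (\<Lambda> p) \<subseteq> snd (\<Lambda> q)}" if "p \<in> S2" for p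
    unfolding stratum_def using Dm that by auto
  have TD: "tie (\<Lambda> p) \<subseteq> D" for p unfolding tie_def \<Lambda>_def using lo_subset[of k D] by fastforce
  have Teq: "p \<bullet> a = p \<bullet> b" if "a \<in> tie (\<Lambda> p)" "b \<in> tie (\<Lambda> p)" for p a b
    using tie_eq[OF fin, of a k "\<lambda>d. p \<bullet> d" b] that unfolding tie_def \<Lambda>_def by simp
  have single: "stratum k D p = {p}" if p: "p \<in> S2" and c: "card (tie (\<Lambda> p)) = 3" for p
  proof -
    obtain a b c where abc: "tie (\<Lambda> p) = {a, b, c}" "a \<noteq> b" "a \<noteq> c" "b \<noteq> c"
      using c by (auto simp: card_3_iff)
    have "q = p" if q: "q \<in> stratum k D p" for q
    proof -
      have q': "q \<in> S2" "fst (\<Lambda> p) \<subseteq> fst (\<Lambda> q)" "snd (\<Lambda> p) \<subseteq> snd (\<Lambda> q)" using q st[OF p] by auto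
      then have sub: "tie (\<Lambda> p) \<subseteq> tie (\<Lambda> q)" unfolding tie_def by auto
      have cr: "cross3 (a - c) (b - c) \<noteq> 0" using nc TD[of p] abc unfolding noncollinear_def by auto
      have "q = p \<or> q = - p"
        by (rule ortho_noncollinear[OF cr]) (use abc sub Teq[of _ p] Teq[of _ q] p q' in \<open>auto simp: inner_diff\<close>)
      \<comment> \<open>Passing to the antipode reverses every comparison. As there are more than
        three dots, one of them is not tied at \<open>p\<close>, and its strict comparison with
        \<open>a\<close> contradicts the inclusions defining the stratum.\<close>
      moreover have "q \<noteq> - p"
      proof
        assume qp: "q = - p"
        have "\<not> D \<subseteq> tie (\<Lambda> p)" using c assms(6) card_mono[of "tie (\<Lambda> p)" D] finite_subset[OF TD fin] by force
        then obtain d where d: "d \<in> D" "d \<notin> tie (\<Lambda> p)" by blast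
        have a: "a \<in> fst (\<Lambda> p)" "a \<in> snd (\<Lambda> p)" using abc unfolding tie_def by auto
        have "d \<in> fst (\<Lambda> p) \<union> snd (\<Lambda> p)" using lo_Un_hi[OF fin, of k "\<lambda>d. p \<bullet> d"] d(1) unfolding \<Lambda>_def by auto
        then consider "d \<in> fst (\<Lambda> p) - snd (\<Lambda> p)" | "d \<in> snd (\<Lambda> p) - fst (\<Lambda> p)" using d(2) unfolding tie_def by auto
        then show False
        proof cases
          case 1
          then have "p \<bullet> a < p \<bullet> d" using lo_hi_parts(10)[OF fin kD, of d "\<lambda>d. p \<bullet> d" a] a unfolding \<Lambda>_def by auto
          moreover have "q \<bullet> a \<le> q \<bullet> d"
            using lo_ge_hi[OF fin, of d k "\<lambda>d. q \<bullet> d" a] q' 1 a unfolding \<Lambda>_def by auto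
          ultimately show False using qp by simp
        next
          case 2
          then have "p \<bullet> d < p \<bullet> a" using lo_hi_parts(11)[OF fin kD, of a "\<lambda>d. p \<bullet> d" d] a unfolding \<Lambda>_def by auto
          moreover have "q \<bullet> d \<le> q \<bullet> a"
            using lo_ge_hi[OF fin, of a k "\<lambda>d. q \<bullet> d" d] q' 2 a unfolding \<Lambda>_def by auto
          ultimately show False using qp by simp
        qed
      qed
      ultimately show ?thesis by blast
    qed
    moreover have "p \<in> stratum k D p" using st[OF p] p by auto
    ultimately show ?thesis by blast
  qed
  have vert: "voronoi_vertices k D = {p \<in> S2. card (tie (\<Lambda> p)) = 3}"
  proof (intro set_eqI iffI)
    fix v assume "v \<in> voronoi_vertices k D"
    then obtain p where "p \<in> S2" "card (tie (\<Lambda> p)) = 3" "stratum k D p = {v}"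
      unfolding voronoi_vertices_def using T by auto
    then show "v \<in> {p \<in> S2. card (tie (\<Lambda> p)) = 3}" using single by auto
  next
    fix v assume "v \<in> {p \<in> S2. card (tie (\<Lambda> p)) = 3}"
    then show "v \<in> voronoi_vertices k D" unfolding voronoi_vertices_def using T single by auto
  qed
  have le3: "card (tie (\<Lambda> p)) \<le> 3" if "p \<in> S2" for p
    unfolding \<Lambda>_def by (rule general_position_tie[OF assms(1-3) that])
  have n1: "card (tie (\<Lambda> p)) \<noteq> 1" for p
    using card_tie_not_1[OF fin kD, of "\<lambda>d. p \<bullet> d"] unfolding \<Lambda>_def tie_def by simp
  have finT: "finite (tie (\<Lambda> p))" for p using finite_subset[OF TD fin] .
  have edges: "voronoi_edges k D = {stratum k D p |p. p \<in> S2 \<and> card (tie (\<Lambda> p)) = 2}"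
    unfolding voronoi_edges_def using T by auto
  have skel: "voronoi_vertices k D \<union> \<Union> (voronoi_edges k D) = {p \<in> S2. tie (\<Lambda> p) \<noteq> {}}" (is "?L = ?R")
  proof
    show "?L \<subseteq> ?R"
    proof
      fix q assume "q \<in> ?L"
      then consider "q \<in> S2" "card (tie (\<Lambda> q)) = 3" | p where "p \<in> S2" "card (tie (\<Lambda> p)) = 2" "q \<in> stratum k D p"
        unfolding vert edges by blast
      then show "q \<in> ?R"
      proof cases
        case 1 then show ?thesis by auto
      next
        case 2
        then have "q \<in> S2" "tie (\<Lambda> p) \<subseteq> tie (\<Lambda> q)" unfolding st[OF 2(1)] tie_def by auto
        then show ?thesis using 2(2) by auto
      qed
    qed
    show "?R \<subseteq> ?L"
    proof
      fix p assume p: "p \<in> ?R"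
      then have "card (tie (\<Lambda> p)) \<noteq> 0" using finT by simp
      then have "card (tie (\<Lambda> p)) = 2 \<or> card (tie (\<Lambda> p)) = 3" using le3[of p] n1[of p] p by force
      moreover have "p \<in> stratum k D p" using p st[of p] by auto
      ultimately show "p \<in> ?L" unfolding vert edges using p by blast
    qed
  qed
  \<comment> \<open>The near part of the label consists of the dots on the left side of the circle
    and the three on it, whence j + 3.\<close>
  have color: "left_center_with D j v \<longleftrightarrow> card (fst (\<Lambda> v)) = j + 3"
    if v: "v \<in> S2" "card (tie (\<Lambda> v)) = 3" and j: "j + 1 = k \<or> j + 2 = k" for j v
  proof -
    have cl: "card (fst (\<Lambda> v)) = card (fst (\<Lambda> v) - snd (\<Lambda> v)) + 3"
      using card_lo_tie3(2)[OF fin kD, of "\<lambda>d. v \<bullet> d"] v(2) unfolding \<Lambda>_def tie_def by simp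
    obtain a b c where abc: "tie (\<Lambda> v) = {a, b, c}" "a \<noteq> b" "a \<noteq> c" "b \<noteq> c"
      using v(2) by (auto simp: card_3_iff)
    have aD: "a \<in> D" "b \<in> D" "c \<in> D" using abc TD[of v] by auto
    have above: "D \<inter> left_side v (v \<bullet> a) = fst (\<Lambda> v) - snd (\<Lambda> v)"
    proof (intro set_eqI iffI)
      fix d assume d: "d \<in> D \<inter> left_side v (v \<bullet> a)"
      then have "v \<bullet> a < v \<bullet> d" by (auto simp: left_side_def)
      moreover have "v \<bullet> d \<le> v \<bullet> a" if "d \<in> snd (\<Lambda> v)"
        using lo_ge_hi[OF fin, of a k "\<lambda>d. v \<bullet> d" d] that abc unfolding \<Lambda>_def tie_def by auto
      moreover have "d \<in> fst (\<Lambda> v) \<union> snd (\<Lambda> v)" using lo_Un_hi[OF fin, of k "\<lambda>d. v \<bullet> d"] d unfolding \<Lambda>_def by auto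
      ultimately show "d \<in> fst (\<Lambda> v) - snd (\<Lambda> v)" by fastforce
    next
      fix d assume d: "d \<in> fst (\<Lambda> v) - snd (\<Lambda> v)"
      have a: "a \<in> snd (\<Lambda> v)" "a \<in> fst (\<Lambda> v)" using abc unfolding tie_def by auto
      then have "v \<bullet> a < v \<bullet> d" using lo_hi_parts(10)[OF fin kD, of d "\<lambda>d. v \<bullet> d" a] d unfolding \<Lambda>_def by auto
      moreover have "d \<in> D" using d lo_subset[of k D] unfolding \<Lambda>_def by auto
      ultimately show "d \<in> D \<inter> left_side v (v \<bullet> a)" using assms(2) by (auto simp: left_side_def)
    qed
    show ?thesis
    proof
      assume "left_center_with D j v"
      then obtain h T' where h: "oriented_circle v h" "T' \<subseteq> D" "card T' = 3" "T' \<subseteq> rim v h" "card (D \<inter> left_side v h) = j"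
        unfolding left_center_with_def by blast
      have "T' \<subseteq> tie (\<Lambda> v)"
      proof
        fix d assume d: "d \<in> T'"
        then have vd: "v \<bullet> d = h" "d \<in> D" using h(2,4) by (auto simp: rim_def)
        have 1: "{e \<in> D. v \<bullet> d < v \<bullet> e} = D \<inter> left_side v h" using assms(2) vd by (auto simp: left_side_def)
        have "T' \<union> (D \<inter> left_side v h) \<subseteq> {e \<in> D. v \<bullet> d \<le> v \<bullet> e}" using h(2,4) vd by (auto simp: rim_def left_side_def)
        then have "card (T' \<union> (D \<inter> left_side v h)) \<le> card {e \<in> D. v \<bullet> d \<le> v \<bullet> e}" using fin by (intro card_mono) auto
        moreover have "card (T' \<union> (D \<inter> left_side v h)) = 3 + j"
        proof -
          have "T' \<inter> (D \<inter> left_side v h) = {}" using h(4) by (auto simp: rim_def left_side_def)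
          then show ?thesis using h(2,3,5) fin finite_subset[OF h(2) fin] by (simp add: card_Un_disjoint)
        qed
        ultimately have "k < card {e \<in> D. v \<bullet> d \<le> v \<bullet> e}" "card {e \<in> D. v \<bullet> d < v \<bullet> e} < k"
          using j h(5) unfolding 1 by linarith+
        then show "d \<in> tie (\<Lambda> v)" unfolding tie_def \<Lambda>_def using vd(2) by (simp add: lo_def hi_def)
      qed
      then have "T' = tie (\<Lambda> v)" using h(3) v(2) finT by (intro card_subset_eq) auto
      then have "v \<bullet> a = h" using h(4) abc by (auto simp: rim_def)
      then show "card (fst (\<Lambda> v)) = j + 3" using above cl h(5) by simp
    next
      assume c: "card (fst (\<Lambda> v)) = j + 3"
      have va: "v \<bullet> d = v \<bullet> a" if "d \<in> tie (\<Lambda> v)" for d using Teq[OF that, of a] abc by auto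
      \<comment> \<open>A circle degenerated to its center would force the distinct dots
        \<open>a\<close> and \<open>b\<close> to coincide.\<close>
      have "\<bar>v \<bullet> a\<bar> \<noteq> 1"
      proof
        assume 1: "\<bar>v \<bullet> a\<bar> = 1"
        have S: "norm v = 1" "norm a = 1" "norm b = 1" using v assms(2) aD by auto
        have "v \<bullet> b = v \<bullet> a" using va[of b] abc by auto
        then have "\<bar>v \<bullet> a\<bar> = norm v * norm a" "\<bar>v \<bullet> b\<bar> = norm v * norm b" using 1 S by auto
        then have "a = (v \<bullet> a) *\<^sub>R v" "b = (v \<bullet> b) *\<^sub>R v"
        proof -
          have "x = (v \<bullet> x) *\<^sub>R v" if "norm x = 1" "\<bar>v \<bullet> x\<bar> = 1" for x
          proof -
            have "(v \<bullet> x)\<^sup>2 = 1" using that(2) by (metis one_power2 power2_abs)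
            moreover have "v \<bullet> v = 1" "x \<bullet> x = 1" using S(1) that(1) by (simp_all add: norm_eq_1)
            ultimately have "(x - (v \<bullet> x) *\<^sub>R v) \<bullet> (x - (v \<bullet> x) *\<^sub>R v) = 0"
              by (simp add: inner_diff inner_commute power2_eq_square algebra_simps)
            then show ?thesis by simp
          qed
          from this[OF S(2) 1] this[OF S(3)] show "a = (v \<bullet> a) *\<^sub>R v" "b = (v \<bullet> b) *\<^sub>R v"
            using 1 \<open>v \<bullet> b = v \<bullet> a\<close> by simp_all
        qed
        then show False using abc \<open>v \<bullet> b = v \<bullet> a\<close> by metis
      qed
      moreover have "\<bar>v \<bullet> a\<bar> \<le> 1" using Cauchy_Schwarz_ineq2[of v a] v assms(2) aD by force
      ultimately have "oriented_circle v (v \<bullet> a)" unfolding oriented_circle_def using v by auto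
      moreover have "tie (\<Lambda> v) \<subseteq> rim v (v \<bullet> a)" unfolding rim_def using va TD assms(2) by blast
      moreover have "card (D \<inter> left_side v (v \<bullet> a)) = j" using above cl c by simp
      ultimately show "left_center_with D j v" unfolding left_center_with_def using TD[of v] v(2) by blast
    qed
  qed
  have "{v \<in> voronoi_vertices k D. k \<ge> 2 \<and> left_center_with D (k - 2) v} = {p \<in> S2. card (tie (\<Lambda> p)) = 3 \<and> card (fst (\<Lambda> p)) = k + 1}"
  proof -
    have "(k \<ge> 2 \<and> left_center_with D (k - 2) v) \<longleftrightarrow> card (fst (\<Lambda> v)) = k + 1" if v: "v \<in> S2" "card (tie (\<Lambda> v)) = 3" for v
    proof (cases "k \<ge> 2")
      case True
      then have "k - 2 + 2 = k" "k - 2 + 3 = k + 1" by simp_all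
      then show ?thesis using color[OF v disjI2, of "k - 2"] True by metis
    next
      case False
      have "tie (\<Lambda> v) \<subseteq> fst (\<Lambda> v)" unfolding tie_def by auto
      moreover have "finite (fst (\<Lambda> v))" unfolding \<Lambda>_def using fin lo_subset finite_subset by (metis lab_simps(1))
      ultimately have "3 \<le> card (fst (\<Lambda> v))" using v(2) card_mono by metis
      then show ?thesis using False by auto
    qed
    then show ?thesis unfolding vert by blast
  qed
  moreover have "{v \<in> voronoi_vertices k D. left_center_with D (k - 1) v} = {p \<in> S2. card (tie (\<Lambda> p)) = 3 \<and> card (fst (\<Lambda> p)) = k + 2}"
  proof -
    have "left_center_with D (k - 1) v \<longleftrightarrow> card (fst (\<Lambda> v)) = k + 2" if v: "v \<in> S2" "card (tie (\<Lambda> v)) = 3" for v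
      using color[OF v, of "k - 1"] assms(4) by auto
    then show ?thesis unfolding vert by blast
  qed
  ultimately show ?thesis unfolding voronoi_def gr_def skel \<Lambda>_def[symmetric] by simp
qed

lemma gr_isotopic:
  assumes H: "isotopy_of_sphere H" and eq: "\<And>p. p \<in> S2 \<Longrightarrow> \<Lambda>' (H 1 p) = \<Lambda> p"
  shows "isotopic (gr k \<Lambda>) (gr k \<Lambda>')"
proof -
  have HS: "H 1 ` S2 = S2" using isotopy_maps(1)[OF H, of 1] by simp
  have *: "H 1 ` {p \<in> S2. P (\<Lambda> p)} = {p \<in> S2. P (\<Lambda>' p)}" for P
  proof (intro set_eqI iffI)
    fix q assume "q \<in> H 1 ` {p \<in> S2. P (\<Lambda> p)}"
    then show "q \<in> {p \<in> S2. P (\<Lambda>' p)}" using eq HS by auto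
  next
    fix q assume q: "q \<in> {p \<in> S2. P (\<Lambda>' p)}"
    then obtain p where "p \<in> S2" "q = H 1 p" using HS by blast
    then show "q \<in> H 1 ` {p \<in> S2. P (\<Lambda> p)}" using q eq by auto
  qed
  show ?thesis unfolding isotopic_def gr_simps
    by (intro exI[of _ H] conjI H *[of "\<lambda>l. card (tie l) = 3 \<and> card (fst l) = k + 1"]
       *[of "\<lambda>l. card (tie l) = 3 \<and> card (fst l) = k + 2"] *[of "\<lambda>l. tie l \<noteq> {}"])
qed

lemma gr_lab_image:
  assumes "inj_on f I"
  shows "gr k (lab k (f ` I) (\<lambda>d. d)) = gr k (lab k I f)"
proof -
  have "tie (lab k (f ` I) (\<lambda>d. d) p) = f ` tie (lab k I f p)" for p
    unfolding tie_def lab_image[OF assms] using lo_subset[of k I] hi_subset[of k I]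
    by (subst inj_on_image_Int[OF assms]) auto
  moreover have "inj_on f (tie (lab k I f p))" "inj_on f (fst (lab k I f p))" for p
    unfolding tie_def using assms lo_subset[of k I] by (fastforce intro: inj_on_subset)+
  ultimately show ?thesis unfolding gr_def lab_image[OF assms] by (simp add: card_image)
qed

section \<open>Coordinates in a cap\<close>

text \<open>\<open>u\<close> and \<open>w\<close> will be the directions of the two diagonals, in
  general not orthogonal, and \<open>us\<close>, \<open>ws\<close> is the basis dual to them in the
  tangent plane at \<open>z\<close>. The coordinates of a point are then its inner products with
  \<open>u\<close> and \<open>w\<close>, the very numbers that rank the four dots.\<close>

locale cap_plane =
  fixes z u w us ws :: point
  assumes z1: "norm z = 1" and zu: "u \<bullet> z = 0" and zw: "w \<bullet> z = 0" and zus: "us \<bullet> z = 0" and zws: "ws \<bullet> z = 0"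
    and dual: "us \<bullet> u = 1" "us \<bullet> w = 0" "ws \<bullet> u = 0" "ws \<bullet> w = 1"
    and expand: "p = (p \<bullet> z) *\<^sub>R z + (p \<bullet> u) *\<^sub>R us + (p \<bullet> w) *\<^sub>R ws"
begin

definition tv :: "real \<times> real \<Rightarrow> point" where "tv y = fst y *\<^sub>R us + snd y *\<^sub>R ws"

abbreviation nu :: "real \<times> real \<Rightarrow> real" where "nu y \<equiv> norm (tv y)"

text \<open>Central projection of the tangent plane at \<open>z\<close>, in the coordinates dual to \<open>u\<close> and \<open>w\<close>.\<close>

definition pl :: "real \<times> real \<Rightarrow> point" where "pl y = sgn (z + tv y)"

definition co :: "point \<Rightarrow> real \<times> real" where "co q = ((q \<bullet> u) / (q \<bullet> z), (q \<bullet> w) / (q \<bullet> z))"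

text \<open>The tangent of \<open>arccos h\<close>, which is the radius of the projected circle at
  height \<open>h\<close>.\<close>

definition rad :: "real \<Rightarrow> real" where "rad h = sqrt (1 / h\<^sup>2 - 1)"

definition rimpt :: "real \<Rightarrow> real \<times> real \<Rightarrow> point" where "rimpt h d = pl ((rad h / nu d) *\<^sub>R d)"

lemma tv_inner: "tv y \<bullet> z = 0" "tv y \<bullet> u = fst y" "tv y \<bullet> w = snd y" "z \<bullet> tv y = 0"
  using zus zws dual by (simp_all add: tv_def inner_add inner_commute)

lemma tv_linear: "tv (y + \<theta>) = tv y + tv \<theta>" "tv (r *\<^sub>R y) = r *\<^sub>R tv y" "tv (y - \<theta>) = tv y - tv \<theta>"
  by (simp_all add: tv_def algebra_simps)

lemma tv_0: "tv 0 = 0" by (simp add: tv_def)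

lemma tv_eq_0: "tv y = 0 \<longleftrightarrow> y = 0"
  using tv_inner(2,3)[of y] by (auto simp: tv_def prod_eq_iff)

lemma nu_pos: "y \<noteq> 0 \<Longrightarrow> 0 < nu y" by (simp add: tv_eq_0)

lemma zz: "z \<bullet> z = 1" using z1 by (simp add: norm_eq_1)

lemma norm_pt: "(norm (z + tv y))\<^sup>2 = 1 + (nu y)\<^sup>2"
  using zz tv_inner(1,4)[of y] by (simp add: power2_norm_eq_inner inner_add)

lemma norm_pt_ge: "1 \<le> norm (z + tv y)"
  by (rule power2_le_imp_le) (simp_all add: norm_pt)

lemma pl_S2: "pl y \<in> S2"
  using norm_pt_ge[of y] unfolding pl_def by (auto simp: norm_sgn)

lemma z_pl: "z \<bullet> pl y = 1 / norm (z + tv y)"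
  unfolding pl_def sgn_div_norm using zz tv_inner(4)[of y] by (simp add: inner_add divide_inverse)

lemma z_pl_pos: "0 < z \<bullet> pl y"
  unfolding z_pl using less_le_trans[OF zero_less_one norm_pt_ge[of y]] by (rule divide_pos_pos[OF zero_less_one])

lemma pl_inner:
  "pl y \<bullet> z = z \<bullet> pl y" "pl y \<bullet> u = fst y * (z \<bullet> pl y)" "pl y \<bullet> w = snd y * (z \<bullet> pl y)"
  unfolding z_pl unfolding pl_def sgn_div_norm using zz tv_inner[of y] zu zw
  by (simp_all add: inner_add inner_commute divide_inverse)

lemma co_pl: "co (pl y) = y"
  using z_pl_pos[of y] unfolding co_def pl_inner by simp

lemma pl_co:
  assumes "q \<in> S2" "0 < z \<bullet> q"
  shows "pl (co q) = q"
proof -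
  have nz: "q \<bullet> z \<noteq> 0" using assms by (simp add: inner_commute)
  have "(q \<bullet> z) *\<^sub>R (z + tv (co q)) = (q \<bullet> z) *\<^sub>R z + (q \<bullet> u) *\<^sub>R us + (q \<bullet> w) *\<^sub>R ws"
    using nz by (simp add: tv_def co_def scaleR_add_right add.assoc)
  then have "q = (q \<bullet> z) *\<^sub>R (z + tv (co q))" using expand[of q] by simp
  then have "sgn q = sgn (z + tv (co q))" using assms(2) by (metis inner_commute sgn_scaleR sgn_pos scaleR_one)
  moreover have "sgn q = q" using assms(1) by (simp add: sgn_div_norm)
  ultimately show ?thesis unfolding pl_def by simp
qed

lemma inj_pl: "pl y = pl \<theta> \<longleftrightarrow> y = \<theta>" by (metis co_pl)

lemma cont_tv: "continuous_on S tv" unfolding tv_def by (intro continuous_intros)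

lemma cont_pl: "continuous_on S pl"
  unfolding pl_def using norm_pt_ge
  by (intro continuous_on_sgn continuous_intros cont_tv) (metis norm_zero not_one_le_zero)

text \<open>The height of \<open>pl y\<close> is the inverse of \<open>norm (z + tv y)\<close>,
  hence a decreasing function of \<open>nu y\<close>.\<close>

lemma height_iff:
  assumes "0 < h" "h < 1"
  shows "h \<le> z \<bullet> pl y \<longleftrightarrow> nu y \<le> rad h" "h < z \<bullet> pl y \<longleftrightarrow> nu y < rad h" "z \<bullet> pl y = h \<longleftrightarrow> nu y = rad h" "0 < rad h"
proof -
  have h2: "1 < 1 / h\<^sup>2" using assms by (simp add: power_less_one_iff)
  then show r0: "0 < rad h" unfolding rad_def by simp
  have r2: "(rad h)\<^sup>2 = 1 / h\<^sup>2 - 1" unfolding rad_def using h2 by simp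
  define N where "N = norm (z + tv y)"
  have N: "1 \<le> N" "N\<^sup>2 = 1 + (nu y)\<^sup>2" using norm_pt_ge norm_pt unfolding N_def by auto
  have e: "z \<bullet> pl y = 1 / N" unfolding z_pl N_def ..
  have i: "(1/h)\<^sup>2 = 1 + (rad h)\<^sup>2" unfolding r2 by (simp add: power_one_over)
  have "h \<le> 1 / N \<longleftrightarrow> N \<le> 1 / h" using N(1) assms by (simp add: field_simps)
  also have "\<dots> \<longleftrightarrow> N\<^sup>2 \<le> (1/h)\<^sup>2" using N(1) assms by (simp add: power2_le_iff_abs_le del: power_divide)
  also have "\<dots> \<longleftrightarrow> nu y \<le> rad h" unfolding N(2) i using r0 by (simp add: power2_le_iff_abs_le)
  finally show A: "h \<le> z \<bullet> pl y \<longleftrightarrow> nu y \<le> rad h" unfolding e .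
  have "1 / N = h \<longleftrightarrow> N = 1 / h" using N(1) assms by (auto simp: field_simps)
  also have "\<dots> \<longleftrightarrow> N\<^sup>2 = (1/h)\<^sup>2" using N(1) assms by (subst power2_eq_iff_nonneg) auto
  also have "\<dots> \<longleftrightarrow> nu y = rad h" unfolding N(2) i using r0 by (simp add: power2_eq_iff_nonneg)
  finally show B: "z \<bullet> pl y = h \<longleftrightarrow> nu y = rad h" unfolding e .
  show "h < z \<bullet> pl y \<longleftrightarrow> nu y < rad h" using A B by linarith
qed

lemma rim_eq:
  assumes "0 < h" "h < 1"
  shows "rim z h = pl ` {y. nu y = rad h}"
proof (intro set_eqI iffI)
  fix q assume "q \<in> rim z h"
  then have q: "q \<in> S2" "z \<bullet> q = h" unfolding rim_def by auto
  then have "pl (co q) = q" using pl_co assms by simp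
  then show "q \<in> pl ` {y. nu y = rad h}" using height_iff(3)[OF assms, of "co q"] q by force
next
  fix q assume "q \<in> pl ` {y. nu y = rad h}"
  then show "q \<in> rim z h" using height_iff(3)[OF assms] pl_S2 unfolding rim_def by auto
qed

lemma rimpt_rim:
  assumes "0 < h" "h < 1" "d \<noteq> 0"
  shows "rimpt h d \<in> rim z h" "nu ((rad h / nu d) *\<^sub>R d) = rad h" "z \<bullet> rimpt h d = h" "rimpt h d \<in> S2"
proof -
  show n: "nu ((rad h / nu d) *\<^sub>R d) = rad h"
    using height_iff(4)[OF assms(1,2)] nu_pos[OF assms(3)] by (simp add: tv_linear)
  then show "rimpt h d \<in> rim z h" unfolding rim_eq[OF assms(1,2)] rimpt_def by blast
  then show "z \<bullet> rimpt h d = h" "rimpt h d \<in> S2" unfolding rim_def by auto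
qed

lemma rimpt_scale: "0 < r \<Longrightarrow> rimpt h (r *\<^sub>R d) = rimpt h d"
  unfolding rimpt_def by (simp add: tv_linear)

lemma rimpt_unique:
  assumes "0 < h" "h < 1" "d \<noteq> 0" "0 < \<tau>" "nu (\<tau> *\<^sub>R d) = rad h"
  shows "pl (\<tau> *\<^sub>R d) = rimpt h d"
proof -
  have "\<tau> = rad h / nu d" using assms(4,5) nu_pos[OF assms(3)] by (simp add: tv_linear field_simps)
  then show ?thesis unfolding rimpt_def by simp
qed

definition cs :: "real \<Rightarrow> real \<times> real" where "cs t = (cos (2 * pi * t), sin (2 * pi * t))"

lemma cs_nz: "cs t \<noteq> 0"
proof
  assume "cs t = 0"
  then have "sin (2 * pi * t) = 0" "cos (2 * pi * t) = 0" by (auto simp: cs_def prod_eq_iff)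
  then show False using sin_cos_squared_add[of "2 * pi * t"] by (simp del: sin_cos_squared_add)
qed

lemma cs_shift: "cs (t + 1/4) = (- snd (cs t), fst (cs t))"
proof -
  have "2 * pi * (t + 1/4) = 2 * pi * t + pi / 2" by (simp add: algebra_simps)
  then show ?thesis unfolding cs_def by (simp add: cos_add sin_add)
qed

lemma cs_quadrant:
  assumes "0 < \<alpha>" "0 \<le> \<beta>"
  shows "\<exists>t r. 0 \<le> t \<and> t < 1/4 \<and> 0 < r \<and> (\<alpha>, \<beta>) = r *\<^sub>R cs t"
proof -
  define r where "r = sqrt (\<alpha>\<^sup>2 + \<beta>\<^sup>2)"
  have "0 < \<alpha>\<^sup>2 + \<beta>\<^sup>2" using assms by (simp add: add_pos_nonneg)
  then have r: "0 < r" "r\<^sup>2 = \<alpha>\<^sup>2 + \<beta>\<^sup>2" unfolding r_def by auto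
  have "(\<alpha> / r)\<^sup>2 + (\<beta> / r)\<^sup>2 = 1" using r assms by (simp add: power_divide add_divide_distrib[symmetric])
  then obtain s where s: "0 \<le> s" "s \<le> pi / 2" "\<alpha> / r = cos s" "\<beta> / r = sin s"
    using sincos_total_pi_half[of "\<alpha> / r" "\<beta> / r"] assms r(1) by auto
  have "cos s \<noteq> 0" using s(3) assms r(1) by (metis divide_eq_0_iff less_irrefl)
  then have "s \<noteq> pi / 2" by (metis cos_pi_half)
  then have "s < pi / 2" using s by simp
  then show ?thesis
    using s r(1) by (intro exI[of _ "s / (2 * pi)"] exI[of _ r]) (auto simp: cs_def field_simps)
qed

text \<open>The coordinates are skew, so \<open>cs\<close> does not run along the rim itself;
  rescaling each direction by its length \<open>nu\<close> turns it into a parametrization of the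
  rim. Directions from the four half-open quadrants get parameters from successive quarters of the
  interval.\<close>

lemma cyclic_quadrants:
  assumes h: "0 < h" "h < 1"
    and d: "0 < fst d1" "0 \<le> snd d1" "0 < snd d2" "fst d2 \<le> 0" "fst d3 < 0" "snd d3 \<le> 0" "snd d4 < 0" "0 \<le> fst d4"
  shows "in_cyclic_order z h [rimpt h d1, rimpt h d2, rimpt h d3, rimpt h d4]"
proof -
  define g where "g = (\<lambda>t. rimpt h (cs t))"
  have ex: "\<exists>t. 0 \<le> t \<and> t < 1/4 \<and> rimpt h d1 = g t"
  proof -
    obtain t r where "0 \<le> t" "t < 1/4" "0 < r" "d1 = r *\<^sub>R cs t" using cs_quadrant[of "fst d1" "snd d1"] d by auto
    then show ?thesis using rimpt_scale unfolding g_def by auto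
  qed
  have ex2: "\<exists>t. 1/4 \<le> t \<and> t < 1/2 \<and> rimpt h d2 = g t"
  proof -
    obtain t r where t: "0 \<le> t" "t < 1/4" "0 < r" "(snd d2, - fst d2) = r *\<^sub>R cs t" using cs_quadrant[of "snd d2" "- fst d2"] d by auto
    then have "d2 = r *\<^sub>R cs (t + 1/4)" unfolding cs_shift by (auto simp: prod_eq_iff)
    then show ?thesis using t rimpt_scale unfolding g_def by (intro exI[of _ "t + 1/4"]) auto
  qed
  have ex3: "\<exists>t. 1/2 \<le> t \<and> t < 3/4 \<and> rimpt h d3 = g t"
  proof -
    obtain t r where t: "0 \<le> t" "t < 1/4" "0 < r" "(- fst d3, - snd d3) = r *\<^sub>R cs t" using cs_quadrant[of "- fst d3" "- snd d3"] d by auto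
    then have "d3 = r *\<^sub>R cs (t + 1/4 + 1/4)" unfolding cs_shift by (auto simp: prod_eq_iff)
    then show ?thesis using t rimpt_scale unfolding g_def by (intro exI[of _ "t + 1/4 + 1/4"]) auto
  qed
  have ex4: "\<exists>t. 3/4 \<le> t \<and> t < 1 \<and> rimpt h d4 = g t"
  proof -
    obtain t r where t: "0 \<le> t" "t < 1/4" "0 < r" "(- snd d4, fst d4) = r *\<^sub>R cs t" using cs_quadrant[of "- snd d4" "fst d4"] d by auto
    then have "d4 = r *\<^sub>R cs (t + 1/4 + 1/4 + 1/4)" unfolding cs_shift by (auto simp: prod_eq_iff)
    then show ?thesis using t rimpt_scale unfolding g_def by (intro exI[of _ "t + 1/4 + 1/4 + 1/4"]) auto
  qed
  have nz: "nu (cs t) \<noteq> 0" for t using nu_pos[OF cs_nz[of t]] by simp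
  have ccs: "continuous_on {0..1} cs" unfolding cs_def by (intro continuous_intros)
  have cont: "continuous_on {0..1} g"
    unfolding g_def rimpt_def
    by (intro continuous_on_compose2[OF cont_pl[of UNIV]] continuous_intros continuous_on_compose2[OF cont_tv[of UNIV]] ccs)
       (auto simp: tv_eq_0 cs_nz)
  have inj: "x = y \<or> x = 0 \<and> y = 1 \<or> x = 1 \<and> y = 0" if xy: "x \<in> {0..1}" "y \<in> {0..1}" "g x = g y" for x y
  proof -
    define a b where "a = rad h / nu (cs x)" and "b = rad h / nu (cs y)"
    have ab: "0 < a" "0 < b" unfolding a_def b_def using height_iff(4)[OF h] nu_pos[OF cs_nz] by auto
    have e: "a *\<^sub>R cs x = b *\<^sub>R cs y" using xy(3) unfolding g_def rimpt_def inj_pl a_def b_def .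
    then have e': "a * cos (2 * pi * x) = b * cos (2 * pi * y)" "a * sin (2 * pi * x) = b * sin (2 * pi * y)"
      by (auto simp: cs_def)
    have "a\<^sup>2 * ((cos (2 * pi * x))\<^sup>2 + (sin (2 * pi * x))\<^sup>2) = b\<^sup>2 * ((cos (2 * pi * y))\<^sup>2 + (sin (2 * pi * y))\<^sup>2)"
      unfolding distrib_left power_mult_distrib[symmetric] e' ..
    then have "a\<^sup>2 = b\<^sup>2" by simp
    then have "a = b" using ab by (auto simp: power2_eq_iff)
    then have "sin (2 * pi * x) = sin (2 * pi * y) \<and> cos (2 * pi * x) = cos (2 * pi * y)" using e' ab by simp
    then obtain n :: int where n: "2 * pi * x = 2 * pi * y + 2 * pi * n" using sin_cos_eq_iff by auto
    then have "2 * pi * x = 2 * pi * (y + n)" by (simp add: algebra_simps)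
    then have n': "x = y + n" by simp
    then have "- 1 \<le> real_of_int n" "real_of_int n \<le> 1" using xy by auto
    then have "n = -1 \<or> n = 0 \<or> n = 1" by linarith
    then show ?thesis using n' xy by auto
  qed
  have img: "g ` {0..1} = rim z h"
  proof
    show "g ` {0..1} \<subseteq> rim z h" unfolding g_def using rimpt_rim(1)[OF h cs_nz] by blast
    show "rim z h \<subseteq> g ` {0..1}"
    proof
      fix q assume "q \<in> rim z h"
      then obtain y where y: "nu y = rad h" "q = pl y" using rim_eq[OF h] by blast
      then have y0: "y \<noteq> 0" using height_iff(4)[OF h] by (auto simp: tv_0)
      define r where "r = sqrt ((fst y)\<^sup>2 + (snd y)\<^sup>2)"
      have "0 < (fst y)\<^sup>2 + (snd y)\<^sup>2" using y0 by (metis fst_zero prod_eq_iff snd_zero sum_power2_gt_zero_iff)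
      then have r: "0 < r" "r\<^sup>2 = (fst y)\<^sup>2 + (snd y)\<^sup>2" unfolding r_def by auto
      have "(fst y / r)\<^sup>2 + (snd y / r)\<^sup>2 = 1" using r(1)
        by (simp add: power_divide add_divide_distrib[symmetric] r(2)[symmetric])
      then obtain s where s: "0 \<le> s" "s < 2 * pi" "fst y / r = cos s" "snd y / r = sin s"
        using sincos_total_2pi by blast
      have "y = r *\<^sub>R cs (s / (2 * pi))" using s r(1) by (auto simp: cs_def prod_eq_iff field_simps)
      then have "q = rimpt h (cs (s / (2 * pi)))" using y rimpt_unique[OF h cs_nz r(1)] by metis
      then show "q \<in> g ` {0..1}" unfolding g_def using s by (intro image_eqI[of _ _ "s / (2 * pi)"]) (auto simp: field_simps)
    qed
  qed
  obtain t1 t2 t3 t4 where t: "0 \<le> t1" "t1 < 1/4" "rimpt h d1 = g t1" "1/4 \<le> t2" "t2 < 1/2" "rimpt h d2 = g t2"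
    "1/2 \<le> t3" "t3 < 3/4" "rimpt h d3 = g t3" "3/4 \<le> t4" "t4 < 1" "rimpt h d4 = g t4"
    using ex ex2 ex3 ex4 by blast
  show ?thesis unfolding in_cyclic_order_def
  proof (intro exI conjI)
    show "simple_path g" unfolding simple_path_def path_def loop_free_def using cont inj by blast
    show "pathfinish g = pathstart g" unfolding pathfinish_def pathstart_def g_def cs_def by simp
    show "path_image g = rim z h" unfolding path_image_def by (rule img)
    show "sorted_wrt (<) [t1, t2, t3, t4]" using t by simp
    show "set [t1, t2, t3, t4] \<subseteq> {0..<1}" using t by simp
    show "[rimpt h d1, rimpt h d2, rimpt h d3, rimpt h d4] = map g [t1, t2, t3, t4]" using t by simp
  qed
qed

text \<open>The norm is convex along the ray and starts below \<open>R\<close>, so it stays above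
  \<open>R\<close> once it has exceeded it.\<close>

lemma ray_in_ball:
  assumes V: "nu V < R" and d: "d \<noteq> 0"
  shows "\<exists>\<tau>0>0. nu (V + \<tau>0 *\<^sub>R d) = R \<and> (\<forall>\<tau>\<ge>0. nu (V + \<tau> *\<^sub>R d) \<le> R \<longleftrightarrow> \<tau> \<le> \<tau>0)"
proof -
  define f where "f = (\<lambda>\<tau>. nu (V + \<tau> *\<^sub>R d))"
  have cf: "continuous_on S f" for S unfolding f_def
    by (intro continuous_on_norm continuous_on_compose2[OF cont_tv[of UNIV]] continuous_intros) auto
  define T where "T = (R + nu V) / nu d"
  have T: "0 \<le> T" unfolding T_def using V norm_ge_zero[of "tv V"] by (intro divide_nonneg_nonneg) (linarith, simp)
  have "f T \<ge> R"
  proof -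
    have "T * nu d = R + nu V" unfolding T_def using nu_pos[OF d] by simp
    moreover have "norm (T *\<^sub>R tv d) - norm (tv V) \<le> norm (tv V + T *\<^sub>R tv d)"
      using norm_diff_ineq[of "T *\<^sub>R tv d" "tv V"] by (simp add: add.commute)
    ultimately show ?thesis using T unfolding f_def tv_linear by simp
  qed
  moreover have f0: "f 0 < R" using V unfolding f_def by simp
  ultimately obtain \<tau>0 where \<tau>0: "0 \<le> \<tau>0" "f \<tau>0 = R" using IVT'[of f 0 R T] T cf[of "{0..T}"] by auto
  have "0 < \<tau>0" using \<tau>0 f0 by (cases "\<tau>0 = 0") auto
  have conv: "f (s * \<tau>) \<le> (1 - s) * f 0 + s * f \<tau>" if "0 \<le> s" "s \<le> 1" for s \<tau>
  proof -
    have "tv (V + (s * \<tau>) *\<^sub>R d) = (1 - s) *\<^sub>R tv V + s *\<^sub>R tv (V + \<tau> *\<^sub>R d)" by (simp add: tv_linear algebra_simps)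
    then have "f (s * \<tau>) \<le> norm ((1 - s) *\<^sub>R tv V) + norm (s *\<^sub>R tv (V + \<tau> *\<^sub>R d))" unfolding f_def by (metis norm_triangle_ineq)
    then show ?thesis using that unfolding f_def by simp
  qed
  have "f \<tau> \<le> R \<longleftrightarrow> \<tau> \<le> \<tau>0" if \<tau>: "0 \<le> \<tau>" for \<tau>
  proof
    assume "\<tau> \<le> \<tau>0"
    have "f (\<tau> / \<tau>0 * \<tau>0) \<le> (1 - \<tau> / \<tau>0) * f 0 + \<tau> / \<tau>0 * f \<tau>0" using \<open>\<tau> \<le> \<tau>0\<close> \<open>0 < \<tau>0\<close> \<tau> by (intro conv) auto
    also have "\<dots> \<le> (1 - \<tau> / \<tau>0) * R + \<tau> / \<tau>0 * R" using \<open>\<tau> \<le> \<tau>0\<close> \<open>0 < \<tau>0\<close> f0 \<tau>0(2) \<tau> by (intro add_mono mult_left_mono) auto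
    also have "\<dots> = R" by (simp add: algebra_simps)
    finally show "f \<tau> \<le> R" using \<open>0 < \<tau>0\<close> by simp
  next
    assume fR: "f \<tau> \<le> R"
    show "\<tau> \<le> \<tau>0"
    proof (rule ccontr)
      assume "\<not> \<tau> \<le> \<tau>0"
      then have lt: "\<tau>0 < \<tau>" by simp
      then have "f (\<tau>0 / \<tau> * \<tau>) \<le> (1 - \<tau>0 / \<tau>) * f 0 + \<tau>0 / \<tau> * f \<tau>" using \<open>0 < \<tau>0\<close> by (intro conv) auto
      also have "\<dots> < (1 - \<tau>0 / \<tau>) * R + \<tau>0 / \<tau> * R"
        using lt \<open>0 < \<tau>0\<close> f0 fR by (intro add_less_le_mono mult_strict_left_mono mult_left_mono) auto
      also have "\<dots> = R" by (simp add: algebra_simps)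
      finally show False using \<tau>0(2) lt \<open>0 < \<tau>0\<close> by simp
    qed
  qed
  then show ?thesis using \<open>0 < \<tau>0\<close> \<tau>0(2) unfolding f_def by blast
qed

lemma segment_ray: "0 < \<tau>0 \<Longrightarrow> closed_segment V (V + \<tau>0 *\<^sub>R d) = {V + \<tau> *\<^sub>R d |\<tau>. 0 \<le> \<tau> \<and> \<tau> \<le> \<tau>0}"
  for V d :: "real \<times> real"
proof (intro set_eqI iffI)
  fix y assume p: "0 < \<tau>0" and "y \<in> closed_segment V (V + \<tau>0 *\<^sub>R d)"
  then obtain s where s: "0 \<le> s" "s \<le> 1" "y = (1 - s) *\<^sub>R V + s *\<^sub>R (V + \<tau>0 *\<^sub>R d)" by (auto simp: closed_segment_def)
  then have "y = V + (s * \<tau>0) *\<^sub>R d" by (simp add: algebra_simps)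
  then show "y \<in> {V + \<tau> *\<^sub>R d |\<tau>. 0 \<le> \<tau> \<and> \<tau> \<le> \<tau>0}" using s p by (auto intro!: exI[of _ "s * \<tau>0"] mult_left_le_one_le)
next
  fix y assume p: "0 < \<tau>0" and "y \<in> {V + \<tau> *\<^sub>R d |\<tau>. 0 \<le> \<tau> \<and> \<tau> \<le> \<tau>0}"
  then obtain \<tau> where t: "0 \<le> \<tau>" "\<tau> \<le> \<tau>0" "y = V + \<tau> *\<^sub>R d" by blast
  then have "y = (1 - \<tau> / \<tau>0) *\<^sub>R V + (\<tau> / \<tau>0) *\<^sub>R (V + \<tau>0 *\<^sub>R d)" using p by (simp add: algebra_simps)
  then show "y \<in> closed_segment V (V + \<tau>0 *\<^sub>R d)" using t p unfolding closed_segment_def by (auto intro!: exI[of _ "\<tau> / \<tau>0"])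
qed

end

lemma single_crossing:
  fixes f :: "real \<Rightarrow> real"
  assumes cont: "continuous_on {0..1} f" and ends: "0 < f 0" "f 1 < 0"
    and uniq: "\<And>s t. s \<in> {0..1} \<Longrightarrow> t \<in> {0..1} \<Longrightarrow> f s = 0 \<Longrightarrow> f t = 0 \<Longrightarrow> s = t"
  obtains s where "0 < s" "s < 1" "f s = 0" "\<And>t. 0 \<le> t \<Longrightarrow> t < s \<Longrightarrow> 0 < f t" "\<And>t. s < t \<Longrightarrow> t \<le> 1 \<Longrightarrow> f t < 0"
proof -
  obtain s where s: "0 \<le> s" "s \<le> 1" "f s = 0" using IVT2'[of f 1 0 0] ends cont by auto
  then have s01: "0 < s" "s < 1" using ends by (auto simp: less_le)
  have sub: "continuous_on {a..b} f" if "0 \<le> a" "b \<le> 1" for a b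
    using cont by (rule continuous_on_subset) (use that in auto)
  have "0 < f t" if t: "0 \<le> t" "t < s" for t
  proof (rule ccontr)
    assume "\<not> 0 < f t"
    then obtain r where "0 \<le> r" "r \<le> t" "f r = 0" using IVT2'[of f t 0 0] ends t sub[of 0 t] s01 by auto
    then show False using uniq[of r s] s t by auto
  qed
  moreover have "f t < 0" if t: "s < t" "t \<le> 1" for t
  proof (rule ccontr)
    assume "\<not> f t < 0"
    then obtain r where "t \<le> r" "r \<le> 1" "f r = 0" using IVT2'[of f 1 0 t] ends t sub[of t 1] s01 by auto
    then show False using uniq[of r s] s t by auto
  qed
  ultimately show ?thesis using that s s01 by blast
qed

section \<open>Edges crossing a circle\<close>

text \<open>\<open>proper k I \<Lambda>\<close>: the labels \<open>\<Lambda>\<close> behave locally like those of a Voronoi decomposition. Unlike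
  being such a decomposition, this is inherited by labels patched together from two of them.\<close>

definition proper :: "nat \<Rightarrow> 'i set \<Rightarrow> (point \<Rightarrow> 'i labels) \<Rightarrow> bool" where
  "proper k I \<Lambda> \<longleftrightarrow> (\<forall>p\<in>S2. fst (\<Lambda> p) \<union> snd (\<Lambda> p) = I \<and>
     (tie (\<Lambda> p) = {} \<or> card (tie (\<Lambda> p)) = 2 \<or>
      card (tie (\<Lambda> p)) = 3 \<and> (card (fst (\<Lambda> p)) = k + 1 \<or> card (fst (\<Lambda> p)) = k + 2)) \<and>
     (\<exists>e>0. \<forall>q\<in>S2. dist q p < e \<longrightarrow> fst (\<Lambda> q) \<subseteq> fst (\<Lambda> p) \<and> snd (\<Lambda> q) \<subseteq> snd (\<Lambda> p)))"

lemma proper_lab: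
  assumes fin: "finite I" "k \<le> card I" and reg: "regular k I x"
  shows "proper k I (lab k I x)"
  unfolding proper_def
proof (intro ballI conjI)
  fix p assume p: "p \<in> S2"
  show "fst (lab k I x p) \<union> snd (lab k I x p) = I" using lo_Un_hi[OF fin(1)] by simp
  have "tie (lab k I x p) \<subseteq> I" unfolding tie_def using lo_subset[of k I] by fastforce
  then have finT: "finite (tie (lab k I x p))" using fin(1) finite_subset by blast
  have le: "card (tie (lab k I x p)) \<le> 3" using reg p unfolding regular_def by blast
  have ne: "card (tie (lab k I x p)) \<noteq> 1" using card_tie_not_1[OF fin, of "\<lambda>i. p \<bullet> x i"] by (simp add: tie_def)
  have "card (fst (lab k I x p)) = k + 1 \<or> card (fst (lab k I x p)) = k + 2" if "card (tie (lab k I x p)) = 3"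
    using card_lo_tie3(1)[OF fin, of "\<lambda>i. p \<bullet> x i"] that by (simp add: tie_def)
  moreover have "card (tie (lab k I x p)) = 0 \<or> card (tie (lab k I x p)) = 2 \<or> card (tie (lab k I x p)) = 3"
    using le ne by linarith
  ultimately show "tie (lab k I x p) = {} \<or> card (tie (lab k I x p)) = 2 \<or>
      card (tie (lab k I x p)) = 3 \<and> (card (fst (lab k I x p)) = k + 1 \<or> card (fst (lab k I x p)) = k + 2)"
    using finT by auto
  obtain y where y: "y > 0" and st: "\<And>x' q i j. (\<forall>i\<in>I. norm (x' i - x i) < y) \<Longrightarrow> norm (q - p) < y \<Longrightarrow>
    i \<in> I \<Longrightarrow> j \<in> I \<Longrightarrow> p \<bullet> x j < p \<bullet> x i \<Longrightarrow> q \<bullet> x' j < q \<bullet> x' i"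
    using strict_stable[OF fin(1), of x p] by metis
  have "fst (lab k I x q) \<subseteq> fst (lab k I x p) \<and> snd (lab k I x q) \<subseteq> snd (lab k I x p)" if "dist q p < y" for q
  proof -
    have *: "q \<bullet> x j < q \<bullet> x i" if "i \<in> lo k I (\<lambda>i. p \<bullet> x i)" "j \<in> hi k I (\<lambda>i. p \<bullet> x i)" "p \<bullet> x j < p \<bullet> x i" for i j
      using st[of x q i j] y \<open>dist q p < y\<close> that lo_subset[of k I "\<lambda>i. p \<bullet> x i"] hi_subset[of k I "\<lambda>i. p \<bullet> x i"]
      by (auto simp: dist_norm)
    show ?thesis
      using lo_hi_upper(1,2)[OF fin, of "\<lambda>i. p \<bullet> x i" "\<lambda>i. q \<bullet> x i"] * by simp
  qed
  then show "\<exists>e>0. \<forall>q\<in>S2. dist q p < e \<longrightarrow> fst (lab k I x q) \<subseteq> fst (lab k I x p) \<and> snd (lab k I x q) \<subseteq> snd (lab k I x p)"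
    using y by blast
qed

lemma proper_comp:
  assumes "proper k I \<Lambda>" and cont: "continuous_on S2 h" and img: "h ` S2 \<subseteq> S2"
  shows "proper k I (\<lambda>p. \<Lambda> (h p))"
  unfolding proper_def
proof (intro ballI conjI)
  fix p assume p: "p \<in> S2"
  then have hp: "h p \<in> S2" using img by blast
  show "fst (\<Lambda> (h p)) \<union> snd (\<Lambda> (h p)) = I" using assms(1) hp unfolding proper_def by blast
  show "tie (\<Lambda> (h p)) = {} \<or> card (tie (\<Lambda> (h p))) = 2 \<or>
      card (tie (\<Lambda> (h p))) = 3 \<and> (card (fst (\<Lambda> (h p))) = k + 1 \<or> card (fst (\<Lambda> (h p))) = k + 2)"
    using assms(1) hp unfolding proper_def by blast
  obtain e where e: "e > 0" "\<forall>q\<in>S2. dist q (h p) < e \<longrightarrow> fst (\<Lambda> q) \<subseteq> fst (\<Lambda> (h p)) \<and> snd (\<Lambda> q) \<subseteq> snd (\<Lambda> (h p))"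
    using assms(1) hp unfolding proper_def by blast
  obtain d where d: "d > 0" "\<forall>q\<in>S2. dist q p < d \<longrightarrow> dist (h q) (h p) < e"
    using cont p e(1) unfolding continuous_on_iff by blast
  show "\<exists>e>0. \<forall>q\<in>S2. dist q p < e \<longrightarrow> fst (\<Lambda> (h q)) \<subseteq> fst (\<Lambda> (h p)) \<and> snd (\<Lambda> (h q)) \<subseteq> snd (\<Lambda> (h p))"
    using d e(2) img by (intro exI[of _ d]) blast
qed

lemma inner_dist:
  assumes "norm z = 1"
  shows "\<bar>z \<bullet> q - z \<bullet> p\<bar> \<le> dist q p"
  using Cauchy_Schwarz_ineq2[of z "q - p"] assms by (simp add: inner_diff dist_norm)

text \<open>The switch at height \<open>m\<close> happens inside a band where the two labelings
  agree, so near every point the patched labeling coincides with one of them.\<close>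

lemma proper_glue:
  assumes A: "proper k I A" and C: "proper k I C" and z: "norm z = 1" and e: "0 < e"
    and eq: "\<And>p. p \<in> S2 \<Longrightarrow> \<bar>z \<bullet> p - m\<bar> < e \<Longrightarrow> A p = C p"
  shows "proper k I (\<lambda>p. if m < z \<bullet> p then C p else A p)" (is "proper k I ?B")
  unfolding proper_def
proof (intro ballI conjI)
  fix p assume p: "p \<in> S2"
  show "fst (?B p) \<union> snd (?B p) = I" using A C p unfolding proper_def by auto
  show "tie (?B p) = {} \<or> card (tie (?B p)) = 2 \<or>
      card (tie (?B p)) = 3 \<and> (card (fst (?B p)) = k + 1 \<or> card (fst (?B p)) = k + 2)"
    using A C p unfolding proper_def by auto
  have "\<exists>P e'. 0 < e' \<and> proper k I P \<and> ?B p = P p \<and> (\<forall>q\<in>S2. dist q p < e' \<longrightarrow> ?B q = P q)"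
  proof (cases "z \<bullet> p = m")
    case True
    have "?B q = A q" if "q \<in> S2" "dist q p < e" for q
      using eq[OF that(1)] inner_dist[OF z, of q p] that(2) True by auto
    then show ?thesis using True e A by (intro exI[of _ A] exI[of _ e]) auto
  next
    case False
    define e' where "e' = \<bar>z \<bullet> p - m\<bar>"
    have e': "0 < e'" using False unfolding e'_def by auto
    have "m < z \<bullet> q \<longleftrightarrow> m < z \<bullet> p" if "dist q p < e'" for q
      using inner_dist[OF z, of q p] that unfolding e'_def by linarith
    then have "\<forall>q\<in>S2. dist q p < e' \<longrightarrow> ?B q = (if m < z \<bullet> p then C else A) q" by simp
    moreover have "proper k I (if m < z \<bullet> p then C else A)" using A C by simp
    moreover have "?B p = (if m < z \<bullet> p then C else A) p" by simp
    ultimately show ?thesis using e' by blast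
  qed
  then obtain P e' where P: "0 < e'" "proper k I P" "?B p = P p" "\<And>q. q \<in> S2 \<Longrightarrow> dist q p < e' \<Longrightarrow> ?B q = P q" by blast
  obtain e'' where e'': "e'' > 0" "\<forall>q\<in>S2. dist q p < e'' \<longrightarrow> fst (P q) \<subseteq> fst (P p) \<and> snd (P q) \<subseteq> snd (P p)"
    using P(2) p unfolding proper_def by blast
  have "fst (?B q) \<subseteq> fst (?B p) \<and> snd (?B q) \<subseteq> snd (?B p)" if "q \<in> S2" "dist q p < min e' e''" for q
    unfolding P(3) using P(4)[OF that(1)] e''(2) that by auto
  then show "\<exists>e>0. \<forall>q\<in>S2. dist q p < e \<longrightarrow> fst (?B q) \<subseteq> fst (?B p) \<and> snd (?B q) \<subseteq> snd (?B p)"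
    using P(1) e''(1) by (intro exI[of _ "min e' e''"]) auto
qed

text \<open>Near a point labels can only shrink. If the number of ties is two at both points, the
  ties agree, and a dot outside them keeps its side because both parts of a label cover all indices.
  So points with different labels lie on different edges.\<close>

lemma edge_label_const:
  assumes pr: "proper k I \<Lambda>" and fin: "finite I" and con: "connected C"
    and C: "C \<subseteq> {p \<in> S2. card (tie (\<Lambda> p)) = 2}" and pq: "p \<in> C" "q \<in> C"
  shows "\<Lambda> p = \<Lambda> q"
proof -
  have "\<Lambda> constant_on C"
  proof (rule locally_constant_imp_constant[OF con])
    fix a assume a: "a \<in> C"
    then have aS: "a \<in> S2" "card (tie (\<Lambda> a)) = 2" using C by auto
    obtain e where e: "e > 0" "\<forall>q\<in>S2. dist q a < e \<longrightarrow> fst (\<Lambda> q) \<subseteq> fst (\<Lambda> a) \<and> snd (\<Lambda> q) \<subseteq> snd (\<Lambda> a)"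
      using pr aS unfolding proper_def by blast
    have eqx: "\<Lambda> x = \<Lambda> a" if x: "x \<in> C \<inter> ball a e" for x
    proof -
      have xS: "x \<in> S2" "card (tie (\<Lambda> x)) = 2" "dist x a < e" using x C by (auto simp: dist_commute)
      then have sub: "fst (\<Lambda> x) \<subseteq> fst (\<Lambda> a)" "snd (\<Lambda> x) \<subseteq> snd (\<Lambda> a)" using e by auto
      have un: "fst (\<Lambda> x) \<union> snd (\<Lambda> x) = I" "fst (\<Lambda> a) \<union> snd (\<Lambda> a) = I" using pr xS aS unfolding proper_def by auto
      have "finite (tie (\<Lambda> a))" unfolding tie_def using un(2) fin by (metis finite_Int finite_Un)
      then have t: "tie (\<Lambda> x) = tie (\<Lambda> a)" using sub aS(2) xS(2) unfolding tie_def by (intro card_subset_eq) auto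
      have "fst (\<Lambda> a) \<subseteq> fst (\<Lambda> x)"
      proof
        fix i assume i: "i \<in> fst (\<Lambda> a)"
        show "i \<in> fst (\<Lambda> x)"
        proof (cases "i \<in> snd (\<Lambda> x)")
          case True then show ?thesis using i sub t unfolding tie_def by blast
        next
          case False then show ?thesis using i un by blast
        qed
      qed
      moreover have "snd (\<Lambda> a) \<subseteq> snd (\<Lambda> x)"
      proof
        fix i assume i: "i \<in> snd (\<Lambda> a)"
        show "i \<in> snd (\<Lambda> x)"
        proof (cases "i \<in> fst (\<Lambda> x)")
          case True then show ?thesis using i sub t unfolding tie_def by blast
        next
          case False then show ?thesis using i un by blast
        qed
      qed
      ultimately show ?thesis using sub by (simp add: prod_eq_iff)
    qed
    have op: "openin (top_of_set C) (C \<inter> ball a e)" by auto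
    show "\<exists>T. openin (top_of_set C) T \<and> a \<in> T \<and> (\<forall>x\<in>T. \<Lambda> x = \<Lambda> a)"
      by (intro exI[of _ "C \<inter> ball a e"] conjI ballI op eqx) (use a e(1) in auto)
  qed
  then show ?thesis using pq unfolding constant_on_def by metis
qed

lemma open_edges_gr:
  assumes "proper k I \<Lambda>"
  shows "open_edges (gr k \<Lambda>) = components {p \<in> S2. card (tie (\<Lambda> p)) = 2}"
proof -
  have "skel (gr k \<Lambda>) - (white (gr k \<Lambda>) \<union> black (gr k \<Lambda>)) = {p \<in> S2. card (tie (\<Lambda> p)) = 2}"
    using assms unfolding gr_simps proper_def by force
  then show ?thesis unfolding open_edges_def by simp
qed

text \<open>A piece of an edge that starts at a vertex inside and leaves the circle at parameter
  \<open>s\<close>. The label is prescribed for positive parameters only, since more dots are tied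
  at the vertex.\<close>

definition spoke :: "(point \<Rightarrow> 'i labels) \<Rightarrow> point \<Rightarrow> real \<Rightarrow> (real \<Rightarrow> point) \<Rightarrow> real \<Rightarrow> 'i labels \<Rightarrow> bool" where
  "spoke \<Lambda> z h \<alpha> s l \<longleftrightarrow> arc \<alpha> \<and> 0 < s \<and> s < 1 \<and> z \<bullet> \<alpha> s = h \<and>
     (\<forall>t. 0 \<le> t \<longrightarrow> t < s \<longrightarrow> h < z \<bullet> \<alpha> t) \<and> (\<forall>t. s < t \<longrightarrow> t \<le> 1 \<longrightarrow> z \<bullet> \<alpha> t < h) \<and>
     (\<forall>t. 0 < t \<longrightarrow> t \<le> 1 \<longrightarrow> \<alpha> t \<in> S2 \<and> \<Lambda> (\<alpha> t) = l) \<and> card (tie l) = 2"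

lemma crossed_by_four_spokes:
  assumes pr: "proper k I \<Lambda>" and fin: "finite I"
    and sp: "\<And>i. i < 4 \<Longrightarrow> spoke \<Lambda> z h (\<alpha> i) (s i) (l i)" and dist: "inj_on l {..<4}"
    and ps: "length ps = 4" "\<And>i. i < 4 \<Longrightarrow> ps ! i = \<alpha> i (s i)"
    and cyc: "in_cyclic_order z h ps" and rim: "skel (gr k \<Lambda>) \<inter> rim z h = set ps"
  shows "crossed_by_four_edges z h (gr k \<Lambda>) ps"
proof -
  define E where "E = {p \<in> S2. card (tie (\<Lambda> p)) = 2}"
  define e where "e = (\<lambda>i. connected_component_set E (ps ! i))"
  have s: "arc (\<alpha> i)" "0 < s i" "s i < 1" "z \<bullet> \<alpha> i (s i) = h" "\<And>t. 0 \<le> t \<Longrightarrow> t < s i \<Longrightarrow> h < z \<bullet> \<alpha> i t"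
    "\<And>t. s i < t \<Longrightarrow> t \<le> 1 \<Longrightarrow> z \<bullet> \<alpha> i t < h" "\<And>t. 0 < t \<Longrightarrow> t \<le> 1 \<Longrightarrow> \<alpha> i t \<in> S2 \<and> \<Lambda> (\<alpha> i t) = l i" "card (tie (l i)) = 2"
    if "i < 4" for i using sp[OF that] unfolding spoke_def by blast+
  have pE: "ps ! i \<in> E" "\<Lambda> (ps ! i) = l i" if "i < 4" for i
    using s(2,3,7,8)[OF that] ps(2)[OF that] unfolding E_def by auto
  have e: "e i \<in> open_edges (gr k \<Lambda>)" "ps ! i \<in> e i" if "i < 4" for i
    using pE[OF that] unfolding open_edges_gr[OF pr] e_def E_def[symmetric] components_def by (auto simp: connected_component_refl)
  have einj: "i = j" if ij: "i < 4" "j < 4" "e i = e j" for i j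
  proof -
    have "\<Lambda> (ps ! i) = \<Lambda> (ps ! j)"
    proof (rule edge_label_const[OF pr fin])
      show "connected (e i)" unfolding e_def by simp
      show "e i \<subseteq> {p \<in> S2. card (tie (\<Lambda> p)) = 2}" unfolding e_def E_def[symmetric] by (rule connected_component_subset)
      show "ps ! i \<in> e i" "ps ! j \<in> e i" using e(2) ij by auto
    qed
    then show ?thesis using pE(2) ij dist unfolding inj_on_def by auto
  qed
  have cr: "crosses_transversally z h (e i) (ps ! i)" if i: "i < 4" for i
  proof -
    note si = s(1-7)[OF i]
    \<comment> \<open>Half of the inner piece is cut off, because the arc in
      \<open>crosses_transversally\<close> must lie in an open edge and so must avoid the vertex at
      parameter 0.\<close>
    define r where "r = s i / 2"
    have r: "0 < r" "r < s i" "r < 1" using si unfolding r_def by auto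
    define g where "g = subpath r 1 (\<alpha> i)"
    have gt: "g t = \<alpha> i ((1 - r) * t + r)" for t unfolding g_def subpath_def ..
    define s' where "s' = (s i - r) / (1 - r)"
    have s': "0 < s'" "s' < 1" "(1 - r) * s' + r = s i" using r si(3) unfolding s'_def by auto
    have ar: "arc g" unfolding g_def using si(1) r by (intro arc_subpath_arc) auto
    have img: "path_image g = \<alpha> i ` {r..1}" unfolding g_def using r by (simp add: path_image_subpath)
    have sub: "path_image g \<subseteq> E" unfolding img E_def using si(7) s(8)[OF i] r by auto
    have conn: "connected (path_image g)" using ar by (simp add: arc_imp_path connected_path_image)
    have mem: "ps ! i \<in> path_image g" unfolding img ps(2)[OF i] using r si(3) by auto
    have "path_image g \<subseteq> e i" unfolding e_def by (rule connected_component_maximal[OF mem conn sub])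
    moreover have "g s' = ps ! i" unfolding gt s'(3) ps(2)[OF i] ..
    moreover have "h < z \<bullet> g t" if "t \<in> {0..<s'}" for t
    proof -
      have "(1 - r) * t < (1 - r) * s'" using that r by (intro mult_strict_left_mono) auto
      moreover have "0 \<le> (1 - r) * t" using that r by simp
      ultimately have "0 \<le> (1 - r) * t + r" "(1 - r) * t + r < s i" using s'(3) r by linarith+
      then show ?thesis unfolding gt by (rule si(5))
    qed
    moreover have "z \<bullet> g t < h" if "t \<in> {s'<..1}" for t
    proof -
      have "(1 - r) * s' < (1 - r) * t" using that r by (intro mult_strict_left_mono) auto
      moreover have "(1 - r) * t \<le> 1 - r" using that r by (intro mult_left_le) auto
      ultimately have "s i < (1 - r) * t + r" "(1 - r) * t + r \<le> 1" using s'(3) r by linarith+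
      then show ?thesis unfolding gt by (rule si(6))
    qed
    ultimately show ?thesis unfolding crosses_transversally_def
      using ar s' si(4) ps(2)[OF i] by (intro exI[of _ g] exI[of _ s']) auto
  qed
  show ?thesis unfolding crossed_by_four_edges_def
  proof (intro conjI ps(1) cyc rim exI[of _ "map e [0..<4]"] allI impI)
    show "length (map e [0..<4]) = 4" by simp
    show "distinct (map e [0..<4])" using einj by (auto simp: distinct_map inj_on_def)
    show "set (map e [0..<4]) \<subseteq> open_edges (gr k \<Lambda>)" using e(1) by auto
    show "ps ! i \<in> map e [0..<4] ! i" "crosses_transversally z h (map e [0..<4] ! i) (ps ! i)" if "i < 4" for i
      using e(2)[OF that] cr[OF that] that by auto
  qed
qed

context cap_plane
begin

text \<open>Seen through \<open>h\<close>, the ray from \<open>V\<close> in direction \<open>d\<close> meets the rim exactly once, because on the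
  rim it carries the label that the ray from the centre has for the unperturbed dots.\<close>

lemma spoke_from_ray:
  fixes LX L0 \<Lambda> :: "point \<Rightarrow> 'i labels"
  assumes homeo: "homeomorphism S2 S2 h g" and near: "\<And>p. p \<in> S2 \<Longrightarrow> norm (h p - p) \<le> \<epsilon>"
    and h: "0 < h2" "h2 + \<epsilon> < h1" "h1 < 1"
    and zone: "\<And>p. p \<in> S2 \<Longrightarrow> h2 - \<epsilon> \<le> z \<bullet> p \<Longrightarrow> \<Lambda> p = LX (h p)"
    and rim: "\<And>p. p \<in> S2 \<Longrightarrow> z \<bullet> p = h1 \<Longrightarrow> \<Lambda> p = L0 p"
    and V: "h1 + \<epsilon> < z \<bullet> pl V" and d: "d \<noteq> 0"
    and labX: "\<And>y. nu y \<le> rad h2 \<Longrightarrow> LX (pl y) = l \<longleftrightarrow> (\<exists>\<tau>>0. y = V + \<tau> *\<^sub>R d)"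
    and lab0: "\<And>y. nu y \<le> rad h2 \<Longrightarrow> L0 (pl y) = l \<longleftrightarrow> (\<exists>\<tau>>0. y = \<tau> *\<^sub>R d)"
    and two: "card (tie l) = 2"
  obtains e s \<tau>1 where "spoke \<Lambda> z h1 (\<lambda>t. g (pl (linepath V e t))) s l"
    "g (pl (linepath V e s)) = rimpt h1 d" "0 < \<tau>1" "linepath V e s = V + \<tau>1 *\<^sub>R d"
    "{y. nu y \<le> rad h2 \<and> (\<exists>\<tau>\<ge>0. y = V + \<tau> *\<^sub>R d) \<and> h1 \<le> z \<bullet> g (pl y)} = closed_segment V (V + \<tau>1 *\<^sub>R d)"
proof -
  have \<epsilon>0: "0 \<le> \<epsilon>" using near[OF pl_S2[of 0]] norm_ge_zero order_trans by blast
  have h12: "0 < h1" "h2 < 1" "h2 < h1" using h \<epsilon>0 by auto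
  have gS: "g q \<in> S2" "h (g q) = q" if "q \<in> S2" for q using homeo that by (auto simp: homeomorphism_def)
  have gnear: "\<bar>z \<bullet> g q - z \<bullet> q\<bar> \<le> \<epsilon>" if "q \<in> S2" for q
    using inner_dist[OF z1, of "g q" q] near[OF gS(1)[OF that]] gS(2)[OF that] by (simp add: dist_norm norm_minus_commute)
  have "nu V < rad h2" using V h \<epsilon>0 height_iff(2)[OF h(1) h12(2), of V] by linarith
  \<comment> \<open>The ray is followed out to height \<open>h2\<close>. As \<open>g\<close> alters
    heights by at most \<epsilon> and \<open>h2 + \<epsilon> < h1\<close>, the end of its image is
    beyond the rim at height \<open>h1\<close>.\<close>
  then obtain \<tau>0 where \<tau>0: "\<tau>0 > 0" "nu (V + \<tau>0 *\<^sub>R d) = rad h2" "\<And>\<tau>. 0 \<le> \<tau> \<Longrightarrow> nu (V + \<tau> *\<^sub>R d) \<le> rad h2 \<longleftrightarrow> \<tau> \<le> \<tau>0"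
    using ray_in_ball[OF _ d] by blast
  define e where "e = V + \<tau>0 *\<^sub>R d"
  have lin: "linepath V e t = V + (t * \<tau>0) *\<^sub>R d" for t unfolding e_def linepath_def by (simp add: algebra_simps)
  define \<alpha> where "\<alpha> = (\<lambda>t. g (pl (linepath V e t)))"
  have cg: "continuous_on S2 g" using homeo by (auto simp: homeomorphism_def)
  have c\<alpha>: "continuous_on S \<alpha>" for S unfolding \<alpha>_def
    by (intro continuous_on_compose2[OF cg] continuous_on_compose2[OF cont_pl[of UNIV]] continuous_on_linepath) (auto simp: pl_S2[simplified])
  have arc: "arc \<alpha>" unfolding arc_def path_def
  proof (intro conjI c\<alpha> inj_onI)
    fix x y assume "x \<in> {0..1}" "y \<in> {0..1}" "\<alpha> x = \<alpha> y"
    then have "pl (linepath V e x) = pl (linepath V e y)" unfolding \<alpha>_def using gS(2)[OF pl_S2] by metis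
    then have "((x - y) * \<tau>0) *\<^sub>R d = 0" unfolding inj_pl lin by (simp add: algebra_simps)
    then show "x = y" using \<tau>0(1) d by simp
  qed
  have inball: "nu (linepath V e t) \<le> rad h2" if "t \<in> {0..1}" for t
    unfolding lin using that \<tau>0(1) by (subst \<tau>0(3)) (auto intro: mult_left_le_one_le)
  have \<Lambda>\<alpha>: "\<Lambda> (\<alpha> t) = LX (pl (linepath V e t))" "\<alpha> t \<in> S2" if t: "t \<in> {0..1}" for t
  proof -
    show S: "\<alpha> t \<in> S2" unfolding \<alpha>_def by (rule gS(1)[OF pl_S2])
    have "h2 \<le> z \<bullet> pl (linepath V e t)" using inball[OF t] height_iff(1)[OF h(1) h12(2)] by blast
    then have "h2 - \<epsilon> \<le> z \<bullet> \<alpha> t" using gnear[OF pl_S2, of "linepath V e t"] unfolding \<alpha>_def by linarith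
    then show "\<Lambda> (\<alpha> t) = LX (pl (linepath V e t))" using zone[OF S] gS(2)[OF pl_S2] unfolding \<alpha>_def by simp
  qed
  have lab: "\<Lambda> (\<alpha> t) = l" if "0 < t" "t \<le> 1" for t
    using \<Lambda>\<alpha>(1)[of t] labX[OF inball[of t]] that \<tau>0(1) unfolding lin by (auto intro!: exI[of _ "t * \<tau>0"])
  define f where "f = (\<lambda>t. z \<bullet> \<alpha> t - h1)"
  have cf: "continuous_on {0..1} f" unfolding f_def by (intro continuous_intros c\<alpha>)
  have f0: "0 < f 0" using V gnear[OF pl_S2, of V] unfolding f_def \<alpha>_def linepath_0' by linarith
  have f1: "f 1 < 0"
  proof -
    have "z \<bullet> pl e = h2" using \<tau>0(2) height_iff(3)[OF h(1) h12(2), of e] unfolding e_def by simp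
    then show ?thesis using h gnear[OF pl_S2, of e] unfolding f_def \<alpha>_def linepath_1' by linarith
  qed
  have on_rim: "\<alpha> t = rimpt h1 d" if t: "t \<in> {0..1}" "f t = 0" for t
  proof -
    have S: "\<alpha> t \<in> S2" and hh: "z \<bullet> \<alpha> t = h1" using \<Lambda>\<alpha>(2)[OF t(1)] t(2) unfolding f_def by auto
    have "t \<noteq> 0" using f0 t(2) by auto
    then have "L0 (\<alpha> t) = l" using lab[of t] rim[OF S hh] t(1) by auto
    moreover have pc: "pl (co (\<alpha> t)) = \<alpha> t" using pl_co[OF S] hh h12 by simp
    moreover have nuc: "nu (co (\<alpha> t)) = rad h1" using height_iff(3)[OF h12(1) h(3), of "co (\<alpha> t)"] pc hh by simp
    moreover have "nu (co (\<alpha> t)) \<le> rad h2" using height_iff(1)[OF h(1) h12(2), of "co (\<alpha> t)"] pc hh h12 by simp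
    ultimately obtain \<tau> where "\<tau> > 0" "co (\<alpha> t) = \<tau> *\<^sub>R d" using lab0[of "co (\<alpha> t)"] by auto
    then show ?thesis using rimpt_unique[OF h12(1) h(3) d] nuc pc by metis
  qed
  have inj\<alpha>: "inj_on \<alpha> {0..1}" using arc by (simp add: arc_def)
  obtain s where s: "0 < s" "s < 1" "f s = 0" "\<And>t. 0 \<le> t \<Longrightarrow> t < s \<Longrightarrow> 0 < f t" "\<And>t. s < t \<Longrightarrow> t \<le> 1 \<Longrightarrow> f t < 0"
  proof (rule single_crossing[OF cf f0 f1])
    show "t = t'" if "t \<in> {0..1}" "t' \<in> {0..1}" "f t = 0" "f t' = 0" for t t'
      using on_rim that inj\<alpha> unfolding inj_on_def by metis
  qed blast
  define \<tau>1 where "\<tau>1 = s * \<tau>0"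
  have \<tau>1: "0 < \<tau>1" "\<tau>1 < \<tau>0" unfolding \<tau>1_def using s \<tau>0(1) by auto
  have "{y. nu y \<le> rad h2 \<and> (\<exists>\<tau>\<ge>0. y = V + \<tau> *\<^sub>R d) \<and> h1 \<le> z \<bullet> g (pl y)} = {V + \<tau> *\<^sub>R d |\<tau>. 0 \<le> \<tau> \<and> \<tau> \<le> \<tau>1}"
  proof (intro set_eqI iffI)
    fix y assume "y \<in> {y. nu y \<le> rad h2 \<and> (\<exists>\<tau>\<ge>0. y = V + \<tau> *\<^sub>R d) \<and> h1 \<le> z \<bullet> g (pl y)}"
    then obtain \<tau> where \<tau>: "0 \<le> \<tau>" "y = V + \<tau> *\<^sub>R d" "nu y \<le> rad h2" "h1 \<le> z \<bullet> g (pl y)" by blast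
    then have "\<tau> \<le> \<tau>0" using \<tau>0(3) by blast
    have "linepath V e (\<tau> / \<tau>0) = y" unfolding lin \<tau>(2) using \<tau>0(1) by simp
    then have "0 \<le> f (\<tau> / \<tau>0)" using \<tau>(4) unfolding f_def \<alpha>_def by simp
    then have "\<tau> / \<tau>0 \<le> s" using s(5)[of "\<tau> / \<tau>0"] \<open>\<tau> \<le> \<tau>0\<close> \<tau>0(1) by (meson divide_le_eq_1_pos not_le)
    then have "\<tau> \<le> \<tau>1" unfolding \<tau>1_def using \<tau>0(1) by (simp add: field_simps)
    then show "y \<in> {V + \<tau> *\<^sub>R d |\<tau>. 0 \<le> \<tau> \<and> \<tau> \<le> \<tau>1}" using \<tau> by blast
  next
    fix y assume "y \<in> {V + \<tau> *\<^sub>R d |\<tau>. 0 \<le> \<tau> \<and> \<tau> \<le> \<tau>1}"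
    then obtain \<tau> where \<tau>: "0 \<le> \<tau>" "\<tau> \<le> \<tau>1" "y = V + \<tau> *\<^sub>R d" by blast
    have l: "linepath V e (\<tau> / \<tau>0) = y" unfolding lin \<tau>(3) using \<tau>0(1) by simp
    have "\<tau> / \<tau>0 \<le> s" using \<tau>(2) \<tau>0(1) unfolding \<tau>1_def by (simp add: field_simps)
    then have "0 \<le> f (\<tau> / \<tau>0)" using s(3) s(4)[of "\<tau> / \<tau>0"] \<tau>(1) \<tau>0(1) by (cases "\<tau> / \<tau>0 = s") auto
    then have "h1 \<le> z \<bullet> g (pl y)" using l unfolding f_def \<alpha>_def by simp
    then show "y \<in> {y. nu y \<le> rad h2 \<and> (\<exists>\<tau>\<ge>0. y = V + \<tau> *\<^sub>R d) \<and> h1 \<le> z \<bullet> g (pl y)}"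
      using \<tau> \<tau>0(3)[OF \<tau>(1)] \<tau>1(2) by auto
  qed
  then have seg: "{y. nu y \<le> rad h2 \<and> (\<exists>\<tau>\<ge>0. y = V + \<tau> *\<^sub>R d) \<and> h1 \<le> z \<bullet> g (pl y)} = closed_segment V (V + \<tau>1 *\<^sub>R d)"
    using segment_ray[OF \<tau>1(1)] by simp
  have "spoke \<Lambda> z h1 \<alpha> s l" unfolding spoke_def
    using arc s lab \<Lambda>\<alpha>(2) two unfolding f_def by auto
  moreover have "\<alpha> s = rimpt h1 d" using on_rim[of s] s by auto
  ultimately show ?thesis using that[of e s \<tau>1] seg \<tau>1(1) unfolding \<alpha>_def lin \<tau>1_def by blast
qed

end

section \<open>Four dots near a common circle\<close>

lemma eq_sub4: "X \<subseteq> {a,b,c,d} \<Longrightarrow> Y \<subseteq> {a,b,c,d} \<Longrightarrow>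
  X = Y \<longleftrightarrow> (a \<in> X \<longleftrightarrow> a \<in> Y) \<and> (b \<in> X \<longleftrightarrow> b \<in> Y) \<and> (c \<in> X \<longleftrightarrow> c \<in> Y) \<and> (d \<in> X \<longleftrightarrow> d \<in> Y)"
  by blast

lemma card_sub4:
  assumes "distinct [a,b,c,d]" "X \<subseteq> {a,b,c,d}"
  shows "card X = of_bool (a \<in> X) + of_bool (b \<in> X) + of_bool (c \<in> X) + of_bool (d \<in> X)"
proof -
  have "X = (if a \<in> X then {a} else {}) \<union> (if b \<in> X then {b} else {}) \<union> (if c \<in> X then {c} else {}) \<union> (if d \<in> X then {d} else {})"
    using assms(2) by auto
  moreover have "card ((if a \<in> X then {a} else {}) \<union> (if b \<in> X then {b} else {}) \<union> (if c \<in> X then {c} else {}) \<union> (if d \<in> X then {d} else {}))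
    = of_bool (a \<in> X) + of_bool (b \<in> X) + of_bool (c \<in> X) + of_bool (d \<in> X)"
    using assms(1) by auto
  ultimately show ?thesis by metis
qed

lemma card_Collect4:
  assumes "distinct [a,b,c,d]"
  shows "card {j \<in> {a,b,c,d}. P j} = of_bool (P a) + of_bool (P b) + of_bool (P c) + of_bool (P d)"
proof -
  have "{j \<in> {a,b,c,d}. P j} \<subseteq> {a,b,c,d}" by blast
  from card_sub4[OF assms this] show ?thesis by simp
qed

text \<open>For four indices membership at orders 1 and 2 becomes an explicit condition on the
  values, so that the pictures below reduce to linear arithmetic with case distinctions.\<close>

lemma lo1_four:
  assumes "distinct [a,b,c,d]"
  shows "i \<in> lo 1 {a,b,c,d} f \<longleftrightarrow> i \<in> {a,b,c,d} \<and> f a \<le> f i \<and> f b \<le> f i \<and> f c \<le> f i \<and> f d \<le> f i"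
  unfolding lo_def card_Collect4[OF assms] by (auto simp: not_less)

lemma hi1_four:
  assumes "distinct [a,b,c,d]"
  shows "a \<in> hi 1 {a,b,c,d} f \<longleftrightarrow> f a \<le> f b \<or> f a \<le> f c \<or> f a \<le> f d"
    "b \<in> hi 1 {a,b,c,d} f \<longleftrightarrow> f b \<le> f a \<or> f b \<le> f c \<or> f b \<le> f d"
    "c \<in> hi 1 {a,b,c,d} f \<longleftrightarrow> f c \<le> f a \<or> f c \<le> f b \<or> f c \<le> f d"
    "d \<in> hi 1 {a,b,c,d} f \<longleftrightarrow> f d \<le> f a \<or> f d \<le> f b \<or> f d \<le> f c"
  unfolding hi_def mem_Collect_eq card_Collect4[OF assms] by auto

lemma lo2_four:
  assumes "distinct [a,b,c,d]"
  shows "a \<in> lo 2 {a,b,c,d} f \<longleftrightarrow> \<not> (f a < f b \<and> f a < f c) \<and> \<not> (f a < f b \<and> f a < f d) \<and> \<not> (f a < f c \<and> f a < f d)"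
    "b \<in> lo 2 {a,b,c,d} f \<longleftrightarrow> \<not> (f b < f a \<and> f b < f c) \<and> \<not> (f b < f a \<and> f b < f d) \<and> \<not> (f b < f c \<and> f b < f d)"
    "c \<in> lo 2 {a,b,c,d} f \<longleftrightarrow> \<not> (f c < f a \<and> f c < f b) \<and> \<not> (f c < f a \<and> f c < f d) \<and> \<not> (f c < f b \<and> f c < f d)"
    "d \<in> lo 2 {a,b,c,d} f \<longleftrightarrow> \<not> (f d < f a \<and> f d < f b) \<and> \<not> (f d < f a \<and> f d < f c) \<and> \<not> (f d < f b \<and> f d < f c)"
  unfolding lo_def mem_Collect_eq card_Collect4[OF assms] by auto

lemma hi2_four:
  assumes "distinct [a,b,c,d]"
  shows "a \<in> hi 2 {a,b,c,d} f \<longleftrightarrow> (f a \<le> f b \<and> f a \<le> f c) \<or> (f a \<le> f b \<and> f a \<le> f d) \<or> (f a \<le> f c \<and> f a \<le> f d)"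
    "b \<in> hi 2 {a,b,c,d} f \<longleftrightarrow> (f b \<le> f a \<and> f b \<le> f c) \<or> (f b \<le> f a \<and> f b \<le> f d) \<or> (f b \<le> f c \<and> f b \<le> f d)"
    "c \<in> hi 2 {a,b,c,d} f \<longleftrightarrow> (f c \<le> f a \<and> f c \<le> f b) \<or> (f c \<le> f a \<and> f c \<le> f d) \<or> (f c \<le> f b \<and> f c \<le> f d)"
    "d \<in> hi 2 {a,b,c,d} f \<longleftrightarrow> (f d \<le> f a \<and> f d \<le> f b) \<or> (f d \<le> f a \<and> f d \<le> f c) \<or> (f d \<le> f b \<and> f d \<le> f c)"
  unfolding hi_def mem_Collect_eq card_Collect4[OF assms] by auto

lemma lo_affine: "0 < r \<Longrightarrow> lo m Q (\<lambda>i. t + r * f i) = lo m Q f"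
  and hi_affine: "0 < r \<Longrightarrow> hi m Q (\<lambda>i. t + r * f i) = hi m Q f"
  by (auto simp: lo_def hi_def)

definition pert :: "('i \<Rightarrow> point) \<Rightarrow> point \<Rightarrow> 'i \<Rightarrow> 'i \<Rightarrow> 'i \<Rightarrow> 'i \<Rightarrow> real \<Rightarrow> 'i \<Rightarrow> point" where
  "pert x0 z a b c d \<gamma> = (\<lambda>i. if i = a \<or> i = c then x0 i + \<gamma> *\<^sub>R z else if i = b \<or> i = d then x0 i - \<gamma> *\<^sub>R z else x0 i)"

text \<open>Four dots equidistant from \<open>z\<close> with crossing diagonals \<open>ac\<close> and \<open>bd\<close>; \<open>cc\<close> is the crossing point.\<close>

locale cap_frame = cap_plane z u w us ws for z u w us ws +
  fixes I :: "'i set" and x0 :: "'i \<Rightarrow> point" and cc :: point and a b c d :: 'i and s1 s2 s3 s4 :: real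
  assumes finI: "finite I" and dis: "distinct [a,b,c,d]" and inI: "{a,b,c,d} \<subseteq> I"
    and s: "0 < s1" "0 < s2" "0 < s3" "0 < s4"
    and x0: "x0 a = cc + s1 *\<^sub>R u" "x0 b = cc + s2 *\<^sub>R w" "x0 c = cc - s3 *\<^sub>R u" "x0 d = cc - s4 *\<^sub>R w"
    and off: "\<And>i. i \<in> I - {a,b,c,d} \<Longrightarrow> z \<bullet> x0 i \<noteq> z \<bullet> cc"
begin

definition Q where "Q = {a,b,c,d}"
definition U where "U = {i \<in> I. z \<bullet> cc < z \<bullet> x0 i}"
definition L where "L = {i \<in> I. z \<bullet> x0 i < z \<bullet> cc}"

abbreviation pe :: "real \<Rightarrow> 'i \<Rightarrow> point" where "pe \<equiv> pert x0 z a b c d"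

text \<open>The four heights as seen from \<open>pl y\<close>, after the normalization carried out
  in \<open>lab_cap\<close>.\<close>

definition val :: "real \<Rightarrow> real \<times> real \<Rightarrow> 'i \<Rightarrow> real" where
  "val \<gamma> y i = (if i = a then s1 * fst y + \<gamma> else if i = b then s2 * snd y - \<gamma>
     else if i = c then \<gamma> - s3 * fst y else - \<gamma> - s4 * snd y)"

definition LQ :: "nat \<Rightarrow> real \<Rightarrow> real \<times> real \<Rightarrow> 'i labels" where
  "LQ m \<gamma> y = (lo m Q (val \<gamma> y), hi m Q (val \<gamma> y))"

text \<open>The four points at which three of the four values \<open>val\<close> coincide, one for
  each omitted dot.\<close>

abbreviation corners :: "real \<Rightarrow> (real \<times> real) set" where
  "corners \<gamma> \<equiv> {(2 * \<gamma> / s3, 0), (0, 2 * \<gamma> / s2), (- 2 * \<gamma> / s1, 0), (0, - 2 * \<gamma> / s4)}"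

abbreviation cap_lab :: "nat \<Rightarrow> real \<Rightarrow> real \<times> real \<Rightarrow> 'i labels" where
  "cap_lab k \<gamma> y \<equiv> (U \<union> fst (LQ (k - card U) \<gamma> y), L \<union> snd (LQ (k - card U) \<gamma> y))"

text \<open>Makes \<open>lo_hi_separated\<close> applicable throughout a cap, with the four dots as
  the middle block.\<close>

definition sep :: "('i \<Rightarrow> point) \<Rightarrow> real \<Rightarrow> bool" where
  "sep x h \<longleftrightarrow> (\<forall>q\<in>S2. h \<le> z \<bullet> q \<longrightarrow> (\<forall>i\<in>U. \<forall>j\<in>Q \<union> L. q \<bullet> x j < q \<bullet> x i) \<and> (\<forall>i\<in>Q. \<forall>j\<in>L. q \<bullet> x j < q \<bullet> x i))"

lemma z_x0: "i \<in> Q \<Longrightarrow> z \<bullet> x0 i = z \<bullet> cc"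
  unfolding Q_def using x0 zu zw by (auto simp: inner_add inner_diff inner_commute)

lemma parts: "I = U \<union> Q \<union> L" "U \<inter> Q = {}" "U \<inter> L = {}" "Q \<inter> L = {}" "finite U" "finite Q" "finite L" "card Q = 4"
proof -
  have "Q \<subseteq> I" using inI unfolding Q_def .
  then show "I = U \<union> Q \<union> L" unfolding U_def L_def using off unfolding Q_def by fastforce
  show "U \<inter> Q = {}" "U \<inter> L = {}" "Q \<inter> L = {}" using z_x0 unfolding U_def L_def by auto
  show "finite U" "finite Q" "finite L" using finI unfolding U_def L_def Q_def by auto
  show "card Q = 4" unfolding Q_def using dis by simp
qed

lemma distinct_simps: "a \<noteq> b" "a \<noteq> c" "a \<noteq> d" "b \<noteq> c" "b \<noteq> d" "c \<noteq> d" "b \<noteq> a" "c \<noteq> a" "d \<noteq> a" "c \<noteq> b" "d \<noteq> b" "d \<noteq> c"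
  using dis by auto

lemma val_simps: "val \<gamma> y a = s1 * fst y + \<gamma>" "val \<gamma> y b = s2 * snd y - \<gamma>"
  "val \<gamma> y c = \<gamma> - s3 * fst y" "val \<gamma> y d = - \<gamma> - s4 * snd y"
  using dis by (auto simp: val_def)

text \<open>The heights of the four dots are \<open>val\<close> up to the common term
  \<open>pl y \<bullet> cc\<close> and the positive factor \<open>z \<bullet> pl y\<close>, neither
  of which affects a ranking.\<close>

lemma lab_cap:
  assumes x: "sep (pe \<gamma>) h" and y: "h \<le> z \<bullet> pl y" and k: "card U \<le> k" "k \<le> card U + 4"
  shows "lab k I (pe \<gamma>) (pl y) = cap_lab k \<gamma> y"
proof -
  let ?f = "\<lambda>i. pl y \<bullet> pe \<gamma> i"
  have sp: "\<And>i j. i \<in> U \<Longrightarrow> j \<in> Q \<Longrightarrow> ?f j < ?f i" "\<And>i j. i \<in> U \<Longrightarrow> j \<in> L \<Longrightarrow> ?f j < ?f i" "\<And>i j. i \<in> Q \<Longrightarrow> j \<in> L \<Longrightarrow> ?f j < ?f i"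
    using x pl_S2 y unfolding sep_def by blast+
  have "lo k (U \<union> Q \<union> L) ?f = U \<union> lo (k - card U) Q ?f" "hi k (U \<union> Q \<union> L) ?f = L \<union> hi (k - card U) Q ?f"
    by (rule lo_hi_separated; use parts sp k in auto)+
  moreover have v: "?f i = pl y \<bullet> cc + (z \<bullet> pl y) * val \<gamma> y i" if "i \<in> Q" for i
  proof -
    have "i = a \<or> i = b \<or> i = c \<or> i = d" using that unfolding Q_def by auto
    then show ?thesis
      by (elim disjE) (simp_all add: pert_def val_simps distinct_simps x0 pl_inner inner_add inner_diff algebra_simps)
  qed
  moreover have "lo m Q ?f = lo m Q (val \<gamma> y)" "hi m Q ?f = hi m Q (val \<gamma> y)" for m
  proof -
    have "lo m Q ?f = lo m Q (\<lambda>i. pl y \<bullet> cc + (z \<bullet> pl y) * val \<gamma> y i)" using v by (rule lo_cong)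
    then show "lo m Q ?f = lo m Q (val \<gamma> y)" using lo_affine[OF z_pl_pos] by simp
    have "hi m Q ?f = hi m Q (\<lambda>i. pl y \<bullet> cc + (z \<bullet> pl y) * val \<gamma> y i)" using v by (rule hi_cong)
    then show "hi m Q ?f = hi m Q (val \<gamma> y)" using hi_affine[OF z_pl_pos] by simp
  qed
  ultimately show ?thesis unfolding lab_def LQ_def parts(1)[symmetric] by simp
qed

lemma LQ_sub: "fst (LQ m \<gamma> y) \<subseteq> Q" "snd (LQ m \<gamma> y) \<subseteq> Q" "tie (LQ m \<gamma> y) \<subseteq> Q"
  unfolding LQ_def tie_def using lo_subset[of m Q] hi_subset[of m Q] by auto

lemma lab_cap_tie:
  assumes "X \<subseteq> Q" "Y \<subseteq> Q"
  shows "tie (U \<union> X, L \<union> Y) = tie (X, Y)" "card (U \<union> X) = card U + card X"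
    "X' \<subseteq> Q \<Longrightarrow> Y' \<subseteq> Q \<Longrightarrow> (U \<union> X, L \<union> Y) = (U \<union> X', L \<union> Y') \<longleftrightarrow> (X, Y) = (X', Y')"
proof -
  show "tie (U \<union> X, L \<union> Y) = tie (X, Y)" unfolding tie_def using assms parts by auto
  show "card (U \<union> X) = card U + card X" using assms parts by (intro card_Un_disjoint) (auto intro: finite_subset)
  have 1: "(U \<union> Z) \<inter> Q = Z" "(L \<union> Z) \<inter> Q = Z" if "Z \<subseteq> Q" for Z using that parts(2,4) by blast+
  show "X' \<subseteq> Q \<Longrightarrow> Y' \<subseteq> Q \<Longrightarrow> (U \<union> X, L \<union> Y) = (U \<union> X', L \<union> Y') \<longleftrightarrow> (X, Y) = (X', Y')"
    by (metis 1 assms prod.inject)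
qed

lemma sgn_facts:
  "0 < s1 * fst y \<longleftrightarrow> 0 < fst y" "0 < s3 * fst y \<longleftrightarrow> 0 < fst y" "0 < s2 * snd y \<longleftrightarrow> 0 < snd y" "0 < s4 * snd y \<longleftrightarrow> 0 < snd y"
  "s1 * fst y < 0 \<longleftrightarrow> fst y < 0" "s3 * fst y < 0 \<longleftrightarrow> fst y < 0" "s2 * snd y < 0 \<longleftrightarrow> snd y < 0" "s4 * snd y < 0 \<longleftrightarrow> snd y < 0"
  using s by (auto simp: zero_less_mult_iff mult_less_0_iff)

lemmas mem1 = lo1_four[OF dis, folded Q_def, unfolded One_nat_def] hi1_four[OF dis, folded Q_def, unfolded One_nat_def]
lemmas mem2 = lo2_four[OF dis, folded Q_def] hi2_four[OF dis, folded Q_def]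

lemma in_Q: "a \<in> Q" "b \<in> Q" "c \<in> Q" "d \<in> Q" unfolding Q_def by auto

lemma LQ_eq:
  assumes "X \<subseteq> Q" "Y \<subseteq> Q"
  shows "LQ m \<gamma> y = (X, Y) \<longleftrightarrow>
    ((a \<in> lo m Q (val \<gamma> y) \<longleftrightarrow> a \<in> X) \<and> (b \<in> lo m Q (val \<gamma> y) \<longleftrightarrow> b \<in> X) \<and> (c \<in> lo m Q (val \<gamma> y) \<longleftrightarrow> c \<in> X) \<and> (d \<in> lo m Q (val \<gamma> y) \<longleftrightarrow> d \<in> X)) \<and>
    ((a \<in> hi m Q (val \<gamma> y) \<longleftrightarrow> a \<in> Y) \<and> (b \<in> hi m Q (val \<gamma> y) \<longleftrightarrow> b \<in> Y) \<and> (c \<in> hi m Q (val \<gamma> y) \<longleftrightarrow> c \<in> Y) \<and> (d \<in> hi m Q (val \<gamma> y) \<longleftrightarrow> d \<in> Y))"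
  using eq_sub4[of "lo m Q (val \<gamma> y)" a b c d X] eq_sub4[of "hi m Q (val \<gamma> y)" a b c d Y] assms lo_subset[of m Q] hi_subset[of m Q]
  unfolding LQ_def Q_def by simp

text \<open>Order 1 asks for the largest of four affine functions, as in an ordinary Voronoi
  diagram. For positive \<gamma> the pair \<open>a\<close>, \<open>c\<close> is raised and shares a
  segment of the axis \<open>fst y = 0\<close>; from its ends two rays each go to infinity, and on a
  ray two neighbouring dots are tied. For \<gamma> = 0 the segment shrinks to the origin.\<close>

lemma flip_labels:
  assumes "0 \<le> \<gamma>"
  shows "LQ 1 \<gamma> y = ({a,b}, Q) \<longleftrightarrow> 0 < fst y \<and> s1 * fst y + 2 * \<gamma> = s2 * snd y"
    "LQ 1 \<gamma> y = ({b,c}, Q) \<longleftrightarrow> fst y < 0 \<and> - s3 * fst y + 2 * \<gamma> = s2 * snd y"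
    "LQ 1 \<gamma> y = ({c,d}, Q) \<longleftrightarrow> fst y < 0 \<and> - s3 * fst y + 2 * \<gamma> = - s4 * snd y"
    "LQ 1 \<gamma> y = ({d,a}, Q) \<longleftrightarrow> 0 < fst y \<and> s1 * fst y + 2 * \<gamma> = - s4 * snd y"
  using assms sgn_facts[of y] in_Q
  by (simp_all add: LQ_eq mem1 val_simps distinct_simps) (smt (verit))+

lemma flip_tie:
  assumes "0 \<le> \<gamma>"
  shows "tie (LQ 1 \<gamma> y) \<noteq> {} \<longleftrightarrow>
    fst y = 0 \<and> - 2 * \<gamma> \<le> s4 * snd y \<and> s2 * snd y \<le> 2 * \<gamma> \<or>
    0 \<le> fst y \<and> s1 * fst y + 2 * \<gamma> = s2 * snd y \<or>
    fst y \<le> 0 \<and> - s3 * fst y + 2 * \<gamma> = s2 * snd y \<or>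
    fst y \<le> 0 \<and> - s3 * fst y + 2 * \<gamma> = - s4 * snd y \<or>
    0 \<le> fst y \<and> s1 * fst y + 2 * \<gamma> = - s4 * snd y"
proof -
  have "tie (LQ 1 \<gamma> y) \<noteq> {} \<longleftrightarrow> a \<in> tie (LQ 1 \<gamma> y) \<or> b \<in> tie (LQ 1 \<gamma> y) \<or> c \<in> tie (LQ 1 \<gamma> y) \<or> d \<in> tie (LQ 1 \<gamma> y)"
    using LQ_sub(3)[of 1 \<gamma> y] unfolding Q_def by blast
  then show ?thesis
    using assms sgn_facts[of y] in_Q
    by (simp add: tie_def LQ_def mem1 val_simps distinct_simps) (smt (verit))
qed

lemma card_Q_sub: "X \<subseteq> Q \<Longrightarrow> card X = of_bool (a \<in> X) + of_bool (b \<in> X) + of_bool (c \<in> X) + of_bool (d \<in> X)"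
  using card_sub4[OF dis] unfolding Q_def by blast

lemma card_eq_3: "X \<subseteq> Q \<Longrightarrow> card X = 3 \<longleftrightarrow>
    (a \<notin> X \<and> b \<in> X \<and> c \<in> X \<and> d \<in> X) \<or> (a \<in> X \<and> b \<notin> X \<and> c \<in> X \<and> d \<in> X) \<or>
    (a \<in> X \<and> b \<in> X \<and> c \<notin> X \<and> d \<in> X) \<or> (a \<in> X \<and> b \<in> X \<and> c \<in> X \<and> d \<notin> X)"
  by (subst card_Q_sub) auto

lemma flip_vertex:
  assumes "0 < \<gamma>"
  shows "card (tie (LQ 1 \<gamma> y)) = 3 \<longleftrightarrow> fst y = 0 \<and> (s2 * snd y = 2 * \<gamma> \<or> s4 * snd y = - 2 * \<gamma>)"
    "card (tie (LQ 1 \<gamma> y)) = 3 \<Longrightarrow> card (fst (LQ 1 \<gamma> y)) = 3"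
proof -
  show "card (tie (LQ 1 \<gamma> y)) = 3 \<longleftrightarrow> fst y = 0 \<and> (s2 * snd y = 2 * \<gamma> \<or> s4 * snd y = - 2 * \<gamma>)"
    using assms sgn_facts[of y] in_Q
    by (simp add: card_eq_3[OF LQ_sub(3)]) (simp add: tie_def LQ_def mem1 val_simps distinct_simps, smt (verit))
  show "card (fst (LQ 1 \<gamma> y)) = 3" if "card (tie (LQ 1 \<gamma> y)) = 3"
    using that assms sgn_facts[of y] in_Q
    unfolding card_eq_3[OF LQ_sub(3)] card_eq_3[OF LQ_sub(1)]
    by (simp add: tie_def LQ_def mem1 val_simps distinct_simps) (smt (verit))
qed

text \<open>Order 2 asks for the two largest values. Around the origin there is a quadrilateral on
  whose sides two neighbouring dots are tied; from each corner a half-axis goes to infinity, on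
  which two opposite dots are tied.\<close>

lemma square_labels:
  assumes "0 \<le> \<gamma>"
  shows "LQ 2 \<gamma> y = ({a,b,d}, {b,c,d}) \<longleftrightarrow> snd y = 0 \<and> 2 * \<gamma> < s3 * fst y"
    "LQ 2 \<gamma> y = ({a,b,c}, {a,c,d}) \<longleftrightarrow> fst y = 0 \<and> 2 * \<gamma> < s2 * snd y"
    "LQ 2 \<gamma> y = ({b,c,d}, {a,b,d}) \<longleftrightarrow> snd y = 0 \<and> 2 * \<gamma> < - s1 * fst y"
    "LQ 2 \<gamma> y = ({a,c,d}, {a,b,c}) \<longleftrightarrow> fst y = 0 \<and> 2 * \<gamma> < - s4 * snd y"
  using assms sgn_facts[of y] in_Q
  by (simp_all add: LQ_eq mem2 val_simps distinct_simps) (smt (verit))+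

lemma square_tie:
  assumes "0 \<le> \<gamma>"
  shows "tie (LQ 2 \<gamma> y) \<noteq> {} \<longleftrightarrow>
    0 \<le> fst y \<and> 0 \<le> snd y \<and> s3 * fst y + s2 * snd y = 2 * \<gamma> \<or>
    fst y \<le> 0 \<and> 0 \<le> snd y \<and> - s1 * fst y + s2 * snd y = 2 * \<gamma> \<or>
    fst y \<le> 0 \<and> snd y \<le> 0 \<and> - s1 * fst y - s4 * snd y = 2 * \<gamma> \<or>
    0 \<le> fst y \<and> snd y \<le> 0 \<and> s3 * fst y - s4 * snd y = 2 * \<gamma> \<or>
    snd y = 0 \<and> 2 * \<gamma> \<le> s3 * fst y \<or> fst y = 0 \<and> 2 * \<gamma> \<le> s2 * snd y \<or>
    snd y = 0 \<and> 2 * \<gamma> \<le> - s1 * fst y \<or> fst y = 0 \<and> 2 * \<gamma> \<le> - s4 * snd y"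
proof -
  have "tie (LQ 2 \<gamma> y) \<noteq> {} \<longleftrightarrow> a \<in> tie (LQ 2 \<gamma> y) \<or> b \<in> tie (LQ 2 \<gamma> y) \<or> c \<in> tie (LQ 2 \<gamma> y) \<or> d \<in> tie (LQ 2 \<gamma> y)"
    using LQ_sub(3)[of 2 \<gamma> y] unfolding Q_def by blast
  then show ?thesis
    using assms sgn_facts[of y] in_Q
    by (simp add: tie_def LQ_def mem2 val_simps distinct_simps) (smt (verit))
qed

text \<open>The color of a corner is determined by the axis on which it lies, so colors alternate
  around the quadrilateral.\<close>

lemma square_vertex:
  assumes "0 < \<gamma>"
  shows "card (tie (LQ 2 \<gamma> y)) = 3 \<and> card (fst (LQ 2 \<gamma> y)) = 3 \<longleftrightarrow> fst y = 0 \<and> (s2 * snd y = 2 * \<gamma> \<or> s4 * snd y = - 2 * \<gamma>)"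
    "card (tie (LQ 2 \<gamma> y)) = 3 \<and> card (fst (LQ 2 \<gamma> y)) = 4 \<longleftrightarrow> snd y = 0 \<and> (s3 * fst y = 2 * \<gamma> \<or> s1 * fst y = - 2 * \<gamma>)"
proof -
  show "card (tie (LQ 2 \<gamma> y)) = 3 \<and> card (fst (LQ 2 \<gamma> y)) = 3 \<longleftrightarrow> fst y = 0 \<and> (s2 * snd y = 2 * \<gamma> \<or> s4 * snd y = - 2 * \<gamma>)"
    using assms sgn_facts[of y] in_Q
    unfolding card_eq_3[OF LQ_sub(3)] card_eq_3[OF LQ_sub(1)]
    by (simp add: tie_def LQ_def mem2 val_simps distinct_simps) (smt (verit))
  have *: "card X = 4 \<longleftrightarrow> a \<in> X \<and> b \<in> X \<and> c \<in> X \<and> d \<in> X" if "X \<subseteq> Q" for X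
    by (subst card_Q_sub[OF that]) auto
  show "card (tie (LQ 2 \<gamma> y)) = 3 \<and> card (fst (LQ 2 \<gamma> y)) = 4 \<longleftrightarrow> snd y = 0 \<and> (s3 * fst y = 2 * \<gamma> \<or> s1 * fst y = - 2 * \<gamma>)"
    using assms sgn_facts[of y] in_Q
    unfolding card_eq_3[OF LQ_sub(3)] *[OF LQ_sub(1)]
    by (simp add: tie_def LQ_def mem2 val_simps distinct_simps) (smt (verit))
qed

text \<open>The cyclic relabeling turns the frame by a quarter and exchanges the raised pair with
  the lowered one. Everything proved for positive \<gamma> thereby covers the other side of the wall
  as well.\<close>

lemma rotated: "cap_frame z w (- u) ws (- us) I x0 cc b c d a s2 s3 s4 s1"
proof (unfold_locales)
  show "p = (p \<bullet> z) *\<^sub>R z + (p \<bullet> w) *\<^sub>R ws + (p \<bullet> - u) *\<^sub>R - us" for p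
    using expand[of p] by (simp add: add.commute add.left_commute add.assoc)
  show "z \<bullet> x0 i \<noteq> z \<bullet> cc" if "i \<in> I - {b,c,d,a}" for i using off[of i] that by auto
qed (use z1 zu zw zus zws dual finI dis inI s x0 in \<open>auto simp: inner_commute\<close>)

end

lemma pert_rotate:
  assumes "distinct [a,b,c,d]"
  shows "pert x0 z b c d a \<gamma> = pert x0 z a b c d (- \<gamma>)"
  using assms by (auto simp: pert_def fun_eq_iff)

section \<open>The picture of a cap seen through a homeomorphism\<close>

context cap_plane
begin

text \<open>Arcs are drawn as straight segments in the tangent plane. Since \<open>pl\<close>
  followed by \<open>g\<close> is injective, their intersections can be computed there.\<close>

lemma drawn_segments:
  assumes homeo: "homeomorphism S2 S2 h g"
    and len: "length As = n" "length Bs = n" and ne: "\<And>i. i < n \<Longrightarrow> As ! i \<noteq> Bs ! i"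
    and X: "X \<inter> (left_side z h1 \<union> rim z h1) = (\<Union>i<n. (\<lambda>y. g (pl y)) ` closed_segment (As ! i) (Bs ! i))"
    and disj: "\<And>i j y. i < j \<Longrightarrow> j < n \<Longrightarrow> y \<in> closed_segment (As ! i) (Bs ! i) \<Longrightarrow> y \<in> closed_segment (As ! j) (Bs ! j) \<Longrightarrow>
      (y = As ! i \<or> y = Bs ! i) \<and> (y = As ! j \<or> y = Bs ! j)"
    and es: "es = map (\<lambda>i. (g (pl (As ! i)), g (pl (Bs ! i)))) [0..<n]"
  shows "drawn_inside z h1 X es"
proof -
  have ginj: "g (pl y) = g (pl \<theta>) \<longleftrightarrow> y = \<theta>" for y \<theta>
    using homeo pl_S2 inj_pl by (metis homeomorphism_apply2)
  have cg: "continuous_on S2 g" using homeo by (auto simp: homeomorphism_def)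
  define \<gamma> where "\<gamma> = (\<lambda>i t. g (pl (linepath (As ! i) (Bs ! i) t)))"
  have c: "continuous_on S (\<gamma> i)" for S i unfolding \<gamma>_def
    by (intro continuous_on_compose2[OF cg] continuous_on_compose2[OF cont_pl[of UNIV]] continuous_on_linepath) (auto simp: pl_S2[simplified])
  have img: "path_image (\<gamma> i) = (\<lambda>y. g (pl y)) ` closed_segment (As ! i) (Bs ! i)" for i
    unfolding path_image_def \<gamma>_def linepath_image_01[symmetric] by (simp add: image_image)
  have arc: "arc (\<gamma> i)" if "i < n" for i
    unfolding arc_def path_def
  proof (intro conjI c inj_onI)
    fix x y assume xy: "x \<in> {0..1}" "y \<in> {0..1}" "\<gamma> i x = \<gamma> i y"
    then have "linepath (As ! i) (Bs ! i) x = linepath (As ! i) (Bs ! i) y" unfolding \<gamma>_def ginj by simp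
    then show "x = y" using inj_on_linepath[OF ne[OF that]] xy by (auto dest: inj_onD)
  qed
  have ends: "pathstart (\<gamma> i) = g (pl (As ! i))" "pathfinish (\<gamma> i) = g (pl (Bs ! i))" for i
    unfolding pathstart_def pathfinish_def \<gamma>_def by (simp_all add: linepath_0' linepath_1')
  have d: "path_image (\<gamma> i) \<inter> path_image (\<gamma> j) \<subseteq> {pathstart (\<gamma> i), pathfinish (\<gamma> i)} \<inter> {pathstart (\<gamma> j), pathfinish (\<gamma> j)}"
    if ij: "i < j" "j < n" for i j
  proof
    fix p assume "p \<in> path_image (\<gamma> i) \<inter> path_image (\<gamma> j)"
    then obtain y where y: "y \<in> closed_segment (As ! i) (Bs ! i)" "y \<in> closed_segment (As ! j) (Bs ! j)" "p = g (pl y)"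
      unfolding img using ginj by auto
    from disj[OF ij y(1,2)] show "p \<in> {pathstart (\<gamma> i), pathfinish (\<gamma> i)} \<inter> {pathstart (\<gamma> j), pathfinish (\<gamma> j)}"
      unfolding ends y(3) by auto
  qed
  have les: "length es = n" unfolding es by simp
  show ?thesis unfolding drawn_inside_def les
  proof (intro exI[of _ \<gamma>] conjI allI impI)
    show "X \<inter> (left_side z h1 \<union> rim z h1) = (\<Union>i<n. path_image (\<gamma> i))" unfolding X img ..
    show "arc (\<gamma> i)" "(pathstart (\<gamma> i), pathfinish (\<gamma> i)) = es ! i" if "i < n" for i
      using arc[OF that] that unfolding ends es by auto
    show "path_image (\<gamma> i) \<inter> path_image (\<gamma> j) \<subseteq> {pathstart (\<gamma> i), pathfinish (\<gamma> i)} \<inter> {pathstart (\<gamma> j), pathfinish (\<gamma> j)}"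
      if "i < n" "j < n" "i \<noteq> j" for i j
      using d[of i j] d[of j i] that by (cases "i < j") auto
  qed
qed

end

text \<open>In the zone the labeling is that of the perturbed dots seen through \<open>h\<close>,
  but on the rim it is exactly that of the unperturbed ones. The rim condition makes the pictures on
  both sides of the wall cross the circle in the same four points.\<close>

locale cap_view = cap_frame z u w us ws I x0 cc a b c d s1 s2 s3 s4
  for z u w us ws and I :: "'i set" and x0 cc a b c d s1 s2 s3 s4 +
  fixes k :: nat and \<gamma> \<epsilon> h1 h2 :: real and h g :: "point \<Rightarrow> point" and \<Lambda> :: "point \<Rightarrow> 'i labels"
  assumes \<gamma>: "0 < \<gamma>" and homeo: "homeomorphism S2 S2 h g" and near: "\<And>p. p \<in> S2 \<Longrightarrow> norm (h p - p) \<le> \<epsilon>"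
    and hs: "0 < h2" "h2 + \<epsilon> < h1" "h1 < 1"
    and zone: "\<And>p. p \<in> S2 \<Longrightarrow> h2 - \<epsilon> \<le> z \<bullet> p \<Longrightarrow> \<Lambda> p = lab k I (pe \<gamma>) (h p)"
    and onrim: "\<And>p. p \<in> S2 \<Longrightarrow> z \<bullet> p = h1 \<Longrightarrow> \<Lambda> p = lab k I x0 p"
    and sepx: "sep (pe \<gamma>) h2" and sep0: "sep x0 h2"
    and small: "\<And>y. y \<in> corners \<gamma> \<Longrightarrow> h1 + \<epsilon> < z \<bullet> pl y"
    and pr: "proper k I \<Lambda>"
begin

lemma eps0: "0 \<le> \<epsilon>" using near[OF pl_S2[of 0]] norm_ge_zero order_trans by blast

lemma hs': "0 < h1" "h2 < 1" "h2 < h1" using hs eps0 by auto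

lemma pe0: "pe 0 = x0" by (auto simp: pert_def fun_eq_iff)

lemma gS: "q \<in> S2 \<Longrightarrow> g q \<in> S2" "q \<in> S2 \<Longrightarrow> h (g q) = q" "p \<in> S2 \<Longrightarrow> h p \<in> S2" "p \<in> S2 \<Longrightarrow> g (h p) = p"
  using homeo by (auto simp: homeomorphism_def)

lemma gnear: "q \<in> S2 \<Longrightarrow> \<bar>z \<bullet> g q - z \<bullet> q\<bar> \<le> \<epsilon>"
  using inner_dist[OF z1, of "g q" q] near[OF gS(1), of q] gS(2)[of q] by (simp add: dist_norm norm_minus_commute)

lemma view:
  assumes "p \<in> S2" "h1 \<le> z \<bullet> p"
  obtains y where "nu y \<le> rad h2" "p = g (pl y)"
proof -
  have 1: "h2 \<le> z \<bullet> h p" using gnear[OF gS(3)[OF assms(1)], unfolded gS(4)[OF assms(1)]] assms(2) hs by linarith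
  then have "pl (co (h p)) = h p" using pl_co[OF gS(3)[OF assms(1)]] hs by simp
  then show ?thesis using that[of "co (h p)"] 1 height_iff(1)[OF hs(1) hs'(2), of "co (h p)"] gS(4)[OF assms(1)] by simp
qed

lemma lab_view:
  assumes "nu y \<le> rad h2" "card U \<le> k" "k \<le> card U + 4"
  shows "\<Lambda> (g (pl y)) = cap_lab k \<gamma> y"
    "lab k I (pe \<gamma>) (pl y) = cap_lab k \<gamma> y"
    "lab k I x0 (pl y) = cap_lab k 0 y"
proof -
  have h: "h2 \<le> z \<bullet> pl y" using assms(1) height_iff(1)[OF hs(1) hs'(2)] by blast
  show A: "lab k I (pe \<gamma>) (pl y) = cap_lab k \<gamma> y"
    by (rule lab_cap[OF sepx h assms(2,3)])
  show "lab k I x0 (pl y) = cap_lab k 0 y"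
    using lab_cap[of 0 h2 y k] sep0 h assms(2,3) unfolding pe0 by blast
  have "h2 - \<epsilon> \<le> z \<bullet> g (pl y)" using gnear[OF pl_S2, of y] h by linarith
  then show "\<Lambda> (g (pl y)) = cap_lab k \<gamma> y"
    using zone[OF gS(1)[OF pl_S2]] gS(2)[OF pl_S2] A by simp
qed

lemma spoke_view:
  assumes k: "card U \<le> k" "k \<le> card U + 4" and XY: "X \<subseteq> Q" "Y \<subseteq> Q" "card (X \<inter> Y) = 2"
    and V: "V \<in> corners \<gamma>" and d: "d' \<noteq> 0"
    and ray: "\<And>y. LQ (k - card U) \<gamma> y = (X, Y) \<longleftrightarrow> (\<exists>\<tau>>0. y = V + \<tau> *\<^sub>R d')"
      "\<And>y. LQ (k - card U) 0 y = (X, Y) \<longleftrightarrow> (\<exists>\<tau>>0. y = \<tau> *\<^sub>R d')"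
  shows "\<exists>\<alpha> s \<tau>1. spoke \<Lambda> z h1 \<alpha> s (U \<union> X, L \<union> Y) \<and> \<alpha> s = rimpt h1 d' \<and> 0 < \<tau>1 \<and> g (pl (V + \<tau>1 *\<^sub>R d')) = rimpt h1 d' \<and>
    {y. nu y \<le> rad h2 \<and> (\<exists>\<tau>\<ge>0. y = V + \<tau> *\<^sub>R d') \<and> h1 \<le> z \<bullet> g (pl y)} = closed_segment V (V + \<tau>1 *\<^sub>R d')"
proof (rule spoke_from_ray[OF homeo near hs, where V = V and d = d' and l = "(U \<union> X, L \<union> Y)" and \<Lambda> = \<Lambda> and ?L0.0 = "lab k I x0" and LX = "lab k I (pe \<gamma>)"])
  show "\<Lambda> p = lab k I (pe \<gamma>) (h p)" if "p \<in> S2" "h2 - \<epsilon> \<le> z \<bullet> p" for p by (rule zone[OF that])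
  show "\<Lambda> p = lab k I x0 p" if "p \<in> S2" "z \<bullet> p = h1" for p by (rule onrim[OF that])
  show "h1 + \<epsilon> < z \<bullet> pl V" by (rule small[OF V])
  show "d' \<noteq> 0" by (rule d)
  show "(lab k I (pe \<gamma>) (pl y) = (U \<union> X, L \<union> Y)) = (\<exists>\<tau>>0. y = V + \<tau> *\<^sub>R d')" if "nu y \<le> rad h2" for y
    unfolding lab_view(2)[OF that k] ray(1)[symmetric] lab_cap_tie(3)[OF LQ_sub(1,2) XY(1,2)] by simp
  show "(lab k I x0 (pl y) = (U \<union> X, L \<union> Y)) = (\<exists>\<tau>>0. y = \<tau> *\<^sub>R d')" if "nu y \<le> rad h2" for y
    unfolding lab_view(3)[OF that k] ray(2)[symmetric] lab_cap_tie(3)[OF LQ_sub(1,2) XY(1,2)] by simp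
  show "card (tie (U \<union> X, L \<union> Y)) = 2" unfolding lab_cap_tie(1)[OF XY(1,2)] using XY(3) by (simp add: tie_def)
  fix e s \<tau>1
  assume A: "spoke \<Lambda> z h1 (\<lambda>t. g (pl (linepath V e t))) s (U \<union> X, L \<union> Y)" "g (pl (linepath V e s)) = rimpt h1 d'" "0 < \<tau>1"
    "linepath V e s = V + \<tau>1 *\<^sub>R d'"
    "{y. nu y \<le> rad h2 \<and> (\<exists>\<tau>\<ge>0. y = V + \<tau> *\<^sub>R d') \<and> h1 \<le> z \<bullet> g (pl y)} = closed_segment V (V + \<tau>1 *\<^sub>R d')"
  show ?thesis
    by (intro exI[of _ "\<lambda>t. g (pl (linepath V e t))"] exI[of _ s] exI[of _ \<tau>1] conjI A(1,2,3,5) A(2)[unfolded A(4)])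
qed

lemma cap_image:
  assumes k: "card U \<le> k" "k \<le> card U + 4"
  shows "{p \<in> S2. P (\<Lambda> p) \<and> h1 \<le> z \<bullet> p} =
    (\<lambda>y. g (pl y)) ` {y. nu y \<le> rad h2 \<and> P (cap_lab k \<gamma> y) \<and> h1 \<le> z \<bullet> g (pl y)}"
proof (intro set_eqI iffI)
  fix p assume "p \<in> {p \<in> S2. P (\<Lambda> p) \<and> h1 \<le> z \<bullet> p}"
  then have p: "p \<in> S2" "P (\<Lambda> p)" "h1 \<le> z \<bullet> p" by auto
  then obtain y where "nu y \<le> rad h2" "p = g (pl y)" using view by blast
  then show "p \<in> (\<lambda>y. g (pl y)) ` {y. nu y \<le> rad h2 \<and> P (cap_lab k \<gamma> y) \<and> h1 \<le> z \<bullet> g (pl y)}"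
    using p lab_view(1)[OF _ k] by auto
next
  fix p assume "p \<in> (\<lambda>y. g (pl y)) ` {y. nu y \<le> rad h2 \<and> P (cap_lab k \<gamma> y) \<and> h1 \<le> z \<bullet> g (pl y)}"
  then obtain y where "nu y \<le> rad h2" "P (cap_lab k \<gamma> y)" "h1 \<le> z \<bullet> g (pl y)" "p = g (pl y)" by blast
  then show "p \<in> {p \<in> S2. P (\<Lambda> p) \<and> h1 \<le> z \<bullet> p}"
    using lab_view(1)[of y, OF _ k] gS(1)[OF pl_S2] by auto
qed

lemma g_inj: "g (pl y) = g (pl \<theta>) \<longleftrightarrow> y = \<theta>"
  using gS(2)[OF pl_S2] inj_pl by metis

text \<open>Corners lie above height \<open>h1 + \<epsilon>\<close>, which is a convex condition in
  the tangent plane, so the segments between them do so too, and \<open>g\<close> lowers them by at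
  most \<epsilon>. Taking \<open>V = W\<close> gives the corners themselves.\<close>

lemma vertex_inside:
  assumes "V \<in> corners \<gamma>"
    and "W \<in> corners \<gamma>" and y: "y \<in> closed_segment V W"
  shows "nu y \<le> rad h2" "h1 < z \<bullet> g (pl y)"
proof -
  have rV: "nu V < rad h1'" "nu W < rad h1'" if "h1' = h1 + \<epsilon>" "h1' < 1" for h1'
    using small[OF assms(1)] small[OF assms(2)] that height_iff(2)[of h1'] hs'(1) eps0 by auto
  have "z \<bullet> pl V \<le> 1" using Cauchy_Schwarz_ineq2[of z "pl V"] z1 pl_S2[of V] by auto
  then have h1': "h1 + \<epsilon> < 1" "0 < h1 + \<epsilon>" using small[OF assms(1)] hs'(1) eps0 by auto
  obtain t where t: "0 \<le> t" "t \<le> 1" "y = (1 - t) *\<^sub>R V + t *\<^sub>R W" using y by (auto simp: closed_segment_def)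
  have "nu y \<le> (1 - t) * nu V + t * nu W"
    unfolding t(3) tv_linear using t norm_triangle_ineq[of "(1 - t) *\<^sub>R tv V" "t *\<^sub>R tv W"] by simp
  also have "\<dots> < rad (h1 + \<epsilon>)"
  proof (cases "t = 0")
    case True then show ?thesis using rV[OF refl h1'(1)] by simp
  next
    case False
    have "(1 - t) * nu V + t * nu W < (1 - t) * rad (h1 + \<epsilon>) + t * rad (h1 + \<epsilon>)"
      using t False rV[OF refl h1'(1)] by (intro add_le_less_mono mult_left_mono mult_strict_left_mono) auto
    then show ?thesis by (simp add: algebra_simps)
  qed
  finally have "h1 + \<epsilon> < z \<bullet> pl y" using height_iff(2)[OF h1'(2,1)] by blast
  then show "h1 < z \<bullet> g (pl y)" "nu y \<le> rad h2"
    using gnear[OF pl_S2, of y] height_iff(1)[OF hs(1) hs'(2), of y] hs'(3) eps0 by auto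
qed

lemma vertices_view:
  assumes k: "card U \<le> k" "k \<le> card U + 4"
    and V: "{y. card (tie (LQ (k - card U) \<gamma> y)) = 3 \<and> card U + card (fst (LQ (k - card U) \<gamma> y)) = m} = W"
      "W \<subseteq> corners \<gamma>"
  shows "{p \<in> S2. card (tie (\<Lambda> p)) = 3 \<and> card (fst (\<Lambda> p)) = m} \<inter> left_side z h1 = (\<lambda>y. g (pl y)) ` W"
proof -
  have "{p \<in> S2. card (tie (\<Lambda> p)) = 3 \<and> card (fst (\<Lambda> p)) = m} \<inter> left_side z h1 =
    {p \<in> {p \<in> S2. (card (tie (\<Lambda> p)) = 3 \<and> card (fst (\<Lambda> p)) = m) \<and> h1 \<le> z \<bullet> p}. h1 < z \<bullet> p}"
    by (auto simp: left_side_def)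
  also have "\<dots> = {p \<in> (\<lambda>y. g (pl y)) ` {y. nu y \<le> rad h2 \<and> (card (tie (LQ (k - card U) \<gamma> y)) = 3 \<and> card U + card (fst (LQ (k - card U) \<gamma> y)) = m) \<and> h1 \<le> z \<bullet> g (pl y)}. h1 < z \<bullet> p}"
    unfolding cap_image[OF k, of "\<lambda>l. card (tie l) = 3 \<and> card (fst l) = m"]
    by (simp add: lab_cap_tie[OF LQ_sub(1,2)] cong: conj_cong)
  also have "\<dots> = (\<lambda>y. g (pl y)) ` W"
  proof (intro set_eqI iffI)
    fix p assume "p \<in> (\<lambda>y. g (pl y)) ` W"
    then obtain y where y: "y \<in> W" "p = g (pl y)" by blast
    then have v: "y \<in> corners \<gamma>" using V(2) by blast
    have "nu y \<le> rad h2" "h1 < z \<bullet> g (pl y)" using vertex_inside[OF v v, of y] by auto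
    moreover have "card (tie (LQ (k - card U) \<gamma> y)) = 3 \<and> card U + card (fst (LQ (k - card U) \<gamma> y)) = m" using V(1) y(1) by blast
    ultimately show "p \<in> {p \<in> (\<lambda>y. g (pl y)) ` {y. nu y \<le> rad h2 \<and> (card (tie (LQ (k - card U) \<gamma> y)) = 3 \<and> card U + card (fst (LQ (k - card U) \<gamma> y)) = m) \<and> h1 \<le> z \<bullet> g (pl y)}. h1 < z \<bullet> p}"
      using y(2) by auto
  next
    fix p assume "p \<in> {p \<in> (\<lambda>y. g (pl y)) ` {y. nu y \<le> rad h2 \<and> (card (tie (LQ (k - card U) \<gamma> y)) = 3 \<and> card U + card (fst (LQ (k - card U) \<gamma> y)) = m) \<and> h1 \<le> z \<bullet> g (pl y)}. h1 < z \<bullet> p}"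
    then show "p \<in> (\<lambda>y. g (pl y)) ` W" using V(1) by blast
  qed
  finally show ?thesis .
qed

lemma skel_view:
  assumes k: "card U \<le> k" "k \<le> card U + 4"
  shows "skel (gr k \<Lambda>) \<inter> (left_side z h1 \<union> rim z h1) =
    (\<lambda>y. g (pl y)) ` {y. nu y \<le> rad h2 \<and> tie (LQ (k - card U) \<gamma> y) \<noteq> {} \<and> h1 \<le> z \<bullet> g (pl y)}"
proof -
  have "skel (gr k \<Lambda>) \<inter> (left_side z h1 \<union> rim z h1) = {p \<in> S2. tie (\<Lambda> p) \<noteq> {} \<and> h1 \<le> z \<bullet> p}"
    unfolding gr_simps by (auto simp: left_side_def rim_def)
  also have "\<dots> = (\<lambda>y. g (pl y)) ` {y. nu y \<le> rad h2 \<and> tie (LQ (k - card U) \<gamma> y) \<noteq> {} \<and> h1 \<le> z \<bullet> g (pl y)}"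
    unfolding cap_image[OF k, of "\<lambda>l. tie l \<noteq> {}"] by (simp add: lab_cap_tie[OF LQ_sub(1,2)])
  finally show ?thesis .
qed

text \<open>On the rim the skeleton is that of the unperturbed dots, where it consists of rays from
  the origin, and each ray meets the rim once.\<close>

lemma skel_rim:
  assumes k: "card U \<le> k" "k \<le> card U + 4" and D: "0 \<notin> D"
    and rays: "\<And>y. y \<noteq> 0 \<Longrightarrow> tie (LQ (k - card U) 0 y) \<noteq> {} \<longleftrightarrow> (\<exists>d'\<in>D. \<exists>\<tau>>0. y = \<tau> *\<^sub>R d')"
  shows "skel (gr k \<Lambda>) \<inter> rim z h1 = rimpt h1 ` D"
proof (intro set_eqI iffI)
  fix p assume "p \<in> skel (gr k \<Lambda>) \<inter> rim z h1"
  then have p: "p \<in> S2" "z \<bullet> p = h1" "tie (\<Lambda> p) \<noteq> {}" unfolding gr_simps rim_def by auto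
  have pc: "pl (co p) = p" using pl_co[OF p(1)] p(2) hs'(1) by simp
  have n1: "nu (co p) = rad h1" using height_iff(3)[OF hs'(1) hs(3), of "co p"] pc p(2) by simp
  have n2: "nu (co p) \<le> rad h2" using height_iff(1)[OF hs(1) hs'(2), of "co p"] pc p(2) hs'(3) by simp
  have "co p \<noteq> 0" using n1 height_iff(4)[OF hs'(1) hs(3)] by (auto simp: tv_0)
  moreover have "tie (LQ (k - card U) 0 (co p)) \<noteq> {}"
    using p(3) onrim[OF p(1,2)] lab_view(3)[OF n2 k] lab_cap_tie(1)[OF LQ_sub(1,2)] pc by simp
  ultimately obtain d' \<tau> where d: "d' \<in> D" "\<tau> > 0" "co p = \<tau> *\<^sub>R d'" using rays by blast
  then have "d' \<noteq> 0" using D by auto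
  then show "p \<in> rimpt h1 ` D" using rimpt_unique[OF hs'(1) hs(3) _ d(2)] n1 pc d by (metis imageI)
next
  fix p assume "p \<in> rimpt h1 ` D"
  then obtain d' where d: "d' \<in> D" "p = rimpt h1 d'" by blast
  then have d0: "d' \<noteq> 0" using D by auto
  note rp = rimpt_rim[OF hs'(1) hs(3) d0]
  let ?t = "rad h1 / nu d'"
  have t: "?t > 0" using nu_pos[OF d0] height_iff(4)[OF hs'(1) hs(3)] by simp
  have "z \<bullet> pl (?t *\<^sub>R d') = h1" using rp(3) unfolding rimpt_def .
  then have n2: "nu (?t *\<^sub>R d') \<le> rad h2" using height_iff(1)[OF hs(1) hs'(2), of "?t *\<^sub>R d'"] hs'(3) by linarith
  have "?t *\<^sub>R d' \<noteq> 0" using nu_pos[OF d0] height_iff(4)[OF hs'(1) hs(3)] d0 by simp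
  then have "tie (LQ (k - card U) 0 (?t *\<^sub>R d')) \<noteq> {}" using rays[of "?t *\<^sub>R d'"] d(1) t by blast
  then have "tie (lab k I x0 p) \<noteq> {}" using lab_view(3)[OF n2 k] lab_cap_tie(1)[OF LQ_sub(1,2)] d(2) unfolding rimpt_def by simp
  then show "p \<in> skel (gr k \<Lambda>) \<inter> rim z h1" using onrim[OF rp(4) rp(3)] rp(1,4) d(2) unfolding gr_simps by simp
qed

end

section \<open>Rays and segments in the tangent plane\<close>

lemma ray_iff:
  fixes y :: "real \<times> real"
  assumes "0 < dx"
  shows "(\<exists>\<tau>>0. y = (0, v) + \<tau> *\<^sub>R (dx, dy)) \<longleftrightarrow> 0 < fst y \<and> dy * fst y + dx * v = dx * snd y"
    "(\<exists>\<tau>\<ge>0. y = (0, v) + \<tau> *\<^sub>R (dx, dy)) \<longleftrightarrow> 0 \<le> fst y \<and> dy * fst y + dx * v = dx * snd y"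
    "(\<exists>\<tau>>0. y = (0, v) + \<tau> *\<^sub>R (- dx, dy)) \<longleftrightarrow> fst y < 0 \<and> - dy * fst y + dx * v = dx * snd y"
    "(\<exists>\<tau>\<ge>0. y = (0, v) + \<tau> *\<^sub>R (- dx, dy)) \<longleftrightarrow> fst y \<le> 0 \<and> - dy * fst y + dx * v = dx * snd y"
proof -
  \<comment> \<open>The sign \<open>e\<close>, a square root of 1, treats the rays to the right and
    to the left at once.\<close>
  have 0: "y = (0, v) + \<tau> *\<^sub>R (e * dx, dy) \<longleftrightarrow> \<tau> = e * fst y / dx \<and> e * dy * fst y + dx * v = dx * snd y"
    if e: "e * e = 1" for \<tau> e
  proof
    assume "y = (0, v) + \<tau> *\<^sub>R (e * dx, dy)"
    then have h: "fst y = \<tau> * (e * dx)" "snd y = v + \<tau> * dy" by auto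
    have "e * fst y = (e * e) * \<tau> * dx" unfolding h by (simp add: algebra_simps)
    then have ef: "e * fst y = \<tau> * dx" using e by simp
    have "e * dy * fst y = dy * (e * fst y)" by simp
    then show "\<tau> = e * fst y / dx \<and> e * dy * fst y + dx * v = dx * snd y"
      unfolding ef using h(2) assms by (simp add: algebra_simps)
  next
    assume h: "\<tau> = e * fst y / dx \<and> e * dy * fst y + dx * v = dx * snd y"
    then have 1: "\<tau> * dx = e * fst y" using assms by simp
    have "\<tau> * (e * dx) = e * (\<tau> * dx)" by simp
    also have "\<dots> = (e * e) * fst y" unfolding 1 by simp
    finally have f: "\<tau> * (e * dx) = fst y" using e by simp
    have "dx * (v + \<tau> * dy) = dx * v + dy * (\<tau> * dx)" by (simp add: algebra_simps)
    also have "\<dots> = dx * snd y" unfolding 1 using h by (simp add: algebra_simps)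
    finally have "v + \<tau> * dy = snd y" using assms by simp
    then show "y = (0, v) + \<tau> *\<^sub>R (e * dx, dy)" using f by (simp add: prod_eq_iff)
  qed
  have 1: "y = (0, v) + \<tau> *\<^sub>R (dx, dy) \<longleftrightarrow> \<tau> = fst y / dx \<and> dy * fst y + dx * v = dx * snd y" for \<tau>
    using 0[of 1 \<tau>] by simp
  have 2: "y = (0, v) + \<tau> *\<^sub>R (- dx, dy) \<longleftrightarrow> \<tau> = - fst y / dx \<and> - dy * fst y + dx * v = dx * snd y" for \<tau>
    using 0[of "-1" \<tau>] by simp
  show "(\<exists>\<tau>>0. y = (0, v) + \<tau> *\<^sub>R (dx, dy)) \<longleftrightarrow> 0 < fst y \<and> dy * fst y + dx * v = dx * snd y"
    "(\<exists>\<tau>\<ge>0. y = (0, v) + \<tau> *\<^sub>R (dx, dy)) \<longleftrightarrow> 0 \<le> fst y \<and> dy * fst y + dx * v = dx * snd y"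
    unfolding 1 using assms by (auto simp: zero_less_divide_iff zero_le_divide_iff)
  show "(\<exists>\<tau>>0. y = (0, v) + \<tau> *\<^sub>R (- dx, dy)) \<longleftrightarrow> fst y < 0 \<and> - dy * fst y + dx * v = dx * snd y"
    "(\<exists>\<tau>\<ge>0. y = (0, v) + \<tau> *\<^sub>R (- dx, dy)) \<longleftrightarrow> fst y \<le> 0 \<and> - dy * fst y + dx * v = dx * snd y"
    unfolding 2 using assms by (auto simp: divide_less_0_iff divide_le_0_iff)
qed

lemma axis_ray_iff:
  fixes y :: "real \<times> real"
  shows "(\<exists>\<tau>>0. y = (v, 0) + \<tau> *\<^sub>R (1, 0)) \<longleftrightarrow> snd y = 0 \<and> v < fst y"
    "(\<exists>\<tau>\<ge>0. y = (v, 0) + \<tau> *\<^sub>R (1, 0)) \<longleftrightarrow> snd y = 0 \<and> v \<le> fst y"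
    "(\<exists>\<tau>>0. y = (v, 0) + \<tau> *\<^sub>R (-1, 0)) \<longleftrightarrow> snd y = 0 \<and> fst y < v"
    "(\<exists>\<tau>\<ge>0. y = (v, 0) + \<tau> *\<^sub>R (-1, 0)) \<longleftrightarrow> snd y = 0 \<and> fst y \<le> v"
    "(\<exists>\<tau>>0. y = (0, v) + \<tau> *\<^sub>R (0, 1)) \<longleftrightarrow> fst y = 0 \<and> v < snd y"
    "(\<exists>\<tau>\<ge>0. y = (0, v) + \<tau> *\<^sub>R (0, 1)) \<longleftrightarrow> fst y = 0 \<and> v \<le> snd y"
    "(\<exists>\<tau>>0. y = (0, v) + \<tau> *\<^sub>R (0, -1)) \<longleftrightarrow> fst y = 0 \<and> snd y < v"
    "(\<exists>\<tau>\<ge>0. y = (0, v) + \<tau> *\<^sub>R (0, -1)) \<longleftrightarrow> fst y = 0 \<and> snd y \<le> v"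
proof -
  have e: "y = (v, 0) + \<tau> *\<^sub>R (1, 0) \<longleftrightarrow> \<tau> = fst y - v \<and> snd y = 0" "y = (v, 0) + \<tau> *\<^sub>R (-1, 0) \<longleftrightarrow> \<tau> = v - fst y \<and> snd y = 0"
    "y = (0, v) + \<tau> *\<^sub>R (0, 1) \<longleftrightarrow> \<tau> = snd y - v \<and> fst y = 0" "y = (0, v) + \<tau> *\<^sub>R (0, -1) \<longleftrightarrow> \<tau> = v - snd y \<and> fst y = 0" for \<tau>
    by (auto simp: prod_eq_iff)
  show "(\<exists>\<tau>>0. y = (v, 0) + \<tau> *\<^sub>R (1, 0)) \<longleftrightarrow> snd y = 0 \<and> v < fst y"
    "(\<exists>\<tau>\<ge>0. y = (v, 0) + \<tau> *\<^sub>R (1, 0)) \<longleftrightarrow> snd y = 0 \<and> v \<le> fst y"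
    "(\<exists>\<tau>>0. y = (v, 0) + \<tau> *\<^sub>R (-1, 0)) \<longleftrightarrow> snd y = 0 \<and> fst y < v"
    "(\<exists>\<tau>\<ge>0. y = (v, 0) + \<tau> *\<^sub>R (-1, 0)) \<longleftrightarrow> snd y = 0 \<and> fst y \<le> v"
    "(\<exists>\<tau>>0. y = (0, v) + \<tau> *\<^sub>R (0, 1)) \<longleftrightarrow> fst y = 0 \<and> v < snd y"
    "(\<exists>\<tau>\<ge>0. y = (0, v) + \<tau> *\<^sub>R (0, 1)) \<longleftrightarrow> fst y = 0 \<and> v \<le> snd y"
    "(\<exists>\<tau>>0. y = (0, v) + \<tau> *\<^sub>R (0, -1)) \<longleftrightarrow> fst y = 0 \<and> snd y < v"
    "(\<exists>\<tau>\<ge>0. y = (0, v) + \<tau> *\<^sub>R (0, -1)) \<longleftrightarrow> fst y = 0 \<and> snd y \<le> v"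
    unfolding e by auto
qed

lemma vertical_segment: "y2 \<le> y1 \<Longrightarrow> closed_segment (0, y1) (0, y2) = {y :: real \<times> real. fst y = 0 \<and> y2 \<le> snd y \<and> snd y \<le> y1}"
proof (intro set_eqI iffI)
  fix y :: "real \<times> real" assume le: "y2 \<le> y1" and "y \<in> closed_segment (0, y1) (0, y2)"
  then obtain t where t: "0 \<le> t" "t \<le> 1" "y = (1 - t) *\<^sub>R (0, y1) + t *\<^sub>R (0, y2)" by (auto simp: closed_segment_def)
  have "t * y2 \<le> t * y1" "(1 - t) * y2 \<le> (1 - t) * y1" using t le by (auto intro: mult_left_mono)
  then show "y \<in> {y. fst y = 0 \<and> y2 \<le> snd y \<and> snd y \<le> y1}" using t(3) by (simp add: algebra_simps)
next
  fix y :: "real \<times> real" assume le: "y2 \<le> y1" and y: "y \<in> {y. fst y = 0 \<and> y2 \<le> snd y \<and> snd y \<le> y1}"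
  show "y \<in> closed_segment (0, y1) (0, y2)"
  proof (cases "y1 = y2")
    case True then show ?thesis using y by (auto simp: prod_eq_iff)
  next
    case False
    then have "y2 < y1" using le by simp
    define t where "t = (y1 - snd y) / (y1 - y2)"
    have "t * (y1 - y2) = y1 - snd y" unfolding t_def using \<open>y2 < y1\<close> by simp
    then have "snd y = (1 - t) * y1 + t * y2" by (simp add: algebra_simps)
    then have "y = (1 - (y1 - snd y) / (y1 - y2)) *\<^sub>R (0, y1) + ((y1 - snd y) / (y1 - y2)) *\<^sub>R (0, y2)"
      unfolding t_def[symmetric] using y by (simp add: prod_eq_iff)
    then show ?thesis using y \<open>y2 < y1\<close> unfolding closed_segment_def
      by (intro CollectI exI[of _ "(y1 - snd y) / (y1 - y2)"]) auto
  qed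
qed

text \<open>The two signs select the quadrant, so that one computation serves all four sides of the
  quadrilateral.\<close>

lemma quadrant_segment:
  assumes "0 < p" "0 < q" "0 < \<gamma>" and e: "e1 = 1 \<or> e1 = -1" "e2 = 1 \<or> e2 = -1"
  shows "closed_segment (e1 * (\<gamma> / p), 0) (0, e2 * (\<gamma> / q)) = {y :: real \<times> real. 0 \<le> e1 * fst y \<and> 0 \<le> e2 * snd y \<and> p * (e1 * fst y) + q * (e2 * snd y) = \<gamma>}"
proof (intro set_eqI iffI)
  fix y :: "real \<times> real" assume "y \<in> closed_segment (e1 * (\<gamma> / p), 0) (0, e2 * (\<gamma> / q))"
  then obtain t where t: "0 \<le> t" "t \<le> 1" "y = (1 - t) *\<^sub>R (e1 * (\<gamma> / p), 0) + t *\<^sub>R (0, e2 * (\<gamma> / q))" by (auto simp: closed_segment_def)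
  have A: "e1 * fst y = (1 - t) * (\<gamma> / p)" "e2 * snd y = t * (\<gamma> / q)" using e t(3) by auto
  have "p * ((1 - t) * (\<gamma> / p)) + q * (t * (\<gamma> / q)) = (1 - t) * \<gamma> + t * \<gamma>" using assms(1,2) by simp
  also have "\<dots> = \<gamma>" by (simp add: algebra_simps)
  finally show "y \<in> {y. 0 \<le> e1 * fst y \<and> 0 \<le> e2 * snd y \<and> p * (e1 * fst y) + q * (e2 * snd y) = \<gamma>}"
    unfolding mem_Collect_eq A using t assms(1-3) by simp
next
  fix y :: "real \<times> real" assume y: "y \<in> {y. 0 \<le> e1 * fst y \<and> 0 \<le> e2 * snd y \<and> p * (e1 * fst y) + q * (e2 * snd y) = \<gamma>}"
  define t where "t = q * (e2 * snd y) / \<gamma>"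
  have pe: "0 \<le> p * (e1 * fst y)" "0 \<le> q * (e2 * snd y)" using y assms by auto
  have t: "0 \<le> t" "t \<le> 1" "1 - t = p * (e1 * fst y) / \<gamma>" using y pe assms unfolding t_def by (auto simp: field_simps)
  have "(1 - t) * (\<gamma> / p) = e1 * fst y" "t * (\<gamma> / q) = e2 * snd y" unfolding t(3) unfolding t_def using assms by auto
  then have "(1 - t) * (e1 * (\<gamma> / p)) = e1 * (e1 * fst y)" "t * (e2 * (\<gamma> / q)) = e2 * (e2 * snd y)" by (metis mult.left_commute)+
  then have "y = (1 - t) *\<^sub>R (e1 * (\<gamma> / p), 0) + t *\<^sub>R (0, e2 * (\<gamma> / q))"
    using e by (auto simp: prod_eq_iff)
  then show "y \<in> closed_segment (e1 * (\<gamma> / p), 0) (0, e2 * (\<gamma> / q))" using t unfolding closed_segment_def by blast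
qed

section \<open>The tree at order 1 of four\<close>

context cap_view
begin

lemma crossing_view:
  assumes len: "length Xs = 4" "length Ys = 4" "length Ds = 4"
    and sub: "\<And>i. i < 4 \<Longrightarrow> Xs ! i \<subseteq> Q \<and> Ys ! i \<subseteq> Q" and dist: "distinct (zip Xs Ys)"
    and sp: "\<And>i. i < 4 \<Longrightarrow> \<exists>\<alpha> s. spoke \<Lambda> z h1 \<alpha> s (U \<union> Xs ! i, L \<union> Ys ! i) \<and> \<alpha> s = rimpt h1 (Ds ! i)"
    and cyc: "in_cyclic_order z h1 (map (rimpt h1) Ds)" and rim: "skel (gr k \<Lambda>) \<inter> rim z h1 = rimpt h1 ` set Ds"
  shows "crossed_by_four_edges z h1 (gr k \<Lambda>) (map (rimpt h1) Ds)"
proof -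
  have "\<forall>i. \<exists>\<alpha> s. i < 4 \<longrightarrow> spoke \<Lambda> z h1 \<alpha> s (U \<union> Xs ! i, L \<union> Ys ! i) \<and> \<alpha> s = rimpt h1 (Ds ! i)" using sp by blast
  then obtain \<alpha> where "\<forall>i. \<exists>s. i < 4 \<longrightarrow> spoke \<Lambda> z h1 (\<alpha> i) s (U \<union> Xs ! i, L \<union> Ys ! i) \<and> (\<alpha> i) s = rimpt h1 (Ds ! i)" by metis
  then obtain s where as: "\<And>i. i < 4 \<Longrightarrow> spoke \<Lambda> z h1 (\<alpha> i) (s i) (U \<union> Xs ! i, L \<union> Ys ! i) \<and> (\<alpha> i) (s i) = rimpt h1 (Ds ! i)" by metis
  show ?thesis
  proof (rule crossed_by_four_spokes[OF pr finI, where \<alpha> = \<alpha> and s = s and l = "\<lambda>i. (U \<union> Xs ! i, L \<union> Ys ! i)"])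
    show "spoke \<Lambda> z h1 (\<alpha> i) (s i) (U \<union> Xs ! i, L \<union> Ys ! i)" if "i < 4" for i using as[OF that] by blast
    show "inj_on (\<lambda>i. (U \<union> Xs ! i, L \<union> Ys ! i)) {..<4}"
    proof (rule inj_onI)
      fix i j :: nat assume ij: "i \<in> {..<4}" "j \<in> {..<4}" "(U \<union> Xs ! i, L \<union> Ys ! i) = (U \<union> Xs ! j, L \<union> Ys ! j)"
      then have "(Xs ! i, Ys ! i) = (Xs ! j, Ys ! j)" using lab_cap_tie(3) sub by (metis lessThan_iff)
      then show "i = j" using nth_eq_iff_index_eq[OF dist, of i j] ij(1,2) len by simp
    qed
    show "length (map (rimpt h1) Ds) = 4" using len by simp
    show "map (rimpt h1) Ds ! i = \<alpha> i (s i)" if "i < 4" for i using as[OF that] len that by simp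
    show "in_cyclic_order z h1 (map (rimpt h1) Ds)" by (rule cyc)
    show "skel (gr k \<Lambda>) \<inter> rim z h1 = set (map (rimpt h1) Ds)" using rim by simp
  qed
qed

lemma vertex_iff:
  "y = (0, 2 * \<gamma> / s2) \<longleftrightarrow> fst y = 0 \<and> s2 * snd y = 2 * \<gamma>" "y = (0, - 2 * \<gamma> / s4) \<longleftrightarrow> fst y = 0 \<and> s4 * snd y = - 2 * \<gamma>"
  "y = (2 * \<gamma> / s3, 0) \<longleftrightarrow> snd y = 0 \<and> s3 * fst y = 2 * \<gamma>" "y = (- 2 * \<gamma> / s1, 0) \<longleftrightarrow> snd y = 0 \<and> s1 * fst y = - 2 * \<gamma>"
  using s by (auto simp: prod_eq_iff field_simps)

text \<open>One of the two pictures of a flip. The crossing is stated for two enumerations of the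
  rim points because in the turned frame the same four points are numbered with a shift by
  one.\<close>

theorem flip_half:
  assumes k: "k = card U + 1"
  defines "P1 \<equiv> rimpt h1 (s2, s1)" and "P2 \<equiv> rimpt h1 (- s2, s3)" and "P3 \<equiv> rimpt h1 (- s4, - s3)" and "P4 \<equiv> rimpt h1 (s4, - s1)"
  shows "\<exists>u v. u \<noteq> v \<and> black (gr k \<Lambda>) \<inter> left_side z h1 = {u, v} \<and> white (gr k \<Lambda>) \<inter> left_side z h1 = {} \<and>
      drawn_inside z h1 (skel (gr k \<Lambda>)) [(u, v), (u, P1), (u, P2), (v, P3), (v, P4)]"
    and "in_cyclic_order z h1 [P1, P2, P3, P4] \<Longrightarrow> crossed_by_four_edges z h1 (gr k \<Lambda>) [P1, P2, P3, P4]"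
    and "in_cyclic_order z h1 [P4, P1, P2, P3] \<Longrightarrow> crossed_by_four_edges z h1 (gr k \<Lambda>) [P4, P1, P2, P3]"
proof -
  have k1: "k - card U = 1" and kU: "card U \<le> k" "k \<le> card U + 4" using k by auto
  define V1 V2 where "V1 = (0::real, 2 * \<gamma> / s2)" and "V2 = (0::real, - 2 * \<gamma> / s4)"
  have Vs: "V1 \<in> corners \<gamma>"
    "V2 \<in> corners \<gamma>" unfolding V1_def V2_def by simp_all
  have V12: "y = V1 \<longleftrightarrow> fst y = 0 \<and> s2 * snd y = 2 * \<gamma>" "y = V2 \<longleftrightarrow> fst y = 0 \<and> s4 * snd y = - 2 * \<gamma>" for y
    unfolding V1_def V2_def by (rule vertex_iff)+
  have z0: "(0, 2 * 0 / s2) = (0 :: real \<times> real)" "(0, - 2 * 0 / s4) = (0 :: real \<times> real)" by (simp_all add: zero_prod_def)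
  have g0: "0 \<le> \<gamma>" using \<gamma> by simp
  have rays: "LQ 1 \<gamma>' y = ({a,b}, Q) \<longleftrightarrow> (\<exists>\<tau>>0. y = (0, 2 * \<gamma>' / s2) + \<tau> *\<^sub>R (s2, s1))"
    "LQ 1 \<gamma>' y = ({b,c}, Q) \<longleftrightarrow> (\<exists>\<tau>>0. y = (0, 2 * \<gamma>' / s2) + \<tau> *\<^sub>R (- s2, s3))"
    "LQ 1 \<gamma>' y = ({c,d}, Q) \<longleftrightarrow> (\<exists>\<tau>>0. y = (0, - 2 * \<gamma>' / s4) + \<tau> *\<^sub>R (- s4, - s3))"
    "LQ 1 \<gamma>' y = ({d,a}, Q) \<longleftrightarrow> (\<exists>\<tau>>0. y = (0, - 2 * \<gamma>' / s4) + \<tau> *\<^sub>R (s4, - s1))" if "0 \<le> \<gamma>'" for \<gamma>' y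
    unfolding flip_labels[OF that] ray_iff(1)[OF s(2)] ray_iff(3)[OF s(2)] ray_iff(1)[OF s(4)] ray_iff(3)[OF s(4)]
    using s by auto
  have rays0: "LQ 1 0 y = ({a,b}, Q) \<longleftrightarrow> (\<exists>\<tau>>0. y = \<tau> *\<^sub>R (s2, s1))"
    "LQ 1 0 y = ({b,c}, Q) \<longleftrightarrow> (\<exists>\<tau>>0. y = \<tau> *\<^sub>R (- s2, s3))"
    "LQ 1 0 y = ({c,d}, Q) \<longleftrightarrow> (\<exists>\<tau>>0. y = \<tau> *\<^sub>R (- s4, - s3))"
    "LQ 1 0 y = ({d,a}, Q) \<longleftrightarrow> (\<exists>\<tau>>0. y = \<tau> *\<^sub>R (s4, - s1))" for y
    using rays[of 0 y] unfolding z0 by auto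
  have two: "card ({a,b} \<inter> Q) = 2" "card ({b,c} \<inter> Q) = 2" "card ({c,d} \<inter> Q) = 2" "card ({d,a} \<inter> Q) = 2"
    using distinct_simps by (auto simp: Q_def)
  have subQ: "{a,b} \<subseteq> Q" "{b,c} \<subseteq> Q" "{c,d} \<subseteq> Q" "{d,a} \<subseteq> Q" by (auto simp: Q_def)
  have dn0: "(s2, s1) \<noteq> 0" "(- s2, s3) \<noteq> 0" "(- s4, - s3) \<noteq> 0" "(s4, - s1) \<noteq> 0" using s by (auto simp: zero_prod_def)
  obtain \<alpha>1 r1 t1 where sp1: "spoke \<Lambda> z h1 \<alpha>1 r1 (U \<union> {a,b}, L \<union> Q)" "\<alpha>1 r1 = P1" "0 < t1" "g (pl (V1 + t1 *\<^sub>R (s2, s1))) = P1"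
    "{y. nu y \<le> rad h2 \<and> (\<exists>\<tau>\<ge>0. y = V1 + \<tau> *\<^sub>R (s2, s1)) \<and> h1 \<le> z \<bullet> g (pl y)} = closed_segment V1 (V1 + t1 *\<^sub>R (s2, s1))"
    using spoke_view[OF kU subQ(1) order_refl two(1) Vs(1) dn0(1)] rays(1)[OF g0] rays0(1) unfolding k1 P1_def V1_def by blast
  obtain \<alpha>2 r2 t2 where sp2: "spoke \<Lambda> z h1 \<alpha>2 r2 (U \<union> {b,c}, L \<union> Q)" "\<alpha>2 r2 = P2" "0 < t2" "g (pl (V1 + t2 *\<^sub>R (- s2, s3))) = P2"
    "{y. nu y \<le> rad h2 \<and> (\<exists>\<tau>\<ge>0. y = V1 + \<tau> *\<^sub>R (- s2, s3)) \<and> h1 \<le> z \<bullet> g (pl y)} = closed_segment V1 (V1 + t2 *\<^sub>R (- s2, s3))"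
    using spoke_view[OF kU subQ(2) order_refl two(2) Vs(1) dn0(2)] rays(2)[OF g0] rays0(2) unfolding k1 P2_def V1_def by blast
  obtain \<alpha>3 r3 t3 where sp3: "spoke \<Lambda> z h1 \<alpha>3 r3 (U \<union> {c,d}, L \<union> Q)" "\<alpha>3 r3 = P3" "0 < t3" "g (pl (V2 + t3 *\<^sub>R (- s4, - s3))) = P3"
    "{y. nu y \<le> rad h2 \<and> (\<exists>\<tau>\<ge>0. y = V2 + \<tau> *\<^sub>R (- s4, - s3)) \<and> h1 \<le> z \<bullet> g (pl y)} = closed_segment V2 (V2 + t3 *\<^sub>R (- s4, - s3))"
    using spoke_view[OF kU subQ(3) order_refl two(3) Vs(2) dn0(3)] rays(3)[OF g0] rays0(3) unfolding k1 P3_def V2_def by blast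
  obtain \<alpha>4 r4 t4 where sp4: "spoke \<Lambda> z h1 \<alpha>4 r4 (U \<union> {d,a}, L \<union> Q)" "\<alpha>4 r4 = P4" "0 < t4" "g (pl (V2 + t4 *\<^sub>R (s4, - s1))) = P4"
    "{y. nu y \<le> rad h2 \<and> (\<exists>\<tau>\<ge>0. y = V2 + \<tau> *\<^sub>R (s4, - s1)) \<and> h1 \<le> z \<bullet> g (pl y)} = closed_segment V2 (V2 + t4 *\<^sub>R (s4, - s1))"
    using spoke_view[OF kU subQ(4) order_refl two(4) Vs(2) dn0(4)] rays(4)[OF g0] rays0(4) unfolding k1 P4_def V2_def by blast
  have seg0: "y \<in> closed_segment V1 V2 \<longleftrightarrow> fst y = 0 \<and> - 2 * \<gamma> \<le> s4 * snd y \<and> s2 * snd y \<le> 2 * \<gamma>" for y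
  proof -
    have "- 2 * \<gamma> / s4 \<le> 0" "0 \<le> 2 * \<gamma> / s2" using s \<gamma> by auto
    then have "- 2 * \<gamma> / s4 \<le> 2 * \<gamma> / s2" by linarith
    from vertical_segment[OF this] show ?thesis unfolding V1_def V2_def using s by (simp add: field_simps)
  qed
  have ray1: "(\<exists>\<tau>\<ge>0. y = V1 + \<tau> *\<^sub>R (s2, s1)) \<longleftrightarrow> 0 \<le> fst y \<and> s1 * fst y + 2 * \<gamma> = s2 * snd y"
    and ray2: "(\<exists>\<tau>\<ge>0. y = V1 + \<tau> *\<^sub>R (- s2, s3)) \<longleftrightarrow> fst y \<le> 0 \<and> - s3 * fst y + 2 * \<gamma> = s2 * snd y"
    and ray3: "(\<exists>\<tau>\<ge>0. y = V2 + \<tau> *\<^sub>R (- s4, - s3)) \<longleftrightarrow> fst y \<le> 0 \<and> - s3 * fst y + 2 * \<gamma> = - s4 * snd y"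
    and ray4: "(\<exists>\<tau>\<ge>0. y = V2 + \<tau> *\<^sub>R (s4, - s1)) \<longleftrightarrow> 0 \<le> fst y \<and> s1 * fst y + 2 * \<gamma> = - s4 * snd y" for y
    unfolding V1_def V2_def ray_iff(2)[OF s(2)] ray_iff(4)[OF s(2)] ray_iff(2)[OF s(4)] ray_iff(4)[OF s(4)]
    using s by auto
  define B1 B2 B3 B4 where B: "B1 = V1 + t1 *\<^sub>R (s2, s1)" "B2 = V1 + t2 *\<^sub>R (- s2, s3)" "B3 = V2 + t3 *\<^sub>R (- s4, - s3)" "B4 = V2 + t4 *\<^sub>R (s4, - s1)"
  note segs = sp1(5)[folded B, unfolded ray1, symmetric] sp2(5)[folded B, unfolded ray2, symmetric] sp3(5)[folded B, unfolded ray3, symmetric] sp4(5)[folded B, unfolded ray4, symmetric]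
  have set_eq: "{y. nu y \<le> rad h2 \<and> tie (LQ 1 \<gamma> y) \<noteq> {} \<and> h1 \<le> z \<bullet> g (pl y)} =
    closed_segment V1 V2 \<union> closed_segment V1 B1 \<union> closed_segment V1 B2 \<union> closed_segment V2 B3 \<union> closed_segment V2 B4"
    unfolding segs flip_tie[OF g0] using vertex_inside[OF Vs] seg0 by (auto simp: less_imp_le)
  define As Bs where AB: "As = [V1, V1, V1, V2, V2]" "Bs = [V2, B1, B2, B3, B4]"
  define u v where uv: "u = g (pl V1)" "v = g (pl V2)"
  have "0 < 2 * \<gamma> / s2" "- 2 * \<gamma> / s4 < 0" using s \<gamma> by auto
  then have V1V2: "V1 \<noteq> V2" unfolding V1_def V2_def by (metis less_asym snd_conv)
  have drawn: "drawn_inside z h1 (skel (gr k \<Lambda>)) [(u, v), (u, P1), (u, P2), (v, P3), (v, P4)]"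
  proof (rule drawn_segments[OF homeo, where As = As and Bs = Bs and n = 5])
    show "length As = 5" "length Bs = 5" unfolding AB by simp_all
    show "As ! i \<noteq> Bs ! i" if "i < 5" for i
    proof -
      have "i = 0 \<or> i = 1 \<or> i = 2 \<or> i = 3 \<or> i = 4" using that by linarith
      then show ?thesis unfolding AB B using V1V2 sp1(3) sp2(3) sp3(3) sp4(3) s by (elim disjE) (auto simp: zero_prod_def)
    qed
    have "{..<5} = {0, 1, 2, 3, 4 :: nat}" by auto
    then show "skel (gr k \<Lambda>) \<inter> (left_side z h1 \<union> rim z h1) = (\<Union>i<5. (\<lambda>y. g (pl y)) ` closed_segment (As ! i) (Bs ! i))"
      unfolding skel_view[OF kU] k1 set_eq AB by (simp add: image_Un Un_assoc)
    show "[(u, v), (u, P1), (u, P2), (v, P3), (v, P4)] = map (\<lambda>i. (g (pl (As ! i)), g (pl (Bs ! i)))) [0..<5]"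
      unfolding AB uv using sp1(4) sp2(4) sp3(4) sp4(4) unfolding B[symmetric] by (simp add: upt_rec numeral_eq_Suc)
    fix i j :: nat and y assume ij: "i < j" "j < 5" and "y \<in> closed_segment (As ! i) (Bs ! i)" "y \<in> closed_segment (As ! j) (Bs ! j)"
    moreover have "(i = 0 \<and> j = 1) \<or> (i = 0 \<and> j = 2) \<or> (i = 0 \<and> j = 3) \<or> (i = 0 \<and> j = 4) \<or> (i = 1 \<and> j = 2) \<or> (i = 1 \<and> j = 3) \<or> (i = 1 \<and> j = 4) \<or>
      (i = 2 \<and> j = 3) \<or> (i = 2 \<and> j = 4) \<or> (i = 3 \<and> j = 4)" using ij by presburger
    \<comment> \<open>Two of the five segments can meet only in an end of the central one; by the
      equations of the segments this is arithmetic in each of the ten pairs.\<close>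
    ultimately have "(y = V1 \<and> (As ! i = V1 \<or> Bs ! i = V1) \<and> (As ! j = V1 \<or> Bs ! j = V1)) \<or> (y = V2 \<and> (As ! i = V2 \<or> Bs ! i = V2) \<and> (As ! j = V2 \<or> Bs ! j = V2))"
      using sgn_facts[of y] \<gamma> unfolding AB
      by (elim disjE conjE; hypsubst; simp add: seg0 segs V12; smt (verit))
    then show "(y = As ! i \<or> y = Bs ! i) \<and> (y = As ! j \<or> y = Bs ! j)" by auto
  qed
  have b: "black (gr k \<Lambda>) \<inter> left_side z h1 = (\<lambda>y. g (pl y)) ` {V1, V2}"
    unfolding gr_simps
  proof (rule vertices_view[OF kU])
    show "{y. card (tie (LQ (k - card U) \<gamma> y)) = 3 \<and> card U + card (fst (LQ (k - card U) \<gamma> y)) = k + 2} = {V1, V2}"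
    proof (rule set_eqI)
      show "y \<in> {y. card (tie (LQ (k - card U) \<gamma> y)) = 3 \<and> card U + card (fst (LQ (k - card U) \<gamma> y)) = k + 2} \<longleftrightarrow> y \<in> {V1, V2}" for y
        unfolding k1 mem_Collect_eq insert_iff empty_iff V12 using flip_vertex[OF \<gamma>, of y] k by auto
    qed
    show "{V1, V2} \<subseteq> corners \<gamma>" using Vs by simp
  qed
  have w: "white (gr k \<Lambda>) \<inter> left_side z h1 = (\<lambda>y. g (pl y)) ` {}"
    unfolding gr_simps
  proof (rule vertices_view[OF kU])
    show "{y. card (tie (LQ (k - card U) \<gamma> y)) = 3 \<and> card U + card (fst (LQ (k - card U) \<gamma> y)) = k + 1} = {}"
      unfolding k1 using flip_vertex(2)[OF \<gamma>] k by auto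
  qed simp
  show "\<exists>u v. u \<noteq> v \<and> black (gr k \<Lambda>) \<inter> left_side z h1 = {u, v} \<and> white (gr k \<Lambda>) \<inter> left_side z h1 = {} \<and>
      drawn_inside z h1 (skel (gr k \<Lambda>)) [(u, v), (u, P1), (u, P2), (v, P3), (v, P4)]"
    using drawn b w V1V2 g_inj unfolding uv by (intro exI[of _ "g (pl V1)"] exI[of _ "g (pl V2)"]) auto
  have skr: "skel (gr k \<Lambda>) \<inter> rim z h1 = rimpt h1 ` {(s2, s1), (- s2, s3), (- s4, - s3), (s4, - s1)}"
  proof (rule skel_rim[OF kU])
    show "0 \<notin> {(s2, s1), (- s2, s3), (- s4, - s3), (s4, - s1)}" using dn0 by auto
    fix y :: "real \<times> real" assume nz: "y \<noteq> 0"
    have "\<not> (fst y = 0 \<and> snd y = 0)" using nz by (auto simp: prod_eq_iff)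
    then have "tie (LQ 1 0 y) \<noteq> {} \<longleftrightarrow> (0 < fst y \<and> s1 * fst y + 2 * 0 = s2 * snd y) \<or> (fst y < 0 \<and> - s3 * fst y + 2 * 0 = s2 * snd y) \<or>
      (fst y < 0 \<and> - s3 * fst y + 2 * 0 = - s4 * snd y) \<or> (0 < fst y \<and> s1 * fst y + 2 * 0 = - s4 * snd y)"
      unfolding flip_tie[of 0 y, OF order_refl] using sgn_facts[of y] by simp (smt (verit))
    also have "\<dots> \<longleftrightarrow> (\<exists>d'\<in>{(s2, s1), (- s2, s3), (- s4, - s3), (s4, - s1)}. \<exists>\<tau>>0. y = \<tau> *\<^sub>R d')"
      unfolding flip_labels[of 0 y, OF order_refl, symmetric] rays0 by simp
    finally show "tie (LQ (k - card U) 0 y) \<noteq> {} \<longleftrightarrow> (\<exists>d'\<in>{(s2, s1), (- s2, s3), (- s4, - s3), (s4, - s1)}. \<exists>\<tau>>0. y = \<tau> *\<^sub>R d')"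
      unfolding k1 .
  qed
  have ex: "\<exists>\<alpha> s. spoke \<Lambda> z h1 \<alpha> s (U \<union> {a,b}, L \<union> Q) \<and> \<alpha> s = rimpt h1 (s2, s1)"
    "\<exists>\<alpha> s. spoke \<Lambda> z h1 \<alpha> s (U \<union> {b,c}, L \<union> Q) \<and> \<alpha> s = rimpt h1 (- s2, s3)"
    "\<exists>\<alpha> s. spoke \<Lambda> z h1 \<alpha> s (U \<union> {c,d}, L \<union> Q) \<and> \<alpha> s = rimpt h1 (- s4, - s3)"
    "\<exists>\<alpha> s. spoke \<Lambda> z h1 \<alpha> s (U \<union> {d,a}, L \<union> Q) \<and> \<alpha> s = rimpt h1 (s4, - s1)"
    using sp1(1,2) sp2(1,2) sp3(1,2) sp4(1,2) unfolding P1_def P2_def P3_def P4_def by blast+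
  have four: "i = 0 \<or> i = 1 \<or> i = 2 \<or> i = 3" if "i < 4" for i :: nat using that by linarith
  have neq: "{a,b} \<noteq> {b,c}" "{a,b} \<noteq> {c,d}" "{a,b} \<noteq> {d,a}" "{b,c} \<noteq> {c,d}" "{b,c} \<noteq> {d,a}" "{c,d} \<noteq> {d,a}"
    using distinct_simps by (auto simp: doubleton_eq_iff)
  show "crossed_by_four_edges z h1 (gr k \<Lambda>) [P1, P2, P3, P4]" if cyc: "in_cyclic_order z h1 [P1, P2, P3, P4]"
  proof -
    have "crossed_by_four_edges z h1 (gr k \<Lambda>) (map (rimpt h1) [(s2, s1), (- s2, s3), (- s4, - s3), (s4, - s1)])"
    proof (rule crossing_view[where Xs = "[{a,b}, {b,c}, {c,d}, {d,a}]" and Ys = "[Q, Q, Q, Q]"])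
      show "[{a,b}, {b,c}, {c,d}, {d,a}] ! i \<subseteq> Q \<and> [Q, Q, Q, Q] ! i \<subseteq> Q" if "i < 4" for i
        using four[OF that] subQ by auto
      show "\<exists>\<alpha> s. spoke \<Lambda> z h1 \<alpha> s (U \<union> [{a,b}, {b,c}, {c,d}, {d,a}] ! i, L \<union> [Q, Q, Q, Q] ! i) \<and>
        \<alpha> s = rimpt h1 ([(s2, s1), (- s2, s3), (- s4, - s3), (s4, - s1)] ! i)" if "i < 4" for i
        using four[OF that] ex by (elim disjE) simp_all
    qed (use neq cyc skr in \<open>auto simp: P1_def P2_def P3_def P4_def\<close>)
    then show ?thesis unfolding P1_def P2_def P3_def P4_def by simp
  qed
  show "crossed_by_four_edges z h1 (gr k \<Lambda>) [P4, P1, P2, P3]" if cyc: "in_cyclic_order z h1 [P4, P1, P2, P3]"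
  proof -
    have "crossed_by_four_edges z h1 (gr k \<Lambda>) (map (rimpt h1) [(s4, - s1), (s2, s1), (- s2, s3), (- s4, - s3)])"
    proof (rule crossing_view[where Xs = "[{d,a}, {a,b}, {b,c}, {c,d}]" and Ys = "[Q, Q, Q, Q]"])
      show "[{d,a}, {a,b}, {b,c}, {c,d}] ! i \<subseteq> Q \<and> [Q, Q, Q, Q] ! i \<subseteq> Q" if "i < 4" for i
        using four[OF that] subQ by auto
      show "\<exists>\<alpha> s. spoke \<Lambda> z h1 \<alpha> s (U \<union> [{d,a}, {a,b}, {b,c}, {c,d}] ! i, L \<union> [Q, Q, Q, Q] ! i) \<and>
        \<alpha> s = rimpt h1 ([(s4, - s1), (s2, s1), (- s2, s3), (- s4, - s3)] ! i)" if "i < 4" for i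
        using four[OF that] ex by (elim disjE) simp_all
    qed (use neq cyc skr in \<open>auto simp: P1_def P2_def P3_def P4_def\<close>)
    then show ?thesis unfolding P1_def P2_def P3_def P4_def by simp
  qed
qed

end

section \<open>The square at order 2 of four\<close>

context cap_view
begin

text \<open>Only one side of the wall has to be drawn, as \<open>move_Sq\<close> compares colors on
  a common skeleton.\<close>

theorem square_half:
  assumes k: "k = card U + 2"
  defines "P1 \<equiv> rimpt h1 (0, 1)" and "P2 \<equiv> rimpt h1 (- 1, 0)" and "P3 \<equiv> rimpt h1 (0, - 1)" and "P4 \<equiv> rimpt h1 (1, 0)"
  assumes cyc: "in_cyclic_order z h1 [P1, P2, P3, P4]"
  shows "\<exists>v1 v2 v3 v4. crossed_by_four_edges z h1 (gr k \<Lambda>) [P1, P2, P3, P4] \<and> distinct [v1, v2, v3, v4] \<and>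
      drawn_inside z h1 (skel (gr k \<Lambda>))
        [(v1, v2), (v2, v3), (v3, v4), (v4, v1), (v1, P1), (v2, P2), (v3, P3), (v4, P4)] \<and>
      white (gr k \<Lambda>) \<inter> left_side z h1 = {v1, v3} \<and> black (gr k \<Lambda>) \<inter> left_side z h1 = {v2, v4} \<and>
      {v1, v3} = (\<lambda>y. g (pl y)) ` {(0, 2 * \<gamma> / s2), (0, - 2 * \<gamma> / s4)} \<and>
      {v2, v4} = (\<lambda>y. g (pl y)) ` {(- 2 * \<gamma> / s1, 0), (2 * \<gamma> / s3, 0)}"
proof -
  have k1: "k - card U = 2" and kU: "card U \<le> k" "k \<le> card U + 4" using k by auto
  have g0: "0 \<le> \<gamma>" using \<gamma> by simp
  define V1 where "V1 = (0 :: real, 2 * \<gamma> / s2)"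
  define V2 where "V2 = (- 2 * \<gamma> / s1, 0 :: real)"
  define V3 where "V3 = (0 :: real, - 2 * \<gamma> / s4)"
  define V4 where "V4 = (2 * \<gamma> / s3, 0 :: real)"
  note V_defs = V1_def V2_def V3_def V4_def
  have Vs: "V1 \<in> corners \<gamma>" "V2 \<in> corners \<gamma>" "V3 \<in> corners \<gamma>" "V4 \<in> corners \<gamma>"
    unfolding V_defs by simp_all
  have V: "y = V1 \<longleftrightarrow> fst y = 0 \<and> s2 * snd y = 2 * \<gamma>" "y = V2 \<longleftrightarrow> snd y = 0 \<and> s1 * fst y = - 2 * \<gamma>"
    "y = V3 \<longleftrightarrow> fst y = 0 \<and> s4 * snd y = - 2 * \<gamma>" "y = V4 \<longleftrightarrow> snd y = 0 \<and> s3 * fst y = 2 * \<gamma>" for y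
    unfolding V_defs by (rule vertex_iff)+
  have z0: "(0, 2 * 0 / s2) = (0 :: real \<times> real)" "(0, - 2 * 0 / s4) = (0 :: real \<times> real)" "(- 2 * 0 / s1, 0) = (0 :: real \<times> real)" "(2 * 0 / s3, 0) = (0 :: real \<times> real)"
    by (simp_all add: zero_prod_def)
  have rays: "LQ 2 \<gamma>' y = ({a,b,c}, {a,c,d}) \<longleftrightarrow> (\<exists>\<tau>>0. y = (0, 2 * \<gamma>' / s2) + \<tau> *\<^sub>R (0, 1))"
    "LQ 2 \<gamma>' y = ({b,c,d}, {a,b,d}) \<longleftrightarrow> (\<exists>\<tau>>0. y = (- 2 * \<gamma>' / s1, 0) + \<tau> *\<^sub>R (- 1, 0))"
    "LQ 2 \<gamma>' y = ({a,c,d}, {a,b,c}) \<longleftrightarrow> (\<exists>\<tau>>0. y = (0, - 2 * \<gamma>' / s4) + \<tau> *\<^sub>R (0, - 1))"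
    "LQ 2 \<gamma>' y = ({a,b,d}, {b,c,d}) \<longleftrightarrow> (\<exists>\<tau>>0. y = (2 * \<gamma>' / s3, 0) + \<tau> *\<^sub>R (1, 0))" if "0 \<le> \<gamma>'" for \<gamma>' y
    unfolding square_labels[OF that] axis_ray_iff using s by (auto simp: field_simps)
  have rays0: "LQ 2 0 y = ({a,b,c}, {a,c,d}) \<longleftrightarrow> (\<exists>\<tau>>0. y = \<tau> *\<^sub>R (0, 1))"
    "LQ 2 0 y = ({b,c,d}, {a,b,d}) \<longleftrightarrow> (\<exists>\<tau>>0. y = \<tau> *\<^sub>R (- 1, 0))"
    "LQ 2 0 y = ({a,c,d}, {a,b,c}) \<longleftrightarrow> (\<exists>\<tau>>0. y = \<tau> *\<^sub>R (0, - 1))"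
    "LQ 2 0 y = ({a,b,d}, {b,c,d}) \<longleftrightarrow> (\<exists>\<tau>>0. y = \<tau> *\<^sub>R (1, 0))" for y
    using rays[of 0 y] unfolding z0 by auto
  have two: "card ({a,b,c} \<inter> {a,c,d}) = 2" "card ({b,c,d} \<inter> {a,b,d}) = 2" "card ({a,c,d} \<inter> {a,b,c}) = 2" "card ({a,b,d} \<inter> {b,c,d}) = 2"
    using distinct_simps by (auto simp: Int_insert_left)
  have subQ: "{a,b,c} \<subseteq> Q" "{b,c,d} \<subseteq> Q" "{a,c,d} \<subseteq> Q" "{a,b,d} \<subseteq> Q" by (auto simp: Q_def)
  have dn0: "(0, 1) \<noteq> (0 :: real \<times> real)" "(- 1, 0) \<noteq> (0 :: real \<times> real)" "(0, - 1) \<noteq> (0 :: real \<times> real)" "(1, 0) \<noteq> (0 :: real \<times> real)" by (auto simp: zero_prod_def)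
  obtain \<alpha>1 r1 t1 where sp1: "spoke \<Lambda> z h1 \<alpha>1 r1 (U \<union> {a,b,c}, L \<union> {a,c,d})" "\<alpha>1 r1 = P1" "0 < t1" "g (pl (V1 + t1 *\<^sub>R (0, 1))) = P1"
    "{y. nu y \<le> rad h2 \<and> (\<exists>\<tau>\<ge>0. y = V1 + \<tau> *\<^sub>R (0, 1)) \<and> h1 \<le> z \<bullet> g (pl y)} = closed_segment V1 (V1 + t1 *\<^sub>R (0, 1))"
    using spoke_view[OF kU subQ(1) subQ(3) two(1) Vs(1) dn0(1)] rays(1)[OF g0] rays0(1) unfolding k1 P1_def V1_def by blast
  obtain \<alpha>2 r2 t2 where sp2: "spoke \<Lambda> z h1 \<alpha>2 r2 (U \<union> {b,c,d}, L \<union> {a,b,d})" "\<alpha>2 r2 = P2" "0 < t2" "g (pl (V2 + t2 *\<^sub>R (- 1, 0))) = P2"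
    "{y. nu y \<le> rad h2 \<and> (\<exists>\<tau>\<ge>0. y = V2 + \<tau> *\<^sub>R (- 1, 0)) \<and> h1 \<le> z \<bullet> g (pl y)} = closed_segment V2 (V2 + t2 *\<^sub>R (- 1, 0))"
    using spoke_view[OF kU subQ(2) subQ(4) two(2) Vs(2) dn0(2)] rays(2)[OF g0] rays0(2) unfolding k1 P2_def V2_def by blast
  obtain \<alpha>3 r3 t3 where sp3: "spoke \<Lambda> z h1 \<alpha>3 r3 (U \<union> {a,c,d}, L \<union> {a,b,c})" "\<alpha>3 r3 = P3" "0 < t3" "g (pl (V3 + t3 *\<^sub>R (0, - 1))) = P3"
    "{y. nu y \<le> rad h2 \<and> (\<exists>\<tau>\<ge>0. y = V3 + \<tau> *\<^sub>R (0, - 1)) \<and> h1 \<le> z \<bullet> g (pl y)} = closed_segment V3 (V3 + t3 *\<^sub>R (0, - 1))"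
    using spoke_view[OF kU subQ(3) subQ(1) two(3) Vs(3) dn0(3)] rays(3)[OF g0] rays0(3) unfolding k1 P3_def V3_def by blast
  obtain \<alpha>4 r4 t4 where sp4: "spoke \<Lambda> z h1 \<alpha>4 r4 (U \<union> {a,b,d}, L \<union> {b,c,d})" "\<alpha>4 r4 = P4" "0 < t4" "g (pl (V4 + t4 *\<^sub>R (1, 0))) = P4"
    "{y. nu y \<le> rad h2 \<and> (\<exists>\<tau>\<ge>0. y = V4 + \<tau> *\<^sub>R (1, 0)) \<and> h1 \<le> z \<bullet> g (pl y)} = closed_segment V4 (V4 + t4 *\<^sub>R (1, 0))"
    using spoke_view[OF kU subQ(4) subQ(2) two(4) Vs(4) dn0(4)] rays(4)[OF g0] rays0(4) unfolding k1 P4_def V4_def by blast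
  have ray1: "(\<exists>\<tau>\<ge>0. y = V1 + \<tau> *\<^sub>R (0, 1)) \<longleftrightarrow> fst y = 0 \<and> 2 * \<gamma> \<le> s2 * snd y"
    and ray2: "(\<exists>\<tau>\<ge>0. y = V2 + \<tau> *\<^sub>R (- 1, 0)) \<longleftrightarrow> snd y = 0 \<and> 2 * \<gamma> \<le> - s1 * fst y"
    and ray3: "(\<exists>\<tau>\<ge>0. y = V3 + \<tau> *\<^sub>R (0, - 1)) \<longleftrightarrow> fst y = 0 \<and> 2 * \<gamma> \<le> - s4 * snd y"
    and ray4: "(\<exists>\<tau>\<ge>0. y = V4 + \<tau> *\<^sub>R (1, 0)) \<longleftrightarrow> snd y = 0 \<and> 2 * \<gamma> \<le> s3 * fst y" for y
    unfolding V_defs axis_ray_iff using s by (auto simp: field_simps)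
  have e4: "V1 = (0, 1 * (2 * \<gamma> / s2))" "V2 = (- 1 * (2 * \<gamma> / s1), 0)" "V3 = (0, - 1 * (2 * \<gamma> / s4))" "V4 = (1 * (2 * \<gamma> / s3), 0)"
    unfolding V_defs by simp_all
  have g2: "0 < 2 * \<gamma>" using \<gamma> by simp
  have side1': "y \<in> closed_segment V2 V1 \<longleftrightarrow> fst y \<le> 0 \<and> 0 \<le> snd y \<and> - s1 * fst y + s2 * snd y = 2 * \<gamma>" for y
    unfolding e4 by (subst quadrant_segment[OF s(1) s(2) g2]) auto
  have side1: "y \<in> closed_segment V1 V2 \<longleftrightarrow> fst y \<le> 0 \<and> 0 \<le> snd y \<and> - s1 * fst y + s2 * snd y = 2 * \<gamma>" for y
    by (subst closed_segment_commute) (rule side1')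
  have side2: "y \<in> closed_segment V2 V3 \<longleftrightarrow> fst y \<le> 0 \<and> snd y \<le> 0 \<and> - s1 * fst y - s4 * snd y = 2 * \<gamma>" for y
    unfolding e4 by (subst quadrant_segment[OF s(1) s(4) g2]) auto
  have side3': "y \<in> closed_segment V4 V3 \<longleftrightarrow> 0 \<le> fst y \<and> snd y \<le> 0 \<and> s3 * fst y - s4 * snd y = 2 * \<gamma>" for y
    unfolding e4 by (subst quadrant_segment[OF s(3) s(4) g2]) auto
  have side3: "y \<in> closed_segment V3 V4 \<longleftrightarrow> 0 \<le> fst y \<and> snd y \<le> 0 \<and> s3 * fst y - s4 * snd y = 2 * \<gamma>" for y
    by (subst closed_segment_commute) (rule side3')
  have side4: "y \<in> closed_segment V4 V1 \<longleftrightarrow> 0 \<le> fst y \<and> 0 \<le> snd y \<and> s3 * fst y + s2 * snd y = 2 * \<gamma>" for y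
    unfolding e4 by (subst quadrant_segment[OF s(3) s(2) g2]) auto
  define B1 B2 B3 B4 where B: "B1 = V1 + t1 *\<^sub>R (0, 1)" "B2 = V2 + t2 *\<^sub>R (- 1, 0)" "B3 = V3 + t3 *\<^sub>R (0, - 1)" "B4 = V4 + t4 *\<^sub>R (1, 0)"
  note segs = sp1(5)[folded B, unfolded ray1, symmetric] sp2(5)[folded B, unfolded ray2, symmetric] sp3(5)[folded B, unfolded ray3, symmetric] sp4(5)[folded B, unfolded ray4, symmetric]
  have set_eq: "{y. nu y \<le> rad h2 \<and> tie (LQ 2 \<gamma> y) \<noteq> {} \<and> h1 \<le> z \<bullet> g (pl y)} =
    closed_segment V1 V2 \<union> closed_segment V2 V3 \<union> closed_segment V3 V4 \<union> closed_segment V4 V1 \<union>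
    closed_segment V1 B1 \<union> closed_segment V2 B2 \<union> closed_segment V3 B3 \<union> closed_segment V4 B4" (is "?l = ?r")
  proof (rule set_eqI)
    fix y
    have "y \<in> closed_segment V1 V2 \<or> y \<in> closed_segment V2 V3 \<or> y \<in> closed_segment V3 V4 \<or> y \<in> closed_segment V4 V1 \<Longrightarrow> nu y \<le> rad h2 \<and> h1 \<le> z \<bullet> g (pl y)"
      using vertex_inside[OF Vs(1,2)] vertex_inside[OF Vs(2,3)] vertex_inside[OF Vs(3,4)] vertex_inside[OF Vs(4,1)] less_imp_le by blast
    then show "y \<in> ?l \<longleftrightarrow> y \<in> ?r"
      unfolding Un_iff mem_Collect_eq segs square_tie[OF g0] side1 side2 side3 side4 by blast
  qed
  define As Bs where AB: "As = [V1, V2, V3, V4, V1, V2, V3, V4]" "Bs = [V2, V3, V4, V1, B1, B2, B3, B4]"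
  define v1 v2 v3 v4 where v: "v1 = g (pl V1)" "v2 = g (pl V2)" "v3 = g (pl V3)" "v4 = g (pl V4)"
  have VV: "V1 \<noteq> V2" "V1 \<noteq> V3" "V1 \<noteq> V4" "V2 \<noteq> V3" "V2 \<noteq> V4" "V3 \<noteq> V4"
  proof -
    have "0 < 2 * \<gamma> / s2" "- 2 * \<gamma> / s4 < 0" "0 < 2 * \<gamma> / s3" "- 2 * \<gamma> / s1 < 0" using s \<gamma> by auto
    then show "V1 \<noteq> V2" "V1 \<noteq> V3" "V1 \<noteq> V4" "V2 \<noteq> V3" "V2 \<noteq> V4" "V3 \<noteq> V4"
      unfolding V_defs prod.inject by linarith+
  qed
  have drawn: "drawn_inside z h1 (skel (gr k \<Lambda>)) [(v1, v2), (v2, v3), (v3, v4), (v4, v1), (v1, P1), (v2, P2), (v3, P3), (v4, P4)]"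
  proof (rule drawn_segments[OF homeo, where As = As and Bs = Bs and n = 8])
    show "length As = 8" "length Bs = 8" unfolding AB by simp_all
    show "As ! i \<noteq> Bs ! i" if "i < 8" for i
    proof -
      have "i = 0 \<or> i = 1 \<or> i = 2 \<or> i = 3 \<or> i = 4 \<or> i = 5 \<or> i = 6 \<or> i = 7" using that by presburger
      then show ?thesis unfolding AB B using VV sp1(3) sp2(3) sp3(3) sp4(3) by (elim disjE) (auto simp: zero_prod_def)
    qed
    have "{..<8} = {0, 1, 2, 3, 4, 5, 6, 7 :: nat}" by auto
    then show "skel (gr k \<Lambda>) \<inter> (left_side z h1 \<union> rim z h1) = (\<Union>i<8. (\<lambda>y. g (pl y)) ` closed_segment (As ! i) (Bs ! i))"
      unfolding skel_view[OF kU] k1 set_eq AB by (simp add: image_Un Un_assoc)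
    show "[(v1, v2), (v2, v3), (v3, v4), (v4, v1), (v1, P1), (v2, P2), (v3, P3), (v4, P4)] = map (\<lambda>i. (g (pl (As ! i)), g (pl (Bs ! i)))) [0..<8]"
      unfolding AB v using sp1(4) sp2(4) sp3(4) sp4(4) unfolding B[symmetric] by (simp add: upt_rec numeral_eq_Suc)
    fix i j :: nat and y assume ij: "i < j" "j < 8" and "y \<in> closed_segment (As ! i) (Bs ! i)" "y \<in> closed_segment (As ! j) (Bs ! j)"
    moreover have "(i = 0 \<and> j = 1) \<or> (i = 0 \<and> j = 2) \<or> (i = 0 \<and> j = 3) \<or> (i = 0 \<and> j = 4) \<or> (i = 0 \<and> j = 5) \<or> (i = 0 \<and> j = 6) \<or> (i = 0 \<and> j = 7) \<or> (i = 1 \<and> j = 2) \<or> (i = 1 \<and> j = 3) \<or> (i = 1 \<and> j = 4) \<or> (i = 1 \<and> j = 5) \<or> (i = 1 \<and> j = 6) \<or> (i = 1 \<and> j = 7) \<or> (i = 2 \<and> j = 3) \<or> (i = 2 \<and> j = 4) \<or> (i = 2 \<and> j = 5) \<or> (i = 2 \<and> j = 6) \<or> (i = 2 \<and> j = 7) \<or> (i = 3 \<and> j = 4) \<or> (i = 3 \<and> j = 5) \<or> (i = 3 \<and> j = 6) \<or> (i = 3 \<and> j = 7) \<or> (i = 4 \<and> j = 5) \<or> (i = 4 \<and> j = 6) \<or> (i = 4 \<and> j = 7) \<or> (i = 5 \<and> j = 6) \<or> (i = 5 \<and> j = 7) \<or> (i = 6 \<and> j = 7)" using ij by presburger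
    ultimately have "(y = V1 \<and> (As ! i = V1 \<or> Bs ! i = V1) \<and> (As ! j = V1 \<or> Bs ! j = V1)) \<or> (y = V2 \<and> (As ! i = V2 \<or> Bs ! i = V2) \<and> (As ! j = V2 \<or> Bs ! j = V2)) \<or>
       (y = V3 \<and> (As ! i = V3 \<or> Bs ! i = V3) \<and> (As ! j = V3 \<or> Bs ! j = V3)) \<or> (y = V4 \<and> (As ! i = V4 \<or> Bs ! i = V4) \<and> (As ! j = V4 \<or> Bs ! j = V4))"
      using sgn_facts[of y] \<gamma> unfolding AB
      by (elim disjE conjE; hypsubst; simp add: side1 side2 side3 side4 segs V; smt (verit))
    then show "(y = As ! i \<or> y = Bs ! i) \<and> (y = As ! j \<or> y = Bs ! j)" by auto
  qed
  have w: "white (gr k \<Lambda>) \<inter> left_side z h1 = (\<lambda>y. g (pl y)) ` {V1, V3}"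
    unfolding gr_simps
  proof (rule vertices_view[OF kU])
    show "{y. card (tie (LQ (k - card U) \<gamma> y)) = 3 \<and> card U + card (fst (LQ (k - card U) \<gamma> y)) = k + 1} = {V1, V3}"
    proof (rule set_eqI)
      show "y \<in> {y. card (tie (LQ (k - card U) \<gamma> y)) = 3 \<and> card U + card (fst (LQ (k - card U) \<gamma> y)) = k + 1} \<longleftrightarrow> y \<in> {V1, V3}" for y
        unfolding k1 mem_Collect_eq insert_iff empty_iff V using square_vertex(1)[OF \<gamma>, of y] k by auto
    qed
    show "{V1, V3} \<subseteq> corners \<gamma>" using Vs by simp
  qed
  have b: "black (gr k \<Lambda>) \<inter> left_side z h1 = (\<lambda>y. g (pl y)) ` {V2, V4}"
    unfolding gr_simps
  proof (rule vertices_view[OF kU])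
    show "{y. card (tie (LQ (k - card U) \<gamma> y)) = 3 \<and> card U + card (fst (LQ (k - card U) \<gamma> y)) = k + 2} = {V2, V4}"
    proof (rule set_eqI)
      show "y \<in> {y. card (tie (LQ (k - card U) \<gamma> y)) = 3 \<and> card U + card (fst (LQ (k - card U) \<gamma> y)) = k + 2} \<longleftrightarrow> y \<in> {V2, V4}" for y
        unfolding k1 mem_Collect_eq insert_iff empty_iff V using square_vertex(2)[OF \<gamma>, of y] k by auto
    qed
    show "{V2, V4} \<subseteq> corners \<gamma>" using Vs by simp
  qed
  have skr: "skel (gr k \<Lambda>) \<inter> rim z h1 = rimpt h1 ` {(0, 1), (- 1, 0), (0, - 1), (1, 0)}"
  proof (rule skel_rim[OF kU])
    show "0 \<notin> {(0, 1), (- 1, 0), (0, - 1), (1 :: real, 0 :: real)}" using dn0 by auto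
    fix y :: "real \<times> real" assume nz: "y \<noteq> 0"
    have "\<not> (fst y = 0 \<and> snd y = 0)" using nz by (auto simp: prod_eq_iff)
    then have "tie (LQ 2 0 y) \<noteq> {} \<longleftrightarrow> (fst y = 0 \<and> 2 * 0 < s2 * snd y) \<or> (snd y = 0 \<and> 2 * 0 < - s1 * fst y) \<or>
      (fst y = 0 \<and> 2 * 0 < - s4 * snd y) \<or> (snd y = 0 \<and> 2 * 0 < s3 * fst y)"
      unfolding square_tie[of 0 y, OF order_refl] using sgn_facts[of y] by simp (smt (verit))
    also have "\<dots> \<longleftrightarrow> (\<exists>d'\<in>{(0, 1), (- 1, 0), (0, - 1), (1, 0)}. \<exists>\<tau>>0. y = \<tau> *\<^sub>R d')"
      unfolding square_labels[of 0 y, OF order_refl, symmetric] rays0 by simp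
    finally show "tie (LQ (k - card U) 0 y) \<noteq> {} \<longleftrightarrow> (\<exists>d'\<in>{(0, 1), (- 1, 0), (0, - 1), (1, 0)}. \<exists>\<tau>>0. y = \<tau> *\<^sub>R d')"
      unfolding k1 .
  qed
  have ex: "\<exists>\<alpha> s. spoke \<Lambda> z h1 \<alpha> s (U \<union> {a,b,c}, L \<union> {a,c,d}) \<and> \<alpha> s = rimpt h1 (0, 1)"
    "\<exists>\<alpha> s. spoke \<Lambda> z h1 \<alpha> s (U \<union> {b,c,d}, L \<union> {a,b,d}) \<and> \<alpha> s = rimpt h1 (- 1, 0)"
    "\<exists>\<alpha> s. spoke \<Lambda> z h1 \<alpha> s (U \<union> {a,c,d}, L \<union> {a,b,c}) \<and> \<alpha> s = rimpt h1 (0, - 1)"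
    "\<exists>\<alpha> s. spoke \<Lambda> z h1 \<alpha> s (U \<union> {a,b,d}, L \<union> {b,c,d}) \<and> \<alpha> s = rimpt h1 (1, 0)"
    using sp1(1,2) sp2(1,2) sp3(1,2) sp4(1,2) unfolding P1_def P2_def P3_def P4_def by blast+
  have four: "i = 0 \<or> i = 1 \<or> i = 2 \<or> i = 3" if "i < 4" for i :: nat using that by linarith
  have neq: "{a,b,c} \<noteq> {b,c,d}" "{a,b,c} \<noteq> {a,c,d}" "{a,b,c} \<noteq> {a,b,d}" "{b,c,d} \<noteq> {a,c,d}" "{b,c,d} \<noteq> {a,b,d}" "{a,c,d} \<noteq> {a,b,d}"
    using distinct_simps by (simp_all add: set_eq_iff) blast+
  have "crossed_by_four_edges z h1 (gr k \<Lambda>) (map (rimpt h1) [(0, 1), (- 1, 0), (0, - 1), (1, 0)])"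
  proof (rule crossing_view[where Xs = "[{a,b,c}, {b,c,d}, {a,c,d}, {a,b,d}]" and Ys = "[{a,c,d}, {a,b,d}, {a,b,c}, {b,c,d}]"])
    show "[{a,b,c}, {b,c,d}, {a,c,d}, {a,b,d}] ! i \<subseteq> Q \<and> [{a,c,d}, {a,b,d}, {a,b,c}, {b,c,d}] ! i \<subseteq> Q" if "i < 4" for i
      using four[OF that] subQ by auto
    show "\<exists>\<alpha> s. spoke \<Lambda> z h1 \<alpha> s (U \<union> [{a,b,c}, {b,c,d}, {a,c,d}, {a,b,d}] ! i, L \<union> [{a,c,d}, {a,b,d}, {a,b,c}, {b,c,d}] ! i) \<and> \<alpha> s = rimpt h1 ([(0, 1), (- 1, 0), (0, - 1), (1, 0)] ! i)" if "i < 4" for i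
      using four[OF that] ex by (elim disjE) simp_all
    show "distinct (zip [{a,b,c}, {b,c,d}, {a,c,d}, {a,b,d}] [{a,c,d}, {a,b,d}, {a,b,c}, {b,c,d}])" using neq by simp
  qed (use cyc skr in \<open>auto simp: P1_def P2_def P3_def P4_def\<close>)
  then have cr: "crossed_by_four_edges z h1 (gr k \<Lambda>) [P1, P2, P3, P4]" unfolding P1_def P2_def P3_def P4_def by simp
  show ?thesis
  proof (intro exI conjI)
    show "crossed_by_four_edges z h1 (gr k \<Lambda>) [P1, P2, P3, P4]" by (rule cr)
    show "distinct [v1, v2, v3, v4]" unfolding v using VV g_inj by simp
    show "drawn_inside z h1 (skel (gr k \<Lambda>)) [(v1, v2), (v2, v3), (v3, v4), (v4, v1), (v1, P1), (v2, P2), (v3, P3), (v4, P4)]" by (rule drawn)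
    show "white (gr k \<Lambda>) \<inter> left_side z h1 = {v1, v3}" unfolding w v by simp
    show "black (gr k \<Lambda>) \<inter> left_side z h1 = {v2, v4}" unfolding b v by simp
    show "{v1, v3} = (\<lambda>y. g (pl y)) ` {(0, 2 * \<gamma> / s2), (0, - 2 * \<gamma> / s4)}" unfolding v V_defs by simp
    show "{v2, v4} = (\<lambda>y. g (pl y)) ` {(- 2 * \<gamma> / s1, 0), (2 * \<gamma> / s3, 0)}" unfolding v V_defs by simp
  qed
qed

end

section \<open>Rescaling a cap radially\<close>

text \<open>Radial rescaling: on each ray, the point where the first gauge is \<open>\<mu>\<close> moves to the point where
  the second gauge is \<open>\<mu>\<close>. The slope of \<open>\<sigma> * cutoff K \<sigma>\<close> lies between \<open>-1/K\<close> and \<open>1\<close>.\<close>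

definition cutoff :: "real \<Rightarrow> real \<Rightarrow> real" where
  "cutoff K \<sigma> = max 0 (min 1 ((1 + 1 / K) / \<sigma> - 1 / K))"

lemma cutoff_range: "0 \<le> cutoff K \<sigma>" "cutoff K \<sigma> \<le> 1"
  by (auto simp: cutoff_def)

lemma cutoff_one: "0 < K \<Longrightarrow> cutoff K 1 = 1" by (simp add: cutoff_def)

lemma cutoff_far:
  assumes "0 < K" "1 + K \<le> \<sigma>"
  shows "cutoff K \<sigma> = 0"
proof -
  have "1 + 1 / K = (1 + K) * (1 / K)" using assms by (simp add: field_simps)
  then have "(1 + 1 / K) / (1 + K) = 1 / K" using assms by simp
  moreover have "(1 + 1 / K) / \<sigma> \<le> (1 + 1 / K) / (1 + K)" using assms by (intro divide_left_mono) auto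
  ultimately have "(1 + 1 / K) / \<sigma> - 1 / K \<le> 0" by linarith
  then show ?thesis unfolding cutoff_def by linarith
qed

lemma cutoff_mult: "0 < \<sigma> \<Longrightarrow> \<sigma> * cutoff K \<sigma> = max 0 (min \<sigma> ((1 + 1 / K) - \<sigma> / K))"
proof -
  assume s: "0 < \<sigma>"
  have "\<sigma> * ((1 + 1 / K) / \<sigma>) = 1 + 1 / K" using s by simp
  then have "\<sigma> * ((1 + 1 / K) / \<sigma> - 1 / K) = (1 + 1 / K) - \<sigma> / K" by (simp add: right_diff_distrib)
  then show ?thesis unfolding cutoff_def using s
    by (simp add: max_mult_distrib_left min_mult_distrib_left)
qed

text \<open>Here \<sigma> is the first gauge in units of the level, and \<kappa> the ratio of the
  gauges on the ray. Stretching by \<kappa> > 1 cannot fold the ray because the cutoff decays with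
  slope at least -1/K and \<kappa> - 1 < K; shrinking cannot because the slope is at most 1 and
  \<kappa> is positive.\<close>

lemma radial_strict_mono:
  assumes K: "1 \<le> K" and \<kappa>: "0 < \<kappa>" "\<kappa> \<le> K" and t: "0 \<le> t" "t \<le> 1" and \<sigma>: "0 < \<sigma>" "\<sigma> < \<sigma>'"
  shows "\<sigma> * (1 + t * ((\<kappa> - 1) * cutoff K \<sigma>)) < \<sigma>' * (1 + t * ((\<kappa> - 1) * cutoff K \<sigma>'))"
proof -
  define \<tau> where "\<tau> = (\<lambda>\<sigma>. max 0 (min \<sigma> ((1 + 1 / K) - \<sigma> / K)))"
  define D where "D = \<tau> \<sigma>' - \<tau> \<sigma>"
  have q: "0 \<le> \<sigma>' / K - \<sigma> / K" "\<sigma>' / K - \<sigma> / K = (\<sigma>' - \<sigma>) / K" using K \<sigma> by (auto simp: diff_divide_distrib divide_right_mono)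
  have "(\<sigma>' - \<sigma>) / K \<le> \<sigma>' - \<sigma>" using K \<sigma> by (simp add: divide_le_eq)
  then have D: "D \<le> \<sigma>' - \<sigma>" "- ((\<sigma>' - \<sigma>) / K) \<le> D"
    unfolding D_def \<tau>_def using q \<sigma> by linarith+
  have e: "x * (1 + t * ((\<kappa> - 1) * cutoff K x)) = x + t * (\<kappa> - 1) * \<tau> x" if "0 < x" for x
    unfolding \<tau>_def cutoff_mult[OF that, symmetric] by (simp add: algebra_simps)
  have "0 < (\<sigma>' - \<sigma>) + t * (\<kappa> - 1) * D"
  proof (cases "1 \<le> \<kappa>")
    case True
    have "t * (\<kappa> - 1) \<le> \<kappa> - 1" using True t mult_right_mono[of t 1 "\<kappa> - 1"] by simp
    then have "t * (\<kappa> - 1) < K" using \<kappa> by linarith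
    moreover have "t * (\<kappa> - 1) * (- ((\<sigma>' - \<sigma>) / K)) \<le> t * (\<kappa> - 1) * D" using True t D by (intro mult_left_mono) auto
    moreover have "t * (\<kappa> - 1) * ((\<sigma>' - \<sigma>) / K) < K * ((\<sigma>' - \<sigma>) / K)"
      using \<open>t * (\<kappa> - 1) < K\<close> \<sigma> K by (intro mult_strict_right_mono) auto
    moreover have "K * ((\<sigma>' - \<sigma>) / K) = \<sigma>' - \<sigma>" using K by simp
    ultimately show ?thesis by linarith
  next
    case False
    have "t * (1 - \<kappa>) * D \<le> t * (1 - \<kappa>) * (\<sigma>' - \<sigma>)" using False t D by (intro mult_left_mono) auto
    also have "\<dots> \<le> 1 * (1 - \<kappa>) * (\<sigma>' - \<sigma>)" using False t \<sigma> by (intro mult_right_mono) auto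
    also have "\<dots> < \<sigma>' - \<sigma>" using \<kappa> \<sigma> by simp
    finally show ?thesis by (simp add: algebra_simps)
  qed
  moreover have "t * (\<kappa> - 1) * D = t * (\<kappa> - 1) * \<tau> \<sigma>' - t * (\<kappa> - 1) * \<tau> \<sigma>"
    unfolding D_def by (rule right_diff_distrib)
  moreover have "0 < \<sigma>'" using \<sigma> by simp
  ultimately show ?thesis unfolding e[OF \<sigma>(1)] e[OF \<open>0 < \<sigma>'\<close>] by linarith
qed

context cap_plane
begin

definition uw :: "point \<Rightarrow> real \<times> real" where "uw p = (p \<bullet> u, p \<bullet> w)"

context
  fixes n n' :: "real \<times> real \<Rightarrow> real" and K \<mu> :: real
  assumes cn: "continuous_on UNIV n" "continuous_on UNIV n'"
    and npos: "\<And>y. y \<noteq> 0 \<Longrightarrow> 0 < n y" "\<And>y. y \<noteq> 0 \<Longrightarrow> 0 < n' y"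
    and hom: "\<And>r y. 0 \<le> r \<Longrightarrow> n (r *\<^sub>R y) = r * n y" "\<And>r y. 0 \<le> r \<Longrightarrow> n' (r *\<^sub>R y) = r * n' y"
    and K: "1 \<le> K" "\<And>y. n y \<le> K * n' y" and \<mu>: "0 < \<mu>"
begin

text \<open>The relative stretch, written homogeneously so that it makes sense on the whole sphere.
  For \<open>z \<bullet> p\<close> not positive the argument of \<open>cutoff\<close> is at most 0,
  also by the value of division by zero, and \<open>cutoff\<close> vanishes; so nothing moves
  outside the cap.\<close>

definition rk :: "point \<Rightarrow> real" where
  "rk p = (n (uw p) / n' (uw p) - 1) * cutoff K (n (uw p) / (\<mu> * (z \<bullet> p)))"

definition rv :: "point \<Rightarrow> point" where "rv p = rk p *\<^sub>R tv (uw p)"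

lemma n0: "n 0 = 0" "n' 0 = 0" using hom[of 0 0] by auto

lemma nnonneg: "0 \<le> n y" "0 \<le> n' y" using npos[of y] n0 by (cases "y = 0"; simp add: less_imp_le)+

lemma ratio: "y \<noteq> 0 \<Longrightarrow> 0 < n y / n' y" "n y / n' y \<le> K"
proof -
  show "y \<noteq> 0 \<Longrightarrow> 0 < n y / n' y" using npos by simp
  show "n y / n' y \<le> K"
    using K nnonneg(2)[of y] by (cases "n' y = 0") (auto simp: divide_le_eq)
qed

lemma decompose: "p = (z \<bullet> p) *\<^sub>R z + tv (uw p)"
  using expand[of p] by (simp add: tv_def uw_def inner_commute add.assoc)

lemma rk_far:
  assumes "(1 + K) * (\<mu> * (z \<bullet> p)) \<le> n (uw p)"
  shows "rk p = 0"
proof (cases "0 < z \<bullet> p")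
  case True
  then have "1 + K \<le> n (uw p) / (\<mu> * (z \<bullet> p))" using assms \<mu> by (simp add: le_divide_eq)
  then show ?thesis unfolding rk_def using cutoff_far K(1) by simp
next
  case False
  then have "\<mu> * (z \<bullet> p) \<le> 0" using \<mu> by (simp add: mult_le_0_iff not_less)
  from divide_nonneg_nonpos[OF nnonneg(1) this] have "n (uw p) / (\<mu> * (z \<bullet> p)) \<le> 0" .
  moreover have "0 \<le> 1 + 1 / K" using K(1) by simp
  ultimately have "(1 + 1 / K) / (n (uw p) / (\<mu> * (z \<bullet> p))) \<le> 0" by (rule divide_nonneg_nonpos[rotated])
  moreover have "0 < 1 / K" using K(1) by simp
  ultimately have "cutoff K (n (uw p) / (\<mu> * (z \<bullet> p))) = 0" unfolding cutoff_def by linarith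
  then show ?thesis unfolding rk_def by simp
qed

lemma rk_bounds: "- 1 \<le> rk p" "rk p \<le> K" "uw p \<noteq> 0 \<Longrightarrow> - 1 < rk p"
proof -
  define A where "A = n (uw p) / n' (uw p) - 1"
  define C where "C = cutoff K (n (uw p) / (\<mu> * (z \<bullet> p)))"
  have C: "0 \<le> C" "C \<le> 1" unfolding C_def using cutoff_range by auto
  have A: "- 1 \<le> A" "A \<le> K" "uw p \<noteq> 0 \<Longrightarrow> - 1 < A"
    unfolding A_def using ratio[of "uw p"] nnonneg[of "uw p"] by auto
  have e: "rk p = A * C" unfolding rk_def A_def C_def ..
  have "A * C \<ge> min A 0" "A * C \<le> max A 0"
    using C mult_left_le[of C A] mult_nonneg_nonneg[of A C] mult_nonpos_nonneg[of A C] mult_left_le[of C "- A"]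
    by (cases "0 \<le> A"; simp)+
  then show "- 1 \<le> rk p" "rk p \<le> K" "uw p \<noteq> 0 \<Longrightarrow> - 1 < rk p" unfolding e using A K(1) by linarith+
qed

lemma rv_continuous: "continuous_on S2 rv"
  unfolding continuous_on_eq_continuous_within
proof
  fix p assume p: "p \<in> S2"
  have cuw: "continuous (at q within S) uw" for q S unfolding uw_def by (intro continuous_intros)
  have ctu: "continuous (at q within S) (\<lambda>q. tv (uw q))" for q S
    unfolding tv_def uw_def by (intro continuous_intros)
  show "continuous (at p within S2) rv"
  proof (cases "uw p = 0")
    case False
    have nn: "continuous (at p within S2) (\<lambda>q. n (uw q))" "continuous (at p within S2) (\<lambda>q. n' (uw q))"
    proof -
      have ic: "isCont n y" "isCont n' y" for y using cn continuous_on_eq_continuous_at[OF open_UNIV] by blast+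
      show "continuous (at p within S2) (\<lambda>q. n (uw q))" "continuous (at p within S2) (\<lambda>q. n' (uw q))"
        by (rule continuous_within_compose3[OF ic(1) cuw], rule continuous_within_compose3[OF ic(2) cuw])
    qed
    have pos: "n (uw p) \<noteq> 0" "n' (uw p) \<noteq> 0" using npos[OF False] by auto
    \<comment> \<open>\<open>cutoff\<close> divides by its argument, so \<open>z \<bullet> q\<close>
      moves to the numerator and its zeros cause no discontinuity. Only the axis
      \<open>uw p = 0\<close> needs the separate estimate below.\<close>
    have cutoff_eq: "cutoff K (n (uw q) / (\<mu> * (z \<bullet> q))) = max 0 (min 1 ((1 + 1 / K) * (\<mu> * (z \<bullet> q)) / n (uw q) - 1 / K))" for q
      unfolding cutoff_def by simp
    show ?thesis unfolding rv_def rk_def cutoff_eq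
      by (intro continuous_intros nn ctu pos)
  next
    case True
    have b: "norm (rv q) \<le> (K + 1) * norm (tv (uw q))" for q
      unfolding rv_def using rk_bounds(1,2)[of q] K(1) by (auto intro!: mult_right_mono)
    have "((\<lambda>q. (K + 1) * norm (tv (uw q))) \<longlongrightarrow> (K + 1) * norm (tv (uw p))) (at p within S2)"
      using ctu[of p S2] unfolding continuous_within by (intro tendsto_intros)
    then have "((\<lambda>q. (K + 1) * norm (tv (uw q))) \<longlongrightarrow> 0) (at p within S2)" unfolding True by (simp add: tv_0)
    then have "(rv \<longlongrightarrow> 0) (at p within S2)" by (rule Lim_null_comparison[rotated]) (simp add: b)
    moreover have "rv p = 0" unfolding rv_def True by (simp add: tv_0)
    ultimately show ?thesis unfolding continuous_within by simp
  qed
qed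

lemma radial_coords:
  assumes t: "t \<in> {0..1}"
  shows "z \<bullet> (p + t *\<^sub>R rv p) = z \<bullet> p" "uw (p + t *\<^sub>R rv p) = (1 + t * rk p) *\<^sub>R uw p" "0 \<le> 1 + t * rk p"
    "uw p \<noteq> 0 \<Longrightarrow> 0 < 1 + t * rk p"
proof -
  show "z \<bullet> (p + t *\<^sub>R rv p) = z \<bullet> p" unfolding rv_def by (simp add: inner_add tv_inner)
  show "uw (p + t *\<^sub>R rv p) = (1 + t * rk p) *\<^sub>R uw p"
    unfolding rv_def uw_def by (simp add: inner_add tv_inner algebra_simps)
  have "- 1 \<le> t * rk p" if "- 1 \<le> rk p"
  proof -
    have "t * (- 1) \<le> t * rk p" using t that by (intro mult_left_mono) auto
    then show ?thesis using t by simp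
  qed
  then show "0 \<le> 1 + t * rk p" using rk_bounds(1)[of p] by linarith
  show "0 < 1 + t * rk p" if "uw p \<noteq> 0"
  proof (cases "t = 0")
    case False
    then have "t * (- 1) < t * rk p" using t rk_bounds(3)[OF that] by (intro mult_strict_left_mono) auto
    then show ?thesis using t by simp
  qed simp
qed

text \<open>Points with parallel images have parallel tangential parts, hence the same ratio of
  gauges, and then strict monotonicity along the ray forces the same stretch.\<close>

lemma radial_isotopy: "isotopy_of_sphere (\<lambda>t p. sgn (p + t *\<^sub>R rv p))"
proof -
  have nz: "p + t *\<^sub>R rv p \<noteq> 0" if p: "p \<in> S2" and t: "t \<in> {0..1}" for p t
  proof
    assume 0: "p + t *\<^sub>R rv p = 0"
    then have "z \<bullet> p = 0" "(1 + t * rk p) *\<^sub>R uw p = 0"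
      using radial_coords(1,2)[OF t, of p] by (auto simp: uw_def zero_prod_def)
    then have "uw p = 0" using radial_coords(4)[OF t, of p] by (metis scaleR_eq_0_iff less_irrefl)
    then have "p = 0" using decompose[of p] \<open>z \<bullet> p = 0\<close> by (simp add: tv_0)
    then show False using p by simp
  qed
  have inj: "inj_on (\<lambda>p. sgn (p + t *\<^sub>R rv p)) S2" if t: "t \<in> {0..1}" for t
  proof (rule inj_onI)
    fix p q assume pq: "p \<in> S2" "q \<in> S2" and eq: "sgn (p + t *\<^sub>R rv p) = sgn (q + t *\<^sub>R rv q)"
    define P P' where "P = p + t *\<^sub>R rv p" and "P' = q + t *\<^sub>R rv q"
    have PP: "P \<noteq> 0" "P' \<noteq> 0" unfolding P_def P'_def using nz pq t by auto
    define lam where "lam = norm P / norm P'"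
    have lam: "0 < lam" unfolding lam_def using PP by simp
    have "P = norm P *\<^sub>R sgn P'" using eq norm_scaleR_sgn[of P] unfolding P_def P'_def by simp
    then have P: "P = lam *\<^sub>R P'" using PP unfolding lam_def by (simp add: sgn_div_norm divide_inverse)
    have c1: "z \<bullet> p = lam * (z \<bullet> q)"
      using radial_coords(1)[OF t, of p] radial_coords(1)[OF t, of q] P unfolding P_def P'_def by simp
    have "uw (lam *\<^sub>R P') = lam *\<^sub>R uw P'" unfolding uw_def by simp
    then have c2: "(1 + t * rk p) *\<^sub>R uw p = (lam * (1 + t * rk q)) *\<^sub>R uw q"
      using radial_coords(2)[OF t, of p] radial_coords(2)[OF t, of q] P unfolding P_def P'_def by simp
    have fin: "p = q" if "uw p = lam *\<^sub>R uw q"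
    proof -
      have "p = lam *\<^sub>R q" using decompose[of p] decompose[of q] c1 that
        by (metis scaleR_scaleR scaleR_add_right tv_linear(2))
      then have "lam = 1" using pq lam by simp
      then show ?thesis using \<open>p = lam *\<^sub>R q\<close> by simp
    qed
    show "p = q"
    proof (cases "uw p = 0 \<or> uw q = 0")
      case True
      have e: "(1 + t * rk x) *\<^sub>R uw x = 0 \<longleftrightarrow> uw x = 0" for x
        using radial_coords(4)[OF t, of x] by (metis scaleR_eq_0_iff less_irrefl)
      have "(1 + t * rk p) *\<^sub>R uw p = lam *\<^sub>R ((1 + t * rk q) *\<^sub>R uw q)" using c2 by simp
      then have "uw p = 0" "uw q = 0" using e[of p] e[of q] lam True by (metis scaleR_eq_0_iff less_irrefl)+
      then show ?thesis by (intro fin) simp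
    next
      case False
      then have nzs: "uw p \<noteq> 0" "uw q \<noteq> 0" by auto
      define m1 m2 where "m1 = 1 + t * rk p" and "m2 = 1 + t * rk q"
      have m: "0 < m1" "0 < m2" unfolding m1_def m2_def using radial_coords(4)[OF t] nzs by auto
      have c2': "m1 *\<^sub>R uw p = (lam * m2) *\<^sub>R uw q" using c2 unfolding m1_def m2_def .
      have na: "m1 * n (uw p) = (lam * m2) * n (uw q)" "m1 * n' (uw p) = (lam * m2) * n' (uw q)"
        using hom[of m1 "uw p"] hom[of "lam * m2" "uw q"] m lam c2' by auto
      have "n (uw p) / n' (uw p) = (m1 * n (uw p)) / (m1 * n' (uw p))" using m by simp
      also have "\<dots> = n (uw q) / n' (uw q)" unfolding na using m lam by simp
      finally have \<kappa>: "n (uw p) / n' (uw p) = n (uw q) / n' (uw q)" .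
      have "rk p = rk q"
      proof (cases "0 < z \<bullet> p")
        case False
        then have "z \<bullet> p \<le> 0" "z \<bullet> q \<le> 0" using c1 lam by (auto simp: mult_le_0_iff not_less)
        moreover have neg: "(1 + K) * (\<mu> * y) \<le> 0" if "y \<le> 0" for y
          using K(1) \<mu> that by (intro mult_nonneg_nonpos) auto
        \<comment> \<open>The heights have the same sign, so both points lie where the map is the
          identity.\<close>
        ultimately have "rk p = 0" "rk q = 0" by (intro rk_far order_trans[OF neg nnonneg(1)]; simp)+
        then show ?thesis by simp
      next
        case True
        then have zq: "0 < z \<bullet> q" using c1 lam by (simp add: zero_less_mult_iff)
        define a b where "a = n (uw p) / (\<mu> * (z \<bullet> p))" and "b = n (uw q) / (\<mu> * (z \<bullet> q))"
        define \<kappa>' where "\<kappa>' = n (uw q) / n' (uw q)"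
        have ab: "0 < a" "0 < b" unfolding a_def b_def using npos nzs True zq \<mu> by auto
        have e: "rk p = (\<kappa>' - 1) * cutoff K a" "rk q = (\<kappa>' - 1) * cutoff K b"
          unfolding rk_def \<kappa> a_def b_def \<kappa>'_def by simp_all
        have "a * m1 = (m1 * n (uw p)) / (\<mu> * (z \<bullet> p))" unfolding a_def by simp
        also have "\<dots> = b * m2" unfolding na c1 b_def using lam by simp
        finally have G: "a * m1 = b * m2" .
        have k: "1 \<le> K" "0 < \<kappa>'" "\<kappa>' \<le> K" "0 \<le> t" "t \<le> 1" using K ratio nzs t unfolding \<kappa>'_def by auto
        have "\<not> a < b" "\<not> b < a"
          using radial_strict_mono[OF k ab(1), of b] radial_strict_mono[OF k ab(2), of a] G unfolding m1_def m2_def e by auto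
        then have "a = b" by simp
        then show ?thesis unfolding e by simp
      qed
      then have "m1 *\<^sub>R uw p = m1 *\<^sub>R (lam *\<^sub>R uw q)" using c2' unfolding m1_def m2_def by (simp add: mult.commute)
      then have "uw p = lam *\<^sub>R uw q" using m(1) by (metis scaleR_cancel_left less_irrefl)
      then show ?thesis by (rule fin)
    qed
  qed
  show ?thesis unfolding isotopy_of_sphere_def
  proof (intro conjI ballI)
    show "continuous_on ({0..1} \<times> S2) (\<lambda>(t, p). sgn (p + t *\<^sub>R rv p))"
      unfolding split_beta
      by (rule continuous_on_sgn) (use nz in \<open>fastforce intro!: continuous_intros continuous_on_compose2[OF rv_continuous, where f=snd]\<close>)+
    show "\<exists>g. homeomorphism S2 S2 (\<lambda>p. sgn (p + t *\<^sub>R rv p)) g" if t: "t \<in> {0..1}" for t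
    proof (rule sphere_injection_homeomorphism[OF _ _ inj[OF t]])
      show "continuous_on S2 (\<lambda>p. sgn (p + t *\<^sub>R rv p))"
        by (rule continuous_on_sgn) (use nz[OF _ t] in \<open>fastforce intro!: continuous_intros rv_continuous\<close>)+
      show "(\<lambda>p. sgn (p + t *\<^sub>R rv p)) ` S2 \<subseteq> S2" using nz[OF _ t] by (auto simp: norm_sgn)
    qed
    show "sgn (p + 0 *\<^sub>R rv p) = p" if "p \<in> S2" for p using that by (simp add: sgn_div_norm)
  qed
qed

lemma radial_fixes:
  assumes "p \<in> S2" "(1 + K) * (\<mu> * (z \<bullet> p)) \<le> n (uw p)"
  shows "sgn (p + rv p) = p"
  using assms rk_far[OF assms(2)] by (simp add: rv_def sgn_div_norm)

text \<open>The position relative to the level \<mu> is recorded because a quadrilateral is a level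
  set of its gauge and the half-axes of the skeleton are cut from the superlevel set. The ray itself
  is preserved, hence also the axes.\<close>

lemma radial_pl:
  obtains m where "0 < m" "sgn (pl y + rv (pl y)) = pl (m *\<^sub>R y)"
    "n' (m *\<^sub>R y) = \<mu> \<longleftrightarrow> n y = \<mu>" "\<mu> < n' (m *\<^sub>R y) \<longleftrightarrow> \<mu> < n y"
proof -
  define Y where "Y = z \<bullet> pl y"
  have Y: "0 < Y" unfolding Y_def by (rule z_pl_pos)
  have uw: "uw (pl y) = Y *\<^sub>R y" unfolding uw_def Y_def pl_inner by (simp add: prod_eq_iff)
  define k where "k = rk (pl y)"
  have plY: "pl y = Y *\<^sub>R (z + tv y)"
    using decompose[of "pl y"] unfolding uw tv_linear Y_def[symmetric] by (simp add: scaleR_add_right)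
  have s: "sgn (pl y + rv (pl y)) = pl ((1 + k) *\<^sub>R y)"
  proof -
    have "rv (pl y) = Y *\<^sub>R (k *\<^sub>R tv y)" unfolding rv_def uw tv_linear k_def by (simp add: mult.commute)
    then have "pl y + rv (pl y) = Y *\<^sub>R (z + tv ((1 + k) *\<^sub>R y))"
      using plY by (simp add: tv_linear algebra_simps)
    then show ?thesis using Y unfolding pl_def[of "(1 + k) *\<^sub>R y"] by (simp add: sgn_scaleR)
  qed
  show ?thesis
  proof (cases "y = 0")
    case True
    then show ?thesis using that[of 1] s n0 \<mu> by simp
  next
    case False
    have nz: "uw (pl y) \<noteq> 0" unfolding uw using Y False by simp
    have k1: "0 < 1 + k" using radial_coords(4)[of 1 "pl y"] nz unfolding k_def by simp
    define \<kappa> \<sigma> where "\<kappa> = n y / n' y" and "\<sigma> = n y / \<mu>"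
    have pos: "0 < n y" "0 < n' y" "0 < \<kappa>" "0 < \<sigma>" "\<kappa> \<le> K" unfolding \<kappa>_def \<sigma>_def using npos[OF False] \<mu> ratio(2) by auto
    have "k = (\<kappa> - 1) * cutoff K \<sigma>"
      unfolding k_def rk_def uw Y_def[symmetric] using Y hom[of Y y] by (simp add: \<kappa>_def \<sigma>_def)
    then have G: "\<kappa> * n' ((1 + k) *\<^sub>R y) = \<mu> * (\<sigma> * (1 + 1 * ((\<kappa> - 1) * cutoff K \<sigma>)))"
      using hom(2)[of "1 + k" y] k1 pos \<mu> unfolding \<kappa>_def \<sigma>_def by simp
    have G1: "1 * (1 + 1 * ((\<kappa> - 1) * cutoff K 1)) = \<kappa>" using cutoff_one[of K] K(1) by simp
    have mono: "\<sigma> < 1 \<Longrightarrow> \<sigma> * (1 + 1 * ((\<kappa> - 1) * cutoff K \<sigma>)) < \<kappa>" "1 < \<sigma> \<Longrightarrow> \<kappa> < \<sigma> * (1 + 1 * ((\<kappa> - 1) * cutoff K \<sigma>))"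
      "\<sigma> = 1 \<Longrightarrow> \<sigma> * (1 + 1 * ((\<kappa> - 1) * cutoff K \<sigma>)) = \<kappa>"
      using radial_strict_mono[of K \<kappa> 1 \<sigma> 1] radial_strict_mono[of K \<kappa> 1 1 \<sigma>] pos K(1) unfolding G1 by (simp, simp, use G1 in simp)
    define X where "X = \<sigma> * (1 + 1 * ((\<kappa> - 1) * cutoff K \<sigma>))"
    have e: "n' ((1 + k) *\<^sub>R y) = \<mu> * (X / \<kappa>)" using G pos unfolding X_def by (simp add: field_simps)
    have X: "X < \<kappa> \<longleftrightarrow> \<sigma> < 1" "X = \<kappa> \<longleftrightarrow> \<sigma> = 1" "\<kappa> < X \<longleftrightarrow> 1 < \<sigma>"
      using mono unfolding X_def[symmetric] by (metis less_asym less_irrefl linorder_less_linear)+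
    have "n' ((1 + k) *\<^sub>R y) = \<mu> \<longleftrightarrow> X = \<kappa>" "\<mu> < n' ((1 + k) *\<^sub>R y) \<longleftrightarrow> \<kappa> < X"
      unfolding e using \<mu> pos by (auto simp: field_simps)
    moreover have "\<sigma> = 1 \<longleftrightarrow> n y = \<mu>" "1 < \<sigma> \<longleftrightarrow> \<mu> < n y" unfolding \<sigma>_def using \<mu> by (auto simp: field_simps)
    ultimately show ?thesis using that[OF k1 s] X by simp
  qed
qed

end

end

section \<open>Local moves at a wall\<close>

definition sw :: "bigraph \<Rightarrow> bigraph" where
  "sw G = \<lparr> white = black G, black = white G, skel = skel G \<rparr>"

lemma sw_simps: "white (sw G) = black G" "black (sw G) = white G" "skel (sw G) = skel G"
  by (simp_all add: sw_def)

lemma flip_move_sw: "flip_move black white c h (sw G) (sw G') = flip_move white black c h G G'"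
proof -
  have oe: "open_edges (sw G) = open_edges G" for G unfolding open_edges_def sw_simps by (simp add: Un_commute)
  have cr: "crossed_by_four_edges c h (sw G) ps = crossed_by_four_edges c h G ps" for G ps
    unfolding crossed_by_four_edges_def oe sw_simps ..
  have un: "unchanged_outside c h (sw G) (sw G') = unchanged_outside c h G G'"
    unfolding unchanged_outside_def sw_simps by blast
  show ?thesis unfolding flip_move_def cr un sw_simps ..
qed

lemma tie_swap: "tie (prod.swap l) = tie l" by (auto simp: tie_def)

lemma lab_neg:
  assumes "finite I" "k \<le> card I"
  shows "lab (card I - k) I (\<lambda>i. - x i) p = prod.swap (lab k I x p)"
  using hi_uminus[OF assms, of "\<lambda>i. p \<bullet> x i"] lo_uminus[OF assms, of "\<lambda>i. p \<bullet> x i"] by (simp add: lab_def)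

lemma card_lo_hi:
  assumes "finite I" "proper k I \<Lambda>" "p \<in> S2"
  shows "card (fst (\<Lambda> p)) + card (snd (\<Lambda> p)) = card I + card (tie (\<Lambda> p))"
proof -
  have "fst (\<Lambda> p) \<union> snd (\<Lambda> p) = I" using assms unfolding proper_def by blast
  then show ?thesis using card_Un_Int[of "fst (\<Lambda> p)" "snd (\<Lambda> p)"] assms(1) unfolding tie_def by (metis finite_Un)
qed

text \<open>The two parts of a label cover I and share three dots, so their sizes add up to n + 3;
  this exchanges k + 2 at order k with n - k + 1 at order n - k.\<close>

lemma swap_colors:
  assumes "finite I" "proper k I \<Lambda>" "p \<in> S2" "k \<le> card I" "card (tie (\<Lambda> p)) = 3"
  shows "card (snd (\<Lambda> p)) = (card I - k) + 1 \<longleftrightarrow> card (fst (\<Lambda> p)) = k + 2"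
    "card (snd (\<Lambda> p)) = (card I - k) + 2 \<longleftrightarrow> card (fst (\<Lambda> p)) = k + 1"
  using card_lo_hi[OF assms(1-3)] assms(4,5) by linarith+

lemma gr_swap:
  assumes "finite I" "k \<le> card I" "proper k I \<Lambda>"
  shows "gr (card I - k) (\<lambda>p. prod.swap (\<Lambda> p)) = sw (gr k \<Lambda>)"
  using swap_colors[OF assms(1,3) _ assms(2)] unfolding sw_def gr_simps unfolding gr_def tie_swap
  by (auto simp del: add_Suc_right)

lemma proper_swap:
  assumes "finite I" "k \<le> card I" "proper k I \<Lambda>"
  shows "proper (card I - k) I (\<lambda>p. prod.swap (\<Lambda> p))"
  unfolding proper_def
proof (intro ballI conjI)
  fix p assume p: "p \<in> S2"
  note P = assms(3)[unfolded proper_def, rule_format, OF p]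
  show "fst (prod.swap (\<Lambda> p)) \<union> snd (prod.swap (\<Lambda> p)) = I" using P by auto
  show "tie (prod.swap (\<Lambda> p)) = {} \<or> card (tie (prod.swap (\<Lambda> p))) = 2 \<or> card (tie (prod.swap (\<Lambda> p))) = 3 \<and>
     (card (fst (prod.swap (\<Lambda> p))) = card I - k + 1 \<or> card (fst (prod.swap (\<Lambda> p))) = card I - k + 2)"
    unfolding tie_swap using P swap_colors[OF assms(1,3) p assms(2)] by auto
  show "\<exists>e>0. \<forall>q\<in>S2. dist q p < e \<longrightarrow> fst (prod.swap (\<Lambda> q)) \<subseteq> fst (prod.swap (\<Lambda> p)) \<and> snd (prod.swap (\<Lambda> q)) \<subseteq> snd (prod.swap (\<Lambda> p))"
    using P by auto
qed

lemma pert_uminus: "pert (\<lambda>i. - x0 i) z a b c d \<gamma> = (\<lambda>i. - pert x0 z a b c d (- \<gamma>) i)"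
  by (auto simp: pert_def fun_eq_iff)

lemma pert_z_uminus: "pert x0 (- z) a b c d \<gamma> = pert x0 z a b c d (- \<gamma>)"
  by (auto simp: pert_def fun_eq_iff)

context cap_frame
begin

lemma pe_0: "pe 0 = x0" by (auto simp: pert_def fun_eq_iff)

text \<open>Negating the dots and the tangent directions, but not \<open>z\<close>, reverses the
  ranking within the same cap and exchanges the roles of \<open>U\<close> and \<open>L\<close>; this
  reduces white flips to black ones.\<close>

lemma negated: "cap_frame z (- u) (- w) (- us) (- ws) I (\<lambda>i. - x0 i) (- cc) a b c d s1 s2 s3 s4"
proof (unfold_locales)
  show "p = (p \<bullet> z) *\<^sub>R z + (p \<bullet> - u) *\<^sub>R - us + (p \<bullet> - w) *\<^sub>R - ws" for p
    using expand[of p] by simp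
  show "z \<bullet> - x0 i \<noteq> z \<bullet> - cc" if "i \<in> I - {a,b,c,d}" for i using off[of i] that by auto
qed (use z1 zu zw zus zws dual finI dis inI s x0 in \<open>auto simp: inner_commute\<close>)

text \<open>The same dots seen from the other pole of their circle.\<close>

lemma antipodal: "cap_frame (- z) u w us ws I x0 cc a b c d s1 s2 s3 s4"
proof (unfold_locales)
  show "p = (p \<bullet> - z) *\<^sub>R - z + (p \<bullet> u) *\<^sub>R us + (p \<bullet> w) *\<^sub>R ws" for p
    using expand[of p] by simp
  show "- z \<bullet> x0 i \<noteq> - z \<bullet> cc" if "i \<in> I - {a,b,c,d}" for i using off[of i] that by auto
qed (use z1 zu zw zus zws dual finI dis inI s x0 in \<open>auto simp: inner_commute\<close>)

lemma rotated_tv: "cap_plane.tv ws (- us) y = tv (- snd y, fst y)"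
proof -
  interpret R: cap_frame z w "- u" ws "- us" I x0 cc b c d a s2 s3 s4 s1 by (rule rotated)
  show ?thesis unfolding R.tv_def tv_def by simp
qed

lemma rotated_pl: "cap_plane.pl z ws (- us) y = pl (- snd y, fst y)"
proof -
  interpret R: cap_frame z w "- u" ws "- us" I x0 cc b c d a s2 s3 s4 s1 by (rule rotated)
  show ?thesis unfolding R.pl_def pl_def rotated_tv ..
qed

lemma rotated_rimpt: "cap_plane.rimpt z ws (- us) h y = rimpt h (- snd y, fst y)"
proof -
  interpret R: cap_frame z w "- u" ws "- us" I x0 cc b c d a s2 s3 s4 s1 by (rule rotated)
  show ?thesis unfolding R.rimpt_def rimpt_def rotated_tv rotated_pl R.rad_def rad_def by simp
qed

lemma rotated_sets: "cap_frame.Q b c d a = Q" "cap_frame.sep z I x0 cc b c d a = sep"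
proof -
  interpret R: cap_frame z w "- u" ws "- us" I x0 cc b c d a s2 s3 s4 s1 by (rule rotated)
  show e: "R.Q = Q" unfolding R.Q_def Q_def by auto
  show "R.sep = sep" unfolding R.sep_def sep_def e ..
qed

text \<open>\<open>A\<close> and \<open>C\<close> are the labels for the dots before and after the move, pulled back so as to agree
  away from \<open>z\<close>.\<close>

definition move_data :: "nat \<Rightarrow> real \<Rightarrow> real \<Rightarrow> real \<Rightarrow> real \<Rightarrow> real \<Rightarrow> (point \<Rightarrow> 'i labels) \<Rightarrow> (point \<Rightarrow> 'i labels) \<Rightarrow> bool" where
  "move_data k \<gamma> r \<epsilon> h1 h2 A C \<longleftrightarrow> 0 < \<gamma> \<and> 0 \<le> \<epsilon> \<and> 0 < h2 \<and> h2 + \<epsilon> < h1 \<and> h1 < 1 \<and>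
     (\<forall>s\<in>{s1, s2, s3, s4}. 2 * \<gamma> / s \<le> r) \<and> (\<forall>y. \<bar>fst y\<bar> \<le> r \<longrightarrow> \<bar>snd y\<bar> \<le> r \<longrightarrow> h1 + \<epsilon> < z \<bullet> pl y) \<and>
     sep (pe \<gamma>) h2 \<and> sep (pe (- \<gamma>)) h2 \<and> sep x0 h2 \<and> proper k I A \<and> proper k I C \<and>
     (\<forall>p\<in>S2. z \<bullet> p \<le> h1 \<longrightarrow> A p = C p) \<and> (\<forall>p\<in>S2. z \<bullet> p = h1 \<longrightarrow> A p = lab k I x0 p)"

definition viewed :: "nat \<Rightarrow> real \<Rightarrow> real \<Rightarrow> real \<Rightarrow> (point \<Rightarrow> 'i labels) \<Rightarrow> bool" where
  "viewed k \<gamma> \<epsilon> h2 \<Lambda> \<longleftrightarrow> (\<exists>h g. homeomorphism S2 S2 h g \<and> (\<forall>p\<in>S2. norm (h p - p) \<le> \<epsilon>) \<and>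
     (\<forall>p\<in>S2. h2 - \<epsilon> \<le> z \<bullet> p \<longrightarrow> \<Lambda> p = lab k I (pe \<gamma>) (h p)))"

lemma unchanged_gr:
  assumes "\<And>p. p \<in> S2 \<Longrightarrow> z \<bullet> p \<le> h1 \<Longrightarrow> A p = C p"
  shows "unchanged_outside z h1 (gr k A) (gr k C)"
  using assms unfolding unchanged_outside_def gr_simps left_side_def by (auto simp: not_less)

text \<open>\<open>A\<close> is viewed in the given frame and \<open>C\<close> in the turned one.
  The shift by one in the numbering of the rim points is exactly the new pairing that a flip
  demands.\<close>

lemma flip_move_gr:
  assumes M: "move_data k \<gamma> r \<epsilon> h1 h2 A C" and vA: "viewed k \<gamma> \<epsilon> h2 A" and vC: "viewed k (- \<gamma>) \<epsilon> h2 C"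
    and k: "k = card U + 1"
  shows "flip_move black white z h1 (gr k A) (gr k C)"
proof -
  note D = M[unfolded move_data_def]
  have h1: "0 < h1" "h1 < 1" using D by auto
  have sm: "h1 + \<epsilon> < z \<bullet> pl y" if "\<bar>fst y\<bar> \<le> r" "\<bar>snd y\<bar> \<le> r" for y using D that by blast
  have rb: "\<bar>2 * \<gamma> / s1\<bar> \<le> r" "\<bar>2 * \<gamma> / s2\<bar> \<le> r" "\<bar>2 * \<gamma> / s3\<bar> \<le> r" "\<bar>2 * \<gamma> / s4\<bar> \<le> r"
    using D s by auto
  have r0: "0 \<le> r" using rb(1) abs_ge_zero order_trans by blast
  obtain hA gA where A: "homeomorphism S2 S2 hA gA" "\<forall>p\<in>S2. norm (hA p - p) \<le> \<epsilon>" "\<forall>p\<in>S2. h2 - \<epsilon> \<le> z \<bullet> p \<longrightarrow> A p = lab k I (pe \<gamma>) (hA p)"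
    using vA unfolding viewed_def by blast
  obtain hC gC where C: "homeomorphism S2 S2 hC gC" "\<forall>p\<in>S2. norm (hC p - p) \<le> \<epsilon>" "\<forall>p\<in>S2. h2 - \<epsilon> \<le> z \<bullet> p \<longrightarrow> C p = lab k I (pe (- \<gamma>)) (hC p)"
    using vC unfolding viewed_def by blast
  interpret A: cap_view z u w us ws I x0 cc a b c d s1 s2 s3 s4 k \<gamma> \<epsilon> h1 h2 hA gA A
  proof unfold_locales
    show "h1 + \<epsilon> < z \<bullet> pl y" if "y \<in> corners \<gamma>" for y
      by (rule sm) (use that rb r0 in auto)
  qed (use A D in auto)
  interpret R: cap_frame z w "- u" ws "- us" I x0 cc b c d a s2 s3 s4 s1 by (rule rotated)
  have pR: "pert x0 z b c d a \<gamma> = pe (- \<gamma>)" by (rule pert_rotate[OF dis])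
  interpret C: cap_view z w "- u" ws "- us" I x0 cc b c d a s2 s3 s4 s1 k \<gamma> \<epsilon> h1 h2 hC gC C
  proof unfold_locales
    show "h1 + \<epsilon> < z \<bullet> R.pl y" if "y \<in> {(2 * \<gamma> / s4, 0), (0, 2 * \<gamma> / s3), (- 2 * \<gamma> / s2, 0), (0, - 2 * \<gamma> / s1)}" for y
      unfolding rotated_pl by (rule sm) (use that rb r0 in auto)
    show "R.sep (pert x0 z b c d a \<gamma>) h2" "R.sep x0 h2" unfolding rotated_sets pR using D by auto
    show "C p = lab k I (pert x0 z b c d a \<gamma>) (hC p)" if "p \<in> S2" "h2 - \<epsilon> \<le> z \<bullet> p" for p using C(3) that unfolding pR by blast
    show "C p = lab k I x0 p" if "p \<in> S2" "z \<bullet> p = h1" for p using D that by (metis order_refl)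
  qed (use C D in auto)
  have cyc: "in_cyclic_order z h1 [rimpt h1 (s2, s1), rimpt h1 (- s2, s3), rimpt h1 (- s4, - s3), rimpt h1 (s4, - s1)]"
    by (rule cyclic_quadrants[OF h1]) (use s in auto)
  have kR: "k = card R.U + 1" using k by simp
  note FA = A.flip_half[OF k]
  note FC = C.flip_half[OF kR, unfolded rotated_rimpt, simplified]
  obtain u1 v1 where uv: "u1 \<noteq> v1" "black (gr k A) \<inter> left_side z h1 = {u1, v1}" "white (gr k A) \<inter> left_side z h1 = {}"
    "drawn_inside z h1 (skel (gr k A)) [(u1, v1), (u1, rimpt h1 (s2, s1)), (u1, rimpt h1 (- s2, s3)), (v1, rimpt h1 (- s4, - s3)), (v1, rimpt h1 (s4, - s1))]"
    using FA(1) by blast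
  obtain u2 v2 where uv2: "u2 \<noteq> v2" "black (gr k C) \<inter> left_side z h1 = {u2, v2}" "white (gr k C) \<inter> left_side z h1 = {}"
    "drawn_inside z h1 (skel (gr k C)) [(u2, v2), (u2, rimpt h1 (- s2, s3)), (u2, rimpt h1 (- s4, - s3)), (v2, rimpt h1 (s4, - s1)), (v2, rimpt h1 (s2, s1))]"
    using FC(1) by blast
  show ?thesis unfolding flip_move_def
  proof (intro conjI exI)
    show "unchanged_outside z h1 (gr k A) (gr k C)" by (rule unchanged_gr) (use D in blast)
    show "crossed_by_four_edges z h1 (gr k A) [rimpt h1 (s2, s1), rimpt h1 (- s2, s3), rimpt h1 (- s4, - s3), rimpt h1 (s4, - s1)]"
      by (rule FA(2)[OF cyc])
    show "crossed_by_four_edges z h1 (gr k C) [rimpt h1 (s2, s1), rimpt h1 (- s2, s3), rimpt h1 (- s4, - s3), rimpt h1 (s4, - s1)]"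
      by (rule FC(3)[OF cyc])
  qed (use uv uv2 in auto)
qed

text \<open>The gauge whose level \<open>2 * \<gamma>\<close> is the quadrilateral of
  \<open>square_tie\<close>. \<open>nM\<close> below plays the same role for
  \<open>pe (- \<gamma>)\<close>; up to the quarter turn it is \<open>nP\<close> of the turned
  frame.\<close>

definition nP :: "real \<times> real \<Rightarrow> real" where
  "nP y = max (s3 * fst y) (- s1 * fst y) + max (s2 * snd y) (- s4 * snd y)"

definition nM :: "real \<times> real \<Rightarrow> real" where
  "nM y = max (s4 * snd y) (- s2 * snd y) + max (s1 * fst y) (- s3 * fst y)"

abbreviation swapped :: "real \<Rightarrow> real \<Rightarrow> real \<times> real \<Rightarrow> bool" where
  "swapped \<gamma> m y \<equiv> (nM (m *\<^sub>R y) = 2 * \<gamma> \<longleftrightarrow> nP y = 2 * \<gamma>) \<and> (2 * \<gamma> < nM (m *\<^sub>R y) \<longleftrightarrow> 2 * \<gamma> < nP y)"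

lemma square_gauge:
  assumes "0 < \<gamma>"
  shows "tie (LQ 2 \<gamma> y) \<noteq> {} \<longleftrightarrow> nP y = 2 * \<gamma> \<or> 2 * \<gamma> < nP y \<and> (fst y = 0 \<or> snd y = 0)"
    "card (tie (LQ 2 \<gamma> y)) = 3 \<and> card (fst (LQ 2 \<gamma> y)) = 3 \<longleftrightarrow> fst y = 0 \<and> nP y = 2 * \<gamma>"
    "card (tie (LQ 2 \<gamma> y)) = 3 \<and> card (fst (LQ 2 \<gamma> y)) = 4 \<longleftrightarrow> snd y = 0 \<and> nP y = 2 * \<gamma>"
proof -
  have g0: "0 \<le> \<gamma>" using assms by simp
  show "tie (LQ 2 \<gamma> y) \<noteq> {} \<longleftrightarrow> nP y = 2 * \<gamma> \<or> 2 * \<gamma> < nP y \<and> (fst y = 0 \<or> snd y = 0)"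
    unfolding square_tie[OF g0] nP_def max_def using sgn_facts[of y] assms by simp (smt (verit))
  show "card (tie (LQ 2 \<gamma> y)) = 3 \<and> card (fst (LQ 2 \<gamma> y)) = 3 \<longleftrightarrow> fst y = 0 \<and> nP y = 2 * \<gamma>"
    unfolding square_vertex(1)[OF assms] nP_def max_def using sgn_facts[of y] assms by simp (smt (verit))
  show "card (tie (LQ 2 \<gamma> y)) = 3 \<and> card (fst (LQ 2 \<gamma> y)) = 4 \<longleftrightarrow> snd y = 0 \<and> nP y = 2 * \<gamma>"
    unfolding square_vertex(2)[OF assms] nP_def max_def using sgn_facts[of y] assms by simp (smt (verit))
qed

text \<open>A point belongs to the skeleton if it is on the quadrilateral, or beyond it on an axis,
  and \<open>R\<close> transports both conditions. The color of a vertex depends on its axis, and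
  the quarter turn between the two sides of the wall exchanges the axes: the skeleton is kept and
  the colors are swapped.\<close>

lemma square_move_gr:
  assumes M: "move_data k \<gamma> r \<epsilon> h1 h2 A C" and k: "k = card U + 2"
    and vA: "\<And>p. p \<in> S2 \<Longrightarrow> h2 - \<epsilon> \<le> z \<bullet> p \<Longrightarrow> A p = lab k I (pe \<gamma>) p"
    and vC: "\<And>p. p \<in> S2 \<Longrightarrow> h1 \<le> z \<bullet> p \<Longrightarrow> C p = lab k I (pe (- \<gamma>)) (R p)"
    and R: "\<And>y. h1 \<le> z \<bullet> pl y \<Longrightarrow> \<exists>m>0. R (pl y) = pl (m *\<^sub>R y) \<and> h2 \<le> z \<bullet> R (pl y) \<and> swapped \<gamma> m y"
  shows "move_Sq z h1 (gr k A) (gr k C)"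
proof -
  note D = M[unfolded move_data_def]
  have h1: "0 < h1" "h1 < 1" "h2 \<le> h1" using D by auto
  have \<gamma>: "0 < \<gamma>" using D by auto
  have sm: "h1 + \<epsilon> < z \<bullet> pl y" if "\<bar>fst y\<bar> \<le> r" "\<bar>snd y\<bar> \<le> r" for y using D that by blast
  have rb: "\<bar>2 * \<gamma> / s1\<bar> \<le> r" "\<bar>2 * \<gamma> / s2\<bar> \<le> r" "\<bar>2 * \<gamma> / s3\<bar> \<le> r" "\<bar>2 * \<gamma> / s4\<bar> \<le> r"
    using D s by auto
  have r0: "0 \<le> r" using rb(1) abs_ge_zero order_trans by blast
  have k1: "k - card U = 2" and kU: "card U \<le> k" "k \<le> card U + 4" using k by auto
  interpret A: cap_view z u w us ws I x0 cc a b c d s1 s2 s3 s4 k \<gamma> \<epsilon> h1 h2 "\<lambda>p. p" "\<lambda>p. p" A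
  proof unfold_locales
    show "h1 + \<epsilon> < z \<bullet> pl y" if "y \<in> corners \<gamma>" for y
      by (rule sm) (use that rb r0 in auto)
    show "homeomorphism S2 S2 (\<lambda>p. p) (\<lambda>p. p)" by (simp add: homeomorphism_def)
  qed (use vA D in auto)
  interpret R: cap_frame z w "- u" ws "- us" I x0 cc b c d a s2 s3 s4 s1 by (rule rotated)
  have pR: "pert x0 z b c d a \<gamma> = pe (- \<gamma>)" by (rule pert_rotate[OF dis])
  have labA: "A (pl y) = (U \<union> fst (LQ 2 \<gamma> y), L \<union> snd (LQ 2 \<gamma> y))" if "h1 \<le> z \<bullet> pl y" for y
  proof -
    have "h2 - \<epsilon> \<le> z \<bullet> pl y" "h2 \<le> z \<bullet> pl y" using that D by auto
    then show ?thesis using vA[OF pl_S2] lab_cap[of \<gamma> h2 y k] D kU unfolding k1 by simp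
  qed
  have nMR: "R.nP y = nM (- snd y, fst y)" for y
    unfolding R.nP_def nM_def by (simp add: max.commute add.commute)
  have labC: "\<exists>\<theta>. C (pl y) = (U \<union> fst (R.LQ 2 \<gamma> \<theta>), L \<union> snd (R.LQ 2 \<gamma> \<theta>)) \<and> (R.nP \<theta> = 2 * \<gamma> \<longleftrightarrow> nP y = 2 * \<gamma>) \<and>
    (2 * \<gamma> < R.nP \<theta> \<longleftrightarrow> 2 * \<gamma> < nP y) \<and> (fst \<theta> = 0 \<longleftrightarrow> snd y = 0) \<and> (snd \<theta> = 0 \<longleftrightarrow> fst y = 0)" if h: "h1 \<le> z \<bullet> pl y" for y
  proof -
    obtain m where m: "0 < m" "R (pl y) = pl (m *\<^sub>R y)" "h2 \<le> z \<bullet> R (pl y)" "nM (m *\<^sub>R y) = 2 * \<gamma> \<longleftrightarrow> nP y = 2 * \<gamma>" "2 * \<gamma> < nM (m *\<^sub>R y) \<longleftrightarrow> 2 * \<gamma> < nP y"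
      using R[OF h] by blast
    \<comment> \<open>The coordinates of \<open>pl (m *\<^sub>R y)\<close> in the turned
      frame.\<close>
    define \<theta> where "\<theta> = (m * snd y, - (m * fst y))"
    have pl\<theta>: "R.pl \<theta> = pl (m *\<^sub>R y)" unfolding rotated_pl \<theta>_def by (simp add: scaleR_prod_def)
    have "C (pl y) = lab k I (pert x0 z b c d a \<gamma>) (R.pl \<theta>)" unfolding pR pl\<theta> using vC[OF pl_S2 h] m(2) by simp
    also have "\<dots> = (R.U \<union> fst (R.LQ (k - card R.U) \<gamma> \<theta>), R.L \<union> snd (R.LQ (k - card R.U) \<gamma> \<theta>))"
      by (rule R.lab_cap[where h = h2]) (use m(2,3) pl\<theta> D kU in \<open>auto simp: rotated_sets pR\<close>)
    also have "\<dots> = (U \<union> fst (R.LQ 2 \<gamma> \<theta>), L \<union> snd (R.LQ 2 \<gamma> \<theta>))" unfolding rotated_sets k1 ..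
    finally have "C (pl y) = (U \<union> fst (R.LQ 2 \<gamma> \<theta>), L \<union> snd (R.LQ 2 \<gamma> \<theta>))" .
    moreover have "R.nP \<theta> = nM (m *\<^sub>R y)" unfolding nMR \<theta>_def by (simp add: scaleR_prod_def)
    moreover have "fst \<theta> = 0 \<longleftrightarrow> snd y = 0" "snd \<theta> = 0 \<longleftrightarrow> fst y = 0" unfolding \<theta>_def using m(1) by auto
    ultimately show ?thesis using m(4,5) by (intro exI[of _ \<theta>]) simp
  qed
  have key: "(tie (A p) \<noteq> {} \<longleftrightarrow> tie (C p) \<noteq> {}) \<and>
    (card (tie (C p)) = 3 \<and> card (fst (C p)) = k + 1 \<longleftrightarrow> card (tie (A p)) = 3 \<and> card (fst (A p)) = k + 2) \<and>
    (card (tie (C p)) = 3 \<and> card (fst (C p)) = k + 2 \<longleftrightarrow> card (tie (A p)) = 3 \<and> card (fst (A p)) = k + 1)"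
    if p: "p \<in> S2" "h1 \<le> z \<bullet> p" for p
  proof -
    define y where "y = co p"
    have pe: "pl y = p" unfolding y_def using pl_co p h1 by simp
    have h: "h1 \<le> z \<bullet> pl y" using p pe by simp
    obtain \<theta> where \<theta>: "C p = (U \<union> fst (R.LQ 2 \<gamma> \<theta>), L \<union> snd (R.LQ 2 \<gamma> \<theta>))" "R.nP \<theta> = 2 * \<gamma> \<longleftrightarrow> nP y = 2 * \<gamma>"
      "2 * \<gamma> < R.nP \<theta> \<longleftrightarrow> 2 * \<gamma> < nP y" "fst \<theta> = 0 \<longleftrightarrow> snd y = 0" "snd \<theta> = 0 \<longleftrightarrow> fst y = 0"
      using labC[OF h] unfolding pe by blast
    have Ap: "A p = (U \<union> fst (LQ 2 \<gamma> y), L \<union> snd (LQ 2 \<gamma> y))" using labA[OF h] unfolding pe .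
    have tA: "tie (A p) = tie (LQ 2 \<gamma> y)" "card (fst (A p)) = card U + card (fst (LQ 2 \<gamma> y))"
      unfolding Ap using lab_cap_tie[OF LQ_sub(1,2)] by simp_all
    have tC: "tie (C p) = tie (R.LQ 2 \<gamma> \<theta>)" "card (fst (C p)) = card U + card (fst (R.LQ 2 \<gamma> \<theta>))"
      unfolding \<theta>(1) using R.lab_cap_tie[OF R.LQ_sub(1,2), unfolded rotated_sets] by simp_all
    show ?thesis unfolding tA tC k
      using square_gauge[OF \<gamma>, of y] R.square_gauge[OF \<gamma>, of \<theta>] \<theta>(2-5) by auto
  qed
  have out: "A p = C p" if "p \<in> S2" "z \<bullet> p \<le> h1" for p using D that by blast
  have skel: "skel (gr k C) = skel (gr k A)" unfolding gr_simps using key out by (metis (no_types, lifting) Collect_cong nle_le)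
  have wC: "white (gr k C) \<inter> left_side z h1 = black (gr k A) \<inter> left_side z h1"
    "black (gr k C) \<inter> left_side z h1 = white (gr k A) \<inter> left_side z h1"
    unfolding gr_simps left_side_def using key less_imp_le by blast+
  have cyc: "in_cyclic_order z h1 [rimpt h1 (0, 1), rimpt h1 (- 1, 0), rimpt h1 (0, - 1), rimpt h1 (1, 0)]"
    using R.cyclic_quadrants[OF h1(1,2), of "(1,0)" "(0,1)" "(-1,0)" "(0,-1)"] unfolding rotated_rimpt by simp
  obtain v1 v2 v3 v4 where v: "crossed_by_four_edges z h1 (gr k A) [rimpt h1 (0, 1), rimpt h1 (- 1, 0), rimpt h1 (0, - 1), rimpt h1 (1, 0)]"
    "distinct [v1, v2, v3, v4]"
    "drawn_inside z h1 (skel (gr k A)) [(v1, v2), (v2, v3), (v3, v4), (v4, v1), (v1, rimpt h1 (0, 1)), (v2, rimpt h1 (- 1, 0)), (v3, rimpt h1 (0, - 1)), (v4, rimpt h1 (1, 0))]"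
    "white (gr k A) \<inter> left_side z h1 = {v1, v3}" "black (gr k A) \<inter> left_side z h1 = {v2, v4}"
    using A.square_half[OF k cyc] by (elim exE conjE) (rule that)
  show ?thesis unfolding move_Sq_def
  proof (intro conjI exI)
    show "unchanged_outside z h1 (gr k A) (gr k C)" by (rule unchanged_gr) (rule out)
    show "skel (gr k C) = skel (gr k A)" by (rule skel)
  qed (fact v | simp only: wC v)+
qed

lemma negated_pl: "cap_plane.pl z (- us) (- ws) y = pl (- y)"
proof -
  interpret N: cap_frame z "- u" "- w" "- us" "- ws" I "\<lambda>i. - x0 i" "- cc" a b c d s1 s2 s3 s4 by (rule negated)
  show ?thesis unfolding N.pl_def pl_def N.tv_def tv_def by simp
qed

lemma negated_UL: "cap_frame.U z I (\<lambda>i. - x0 i) (- cc) = L" "cap_frame.L z I (\<lambda>i. - x0 i) (- cc) = U"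
proof -
  interpret N: cap_frame z "- u" "- w" "- us" "- ws" I "\<lambda>i. - x0 i" "- cc" a b c d s1 s2 s3 s4 by (rule negated)
  show "N.U = L" "N.L = U" unfolding N.U_def N.L_def U_def L_def by auto
qed

lemma negated_sep: "sep x h \<Longrightarrow> cap_frame.sep z I (\<lambda>i. - x0 i) (- cc) a b c d (\<lambda>i. - x i) h"
proof -
  interpret N: cap_frame z "- u" "- w" "- us" "- ws" I "\<lambda>i. - x0 i" "- cc" a b c d s1 s2 s3 s4 by (rule negated)
  assume "sep x h"
  then show ?thesis unfolding N.sep_def sep_def negated_UL N.Q_def Q_def by auto
qed

lemma card_parts: "card I = card U + 4 + card L"
proof -
  have "card (U \<union> Q \<union> L) = card (U \<union> Q) + card L" using parts by (intro card_Un_disjoint) auto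
  moreover have "card (U \<union> Q) = card U + card Q" using parts by (intro card_Un_disjoint) auto
  ultimately show ?thesis using parts by simp
qed

lemma local_move_gr:
  assumes M: "move_data k \<gamma> r \<epsilon> h1 h2 A C" and k: "card U < k" "k < card U + 4"
    and vA: "viewed k \<gamma> \<epsilon> h2 A" and vC: "viewed k (- \<gamma>) \<epsilon> h2 C"
    and sq: "k = card U + 2 \<Longrightarrow> (\<forall>p\<in>S2. h2 - \<epsilon> \<le> z \<bullet> p \<longrightarrow> A p = lab k I (pe \<gamma>) p) \<and>
      (\<forall>p\<in>S2. h1 \<le> z \<bullet> p \<longrightarrow> C p = lab k I (pe (- \<gamma>)) (R p)) \<and>
      (\<forall>y. h1 \<le> z \<bullet> pl y \<longrightarrow> (\<exists>m>0. R (pl y) = pl (m *\<^sub>R y) \<and> h2 \<le> z \<bullet> R (pl y) \<and> swapped \<gamma> m y))"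
  shows "local_move z h1 (gr k A) (gr k C)"
proof -
  note D = M[unfolded move_data_def]
  have oc: "oriented_circle z h1" unfolding oriented_circle_def using D z1 by auto
  consider "k = card U + 1" | "k = card U + 2" | "k = card U + 3" using k by linarith
  then show ?thesis
  proof cases
    case 1
    from flip_move_gr[OF M vA vC 1] show ?thesis unfolding local_move_def move_B_def using oc by blast
  next
    case 2
    have "move_Sq z h1 (gr k A) (gr k C)"
      by (rule square_move_gr[OF M 2, where R = R]) (use sq[OF 2] in blast)+
    then show ?thesis unfolding local_move_def using oc by blast
  next
    \<comment> \<open>Order 3 of four becomes order 1 when the ranking is reversed. Negating the
      dots also changes the sign of \<gamma>, so \<open>A\<close> and \<open>C\<close> trade places,
      and the colors are swapped back at the end.\<close>
    case 3
    interpret N: cap_frame z "- u" "- w" "- us" "- ws" I "\<lambda>i. - x0 i" "- cc" a b c d s1 s2 s3 s4 by (rule negated)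
    define A' where "A' = (\<lambda>p. prod.swap (C p))"
    define C' where "C' = (\<lambda>p. prod.swap (A p))"
    define k' where "k' = card I - k"
    have kI: "k \<le> card I" and k': "k' = card L + 1" using card_parts 3 unfolding k'_def by auto
    have Npe: "N.pe g = (\<lambda>i. - pe (- g) i)" for g by (rule pert_uminus)
    have pp: "proper k I A" "proper k I C" using D by auto
    have "N.move_data k' \<gamma> r \<epsilon> h1 h2 A' C'"
      unfolding N.move_data_def
    proof (intro conjI)
      show "N.sep (N.pe \<gamma>) h2" "N.sep (N.pe (- \<gamma>)) h2" "N.sep (\<lambda>i. - x0 i) h2"
        unfolding Npe using D negated_sep by auto
      show "proper k' I A'" "proper k' I C'" unfolding k'_def A'_def C'_def using proper_swap[OF finI kI] pp by blast+
      show "\<forall>p\<in>S2. z \<bullet> p \<le> h1 \<longrightarrow> A' p = C' p" using D unfolding A'_def C'_def by auto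
      show "\<forall>p\<in>S2. z \<bullet> p = h1 \<longrightarrow> A' p = lab k' I (\<lambda>i. - x0 i) p"
        unfolding k'_def lab_neg[OF finI kI] A'_def using D by (metis order_refl)
      show "\<forall>y. \<bar>fst y\<bar> \<le> r \<longrightarrow> \<bar>snd y\<bar> \<le> r \<longrightarrow> h1 + \<epsilon> < z \<bullet> N.pl y"
      proof (intro allI impI)
        fix y :: "real \<times> real" assume "\<bar>fst y\<bar> \<le> r" "\<bar>snd y\<bar> \<le> r"
        then show "h1 + \<epsilon> < z \<bullet> N.pl y" unfolding negated_pl
          using D by (metis abs_minus_cancel fst_uminus snd_uminus)
      qed
    qed (use D in blast)+
    moreover have "N.viewed k' \<gamma> \<epsilon> h2 A'" "N.viewed k' (- \<gamma>) \<epsilon> h2 C'"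
    proof -
      obtain hA gA where "homeomorphism S2 S2 hA gA" "\<forall>p\<in>S2. norm (hA p - p) \<le> \<epsilon>" "\<forall>p\<in>S2. h2 - \<epsilon> \<le> z \<bullet> p \<longrightarrow> A p = lab k I (pe \<gamma>) (hA p)"
        using vA unfolding viewed_def by blast
      then show "N.viewed k' (- \<gamma>) \<epsilon> h2 C'" unfolding N.viewed_def Npe k'_def lab_neg[OF finI kI] C'_def
        by (intro exI[of _ hA] exI[of _ gA]) simp
      obtain hC gC where "homeomorphism S2 S2 hC gC" "\<forall>p\<in>S2. norm (hC p - p) \<le> \<epsilon>" "\<forall>p\<in>S2. h2 - \<epsilon> \<le> z \<bullet> p \<longrightarrow> C p = lab k I (pe (- \<gamma>)) (hC p)"
        using vC unfolding viewed_def by blast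
      then show "N.viewed k' \<gamma> \<epsilon> h2 A'" unfolding N.viewed_def Npe k'_def lab_neg[OF finI kI] A'_def
        by (intro exI[of _ hC] exI[of _ gC]) simp
    qed
    moreover have "k' = card N.U + 1" unfolding negated_UL using k' .
    ultimately have "flip_move black white z h1 (gr k' A') (gr k' C')" by (rule N.flip_move_gr)
    then have "flip_move white black z h1 (gr k C) (gr k A)"
      unfolding A'_def C'_def k'_def gr_swap[OF finI kI pp(1)] gr_swap[OF finI kI pp(2)] flip_move_sw .
    then show ?thesis unfolding local_move_def move_W_def using oc by blast
  qed
qed

end

section \<open>Conditions that are stable under small motions of the dots\<close>

definition close :: "'i set \<Rightarrow> ('i \<Rightarrow> point) \<Rightarrow> real \<Rightarrow> ('i \<Rightarrow> point) \<Rightarrow> bool" where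
  "close I x0 \<delta> x \<longleftrightarrow> (\<forall>i\<in>I. norm (x i - x0 i) < \<delta>)"

lemma close_mono: "close I x0 \<delta> x \<Longrightarrow> \<delta> \<le> \<delta>' \<Longrightarrow> close I x0 \<delta>' x"
  unfolding close_def by (meson less_le_trans)

lemma close_finite:
  assumes "finite S" "\<And>s. s \<in> S \<Longrightarrow> \<exists>\<delta>>0. \<forall>x. close I x0 \<delta> x \<longrightarrow> P s x"
  shows "\<exists>\<delta>>0. \<forall>x. close I x0 \<delta> x \<longrightarrow> (\<forall>s\<in>S. P s x)"
  using assms
proof (induction S rule: finite_induct)
  case empty
  show ?case by (intro exI[of _ 1]) auto
next
  case (insert s S)
  obtain d1 where d1: "d1 > 0" "\<forall>x. close I x0 d1 x \<longrightarrow> P s x" using insert.prems[of s] by blast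
  obtain d2 where d2: "d2 > 0" "\<forall>x. close I x0 d2 x \<longrightarrow> (\<forall>s\<in>S. P s x)" using insert.IH insert.prems by blast
  have "min d1 d2 > 0" using d1 d2 by simp
  moreover have "\<forall>s\<in>insert s S. P s x" if "close I x0 (min d1 d2) x" for x
  proof -
    have "close I x0 d1 x" "close I x0 d2 x" using close_mono[OF that] by auto
    then show ?thesis using d1 d2 by blast
  qed
  ultimately show ?case by blast
qed

lemma close_uniform:
  assumes "compact K"
    and loc: "\<And>p0. p0 \<in> K \<Longrightarrow> \<exists>e>0. \<forall>x p. close I x0 e x \<longrightarrow> norm (p - p0) < e \<longrightarrow> P x p"
  shows "\<exists>e>0. \<forall>x. close I x0 e x \<longrightarrow> (\<forall>p\<in>K. P x p)"
proof -
  obtain e where e: "\<And>p0. p0 \<in> K \<Longrightarrow> 0 < e p0" "\<And>p0 x p. p0 \<in> K \<Longrightarrow> close I x0 (e p0) x \<Longrightarrow> norm (p - p0) < e p0 \<Longrightarrow> P x p"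
    using loc by metis
  have "K \<subseteq> (\<Union>p0\<in>K. ball p0 (e p0))" using e(1) by fastforce
  then obtain M where M: "M \<subseteq> K" "finite M" "K \<subseteq> (\<Union>p0\<in>M. ball p0 (e p0))"
    by (rule compactE_image[OF assms(1) open_ball])
  define d where "d = Min (insert 1 (e ` M))"
  have "0 < d" unfolding d_def using M e(1) by auto
  moreover have "P x p" if x: "close I x0 d x" and p: "p \<in> K" for x p
  proof -
    obtain p0 where p0: "p0 \<in> M" "p \<in> ball p0 (e p0)" using M(3) p by blast
    have "d \<le> e p0" unfolding d_def using M(2) p0(1) by auto
    then have "close I x0 (e p0) x" using x close_mono by blast
    then show ?thesis using e(2)[of p0 x p] p0 M(1) by (auto simp: dist_norm norm_minus_commute)
  qed
  ultimately show ?thesis by blast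
qed

lemma close_open3:
  fixes W :: "(point \<times> point \<times> point) set"
  assumes "open W" "(x0 a, x0 b, x0 c) \<in> W" "a \<in> I" "b \<in> I" "c \<in> I"
  shows "\<exists>\<delta>>0. \<forall>x. close I x0 \<delta> x \<longrightarrow> (x a, x b, x c) \<in> W"
proof -
  obtain e where e: "e > 0" "\<And>q. dist q (x0 a, x0 b, x0 c) < e \<Longrightarrow> q \<in> W" using assms(1,2) unfolding open_dist by blast
  have "(x a, x b, x c) \<in> W" if "close I x0 (e / 3) x" for x
  proof (rule e(2))
    have n: "norm (x a - x0 a) < e / 3" "norm (x b - x0 b) < e / 3" "norm (x c - x0 c) < e / 3"
      using that assms(3-5) unfolding close_def by auto
    have "dist (x a, x b, x c) (x0 a, x0 b, x0 c) = norm (x a - x0 a, x b - x0 b, x c - x0 c)" by (simp add: dist_norm)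
    also have "\<dots> \<le> norm (x a - x0 a) + norm (x b - x0 b, x c - x0 c)" by (rule norm_Pair_le)
    also have "\<dots> \<le> norm (x a - x0 a) + (norm (x b - x0 b) + norm (x c - x0 c))" by (rule add_left_mono[OF norm_Pair_le])
    finally show "dist (x a, x b, x c) (x0 a, x0 b, x0 c) < e" using n by linarith
  qed
  then show ?thesis using e(1) by (intro exI[of _ "e / 3"]) auto
qed

lemma noncollinear_stable:
  assumes "finite I" "noncollinear I x0"
  shows "\<exists>\<delta>>0. \<forall>x. close I x0 \<delta> x \<longrightarrow> noncollinear I x"
proof -
  have "\<exists>\<delta>>0. \<forall>x. close I x0 \<delta> x \<longrightarrow> (\<forall>t\<in>{(a, b, c). a \<in> I \<and> b \<in> I \<and> c \<in> I \<and> a \<noteq> b \<and> a \<noteq> c \<and> b \<noteq> c}.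
    cross3 (x (fst t) - x (snd (snd t))) (x (fst (snd t)) - x (snd (snd t))) \<noteq> 0)"
  proof (rule close_finite)
    show "finite {(a, b, c). a \<in> I \<and> b \<in> I \<and> c \<in> I \<and> a \<noteq> b \<and> a \<noteq> c \<and> b \<noteq> c}"
      by (rule finite_subset[of _ "I \<times> I \<times> I"]) (use assms(1) in auto)
    fix t assume t: "t \<in> {(a, b, c). a \<in> I \<and> b \<in> I \<and> c \<in> I \<and> a \<noteq> b \<and> a \<noteq> c \<and> b \<noteq> c}"
    obtain a b c where abc: "t = (a, b, c)" "a \<in> I" "b \<in> I" "c \<in> I" "a \<noteq> b" "a \<noteq> c" "b \<noteq> c" using t by auto
    let ?W = "{q :: point \<times> point \<times> point. cross3 (fst q - snd (snd q)) (fst (snd q) - snd (snd q)) \<noteq> 0}"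
    have "continuous_on UNIV (\<lambda>q :: point \<times> point \<times> point. cross3 (fst q - snd (snd q)) (fst (snd q) - snd (snd q)))"
      by (intro continuous_on_cross continuous_intros)
    then have "open ?W" by (rule open_Collect_neq) (rule continuous_on_const)
    moreover have "(x0 a, x0 b, x0 c) \<in> ?W" using assms(2) abc unfolding noncollinear_def by simp
    ultimately show "\<exists>\<delta>>0. \<forall>x. close I x0 \<delta> x \<longrightarrow> cross3 (x (fst t) - x (snd (snd t))) (x (fst (snd t)) - x (snd (snd t))) \<noteq> 0"
      using close_open3[of ?W x0 a b c I] abc by simp
  qed
  then show ?thesis unfolding noncollinear_def by fastforce
qed

text \<open>For four dots on the sphere this amounts to lying on a common circle, but it remains
  meaningful for perturbed dots off the sphere.\<close>

definition in_plane :: "('i \<Rightarrow> point) \<Rightarrow> 'i set \<Rightarrow> bool" where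
  "in_plane x S \<longleftrightarrow> (\<exists>p\<in>S2. \<forall>i\<in>S. \<forall>j\<in>S. p \<bullet> x i = p \<bullet> x j)"

lemma not_in_plane_stable:
  assumes "finite I" "S \<subseteq> I" "\<not> in_plane x0 S"
  shows "\<exists>\<delta>>0. \<forall>x. close I x0 \<delta> x \<longrightarrow> \<not> in_plane x S"
proof -
  have "\<exists>\<delta>>0. \<forall>x. close I x0 \<delta> x \<longrightarrow> (\<forall>p\<in>S2. \<not> (\<forall>i\<in>S. \<forall>j\<in>S. p \<bullet> x i = p \<bullet> x j))"
  proof (rule close_uniform)
    show "compact S2" by simp
    fix p0 :: point assume "p0 \<in> S2"
    then obtain i j where ij: "i \<in> S" "j \<in> S" "p0 \<bullet> x0 j < p0 \<bullet> x0 i"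
      using assms(3) unfolding in_plane_def by (metis linorder_neqE_linordered_idom)
    obtain e where e: "e > 0" "\<And>x q. (\<forall>i\<in>I. norm (x i - x0 i) < e) \<Longrightarrow> norm (q - p0) < e \<Longrightarrow>
      (\<forall>i\<in>I. \<forall>j\<in>I. p0 \<bullet> x0 j < p0 \<bullet> x0 i \<longrightarrow> q \<bullet> x j < q \<bullet> x i)"
      using strict_stable[OF assms(1), of x0 p0] by blast
    have ijI: "i \<in> I" "j \<in> I" using ij assms(2) by auto
    then show "\<exists>e>0. \<forall>x p. close I x0 e x \<longrightarrow> norm (p - p0) < e \<longrightarrow> \<not> (\<forall>i\<in>S. \<forall>j\<in>S. p \<bullet> x i = p \<bullet> x j)"
    proof (intro exI[of _ e] conjI allI impI e(1) notI)
      fix x p assume x: "close I x0 e x" "norm (p - p0) < e" "\<forall>i\<in>S. \<forall>j\<in>S. p \<bullet> x i = p \<bullet> x j"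
      have "p \<bullet> x j < p \<bullet> x i" using e(2)[of x p] x(1,2) ij(3) ijI unfolding close_def by blast
      moreover have "p \<bullet> x j = p \<bullet> x i" using x(3) ij(1,2) by blast
      ultimately show False by simp
    qed
  qed
  then show ?thesis unfolding in_plane_def by blast
qed

lemma four_tied:
  assumes "finite I" "\<not> card (tie (lab k I x p)) \<le> 3"
  obtains S where "S \<subseteq> I" "S \<subseteq> tie (lab k I x p)" "card S = 4" "\<And>i j. i \<in> S \<Longrightarrow> j \<in> S \<Longrightarrow> p \<bullet> x i = p \<bullet> x j"
proof -
  have "4 \<le> card (tie (lab k I x p))" using assms(2) by simp
  then obtain S where S: "S \<subseteq> tie (lab k I x p)" "card S = 4" by (meson obtain_subset_with_card_n)
  have "tie (lab k I x p) \<subseteq> I" unfolding tie_def lab_def using lo_subset[of k I] by auto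
  moreover have "p \<bullet> x i = p \<bullet> x j" if "i \<in> S" "j \<in> S" for i j
    using tie_eq[OF assms(1), of i k "\<lambda>i. p \<bullet> x i" j] that S(1) unfolding tie_def lab_def by auto
  ultimately show ?thesis using that S by blast
qed

lemma regularI:
  assumes "finite I" "noncollinear I x" "\<And>S. S \<subseteq> I \<Longrightarrow> card S = 4 \<Longrightarrow> \<not> in_plane x S"
  shows "regular k I x"
  unfolding regular_def
proof (intro conjI ballI assms(2))
  fix p :: point assume p: "p \<in> S2"
  show "card (tie (lab k I x p)) \<le> 3"
  proof (rule ccontr)
    assume n: "\<not> card (tie (lab k I x p)) \<le> 3"
    obtain S where S: "S \<subseteq> I" "card S = 4" "\<And>i j. i \<in> S \<Longrightarrow> j \<in> S \<Longrightarrow> p \<bullet> x i = p \<bullet> x j"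
      using four_tied[OF assms(1) n] by metis
    then have "in_plane x S" unfolding in_plane_def using p by blast
    then show False using assms(3) S by blast
  qed
qed

section \<open>Gauges and the region in which the radial map acts\<close>

lemma gauge_facts:
  fixes p q x :: real
  assumes "0 < p" "0 < q"
  shows "0 \<le> max (p * x) (- q * x)" "x \<noteq> 0 \<Longrightarrow> 0 < max (p * x) (- q * x)"
    "max (p * x) (- q * x) \<le> (p / q + q / p) * max (q * x) (- p * x)"
    "0 \<le> r \<Longrightarrow> max (p * (r * x)) (- q * (r * x)) = r * max (p * x) (- q * x)"
proof -
  have s: "0 < x \<Longrightarrow> 0 < p * x" "0 < x \<Longrightarrow> 0 < q * x" "x < 0 \<Longrightarrow> p * x < 0" "x < 0 \<Longrightarrow> q * x < 0"
    using assms by (auto simp: mult_pos_neg)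
  show "0 \<le> max (p * x) (- q * x)" "x \<noteq> 0 \<Longrightarrow> 0 < max (p * x) (- q * x)"
    using s by (cases "x = 0"; cases "0 < x"; force)+
  \<comment> \<open>For either sign of x one of the summands p/q and q/p is the exact factor between
    the two gauges; their sum serves both signs.\<close>
  have e: "(p / q + q / p) * (q * x) = p * x + q / p * (q * x)" "(p / q + q / p) * (- p * x) = - q * x + p / q * (- p * x)"
    using assms by (simp_all add: field_simps)
  consider "x = 0" | "0 < x" | "x < 0" by linarith
  then show "max (p * x) (- q * x) \<le> (p / q + q / p) * max (q * x) (- p * x)"
  proof cases
    case 2
    then have pos: "0 < p * x" "0 < q * x" using s by auto
    have "max (q * x) (- p * x) = q * x" "max (p * x) (- q * x) = p * x" by (rule max_absorb1, use pos in linarith)+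
    moreover have "0 < q / p * (q * x)" by (rule mult_pos_pos[OF divide_pos_pos[OF assms(2,1)] pos(2)])
    ultimately show ?thesis using e by simp
  next
    case 3
    then have m: "max (q * x) (- p * x) = - p * x" "max (p * x) (- q * x) = - q * x" using s(3,4)[OF 3] by (auto simp: max_def)
    have "0 < - p * x" using s(3)[OF 3] by linarith
    then have "0 < p / q * (- p * x)" by (rule mult_pos_pos[OF divide_pos_pos[OF assms]])
    then show ?thesis unfolding m e by simp
  qed simp
  assume "0 \<le> r"
  then show "max (p * (r * x)) (- q * (r * x)) = r * max (p * x) (- q * x)"
    by (simp add: max_mult_distrib_left mult.left_commute)
qed

context cap_plane
begin

lemma pl_0: "pl 0 = z" unfolding pl_def by (simp add: tv_0 sgn_div_norm z1)

lemma high_ball: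
  assumes "h < 1"
  shows "\<exists>r>0. \<forall>y. \<bar>fst y\<bar> \<le> r \<longrightarrow> \<bar>snd y\<bar> \<le> r \<longrightarrow> h < z \<bullet> pl y"
proof -
  have "open {y. h < z \<bullet> pl y}" by (intro open_Collect_less continuous_intros cont_pl)
  moreover have "0 \<in> {y. h < z \<bullet> pl y}" using assms pl_0 zz by simp
  ultimately obtain e where e: "e > 0" "\<And>y. dist y 0 < e \<Longrightarrow> h < z \<bullet> pl y" unfolding open_dist by blast
  have "h < z \<bullet> pl y" if "\<bar>fst y\<bar> \<le> e / 3" "\<bar>snd y\<bar> \<le> e / 3" for y
  proof (rule e(2))
    show "dist y 0 < e" using that e(1) norm_Pair_le[of "fst y" "snd y"] by simp
  qed
  then show ?thesis using e(1) by (intro exI[of _ "e / 3"]) auto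
qed

lemma near_z: "q \<in> S2 \<Longrightarrow> (norm (q - z))\<^sup>2 = 2 - 2 * (z \<bullet> q)"
  using z1 by (simp add: power2_norm_eq_inner inner_diff norm_eq_1 inner_commute)

end

context cap_frame
begin

lemma nP_facts: "y \<noteq> 0 \<Longrightarrow> 0 < nP y" "0 \<le> r \<Longrightarrow> nP (r *\<^sub>R y) = r * nP y" "continuous_on S nP"
proof -
  show "0 < nP y" if "y \<noteq> 0"
  proof (cases "fst y = 0")
    case True
    then have "snd y \<noteq> 0" using that by (auto simp: prod_eq_iff)
    then show ?thesis unfolding nP_def using gauge_facts(1)[OF s(3,1), of "fst y"] gauge_facts(2)[OF s(2,4)] by fastforce
  next
    case False
    then show ?thesis unfolding nP_def using gauge_facts(2)[OF s(3,1)] gauge_facts(1)[OF s(2,4), of "snd y"] by fastforce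
  qed
  show "0 \<le> r \<Longrightarrow> nP (r *\<^sub>R y) = r * nP y"
    unfolding nP_def using gauge_facts(4)[OF s(3,1)] gauge_facts(4)[OF s(2,4)] by (simp add: distrib_left)
  show "continuous_on S nP" unfolding nP_def by (intro continuous_intros)
qed

lemma nM_rotated: "nM y = cap_frame.nP s2 s3 s4 s1 (snd y, - fst y)"
proof -
  interpret R: cap_frame z w "- u" ws "- us" I x0 cc b c d a s2 s3 s4 s1 by (rule rotated)
  show ?thesis unfolding nM_def R.nP_def by (simp add: max.commute)
qed

lemma nM_facts: "y \<noteq> 0 \<Longrightarrow> 0 < nM y" "0 \<le> r \<Longrightarrow> nM (r *\<^sub>R y) = r * nM y" "continuous_on S nM"
proof -
  interpret R: cap_frame z w "- u" ws "- us" I x0 cc b c d a s2 s3 s4 s1 by (rule rotated)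
  show "0 < nM y" if "y \<noteq> 0" unfolding nM_rotated using that by (intro R.nP_facts(1)) (auto simp: prod_eq_iff)
  show "0 \<le> r \<Longrightarrow> nM (r *\<^sub>R y) = r * nM y"
    unfolding nM_rotated using R.nP_facts(2)[of r "(snd y, - fst y)"] by (simp add: scaleR_prod_def)
  show "continuous_on S nM" unfolding nM_def by (intro continuous_intros)
qed

lemma nP_le_nM: "\<exists>K\<ge>1. \<forall>y. nP y \<le> K * nM y"
proof -
  define A B where "A = s3 / s1 + s1 / s3" and "B = s2 / s4 + s4 / s2"
  have AB: "0 < A" "0 < B" unfolding A_def B_def using s by (simp_all add: add_pos_pos)
  have "nP y \<le> (1 + A + B) * nM y" for y
  proof -
    define p q where "p = max (s1 * fst y) (- s3 * fst y)" and "q = max (s4 * snd y) (- s2 * snd y)"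
    have pq: "0 \<le> p" "0 \<le> q" unfolding p_def q_def using gauge_facts(1) s by auto
    have "nP y \<le> A * p + B * q" unfolding nP_def A_def B_def p_def q_def
      by (intro add_mono gauge_facts(3) s)
    also have "\<dots> \<le> (1 + A + B) * p + (1 + A + B) * q" using pq AB by (intro add_mono mult_right_mono) auto
    also have "\<dots> = (1 + A + B) * nM y" unfolding nM_def p_def q_def by (simp add: distrib_left)
    finally show ?thesis .
  qed
  then show ?thesis using AB by (intro exI[of _ "1 + A + B"]) auto
qed

text \<open>The quadrilaterals shrink with \<gamma>. By compactness the gauge is bounded below on
  the part of the hemisphere with height at most \<open>h\<close>, and once
  \<open>(1 + K) * (2 * \<gamma>)\<close> is smaller, the cutoff leaves that part fixed.\<close>

lemma tiny_radial:
  assumes h: "h < 1"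
  shows "\<exists>g>0. \<forall>\<gamma>. 0 < \<gamma> \<longrightarrow> \<gamma> < g \<longrightarrow> (\<exists>H. isotopy_of_sphere H \<and> (\<forall>p\<in>S2. z \<bullet> p \<le> h \<longrightarrow> H 1 p = p) \<and>
    (\<forall>y. \<exists>m>0. H 1 (pl y) = pl (m *\<^sub>R y) \<and> swapped \<gamma> m y))"
proof -
  obtain K where K: "1 \<le> K" "\<And>y. nP y \<le> K * nM y" using nP_le_nM by blast
  define C where "C = {p \<in> S2. 0 \<le> z \<bullet> p \<and> z \<bullet> p \<le> h}"
  have "C = S2 \<inter> {p. 0 \<le> z \<bullet> p} \<inter> {p. z \<bullet> p \<le> h}" unfolding C_def by auto
  then have cC: "compact C" by (simp add: compact_Int_closed closed_halfspace_ge closed_halfspace_le)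
  have cont: "continuous_on C (\<lambda>p. nP (uw p))"
    unfolding uw_def by (intro continuous_on_compose2[OF nP_facts(3)[of UNIV]] continuous_intros) auto
  have pos: "0 < nP (uw p)" if "p \<in> C" for p
  proof (rule nP_facts(1), rule notI)
    assume 0: "uw p = 0"
    have "p = (z \<bullet> p) *\<^sub>R z" using expand[of p] 0 unfolding uw_def by (auto simp: zero_prod_def inner_commute)
    moreover have "norm p = 1" using that unfolding C_def by simp
    ultimately have "\<bar>z \<bullet> p\<bar> = 1" using z1 by (metis mult.right_neutral norm_scaleR)
    then show False using that h unfolding C_def by auto
  qed
  obtain m where m: "0 < m" "\<And>p. p \<in> C \<Longrightarrow> m \<le> nP (uw p)"
  proof (cases "C = {}")
    case True
    then show ?thesis using that[of 1] by auto
  next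
    case False
    then obtain p0 where "p0 \<in> C" "\<And>p. p \<in> C \<Longrightarrow> nP (uw p0) \<le> nP (uw p)"
      using continuous_attains_inf[OF cC _ cont] by blast
    then show ?thesis using that[of "nP (uw p0)"] pos by blast
  qed
  define g where "g = m / (2 * (1 + K))"
  have "0 < g" unfolding g_def using m K by simp
  moreover have "\<exists>H. isotopy_of_sphere H \<and> (\<forall>p\<in>S2. z \<bullet> p \<le> h \<longrightarrow> H 1 p = p) \<and>
    (\<forall>y. \<exists>m>0. H 1 (pl y) = pl (m *\<^sub>R y) \<and> swapped \<gamma> m y)"
    if \<gamma>: "0 < \<gamma>" "\<gamma> < g" for \<gamma>
  proof -
    have \<mu>: "0 < 2 * \<gamma>" using \<gamma> by simp
    note P = nP_facts(3) nM_facts(3) nP_facts(1) nM_facts(1) nP_facts(2) nM_facts(2) K \<mu>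
    define H where "H = (\<lambda>t p. sgn (p + t *\<^sub>R rv nP nM K (2 * \<gamma>) p))"
    have "isotopy_of_sphere H" unfolding H_def by (rule radial_isotopy; (rule P; assumption?))
    moreover have "H 1 p = p" if p: "p \<in> S2" "z \<bullet> p \<le> h" for p
    proof -
      have small: "(1 + K) * (2 * \<gamma>) < m" using \<gamma>(2) K(1) unfolding g_def by (simp add: field_simps)
      have "(1 + K) * (2 * \<gamma> * (z \<bullet> p)) \<le> nP (uw p)"
      proof (cases "0 \<le> z \<bullet> p")
        case True
        have "(1 + K) * (2 * \<gamma> * (z \<bullet> p)) = ((1 + K) * (2 * \<gamma>)) * (z \<bullet> p)" by simp
        also have "\<dots> \<le> m * 1" using small p h K(1) \<gamma>(1) True m(1) by (intro mult_mono) auto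
        also have "\<dots> \<le> nP (uw p)" using m(2)[of p] p True unfolding C_def by simp
        finally show ?thesis .
      next
        case False
        have n0: "0 \<le> nP y" for y using nP_facts(1)[of y] nP_facts(2)[of 0 0] by (cases "y = 0") auto
        have "(1 + K) * (2 * \<gamma> * (z \<bullet> p)) \<le> 0" using False K(1) \<gamma>(1) by (intro mult_nonneg_nonpos) auto
        then show ?thesis using n0[of "uw p"] by linarith
      qed
      note * = this
      show ?thesis unfolding H_def scaleR_one
        by (rule radial_fixes; (rule P p(1) *; assumption?))
    qed
    moreover have "\<exists>m>0. H 1 (pl y) = pl (m *\<^sub>R y) \<and> swapped \<gamma> m y" for y
      unfolding H_def scaleR_one
      by (rule radial_pl[of nP nM K "2 * \<gamma>" y]; (rule P; assumption?)?; blast)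
    ultimately show ?thesis by blast
  qed
  ultimately show ?thesis by blast
qed

lemma sep_mono: "sep x h \<Longrightarrow> h \<le> h' \<Longrightarrow> sep x h'"
  unfolding sep_def by (meson order_trans)

lemma sep_near: "\<exists>h<1. \<exists>\<delta>>0. \<forall>x. close I x0 \<delta> x \<longrightarrow> sep x h"
proof -
  obtain e where e: "e > 0" "\<And>x q. (\<forall>i\<in>I. norm (x i - x0 i) < e) \<Longrightarrow> norm (q - z) < e \<Longrightarrow>
    (\<forall>i\<in>I. \<forall>j\<in>I. z \<bullet> x0 j < z \<bullet> x0 i \<longrightarrow> q \<bullet> x j < q \<bullet> x i)"
    using strict_stable[OF finI, of x0 z] by blast
  \<comment> \<open>By \<open>near_z\<close> the points at least this high have squared distance at
    most half of the square of \<open>e\<close> from \<open>z\<close>.\<close>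
  define h where "h = 1 - e\<^sup>2 / 4"
  have "h < 1" unfolding h_def using e(1) by simp
  moreover have "sep x h" if x: "close I x0 e x" for x
    unfolding sep_def
  proof (intro ballI impI)
    fix q assume q: "q \<in> S2" "h \<le> z \<bullet> q"
    have "(norm (q - z))\<^sup>2 \<le> e\<^sup>2 / 2" using near_z[OF q(1)] q(2) unfolding h_def by simp
    also have "\<dots> < e\<^sup>2" using e(1) by simp
    finally have "norm (q - z) < e" using e(1) by (simp add: power2_less_imp_less)
    then have st: "q \<bullet> x j < q \<bullet> x i" if "i \<in> I" "j \<in> I" "z \<bullet> x0 j < z \<bullet> x0 i" for i j
      using e(2)[of x q] x that unfolding close_def by blast
    have "I = U \<union> Q \<union> L" by (rule parts(1))
    then show "(\<forall>i\<in>U. \<forall>j\<in>Q \<union> L. q \<bullet> x j < q \<bullet> x i) \<and> (\<forall>i\<in>Q. \<forall>j\<in>L. q \<bullet> x j < q \<bullet> x i)"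
      using st z_x0 unfolding U_def L_def by (smt (verit) Un_iff mem_Collect_eq)
  qed
  ultimately show ?thesis using e(1) by blast
qed

lemma square_tie_0:
  assumes "y \<noteq> 0"
  shows "tie (LQ 2 0 y) \<subseteq> {a, c} \<or> tie (LQ 2 0 y) \<subseteq> {b, d}"
proof -
  have "\<not> (fst y = 0 \<and> snd y = 0)" using assms by (auto simp: prod_eq_iff)
  then have "(a \<notin> tie (LQ 2 0 y) \<and> c \<notin> tie (LQ 2 0 y)) \<or> (b \<notin> tie (LQ 2 0 y) \<and> d \<notin> tie (LQ 2 0 y))"
    using sgn_facts[of y] in_Q
    by (simp add: tie_def LQ_def mem2 val_simps distinct_simps) (smt (verit))
  then show ?thesis using LQ_sub(3)[of 2 0 y] unfolding Q_def by blast
qed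

lemma pe_close: "\<bar>\<gamma>\<bar> < \<delta> \<Longrightarrow> close I x0 \<delta> (pe \<gamma>)"
  unfolding close_def pert_def using z1 by auto

text \<open>In the cap at order 2, away from \<open>z\<close>, only an opposite pair can be tied for
  the unperturbed dots. The perturbation moves both dots of such a pair by the same vector, so a
  point compares them as before without being moved itself. This exactness makes equal skeletons
  attainable.\<close>

lemma square_cmp:
  assumes k: "k = card U + 2" and h3: "0 < h3" and sp: "sep x0 h3" and \<rho>: "0 < \<rho>"
  shows "\<exists>g>0. \<forall>\<gamma>. \<bar>\<gamma>\<bar> < g \<longrightarrow> (\<forall>p\<in>S2. h3 \<le> z \<bullet> p \<longrightarrow> \<rho> \<le> norm (p - z) \<longrightarrow> cmp k I x0 (pe \<gamma>) p p)"
proof -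
  define C where "C = {p \<in> S2. h3 \<le> z \<bullet> p \<and> \<rho> \<le> norm (p - z)}"
  have "C = S2 \<inter> {p. h3 \<le> z \<bullet> p} \<inter> {p. \<rho> \<le> norm (p - z)}" unfolding C_def by auto
  moreover have "closed {p. \<rho> \<le> norm (p - z)}" by (intro closed_Collect_le continuous_intros)
  ultimately have cC: "compact C" by (simp add: compact_Int_closed closed_halfspace_ge)
  have kI: "k \<le> card I" and kU: "card U \<le> k" "k \<le> card U + 4" "k - card U = 2" using card_parts k by auto
  have "\<exists>e>0. \<forall>x. close I x0 e x \<longrightarrow> (\<forall>p\<in>C. (\<exists>\<gamma>. x = pe \<gamma>) \<longrightarrow> cmp k I x0 x p p)"
  proof (rule close_uniform[OF cC])
    fix p0 assume p0: "p0 \<in> C"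
    define y where "y = co p0"
    have p0S: "p0 \<in> S2" "h3 \<le> z \<bullet> p0" "\<rho> \<le> norm (p0 - z)" using p0 unfolding C_def by auto
    have pe: "pl y = p0" unfolding y_def using pl_co p0S h3 by simp
    have "y \<noteq> 0" using pe pl_0 p0S(3) \<rho> by auto
    have "lab k I x0 p0 = (U \<union> fst (LQ 2 0 y), L \<union> snd (LQ 2 0 y))"
      using lab_cap[of 0 h3 y k] sp kU p0S(2) unfolding pe pe_0 by simp
    then have "tie (lab k I x0 p0) = tie (LQ 2 0 y)" using lab_cap_tie(1)[OF LQ_sub(1,2)] by simp
    then have T: "tie (lab k I x0 p0) \<subseteq> {a, c} \<or> tie (lab k I x0 p0) \<subseteq> {b, d}" using square_tie_0[OF \<open>y \<noteq> 0\<close>] by simp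
    have eq: "pe \<gamma> i - pe \<gamma> j = x0 i - x0 j" if "i \<in> tie (lab k I x0 p0)" "j \<in> tie (lab k I x0 p0)" for \<gamma> i j
    proof -
      have "i \<in> {a, c} \<and> j \<in> {a, c} \<or> i \<in> {b, d} \<and> j \<in> {b, d}" using T that by blast
      then show ?thesis using distinct_simps by (auto simp: pert_def)
    qed
    obtain e where e: "e > 0" "\<forall>x p q. (\<forall>i\<in>I. norm (x i - x0 i) < e) \<longrightarrow> norm (p - p0) < e \<longrightarrow> norm (q - p0) < e \<longrightarrow>
      (\<forall>i\<in>tie (lab k I x0 p0). \<forall>j\<in>tie (lab k I x0 p0). q \<bullet> (x i - x j) = p \<bullet> (x0 i - x0 j)) \<longrightarrow> cmp k I x0 x p q"
      using cmp_local[OF finI kI] by blast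
    show "\<exists>e>0. \<forall>x p. close I x0 e x \<longrightarrow> norm (p - p0) < e \<longrightarrow> (\<exists>\<gamma>. x = pe \<gamma>) \<longrightarrow> cmp k I x0 x p p"
    proof (intro exI[of _ e] conjI allI impI e(1))
      fix x p assume x: "close I x0 e x" "norm (p - p0) < e" "\<exists>\<gamma>. x = pe \<gamma>"
      then obtain \<gamma> where "x = pe \<gamma>" by blast
      then have "\<forall>i\<in>tie (lab k I x0 p0). \<forall>j\<in>tie (lab k I x0 p0). p \<bullet> (x i - x j) = p \<bullet> (x0 i - x0 j)" using eq by simp
      then show "cmp k I x0 x p p" using e(2)[rule_format, of x p p] x unfolding close_def by blast
    qed
  qed
  then obtain e where e: "e > 0" "\<And>x p. close I x0 e x \<Longrightarrow> p \<in> C \<Longrightarrow> (\<exists>\<gamma>. x = pe \<gamma>) \<Longrightarrow> cmp k I x0 x p p" by blast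
  show ?thesis
    by (intro exI[of _ e] conjI allI impI ballI e(1)) (use e(2) pe_close C_def in blast)
qed

end

lemma cap_norm:
  fixes \<zeta> p q :: point
  assumes \<zeta>: "norm \<zeta> = 1" and p: "p \<in> S2"
  shows "\<zeta> \<bullet> p \<le> h \<Longrightarrow> sqrt (2 - 2 * h) \<le> norm (p - \<zeta>)"
    and "q \<in> S2 \<Longrightarrow> h < \<zeta> \<bullet> p \<Longrightarrow> h < \<zeta> \<bullet> q \<Longrightarrow> norm (q - p) \<le> 2 * sqrt (2 - 2 * h)"
proof -
  have n: "(norm (x - \<zeta>))\<^sup>2 = 2 - 2 * (\<zeta> \<bullet> x)" if "x \<in> S2" for x
    using that \<zeta> by (simp add: power2_norm_eq_inner inner_diff norm_eq_1 inner_commute)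
  show "\<zeta> \<bullet> p \<le> h \<Longrightarrow> sqrt (2 - 2 * h) \<le> norm (p - \<zeta>)"
    by (rule real_le_lsqrt) (use n[OF p] in auto)
  have le: "norm (x - \<zeta>) \<le> sqrt (2 - 2 * h)" if "x \<in> S2" "h < \<zeta> \<bullet> x" for x
    by (rule real_le_rsqrt) (use n[OF that(1)] that(2) in auto)
  assume "q \<in> S2" "h < \<zeta> \<bullet> p" "h < \<zeta> \<bullet> q"
  then have "norm (p - \<zeta>) \<le> sqrt (2 - 2 * h)" "norm (q - \<zeta>) \<le> sqrt (2 - 2 * h)" using le p by auto
  then show "norm (q - p) \<le> 2 * sqrt (2 - 2 * h)" using norm_triangle_ineq4[of "q - \<zeta>" "p - \<zeta>"] by simp
qed

text \<open>A bijection that fixes everything outside the cap cannot send a point of the cap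
  there.\<close>

lemma cap_preserved:
  assumes H: "isotopy_of_sphere H" and fixd: "\<And>p. p \<in> S2 \<Longrightarrow> \<zeta> \<bullet> p \<le> h \<Longrightarrow> H 1 p = p" and p: "p \<in> S2" "h < \<zeta> \<bullet> p"
  shows "h < \<zeta> \<bullet> H 1 p"
proof (rule ccontr)
  assume n: "\<not> h < \<zeta> \<bullet> H 1 p"
  have m: "H 1 ` S2 = S2" "inj_on (H 1) S2" using isotopy_maps[OF H, of 1] by auto
  then have "H 1 p \<in> S2" using p by blast
  then have "H 1 (H 1 p) = H 1 p" using fixd[of "H 1 p"] n by simp
  then have "H 1 p = p" using m(2) \<open>H 1 p \<in> S2\<close> p(1) by (meson inj_onD)
  then show False using n p by simp
qed

lemma small_common:
  fixes xs :: "real list"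
  assumes "\<And>x. x \<in> set xs \<Longrightarrow> 0 < x"
  shows "\<exists>g>0. \<forall>x\<in>set xs. g \<le> x"
proof (intro exI[of _ "Min (insert 1 (set xs))"] conjI)
  show "0 < Min (insert 1 (set xs))" using assms by auto
qed simp

section \<open>Crossing a wall along the normal form\<close>

context cap_frame
begin

text \<open>Both perturbed labelings are pulled back so that they agree with the unperturbed one
  outside the visible caps. Going from the first to the second is then a change in two disjoint
  caps, done one after the other.\<close>

theorem wall_crossing:
  assumes nc: "noncollinear I x0"
    and tie3: "\<And>p. p \<in> S2 \<Longrightarrow> card (tie (lab k I x0 p)) \<le> 3 \<or> p = z \<and> card U < k \<and> k < card U + 4 \<or> p = - z \<and> card L < k \<and> k < card L + 4"
    and kI: "k \<le> card I"
    and reg: "\<exists>g>0. \<forall>\<gamma>. 0 < \<bar>\<gamma>\<bar> \<longrightarrow> \<bar>\<gamma>\<bar> < g \<longrightarrow> regular k I (pe \<gamma>)"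
  shows "\<exists>g>0. \<forall>\<gamma>. 0 < \<gamma> \<longrightarrow> \<gamma> < g \<longrightarrow> (\<exists>A (B :: point \<Rightarrow> 'i labels) C h. 0 < h \<and>
    label_isotopic A (lab k I (pe \<gamma>)) \<and> label_isotopic C (lab k I (pe (- \<gamma>))) \<and>
    (if card U < k \<and> k < card U + 4 then local_move z h (gr k A) (gr k B) else gr k A = gr k B) \<and>
    (if card L < k \<and> k < card L + 4 then local_move (- z) h (gr k B) (gr k C) else gr k B = gr k C))"
proof -
  \<comment> \<open>Replacing \<open>z\<close> by \<open>- z\<close> reverses the sign of the
    perturbation, and a quarter turn reverses it again. In this frame at the antipode the
    perturbation therefore carries the same \<gamma>.\<close>
  interpret S: cap_frame "- z" w "- u" ws "- us" I x0 cc b c d a s2 s3 s4 s1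
    by (rule cap_frame.rotated[OF antipodal])
  have Spe: "S.pe = pe" using pert_rotate[OF dis, of x0 "- z"] pert_z_uminus[of x0 z a b c d] by (simp add: fun_eq_iff)
  have SUL: "S.U = L" "S.L = U" unfolding S.U_def S.L_def U_def L_def by auto
  define vis where "vis \<longleftrightarrow> card U < k \<and> k < card U + 4"
  define vis' where "vis' \<longleftrightarrow> card L < k \<and> k < card L + 4"
  obtain hz \<delta>z where hz: "hz < 1" "\<delta>z > 0" "\<And>x. close I x0 \<delta>z x \<Longrightarrow> sep x hz" using sep_near by blast
  obtain hs \<delta>s where hs: "hs < 1" "\<delta>s > 0" "\<And>x. close I x0 \<delta>s x \<Longrightarrow> S.sep x hs" using S.sep_near by blast
  define h3 e0 where "h3 = max (1/2) (max hz hs)" and "e0 = (1 - h3) / 4"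
  \<comment> \<open>From \<open>h3\<close> over \<open>h2\<close> and \<open>h1\<close> to 1 the
    gaps are \<open>e0\<close>, \<open>2 * e0\<close> and \<open>e0\<close>, while \<epsilon> is
    half of \<open>e0\<close>; a displacement by \<epsilon> bridges none of them.\<close>
  define h2 h1 \<epsilon> where "h2 = h3 + e0" and "h1 = h3 + 3 * e0" and "\<epsilon> = e0 / 2"
  have h3: "1/2 \<le> h3" "h3 < 1" "hz \<le> h3" "hs \<le> h3" unfolding h3_def using hz hs by auto
  have e0: "0 < e0" "h3 = 1 - 4 * e0" unfolding e0_def using h3(2) by (simp_all add: field_simps)
  have hh: "0 < \<epsilon>" "0 < h2" "h2 + \<epsilon> < h1" "h1 + \<epsilon> < 1" "h1 < 1" "h3 \<le> h2 - \<epsilon>" "h3 \<le> h1" "h3 \<le> h2" "0 < h1" "0 < h3" "h2 \<le> h1" "0 < h2 - \<epsilon>"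
    unfolding h2_def h1_def \<epsilon>_def using e0 h3(1) by auto
  obtain r1 where r1: "r1 > 0" "\<And>y. \<bar>fst y\<bar> \<le> r1 \<Longrightarrow> \<bar>snd y\<bar> \<le> r1 \<Longrightarrow> h1 + \<epsilon> < z \<bullet> pl y" using high_ball[OF hh(4)] by blast
  obtain r2 where r2: "r2 > 0" "\<And>y. \<bar>fst y\<bar> \<le> r2 \<Longrightarrow> \<bar>snd y\<bar> \<le> r2 \<Longrightarrow> h1 + \<epsilon> < - z \<bullet> S.pl y" using S.high_ball[OF hh(4)] by blast
  define r where "r = min r1 r2"
  have r: "0 < r" "r \<le> r1" "r \<le> r2" unfolding r_def using r1(1) r2(1) by auto
  \<comment> \<open>The chord from a pole to the circle at height \<open>h1\<close>: points on or
    outside the circle are at least this far from the pole.\<close>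
  define \<rho> where "\<rho> = sqrt (2 - 2 * h1)"
  have \<rho>: "0 < \<rho>" "0 < \<rho> / 2" "2 * (\<rho> / 2) \<le> \<rho>" unfolding \<rho>_def using hh by auto
  \<comment> \<open>The radial map will act above height \<open>ht\<close> only. That cap has
    diameter at most \<open>\<epsilon> / 2\<close>, which bounds the displacement of whatever map
    acts within it.\<close>
  define ht where "ht = max h1 (1 - \<epsilon>\<^sup>2 / 32)"
  have ht: "ht < 1" "h1 \<le> ht" "0 < ht" unfolding ht_def using hh by (auto simp: zero_less_power)
  have tiny: "2 * sqrt (2 - 2 * ht) \<le> \<epsilon> / 2"
  proof -
    have "2 - 2 * ht \<le> (\<epsilon> / 4)\<^sup>2" unfolding ht_def by (simp add: power_divide max_def)
    then have "sqrt (2 - 2 * ht) \<le> \<epsilon> / 4" using hh(1) by (intro real_le_lsqrt) auto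
    then show ?thesis by simp
  qed
  define rad where "rad = (\<lambda>(H :: real \<Rightarrow> point \<Rightarrow> point) \<gamma>. \<forall>y. \<exists>m>0. H 1 (pl y) = pl (m *\<^sub>R y) \<and> swapped \<gamma> m y)"
  define radS where "radS = (\<lambda>(H :: real \<Rightarrow> point \<Rightarrow> point) \<gamma>. \<forall>y. \<exists>m>0. H 1 (S.pl y) = S.pl (m *\<^sub>R y) \<and> S.swapped \<gamma> m y)"
  obtain gr1 where gr1: "gr1 > 0" "\<And>\<gamma>. 0 < \<gamma> \<Longrightarrow> \<gamma> < gr1 \<Longrightarrow> \<exists>H. isotopy_of_sphere H \<and> (\<forall>p\<in>S2. z \<bullet> p \<le> ht \<longrightarrow> H 1 p = p) \<and> rad H \<gamma>"
    using tiny_radial[OF ht(1)] unfolding rad_def by blast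
  obtain gr2 where gr2: "gr2 > 0" "\<And>\<gamma>. 0 < \<gamma> \<Longrightarrow> \<gamma> < gr2 \<Longrightarrow> \<exists>H. isotopy_of_sphere H \<and> (\<forall>p\<in>S2. - z \<bullet> p \<le> ht \<longrightarrow> H 1 p = p) \<and> radS H \<gamma>"
    using S.tiny_radial[OF ht(1)] unfolding radS_def by blast
  have sep03: "sep x0 h3" "S.sep x0 h3"
    using sep_mono[OF hz(3)[of x0] h3(3)] S.sep_mono[OF hs(3)[of x0] h3(4)] hz(2) hs(2) unfolding close_def by auto
  obtain gc1 where gc1: "gc1 > 0" "\<And>\<gamma> p. \<bar>\<gamma>\<bar> < gc1 \<Longrightarrow> k = card U + 2 \<Longrightarrow> p \<in> S2 \<Longrightarrow> h3 \<le> z \<bullet> p \<Longrightarrow> \<rho> / 2 \<le> norm (p - z) \<Longrightarrow> cmp k I x0 (pe \<gamma>) p p"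
  proof (cases "k = card U + 2")
    case True
    then show ?thesis using square_cmp[OF True hh(10) sep03(1) \<rho>(2)] that by blast
  next
    case False
    then show ?thesis using that[of 1] by simp
  qed
  obtain gc2 where gc2: "gc2 > 0" "\<And>\<gamma> p. \<bar>\<gamma>\<bar> < gc2 \<Longrightarrow> k = card L + 2 \<Longrightarrow> p \<in> S2 \<Longrightarrow> h3 \<le> - z \<bullet> p \<Longrightarrow> \<rho> / 2 \<le> norm (p - - z) \<Longrightarrow> cmp k I x0 (pe \<gamma>) p p"
  proof (cases "k = card L + 2")
    case True
    then show ?thesis using S.square_cmp[unfolded SUL Spe, OF True hh(10) sep03(2) \<rho>(2)] that by blast
  next
    case False
    then show ?thesis using that[of 1] by simp
  qed
  \<comment> \<open>Only the poles visible at order k are spared. At an invisible pole the four dots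
    are not all tied in the label, the isotopy runs through it, and the graphs on both sides
    coincide there.\<close>
  define Z where "Z = (if vis then {z} else {}) \<union> (if vis' then {- z} else {})"
  have Z: "finite Z" "\<zeta> \<in> Z \<longleftrightarrow> \<zeta> = z \<and> vis \<or> \<zeta> = - z \<and> vis'" for \<zeta> unfolding Z_def by auto
  have I3: "3 \<le> card I" using card_parts by simp
  have "\<And>p. p \<in> S2 - Z \<Longrightarrow> card (tie (lab k I x0 p)) \<le> 3" using tie3 Z(2) unfolding vis_def vis'_def by blast
  from local_triviality[OF finI I3 kI nc Z(1) this \<rho>(2,3), of "\<epsilon> / 2"] hh(1)
  obtain \<delta> where \<delta>: "\<delta> > 0" "\<And>x. close I x0 \<delta> x \<Longrightarrow> \<exists>H. isotopy_of_sphere H \<and>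
    (\<forall>p\<in>S2. norm (H 1 p - p) \<le> \<epsilon> / 2) \<and>
    (\<forall>p\<in>S2. (\<forall>z\<in>Z. \<rho> \<le> norm (p - z) \<or> \<rho> / 2 \<le> norm (p - z) \<and> cmp k I x0 x p p) \<longrightarrow> lab k I x (H 1 p) = lab k I x0 p) \<and>
    (\<forall>p\<in>S2. \<forall>z\<in>Z. norm (p - z) < \<rho> / 2 \<longrightarrow> H 1 p = p)" unfolding close_def by auto
  obtain gg where gg: "gg > 0" "\<And>\<gamma>. 0 < \<bar>\<gamma>\<bar> \<Longrightarrow> \<bar>\<gamma>\<bar> < gg \<Longrightarrow> regular k I (pe \<gamma>)" using reg by blast
  have posl: "0 < x" if "x \<in> set [\<delta>z, \<delta>s, gr1, gr2, gc1, gc2, \<delta>, gg, r * s1 / 2, r * s2 / 2, r * s3 / 2, r * s4 / 2]" for x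
  proof -
    have "0 < r * s1 / 2" "0 < r * s2 / 2" "0 < r * s3 / 2" "0 < r * s4 / 2" using r(1) s by simp_all
    then show ?thesis using that hz(2) hs(2) gr1(1) gr2(1) gc1(1) gc2(1) \<delta>(1) gg(1)
      by (simp only: list.set insert_iff empty_iff) (elim disjE; simp only:)
  qed
  obtain g where g: "0 < g" "\<And>x. x \<in> set [\<delta>z, \<delta>s, gr1, gr2, gc1, gc2, \<delta>, gg, r * s1 / 2, r * s2 / 2, r * s3 / 2, r * s4 / 2] \<Longrightarrow> g \<le> x"
    using small_common[OF posl] by blast
  have "\<exists>A (B :: point \<Rightarrow> 'i labels) C h. 0 < h \<and>
    label_isotopic A (lab k I (pe \<gamma>)) \<and> label_isotopic C (lab k I (pe (- \<gamma>))) \<and>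
    (if vis then local_move z h (gr k A) (gr k B) else gr k A = gr k B) \<and>
    (if vis' then local_move (- z) h (gr k B) (gr k C) else gr k B = gr k C)" if \<gamma>: "0 < \<gamma>" "\<gamma> < g" for \<gamma>
  proof -
    have lt: "\<gamma> < x" if "x \<in> set [\<delta>z, \<delta>s, gr1, gr2, gc1, gc2, \<delta>, gg, r * s1 / 2, r * s2 / 2, r * s3 / 2, r * s4 / 2]" for x
      using g(2)[OF that] \<gamma>(2) by linarith
    have lts: "\<gamma> < \<delta>z" "\<gamma> < \<delta>s" "\<gamma> < gr1" "\<gamma> < gr2" "\<gamma> < gc1" "\<gamma> < gc2" "\<gamma> < \<delta>" "\<gamma> < gg"
      and ltr: "\<gamma> < r * s1 / 2" "\<gamma> < r * s2 / 2" "\<gamma> < r * s3 / 2" "\<gamma> < r * s4 / 2" by (rule lt, simp only: list.set insert_iff simp_thms)+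
    have sr: "2 * \<gamma> / t \<le> r" if "t \<in> {s1, s2, s3, s4}" for t
    proof -
      have "0 < t \<and> \<gamma> < r * t / 2" using that ltr s by (elim insertE emptyE; simp only: simp_thms)
      then show ?thesis by (simp add: divide_le_eq)
    qed
    have cl: "close I x0 d (pe \<gamma>)" "close I x0 d (pe (- \<gamma>))" if "\<gamma> < d" for d using pe_close[of \<gamma> d] pe_close[of "- \<gamma>" d] that \<gamma>(1) by auto
    have seps: "sep (pe \<gamma>) h2" "sep (pe (- \<gamma>)) h2" "sep x0 h2" "S.sep (pe \<gamma>) h2" "S.sep (pe (- \<gamma>)) h2" "S.sep x0 h2"
      using sep_mono[OF hz(3)[OF cl(1)[OF lts(1)]]] sep_mono[OF hz(3)[OF cl(2)[OF lts(1)]]] sep_mono[OF sep03(1)]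
        S.sep_mono[OF hs(3)[OF cl(1)[OF lts(2)]]] S.sep_mono[OF hs(3)[OF cl(2)[OF lts(2)]]] S.sep_mono[OF sep03(2)] h3 hh(8) by auto
    have regs: "regular k I (pe \<gamma>)" "regular k I (pe (- \<gamma>))" using gg(2)[of \<gamma>] gg(2)[of "- \<gamma>"] \<gamma>(1) lts(8) by auto
    obtain H where H: "isotopy_of_sphere H" "\<And>p. p \<in> S2 \<Longrightarrow> norm (H 1 p - p) \<le> \<epsilon> / 2"
      "\<And>p. p \<in> S2 \<Longrightarrow> (\<forall>z\<in>Z. \<rho> \<le> norm (p - z) \<or> \<rho> / 2 \<le> norm (p - z) \<and> cmp k I x0 (pe \<gamma>) p p) \<Longrightarrow> lab k I (pe \<gamma>) (H 1 p) = lab k I x0 p"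
      "\<And>p z. p \<in> S2 \<Longrightarrow> z \<in> Z \<Longrightarrow> norm (p - z) < \<rho> / 2 \<Longrightarrow> H 1 p = p"
      using \<delta>(2)[OF cl(1)[OF lts(7)]] by blast
    obtain H' where H': "isotopy_of_sphere H'" "\<And>p. p \<in> S2 \<Longrightarrow> norm (H' 1 p - p) \<le> \<epsilon> / 2"
      "\<And>p. p \<in> S2 \<Longrightarrow> (\<forall>z\<in>Z. \<rho> \<le> norm (p - z) \<or> \<rho> / 2 \<le> norm (p - z) \<and> cmp k I x0 (pe (- \<gamma>)) p p) \<Longrightarrow> lab k I (pe (- \<gamma>)) (H' 1 p) = lab k I x0 p"
      "\<And>p z. p \<in> S2 \<Longrightarrow> z \<in> Z \<Longrightarrow> norm (p - z) < \<rho> / 2 \<Longrightarrow> H' 1 p = p"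
      using \<delta>(2)[OF cl(2)[OF lts(7)]] by blast
    \<comment> \<open>The radial correction serves the square alone; at the other orders it is the
      identity, and the cap is only known through \<open>H\<close> and \<open>H'\<close>.\<close>
    obtain Hz where Hz: "isotopy_of_sphere Hz" "\<And>p. p \<in> S2 \<Longrightarrow> z \<bullet> p \<le> ht \<Longrightarrow> Hz 1 p = p" "k = card U + 2 \<Longrightarrow> rad Hz \<gamma>" "k \<noteq> card U + 2 \<Longrightarrow> Hz 1 = (\<lambda>p. p)"
    proof (cases "k = card U + 2")
      case True
      then show ?thesis using gr1(2)[OF \<gamma>(1) lts(3)] that by blast
    next
      case False
      then show ?thesis using that[of "\<lambda>t p. p"] isotopy_id by simp
    qed
    obtain Hs where Hs: "isotopy_of_sphere Hs" "\<And>p. p \<in> S2 \<Longrightarrow> - z \<bullet> p \<le> ht \<Longrightarrow> Hs 1 p = p" "k = card L + 2 \<Longrightarrow> radS Hs \<gamma>" "k \<noteq> card L + 2 \<Longrightarrow> Hs 1 = (\<lambda>p. p)"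
    proof (cases "k = card L + 2")
      case True
      then show ?thesis using gr2(2)[OF \<gamma>(1) lts(4)] that by blast
    next
      case False
      then show ?thesis using that[of "\<lambda>t p. p"] isotopy_id by simp
    qed
    define R where "R = (\<lambda>p. Hs 1 (Hz 1 p))"
    note S2z = isotopy_maps(1)[OF Hz(1), of 1, simplified] and S2s = isotopy_maps(1)[OF Hs(1), of 1, simplified]
    have Rz: "R p = Hz 1 p" "ht < z \<bullet> R p" if "p \<in> S2" "ht < z \<bullet> p" for p
    proof -
      have 1: "ht < z \<bullet> Hz 1 p" by (rule cap_preserved[OF Hz(1,2) that])
      have "Hz 1 p \<in> S2" using isotopy_maps(1)[OF Hz(1), of 1] that(1) by auto
      then show "R p = Hz 1 p" unfolding R_def using Hs(2)[of "Hz 1 p"] 1 ht(3) by simp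
      then show "ht < z \<bullet> R p" using 1 by simp
    qed
    have Rs: "R p = Hs 1 p" if "p \<in> S2" "z \<bullet> p \<le> ht" for p
      unfolding R_def using Hz(2)[OF that] by simp
    have Rs': "ht < - z \<bullet> R p" if "p \<in> S2" "ht < - z \<bullet> p" for p
      unfolding Rs[OF that(1)] using cap_preserved[OF Hs(1,2) that] Rs[of p] that ht(3) by simp
    have Rid: "R p = p" if "p \<in> S2" "z \<bullet> p \<le> ht" "- z \<bullet> p \<le> ht" for p
      unfolding Rs[OF that(1,2)] by (rule Hs(2)[OF that(1,3)])
    have RS: "R p \<in> S2" if "p \<in> S2" for p
    proof -
      have "Hz 1 p \<in> S2" using isotopy_maps(1)[OF Hz(1), of 1] that by auto
      then show ?thesis unfolding R_def using isotopy_maps(1)[OF Hs(1), of 1] by auto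
    qed
    have Rnear: "norm (R p - p) \<le> \<epsilon> / 2" if p: "p \<in> S2" for p
    proof -
      have "z \<bullet> p \<le> ht \<and> - z \<bullet> p \<le> ht \<or> ht < z \<bullet> p \<or> ht < - z \<bullet> p" by linarith
      then show ?thesis
        using Rid[OF p] cap_norm(2)[OF z1 p RS[OF p], of ht] Rz(2)[OF p] cap_norm(2)[OF S.z1 p RS[OF p], of ht] Rs'[OF p] tiny hh(1) by auto
    qed
    \<comment> \<open>\<open>A\<close> belongs to positive \<gamma> and \<open>C\<close> to negative
      \<gamma>, with the radial maps inserted first. \<open>B\<close> takes the new labels on the
      hemisphere of \<open>z\<close> and the old ones on the other, so that \<open>A\<close> and
      \<open>B\<close> differ only near \<open>z\<close>, and \<open>B\<close> and \<open>C\<close>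
      only near \<open>- z\<close>.\<close>
    define A C B where "A = (\<lambda>p. lab k I (pe \<gamma>) (H 1 p))" and "C = (\<lambda>p. lab k I (pe (- \<gamma>)) (H' 1 (R p)))"
      and "B = (\<lambda>p. if 0 < z \<bullet> p then C p else A p)"
    define K where "K = (\<lambda>t x. H' t (Hs t (Hz t x)))"
    have K: "isotopy_of_sphere K" unfolding K_def by (rule isotopy_compose[OF isotopy_compose[OF Hz(1) Hs(1)] H'(1)])
    have K1: "K 1 p = H' 1 (R p)" for p unfolding K_def R_def ..
    have Knear: "norm (K 1 p - p) \<le> \<epsilon>" if p: "p \<in> S2" for p
      using H'(2)[OF RS[OF p]] Rnear[OF p] norm_triangle_ineq[of "K 1 p - R p" "R p - p"] unfolding K1 by simp
    have far: "\<forall>\<zeta>\<in>Z. \<rho> \<le> norm (p - \<zeta>)" if p: "p \<in> S2" "z \<bullet> p \<le> h1 \<or> \<not> vis" "- z \<bullet> p \<le> h1 \<or> \<not> vis'" for p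
    proof
      fix \<zeta> assume "\<zeta> \<in> Z"
      then have "\<zeta> = z \<and> vis \<or> \<zeta> = - z \<and> vis'" by (simp only: Z(2))
      then show "\<rho> \<le> norm (p - \<zeta>)"
        unfolding \<rho>_def using cap_norm(1)[OF z1 p(1), of h1] cap_norm(1)[OF S.z1 p(1), of h1] p(2,3) by metis
    qed
    have AC0: "A p = lab k I x0 p \<and> C p = lab k I x0 p" if p: "p \<in> S2" "z \<bullet> p \<le> h1 \<or> \<not> vis" "- z \<bullet> p \<le> h1 \<or> \<not> vis'" for p
    proof -
      have "Hz 1 p = p" using Hz(2)[OF p(1)] Hz(4) p(2) ht(2) unfolding vis_def by (cases "k = card U + 2") auto
      moreover have "Hs 1 p = p" using Hs(2)[OF p(1)] Hs(4) p(3) ht(2) unfolding vis'_def by (cases "k = card L + 2") auto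
      ultimately have "R p = p" unfolding R_def by simp
      then show ?thesis unfolding A_def C_def using H(3)[OF p(1)] H'(3)[OF p(1)] far[OF p] by simp
    qed
    \<comment> \<open>In the square case the pullback changes no label in the cap. Within
      \<open>\<rho> / 2\<close> of the pole the map is the identity; farther out \<open>p\<close>
      and \<open>G p\<close> both carry the label that the unperturbed dots give to
      \<open>p\<close>.\<close>
    have exact: "lab k I x (G p) = lab k I x p"
      if G: "\<And>p. p \<in> S2 \<Longrightarrow> (\<forall>z\<in>Z. \<rho> \<le> norm (p - z) \<or> \<rho> / 2 \<le> norm (p - z) \<and> cmp k I x0 x p p) \<Longrightarrow> lab k I x (G p) = lab k I x0 p"
        "\<And>p z. p \<in> S2 \<Longrightarrow> z \<in> Z \<Longrightarrow> norm (p - z) < \<rho> / 2 \<Longrightarrow> G p = p"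
        and \<zeta>: "\<zeta> = z \<or> \<zeta> = - z" "\<zeta> \<in> Z" and cm: "\<And>p. p \<in> S2 \<Longrightarrow> h3 \<le> \<zeta> \<bullet> p \<Longrightarrow> \<rho> / 2 \<le> norm (p - \<zeta>) \<Longrightarrow> cmp k I x0 x p p"
        and p: "p \<in> S2" "h3 \<le> \<zeta> \<bullet> p" for x G \<zeta> p
    proof (cases "norm (p - \<zeta>) < \<rho> / 2")
      case True
      then show ?thesis using G(2)[OF p(1) \<zeta>(2)] by simp
    next
      case False
      then have c: "\<rho> / 2 \<le> norm (p - \<zeta>)" "cmp k I x0 x p p" using cm[OF p] by auto
      have "norm (- \<zeta>) = 1" using \<zeta>(1) z1 by auto
      moreover have "- \<zeta> \<bullet> p \<le> h1" using p(2) hh(9,10) by simp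
      ultimately have "\<rho> \<le> norm (p - - \<zeta>)" unfolding \<rho>_def by (intro cap_norm(1) p(1))
      moreover have "z' = \<zeta> \<or> z' = - \<zeta>" if "z' \<in> Z" for z' using that Z(2) \<zeta>(1) by auto
      ultimately have "\<forall>z\<in>Z. \<rho> \<le> norm (p - z) \<or> \<rho> / 2 \<le> norm (p - z) \<and> cmp k I x0 x p p" using c by blast
      then show ?thesis using G(1)[OF p(1)] cmp_lab[OF finI kI c(2)] by simp
    qed
    have AC: "A p = C p" if "p \<in> S2" "\<bar>z \<bullet> p\<bar> \<le> h1" for p using AC0[of p] that by (simp add: abs_le_iff)
    obtain gH gK where homeo: "homeomorphism S2 S2 (H 1) gH" "homeomorphism S2 S2 (K 1) gK"
      using H(1) K unfolding isotopy_of_sphere_def by (metis atLeastAtMost_iff order_refl zero_le_one)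
    have pA: "proper k I A" unfolding A_def
      by (rule proper_comp[OF proper_lab[OF finI kI regs(1)]]) (use homeo(1) in \<open>auto simp: homeomorphism_def\<close>)
    have pC: "proper k I C" unfolding C_def K1[symmetric]
      by (rule proper_comp[OF proper_lab[OF finI kI regs(2)]]) (use homeo(2) in \<open>auto simp: homeomorphism_def\<close>)
    have pB: "proper k I B" unfolding B_def
      by (rule proper_glue[OF pA pC z1 hh(9)]) (use AC in auto)
    have BA: "B p = A p" if "p \<in> S2" "z \<bullet> p \<le> h1" for p unfolding B_def using AC[OF that(1)] that(2) by auto
    have BC: "B p = C p" if "p \<in> S2" "- z \<bullet> p \<le> h1" for p unfolding B_def using AC[OF that(1)] that(2) by auto
    have Hnear: "norm (H 1 p - p) \<le> \<epsilon>" if p: "p \<in> S2" for p using H(2)[OF p] hh(1) by linarith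
    have vA: "viewed k \<gamma> \<epsilon> h2 A" unfolding viewed_def
      using homeo(1) Hnear unfolding A_def by (intro exI[of _ "H 1"] exI[of _ gH]) auto
    have vB: "viewed k (- \<gamma>) \<epsilon> h2 B" unfolding viewed_def
      using homeo(2) Knear hh(12) unfolding B_def C_def K1[symmetric] by (intro exI[of _ "K 1"] exI[of _ gK]) auto
    have vB': "S.viewed k \<gamma> \<epsilon> h2 B" unfolding S.viewed_def Spe
      using homeo(1) Hnear hh(12) unfolding B_def A_def by (intro exI[of _ "H 1"] exI[of _ gH]) auto
    have vC: "S.viewed k (- \<gamma>) \<epsilon> h2 C" unfolding S.viewed_def Spe
      using homeo(2) Knear unfolding C_def K1[symmetric] by (intro exI[of _ "K 1"] exI[of _ gK]) auto
    have M: "move_data k \<gamma> r \<epsilon> h1 h2 A B" unfolding move_data_def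
    proof (intro conjI)
      show "\<forall>p\<in>S2. z \<bullet> p = h1 \<longrightarrow> A p = lab k I x0 p" using AC0 hh(9) by auto
      show "\<forall>p\<in>S2. z \<bullet> p \<le> h1 \<longrightarrow> A p = B p" using BA by auto
      show "\<forall>y. \<bar>fst y\<bar> \<le> r \<longrightarrow> \<bar>snd y\<bar> \<le> r \<longrightarrow> h1 + \<epsilon> < z \<bullet> pl y" using r1(2) r(2) by (meson order_trans)
      show "\<forall>s\<in>{s1, s2, s3, s4}. 2 * \<gamma> / s \<le> r" using sr by blast
      show "0 \<le> \<epsilon>" using hh(1) by simp
    qed (use hh \<gamma> seps pA pB in blast)+
    have M': "S.move_data k \<gamma> r \<epsilon> h1 h2 B C" unfolding S.move_data_def Spe
    proof (intro conjI)
      show "\<forall>p\<in>S2. - z \<bullet> p = h1 \<longrightarrow> B p = lab k I x0 p" using AC0 hh(9) unfolding B_def by auto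
      show "\<forall>p\<in>S2. - z \<bullet> p \<le> h1 \<longrightarrow> B p = C p" using BC by auto
      show "\<forall>y. \<bar>fst y\<bar> \<le> r \<longrightarrow> \<bar>snd y\<bar> \<le> r \<longrightarrow> h1 + \<epsilon> < - z \<bullet> S.pl y" using r2(2) r(3) by (meson order_trans)
      show "\<forall>s\<in>{s2, s3, s4, s1}. 2 * \<gamma> / s \<le> r" using sr by blast
      show "0 \<le> \<epsilon>" using hh(1) by simp
    qed (use hh \<gamma> seps pB pC in blast)+
    have g1: "\<bar>\<gamma>\<bar> < gc1" "\<bar>- \<gamma>\<bar> < gc1" "\<bar>\<gamma>\<bar> < gc2" "\<bar>- \<gamma>\<bar> < gc2" using \<gamma>(1) lts by auto
    have mv: "local_move z h1 (gr k A) (gr k B)" if v: vis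
    proof (rule local_move_gr[OF M _ _ vA vB, where R = R])
      show "card U < k" "k < card U + 4" using v unfolding vis_def by auto
      assume kU: "k = card U + 2"
      have zZ: "z \<in> Z" using v Z(2) by blast
      have ex: "lab k I (pe \<gamma>) (H 1 p) = lab k I (pe \<gamma>) p" "lab k I (pe (- \<gamma>)) (H' 1 p) = lab k I (pe (- \<gamma>)) p" if "p \<in> S2" "h3 \<le> z \<bullet> p" for p
        by (rule exact[OF H(3,4) _ zZ gc1(2)[OF g1(1) kU] that], simp_all) (rule exact[OF H'(3,4) _ zZ gc1(2)[OF g1(2) kU] that], simp_all)
      have Rh: "h1 \<le> z \<bullet> R p" "R p = Hz 1 p" if "p \<in> S2" "h1 \<le> z \<bullet> p" for p
      proof -
        have "- z \<bullet> p \<le> ht" using that(2) hh(9) ht(3) by simp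
        then show "h1 \<le> z \<bullet> R p" "R p = Hz 1 p"
          using Rz[OF that(1)] Rid[OF that(1)] Hz(2)[OF that(1)] that(2) ht(2) by (cases "ht < z \<bullet> p"; force)+
      qed
      show "(\<forall>p\<in>S2. h2 - \<epsilon> \<le> z \<bullet> p \<longrightarrow> A p = lab k I (pe \<gamma>) p) \<and>
        (\<forall>p\<in>S2. h1 \<le> z \<bullet> p \<longrightarrow> B p = lab k I (pe (- \<gamma>)) (R p)) \<and>
        (\<forall>y. h1 \<le> z \<bullet> pl y \<longrightarrow> (\<exists>m>0. R (pl y) = pl (m *\<^sub>R y) \<and> h2 \<le> z \<bullet> R (pl y) \<and> swapped \<gamma> m y))"
      proof (intro conjI ballI allI impI)
        show "A p = lab k I (pe \<gamma>) p" if "p \<in> S2" "h2 - \<epsilon> \<le> z \<bullet> p" for p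
          unfolding A_def using ex(1)[OF that(1)] that(2) hh(6) by simp
        show "B p = lab k I (pe (- \<gamma>)) (R p)" if "p \<in> S2" "h1 \<le> z \<bullet> p" for p
          unfolding B_def C_def using ex(2)[OF RS[OF that(1)]] Rh(1)[OF that] that(2) hh by simp
        fix y assume h: "h1 \<le> z \<bullet> pl y"
        obtain m where "m > 0" "Hz 1 (pl y) = pl (m *\<^sub>R y)" "swapped \<gamma> m y"
          using Hz(3)[OF kU] unfolding rad_def by blast
        then show "\<exists>m>0. R (pl y) = pl (m *\<^sub>R y) \<and> h2 \<le> z \<bullet> R (pl y) \<and> swapped \<gamma> m y"
          using Rh[OF pl_S2 h] hh(11) by (intro exI[of _ m]) simp
      qed
    qed
    have mv': "local_move (- z) h1 (gr k B) (gr k C)" if v: vis'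
    proof (rule S.local_move_gr[OF M' _ _ vB' vC, where R = R])
      show "card S.U < k" "k < card S.U + 4" using v unfolding vis'_def SUL by auto
      assume "k = card S.U + 2"
      then have kU: "k = card L + 2" unfolding SUL .
      have zZ: "- z \<in> Z" using v Z(2) by blast
      have ex: "lab k I (pe \<gamma>) (H 1 p) = lab k I (pe \<gamma>) p" "lab k I (pe (- \<gamma>)) (H' 1 p) = lab k I (pe (- \<gamma>)) p" if "p \<in> S2" "h3 \<le> - z \<bullet> p" for p
        by (rule exact[OF H(3,4) _ zZ gc2(2)[OF g1(3) kU] that], simp_all) (rule exact[OF H'(3,4) _ zZ gc2(2)[OF g1(4) kU] that], simp_all)
      have Rh: "h1 \<le> - z \<bullet> R p" "R p = Hs 1 p" if "p \<in> S2" "h1 \<le> - z \<bullet> p" for p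
      proof -
        have zp: "z \<bullet> p \<le> ht" using that(2) hh(9) ht(3) by simp
        show "R p = Hs 1 p" by (rule Rs[OF that(1) zp])
        show "h1 \<le> - z \<bullet> R p"
          using Rs'[OF that(1)] Rid[OF that(1) zp] that(2) ht(2) by (cases "ht < - z \<bullet> p"; force)
      qed
      show "(\<forall>p\<in>S2. h2 - \<epsilon> \<le> - z \<bullet> p \<longrightarrow> B p = lab k I (S.pe \<gamma>) p) \<and>
        (\<forall>p\<in>S2. h1 \<le> - z \<bullet> p \<longrightarrow> C p = lab k I (S.pe (- \<gamma>)) (R p)) \<and>
        (\<forall>y. h1 \<le> - z \<bullet> S.pl y \<longrightarrow> (\<exists>m>0. R (S.pl y) = S.pl (m *\<^sub>R y) \<and> h2 \<le> - z \<bullet> R (S.pl y) \<and> S.swapped \<gamma> m y))"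
        unfolding Spe
      proof (intro conjI ballI allI impI)
        show "B p = lab k I (pe \<gamma>) p" if "p \<in> S2" "h2 - \<epsilon> \<le> - z \<bullet> p" for p
          unfolding B_def A_def using ex(1)[OF that(1)] that(2) hh(6,12) by simp
        show "C p = lab k I (pe (- \<gamma>)) (R p)" if "p \<in> S2" "h1 \<le> - z \<bullet> p" for p
          unfolding C_def using ex(2)[OF RS[OF that(1)]] Rh(1)[OF that] that(2) hh by simp
        fix y assume h: "h1 \<le> - z \<bullet> S.pl y"
        obtain m where "m > 0" "Hs 1 (S.pl y) = S.pl (m *\<^sub>R y)" "S.swapped \<gamma> m y"
          using Hs(3)[OF kU] unfolding radS_def by blast
        then show "\<exists>m>0. R (S.pl y) = S.pl (m *\<^sub>R y) \<and> h2 \<le> - z \<bullet> R (S.pl y) \<and> S.swapped \<gamma> m y"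
          using Rh[OF S.pl_S2 h] hh(11) by (intro exI[of _ m]) simp
      qed
    qed
    have gr_eq: "gr k \<Lambda> = gr k \<Lambda>'" if "\<And>p. p \<in> S2 \<Longrightarrow> \<Lambda> p = \<Lambda>' p" for \<Lambda> \<Lambda>' :: "point \<Rightarrow> 'i labels"
      unfolding gr_def using that by (auto cong: conj_cong)
    have nv: "gr k A = gr k B" if "\<not> vis"
    proof (rule gr_eq)
      fix p assume p: "p \<in> S2"
      show "A p = B p" unfolding B_def using AC0[OF p] that hh(9) by auto
    qed
    have nv': "gr k B = gr k C" if "\<not> vis'"
    proof (rule gr_eq)
      fix p assume p: "p \<in> S2"
      show "B p = C p" unfolding B_def using AC0[OF p] that hh(9) by auto
    qed
    show ?thesis
    proof (intro exI conjI)
      show "0 < h1" by (rule hh(9))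
      show "label_isotopic A (lab k I (pe \<gamma>))" unfolding label_isotopic_def A_def using H(1) by blast
      show "label_isotopic C (lab k I (pe (- \<gamma>)))" unfolding label_isotopic_def C_def K1[symmetric] using K by blast
      show "if vis then local_move z h1 (gr k A) (gr k B) else gr k A = gr k B" using mv nv by (cases vis) simp_all
      show "if vis' then local_move (- z) h1 (gr k B) (gr k C) else gr k B = gr k C" using mv' nv' by (cases vis') simp_all
    qed
  qed
  then show ?thesis using g(1) unfolding vis_def vis'_def by blast
qed

end

section \<open>The two sides of a wall\<close>

context cap_frame
begin

text \<open>With these weights the crossing point \<open>cc\<close> is a convex combination of
  \<open>x0 a\<close>, \<open>x0 c\<close> and also of \<open>x0 b\<close>, \<open>x0 d\<close>. The
  vector measures by how much the two diagonals miss each other.\<close>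

definition ev :: "('i \<Rightarrow> point) \<Rightarrow> point" where
  "ev x = (s3 / (s1 + s3)) *\<^sub>R x a + (s1 / (s1 + s3)) *\<^sub>R x c - (s4 / (s2 + s4)) *\<^sub>R x b - (s2 / (s2 + s4)) *\<^sub>R x d"

definition nv :: "('i \<Rightarrow> point) \<Rightarrow> point" where
  "nv x = cross3 (x a - x c) (x b - x c)"

text \<open>The sign of \<open>vol\<close> tells the two sides of the wall, on which the four dots are cocircular, apart.\<close>

definition vol :: "('i \<Rightarrow> point) \<Rightarrow> real" where "vol x = ev x \<bullet> nv x"

text \<open>Prescribes the mismatch of the diagonals by moving the dot \<open>d\<close> alone. The
  normal \<open>nv\<close> does not involve \<open>d\<close>, so \<open>vol\<close> becomes linear
  in the prescribed vector.\<close>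

definition set_ev :: "('i \<Rightarrow> point) \<Rightarrow> point \<Rightarrow> 'i \<Rightarrow> point" where
  "set_ev x e = x(d := ((s2 + s4) / s2) *\<^sub>R ((s3 / (s1 + s3)) *\<^sub>R x a + (s1 / (s1 + s3)) *\<^sub>R x c - (s4 / (s2 + s4)) *\<^sub>R x b - e))"

lemma weights: "s3 / (s1 + s3) + s1 / (s1 + s3) = 1" "s4 / (s2 + s4) + s2 / (s2 + s4) = 1" "(s2 / (s2 + s4)) * ((s2 + s4) / s2) = 1"
proof -
  have "s1 + s3 \<noteq> 0" "s2 + s4 \<noteq> 0" "s2 \<noteq> 0" using s by auto
  then show "s3 / (s1 + s3) + s1 / (s1 + s3) = 1" "s4 / (s2 + s4) + s2 / (s2 + s4) = 1" "(s2 / (s2 + s4)) * ((s2 + s4) / s2) = 1"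
    by (simp_all add: add_divide_distrib[symmetric] add.commute)
qed

lemma ev_pe: "ev (pe \<gamma>) = (2 * \<gamma>) *\<^sub>R z"
proof -
  define \<alpha> \<alpha>' \<beta> \<beta>' where "\<alpha> = s3 / (s1 + s3)" and "\<alpha>' = s1 / (s1 + s3)" and "\<beta> = s4 / (s2 + s4)" and "\<beta>' = s2 / (s2 + s4)"
  have w1: "\<alpha> + \<alpha>' = 1" "\<beta> + \<beta>' = 1" using weights unfolding \<alpha>_def \<alpha>'_def \<beta>_def \<beta>'_def by auto
  have bal: "\<alpha> * s1 = \<alpha>' * s3" "\<beta> * s2 = \<beta>' * s4" unfolding \<alpha>_def \<alpha>'_def \<beta>_def \<beta>'_def by simp_all
  have v: "pe \<gamma> a = cc + s1 *\<^sub>R u + \<gamma> *\<^sub>R z" "pe \<gamma> c = cc - s3 *\<^sub>R u + \<gamma> *\<^sub>R z" "pe \<gamma> b = cc + s2 *\<^sub>R w - \<gamma> *\<^sub>R z" "pe \<gamma> d = cc - s4 *\<^sub>R w - \<gamma> *\<^sub>R z"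
    using distinct_simps x0 by (simp_all add: pert_def)
  have "\<alpha> *\<^sub>R pe \<gamma> a + \<alpha>' *\<^sub>R pe \<gamma> c = (\<alpha> + \<alpha>') *\<^sub>R (cc + \<gamma> *\<^sub>R z) + (\<alpha> * s1 - \<alpha>' * s3) *\<^sub>R u"
    unfolding v by (simp add: algebra_simps)
  moreover have "\<beta> *\<^sub>R pe \<gamma> b + \<beta>' *\<^sub>R pe \<gamma> d = (\<beta> + \<beta>') *\<^sub>R (cc - \<gamma> *\<^sub>R z) + (\<beta> * s2 - \<beta>' * s4) *\<^sub>R w"
    unfolding v by (simp add: algebra_simps)
  ultimately have "\<alpha> *\<^sub>R pe \<gamma> a + \<alpha>' *\<^sub>R pe \<gamma> c - (\<beta> *\<^sub>R pe \<gamma> b + \<beta>' *\<^sub>R pe \<gamma> d) = \<gamma> *\<^sub>R z + \<gamma> *\<^sub>R z"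
    using w1 bal by simp
  then show ?thesis unfolding ev_def \<alpha>_def[symmetric] \<alpha>'_def[symmetric] \<beta>_def[symmetric] \<beta>'_def[symmetric]
    by (simp add: scaleR_2[symmetric] diff_diff_eq)
qed

lemma set_ev_simps: "ev (set_ev x e) = e" "nv (set_ev x e) = nv x" "vol (set_ev x e) = e \<bullet> nv x" "set_ev x (ev x) = x"
proof -
  let ?y = "(s3 / (s1 + s3)) *\<^sub>R x a + (s1 / (s1 + s3)) *\<^sub>R x c - (s4 / (s2 + s4)) *\<^sub>R x b"
  have m: "(s2 / (s2 + s4)) *\<^sub>R ((s2 + s4) / s2) *\<^sub>R v = v" "((s2 + s4) / s2) *\<^sub>R (s2 / (s2 + s4)) *\<^sub>R v = v" for v :: point
    unfolding scaleR_scaleR using weights(3) by (simp_all add: mult.commute)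
  show e: "ev (set_ev x e) = e" unfolding ev_def set_ev_def using distinct_simps m(1)[of "?y - e"] by simp
  show n: "nv (set_ev x e) = nv x" unfolding nv_def set_ev_def using distinct_simps by simp
  show "vol (set_ev x e) = e \<bullet> nv x" unfolding vol_def e n ..
  show "set_ev x (ev x) = x" unfolding ev_def set_ev_def using m(2)[of "x d"] by (simp add: fun_eq_iff)
qed

text \<open>The coefficients in \<open>ev\<close> sum to zero. Along the common normal of
  \<open>a\<close>, \<open>b\<close>, \<open>c\<close> it therefore measures the height of
  \<open>d\<close> relative to their plane, up to a nonzero factor.\<close>

lemma in_plane_vol:
  assumes n: "nv x \<noteq> 0"
  shows "in_plane x Q \<longleftrightarrow> vol x = 0"
proof
  have bp: "0 < s2 / (s2 + s4)" using s by simp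
  define p where "p = sgn (nv x)"
  have p: "norm p = 1" unfolding p_def using n by (simp add: norm_sgn)
  have p0: "p \<bullet> (x a - x c) = 0" "p \<bullet> (x b - x c) = 0"
    unfolding p_def sgn_div_norm nv_def by (simp_all add: dot_cross_self inner_commute)
  have nvp: "nv x = norm (nv x) *\<^sub>R p" unfolding p_def by (rule norm_scaleR_sgn[symmetric])
  have dx: "q \<bullet> ev x = (s2 / (s2 + s4)) * (q \<bullet> x c - q \<bullet> x d)" if "q \<bullet> x a = q \<bullet> x c" "q \<bullet> x b = q \<bullet> x c" for q
  proof -
    define \<alpha> \<alpha>' \<beta> \<beta>' where "\<alpha> = s3 / (s1 + s3)" and "\<alpha>' = s1 / (s1 + s3)" and "\<beta> = s4 / (s2 + s4)" and "\<beta>' = s2 / (s2 + s4)"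
    have w1: "\<alpha>' = 1 - \<alpha>" "\<beta> = 1 - \<beta>'" using weights unfolding \<alpha>_def \<alpha>'_def \<beta>_def \<beta>'_def by auto
    have "q \<bullet> ev x = \<alpha> * (q \<bullet> x c) + \<alpha>' * (q \<bullet> x c) - \<beta> * (q \<bullet> x c) - \<beta>' * (q \<bullet> x d)"
      unfolding ev_def \<alpha>_def[symmetric] \<alpha>'_def[symmetric] \<beta>_def[symmetric] \<beta>'_def[symmetric] using that by (simp add: inner_add inner_diff)
    then show ?thesis unfolding \<beta>'_def[symmetric] w1 by (simp add: algebra_simps)
  qed
  show "vol x = 0" if ip: "in_plane x Q"
  proof -
    obtain q where q: "q \<in> S2" "\<forall>i\<in>Q. \<forall>j\<in>Q. q \<bullet> x i = q \<bullet> x j" using ip unfolding in_plane_def by blast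
    have e: "q \<bullet> x a = q \<bullet> x c" "q \<bullet> x b = q \<bullet> x c" "q \<bullet> x d = q \<bullet> x c" using q(2) in_Q by blast+
    have "q = p \<or> q = - p"
      by (rule ortho_noncollinear[of "x a - x c" "x b - x c" p q]) (use n p p0 q e in \<open>auto simp: nv_def inner_diff\<close>)
    moreover have "q \<bullet> ev x = 0" using dx[OF e(1,2)] e(3) by simp
    ultimately have "p \<bullet> ev x = 0" by auto
    then show ?thesis unfolding vol_def by (subst nvp) (simp add: inner_commute)
  qed
  show "in_plane x Q" if "vol x = 0"
  proof -
    have "norm (nv x) * (p \<bullet> ev x) = 0" using that unfolding vol_def by (subst (asm) nvp) (simp add: inner_commute)
    then have pe: "p \<bullet> ev x = 0" using n by simp
    have e: "p \<bullet> x a = p \<bullet> x c" "p \<bullet> x b = p \<bullet> x c" using p0 by (simp_all add: inner_diff)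
    have "p \<bullet> x c - p \<bullet> x d = 0" using dx[OF e] pe bp by (metis less_irrefl mult_eq_0_iff)
    then have "\<forall>i\<in>Q. p \<bullet> x i = p \<bullet> x c" unfolding Q_def using e by auto
    then show ?thesis unfolding in_plane_def using p by (intro bexI[of _ p]) auto
  qed
qed

lemma nv_nz: "noncollinear I x \<Longrightarrow> nv x \<noteq> 0"
  unfolding noncollinear_def nv_def using inI distinct_simps by blast

lemma set_ev_segment:
  assumes "close I x0 \<delta> (set_ev x e)" "close I x0 \<delta> (set_ev x e')" "t \<in> {0..1}"
  shows "close I x0 \<delta> (set_ev x ((1 - t) *\<^sub>R e + t *\<^sub>R e'))"
proof -
  let ?y = "(s3 / (s1 + s3)) *\<^sub>R x a + (s1 / (s1 + s3)) *\<^sub>R x c - (s4 / (s2 + s4)) *\<^sub>R x b"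
  define m where "m = (s2 + s4) / s2"
  have comb: "m *\<^sub>R (y - ((1 - t) *\<^sub>R e + t *\<^sub>R e')) = (1 - t) *\<^sub>R (m *\<^sub>R (y - e)) + t *\<^sub>R (m *\<^sub>R (y - e'))" for y :: point
    by (simp add: algebra_simps)
  have "m *\<^sub>R (?y - e) \<in> ball (x0 d) \<delta>" "m *\<^sub>R (?y - e') \<in> ball (x0 d) \<delta>"
    using assms(1,2) inI unfolding close_def set_ev_def m_def by (auto simp: dist_norm norm_minus_commute dest!: bspec[of I _ d])
  then have "m *\<^sub>R (?y - ((1 - t) *\<^sub>R e + t *\<^sub>R e')) \<in> ball (x0 d) \<delta>"
    unfolding comb using assms(3) by (intro convexD_alt[OF convex_ball]) auto
  moreover have "norm (x i - x0 i) < \<delta>" if "i \<in> I" "i \<noteq> d" for i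
    using assms(1) that unfolding close_def set_ev_def by auto
  ultimately show ?thesis unfolding close_def set_ev_def m_def by (auto simp: dist_norm norm_minus_commute)
qed

lemma set_ev_close:
  assumes \<delta>: "0 < \<delta>"
  shows "\<exists>\<eta>>0. \<eta> \<le> \<delta> \<and> (\<forall>x r. close I x0 \<eta> x \<longrightarrow> \<bar>r\<bar> < \<eta> \<longrightarrow> close I x0 \<delta> (set_ev x (r *\<^sub>R nv x)))"
proof -
  define f where "f = (\<lambda>q :: point \<times> point \<times> point. ((s2 + s4) / s2) *\<^sub>R ((s3 / (s1 + s3)) *\<^sub>R fst q + (s1 / (s1 + s3)) *\<^sub>R snd (snd q) - (s4 / (s2 + s4)) *\<^sub>R fst (snd q)))"
  define n where "n = (\<lambda>q :: point \<times> point \<times> point. cross3 (fst q - snd (snd q)) (fst (snd q) - snd (snd q)))"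
  have cf: "continuous_on UNIV f" unfolding f_def by (intro continuous_intros)
  have cn: "continuous_on UNIV n" unfolding n_def by (intro continuous_on_cross continuous_intros)
  have fx: "set_ev x e d = f (x a, x b, x c) - ((s2 + s4) / s2) *\<^sub>R e" and nx: "nv x = n (x a, x b, x c)" for x e
    unfolding f_def n_def set_ev_def nv_def by (simp_all add: scaleR_diff_right)
  define M where "M = norm (nv x0) + 1"
  have "ev x0 = 0" using ev_pe[of 0] unfolding pe_0 by simp
  then have f0: "f (x0 a, x0 b, x0 c) = x0 d" using fx[of x0 0] set_ev_simps(4)[of x0] by simp
  have "open {q. norm (f q - x0 d) < \<delta> / 2}" "open {q. norm (n q) < M}"
    by (intro open_Collect_less continuous_intros cf cn)+
  moreover have "(x0 a, x0 b, x0 c) \<in> {q. norm (f q - x0 d) < \<delta> / 2}" "(x0 a, x0 b, x0 c) \<in> {q. norm (n q) < M}"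
    using f0 \<delta> nx[of x0] unfolding M_def by auto
  ultimately obtain d1 d2 where d: "d1 > 0" "\<And>x. close I x0 d1 x \<Longrightarrow> norm (f (x a, x b, x c) - x0 d) < \<delta> / 2"
    "d2 > 0" "\<And>x. close I x0 d2 x \<Longrightarrow> norm (n (x a, x b, x c)) < M"
    using close_open3[of "{q. norm (f q - x0 d) < \<delta> / 2}" x0 a b c I] close_open3[of "{q. norm (n q) < M}" x0 a b c I] inI by auto
  define m where "m = (s2 + s4) / s2"
  have m: "0 < m" unfolding m_def using s by simp
  have M: "0 < M" unfolding M_def by (simp add: add_nonneg_pos)
  have "\<exists>g>0. \<forall>y\<in>set [\<delta>, d1, d2, \<delta> / (2 * m * M)]. g \<le> y" by (rule small_common) (use \<delta> d m M in auto)
  then obtain \<eta> where \<eta>: "\<eta> > 0" "\<eta> \<le> \<delta>" "\<eta> \<le> d1" "\<eta> \<le> d2" "\<eta> \<le> \<delta> / (2 * m * M)" by auto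
  have "close I x0 \<delta> (set_ev x (r *\<^sub>R nv x))" if x: "close I x0 \<eta> x" and r: "\<bar>r\<bar> < \<eta>" for x r
    unfolding close_def
  proof
    fix i assume i: "i \<in> I"
    show "norm (set_ev x (r *\<^sub>R nv x) i - x0 i) < \<delta>"
    proof (cases "i = d")
      case False
      then show ?thesis using x i \<eta>(2) unfolding close_def set_ev_def by fastforce
    next
      case True
      have 1: "norm (f (x a, x b, x c) - x0 d) < \<delta> / 2" "norm (nv x) < M" unfolding nx
        using d(2,4) close_mono[OF x] \<eta>(3,4) by blast+
      have "norm (m *\<^sub>R (r *\<^sub>R nv x)) = m * (\<bar>r\<bar> * norm (nv x))" using m by (simp add: abs_mult)
      also have "\<dots> \<le> m * (\<delta> / (2 * m * M) * M)" using m r \<eta>(5) 1(2) by (intro mult_left_mono mult_mono) auto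
      also have "\<dots> = \<delta> / 2" using m M by simp
      finally have "norm (m *\<^sub>R (r *\<^sub>R nv x)) \<le> \<delta> / 2" .
      then show ?thesis unfolding True fx m_def[symmetric]
        using 1(1) norm_triangle_ineq4[of "f (x a, x b, x c) - x0 d" "m *\<^sub>R (r *\<^sub>R nv x)"] by (simp add: algebra_simps)
    qed
  qed
  then show ?thesis using \<eta> by blast
qed

context
  fixes k :: nat and \<delta> :: real
  assumes kI: "k \<le> card I" and good: "\<And>x. close I x0 \<delta> x \<Longrightarrow> noncollinear I x" "\<And>x. close I x0 \<delta> x \<Longrightarrow> vol x \<noteq> 0 \<Longrightarrow> regular k I x"
begin

text \<open>Along a segment of prescribed mismatches \<open>vol\<close> is affine and has the same
  sign at both ends, so it never vanishes.\<close>

lemma same_side_ev: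
  assumes "close I x0 \<delta> x" "close I x0 \<delta> (set_ev x e)" "0 < vol x * (e \<bullet> nv x)"
  shows "lab_isotopic k I x (set_ev x e)"
proof -
  let ?X = "\<lambda>t. set_ev x ((1 - t) *\<^sub>R ev x + t *\<^sub>R e)"
  have I3: "3 \<le> card I" using card_parts by simp
  have "lab_isotopic k I (?X 0) (?X 1)"
  proof (rule lab_isotopic_path[OF finI I3 kI])
    show "continuous_on {0..1} (\<lambda>t. ?X t i)" for i unfolding set_ev_def fun_upd_apply
      by (cases "i = d") (auto intro!: continuous_intros)
    fix t :: real assume t: "t \<in> {0..1}"
    show "regular k I (?X t)"
    proof (rule good(2))
      show "close I x0 \<delta> (?X t)" by (rule set_ev_segment[OF _ assms(2) t]) (use assms(1) set_ev_simps(4) in simp)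
      have e: "vol (?X t) = (1 - t) * vol x + t * (e \<bullet> nv x)" unfolding set_ev_simps(3) by (simp add: inner_add vol_def)
      have "0 < vol x * ((1 - t) * vol x + t * (e \<bullet> nv x))"
      proof (cases "t = 0")
        case True
        have "vol x \<noteq> 0" using assms(3) by auto
        then show ?thesis using True by (auto simp: zero_less_mult_iff linorder_neq_iff)
      next
        case False
        have "0 \<le> (1 - t) * (vol x * vol x)" "0 < t * (vol x * (e \<bullet> nv x))" using t False assms(3) by auto
        then show ?thesis by (simp add: algebra_simps)
      qed
      then show "vol (?X t) \<noteq> 0" unfolding e by auto
    qed
  qed simp
  then show ?thesis by (simp add: set_ev_simps(4))
qed

text \<open>A path in three legs. First the mismatch of \<open>x\<close> is straightened to a
  multiple of its normal; then the dots move linearly to those of \<open>y\<close> while the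
  mismatch is kept at that multiple of the current normal, so that \<open>vol\<close> is
  \<open>r\<close> times a positive number; finally the first leg is undone for
  \<open>y\<close>.\<close>

lemma same_side:
  assumes \<eta>: "\<eta> \<le> \<delta>" "\<And>x r. close I x0 \<eta> x \<Longrightarrow> \<bar>r\<bar> < \<eta> \<Longrightarrow> close I x0 \<delta> (set_ev x (r *\<^sub>R nv x))"
    and x: "close I x0 \<eta> x" and y: "close I x0 \<eta> y" and xy: "0 < vol x * vol y" and \<eta>0: "0 < \<eta>"
  shows "lab_isotopic k I x y"
proof -
  define r where "r = (\<eta> / 2) * sgn (vol x)"
  have vx: "vol x \<noteq> 0" using xy by auto
  have "r * vol x = (\<eta> / 2) * \<bar>vol x\<bar>" unfolding r_def by (simp add: sgn_if)
  then have r3: "0 < r * vol x" using \<eta>0 vx by (metis half_gt_zero mult_pos_pos zero_less_abs_iff)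
  have r: "\<bar>r\<bar> < \<eta>" "r \<noteq> 0" using \<eta>0 vx by (auto simp: r_def abs_mult sgn_if)
  have ry: "0 < r * vol y" using r3 xy by (auto simp: zero_less_mult_iff)
  have I3: "3 \<le> card I" using card_parts by simp
  have cl: "close I x0 \<delta> v" if "close I x0 \<eta> v" for v using close_mono[OF that \<eta>(1)] .
  have one: "lab_isotopic k I v (set_ev v (r *\<^sub>R nv v))" if v: "close I x0 \<eta> v" "0 < r * vol v" for v
  proof (rule same_side_ev[OF cl[OF v(1)] \<eta>(2)[OF v(1) r(1)]])
    have "nv v \<noteq> 0" by (rule nv_nz[OF good(1)[OF cl[OF v(1)]]])
    then have "0 < nv v \<bullet> nv v" by simp
    then have "0 < (r * vol v) * (nv v \<bullet> nv v)" using v(2) by (rule mult_pos_pos[rotated])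
    then show "0 < vol v * ((r *\<^sub>R nv v) \<bullet> nv v)" by (simp add: mult_ac)
  qed
  let ?x = "\<lambda>t i. (1 - t) *\<^sub>R x i + t *\<^sub>R y i"
  let ?X = "\<lambda>t. set_ev (?x t) (r *\<^sub>R nv (?x t))"
  have "lab_isotopic k I (?X 0) (?X 1)"
  proof (rule lab_isotopic_path[OF finI I3 kI])
    show "continuous_on {0..1} (\<lambda>t. ?X t i)" for i unfolding set_ev_def fun_upd_apply nv_def
      by (cases "i = d") (auto intro!: continuous_intros continuous_on_cross)
    fix t :: real assume t: "t \<in> {0..1}"
    have c: "close I x0 \<eta> (?x t)" unfolding close_def
    proof
      fix i assume "i \<in> I"
      then have "x i \<in> ball (x0 i) \<eta>" "y i \<in> ball (x0 i) \<eta>" using x y unfolding close_def by (auto simp: dist_norm norm_minus_commute)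
      then have "(1 - t) *\<^sub>R x i + t *\<^sub>R y i \<in> ball (x0 i) \<eta>" using convex_ball[of "x0 i" \<eta>] t unfolding convex_alt by simp
      then show "norm (?x t i - x0 i) < \<eta>" by (simp add: dist_norm norm_minus_commute)
    qed
    have "nv (?x t) \<noteq> 0" by (rule nv_nz[OF good(1)[OF cl[OF c]]])
    then show "regular k I (?X t)"
      using good(2)[OF \<eta>(2)[OF c r(1)]] r(2) by (simp add: set_ev_simps)
  qed simp
  then have "lab_isotopic k I (set_ev x (r *\<^sub>R nv x)) (set_ev y (r *\<^sub>R nv y))" by simp
  then show ?thesis
    using label_isotopic_trans[OF label_isotopic_trans[OF one[OF x r3]] label_isotopic_sym[OF one[OF y ry]]] by blast
qed

end

definition wall_moves :: "nat \<Rightarrow> ('i \<Rightarrow> point) \<Rightarrow> ('i \<Rightarrow> point) \<Rightarrow> bool" where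
  "wall_moves k x y \<longleftrightarrow> (\<exists>A (B :: point \<Rightarrow> 'i labels) C h. 0 < h \<and>
    label_isotopic A (lab k I x) \<and> label_isotopic C (lab k I y) \<and>
    (if card U < k \<and> k < card U + 4 then local_move z h (gr k A) (gr k B) else gr k A = gr k B) \<and>
    (if card L < k \<and> k < card L + 4 then local_move (- z) h (gr k B) (gr k C) else gr k B = gr k C))"

lemma wall_moves_isotopic:
  assumes "wall_moves k x y" "lab_isotopic k I x x'" "lab_isotopic k I y y'"
  shows "wall_moves k x' y'"
proof -
  obtain A C h and B :: "point \<Rightarrow> 'i labels" where W: "0 < h" "label_isotopic A (lab k I x)" "label_isotopic C (lab k I y)"
    "if card U < k \<and> k < card U + 4 then local_move z h (gr k A) (gr k B) else gr k A = gr k B"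
    "if card L < k \<and> k < card L + 4 then local_move (- z) h (gr k B) (gr k C) else gr k B = gr k C"
    using assms(1) unfolding wall_moves_def by (elim exE conjE) (rule that)
  show ?thesis unfolding wall_moves_def
  proof (intro exI conjI)
    show "label_isotopic A (lab k I x')" by (rule label_isotopic_trans[OF W(2) assms(2)])
    show "label_isotopic C (lab k I y')" by (rule label_isotopic_trans[OF W(3) assms(3)])
  qed (fact W)+
qed

text \<open>At \<open>z\<close> the dots strictly above the four are \<open>U\<close>, the dots
  weakly above are \<open>U\<close> with the four; the tie is visible iff the k-th place falls
  between the two counts. At \<open>- z\<close> the same holds for \<open>L\<close>.\<close>

lemma tie_visible:
  assumes "a \<in> tie (lab k I x0 p)" "p = z \<or> p = - z"
  shows "p = z \<and> card U < k \<and> k < card U + 4 \<or> p = - z \<and> card L < k \<and> k < card L + 4"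
proof -
  have za: "z \<bullet> x0 a = z \<bullet> cc" using z_x0 in_Q by blast
  have qi: "i \<in> Q \<longleftrightarrow> z \<bullet> x0 i = z \<bullet> cc" if "i \<in> I" for i
  proof (cases "i \<in> Q")
    case False
    then have "i \<in> I - {a, b, c, d}" using that unfolding Q_def by simp
    then show ?thesis using off False by simp
  qed (use z_x0 in simp)
  have ge: "z \<bullet> cc \<le> z \<bullet> x0 i \<longleftrightarrow> i \<in> U \<union> Q" "z \<bullet> x0 i \<le> z \<bullet> cc \<longleftrightarrow> i \<in> L \<union> Q" if "i \<in> I" for i
    unfolding Un_iff qi[OF that] U_def L_def using that by auto
  have Ieq: "U \<union> Q \<subseteq> I" "L \<union> Q \<subseteq> I" using parts(1) by auto
  have "card (U \<union> Q) = card U + 4" using parts by (simp add: card_Un_disjoint)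
  moreover have "card (L \<union> Q) = card L + 4" using parts by (subst card_Un_disjoint) auto
  moreover have "{j \<in> I. z \<bullet> cc \<le> z \<bullet> x0 j} = U \<union> Q" "{j \<in> I. z \<bullet> x0 j \<le> z \<bullet> cc} = L \<union> Q" using ge Ieq by blast+
  ultimately show ?thesis using assms za unfolding tie_def lab_def lo_def hi_def U_def[symmetric] L_def[symmetric]
    by (auto simp: U_def[symmetric] L_def[symmetric])
qed

text \<open>Near the wall each side is connected through regular configurations and contains a
  normal form, so the passage between any two configurations reduces to \<open>wall_crossing\<close>
  for the normal forms.\<close>

theorem crossing:
  assumes nc: "noncollinear I x0" and quad: "\<And>S. S \<subseteq> I \<Longrightarrow> card S = 4 \<Longrightarrow> in_plane x0 S \<Longrightarrow> S = Q" and kI: "k \<le> card I"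
  shows "\<exists>\<eta>>0. \<forall>x y. close I x0 \<eta> x \<longrightarrow> close I x0 \<eta> y \<longrightarrow> vol x \<noteq> 0 \<longrightarrow> vol y \<noteq> 0 \<longrightarrow> lab_isotopic k I x y \<or> wall_moves k x y"
proof -
  obtain d1 where d1: "d1 > 0" "\<And>x. close I x0 d1 x \<Longrightarrow> noncollinear I x" using noncollinear_stable[OF finI nc] by blast
  have "\<exists>\<delta>>0. \<forall>x. close I x0 \<delta> x \<longrightarrow> (\<forall>S\<in>{S. S \<subseteq> I \<and> card S = 4 \<and> S \<noteq> Q}. \<not> in_plane x S)"
  proof (rule close_finite)
    show "finite {S. S \<subseteq> I \<and> card S = 4 \<and> S \<noteq> Q}" by (rule finite_subset[of _ "Pow I"]) (use finI in auto)
    fix S assume S: "S \<in> {S. S \<subseteq> I \<and> card S = 4 \<and> S \<noteq> Q}"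
    show "\<exists>\<delta>>0. \<forall>x. close I x0 \<delta> x \<longrightarrow> \<not> in_plane x S"
      by (rule not_in_plane_stable[OF finI]) (use S quad in auto)
  qed
  then obtain d2 where d2: "d2 > 0" "\<And>x S. close I x0 d2 x \<Longrightarrow> S \<subseteq> I \<Longrightarrow> card S = 4 \<Longrightarrow> S \<noteq> Q \<Longrightarrow> \<not> in_plane x S" by blast
  define \<delta> where "\<delta> = min d1 d2"
  have \<delta>0: "0 < \<delta>" unfolding \<delta>_def using d1 d2 by simp
  have g1: "noncollinear I x" if "close I x0 \<delta> x" for x using d1(2) close_mono[OF that, of d1] unfolding \<delta>_def by simp
  have g2: "regular k I x" if x: "close I x0 \<delta> x" "vol x \<noteq> 0" for x
  proof (rule regularI[OF finI g1[OF x(1)]])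
    fix S assume S: "S \<subseteq> I" "card S = 4"
    show "\<not> in_plane x S"
    proof (cases "S = Q")
      case True
      then show ?thesis using in_plane_vol[OF nv_nz[OF g1[OF x(1)]]] x(2) by simp
    next
      case False
      then show ?thesis using d2(2)[OF _ S False] close_mono[OF x(1), of d2] unfolding \<delta>_def by simp
    qed
  qed
  obtain \<eta> where \<eta>: "\<eta> > 0" "\<eta> \<le> \<delta>" "\<And>x r. close I x0 \<eta> x \<Longrightarrow> \<bar>r\<bar> < \<eta> \<Longrightarrow> close I x0 \<delta> (set_ev x (r *\<^sub>R nv x))"
    using set_ev_close[OF \<delta>0] by blast
  have side: "lab_isotopic k I x y" if "close I x0 \<eta> x" "close I x0 \<eta> y" "0 < vol x * vol y" for x y
    by (rule same_side[where \<delta> = \<delta> and \<eta> = \<eta>]) (use kI g1 g2 \<eta> that in blast)+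
  \<comment> \<open>The normal of the unperturbed plane is parallel to \<open>z\<close>, and nearby
    normals keep the sign of their component along \<open>z\<close>. With \<open>ev_pe\<close> this
    puts \<open>pe \<gamma>\<close> and \<open>pe (- \<gamma>)\<close> on opposite sides.\<close>
  define \<tau> where "\<tau> = z \<bullet> nv x0"
  have \<tau>: "\<tau> \<noteq> 0"
  proof -
    have n0: "nv x0 \<noteq> 0" by (rule nv_nz[OF nc])
    have "sgn (nv x0) = z \<or> sgn (nv x0) = - z"
      by (rule ortho_noncollinear[of "x0 a - x0 c" "x0 b - x0 c" z "sgn (nv x0)"])
        (use n0 z1 zu zw x0 in \<open>auto simp: nv_def inner_diff inner_add inner_commute norm_sgn sgn_div_norm dot_cross_self\<close>)
    then have "nv x0 = norm (nv x0) *\<^sub>R z \<or> nv x0 = norm (nv x0) *\<^sub>R (- z)" using norm_scaleR_sgn[of "nv x0"] by metis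
    then have "z \<bullet> nv x0 = z \<bullet> (norm (nv x0) *\<^sub>R z) \<or> z \<bullet> nv x0 = z \<bullet> (norm (nv x0) *\<^sub>R (- z))" by (elim disjE) (simp only: simp_thms)+
    then show ?thesis unfolding \<tau>_def using n0 zz by auto
  qed
  let ?W = "{q :: point \<times> point \<times> point. 0 < \<tau> * (z \<bullet> cross3 (fst q - snd (snd q)) (fst (snd q) - snd (snd q)))}"
  have "open ?W" by (intro open_Collect_less continuous_on_cross continuous_intros)
  moreover have "(x0 a, x0 b, x0 c) \<in> ?W" using \<tau> unfolding \<tau>_def nv_def by (auto simp: zero_less_mult_iff linorder_neq_iff)
  ultimately obtain d3 where d3: "d3 > 0" "\<And>x. close I x0 d3 x \<Longrightarrow> 0 < \<tau> * (z \<bullet> nv x)"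
    using close_open3[of ?W x0 a b c I] inI unfolding nv_def by auto
  have vpe: "0 < (\<gamma> * \<tau>) * vol (pe \<gamma>)" if "\<gamma> \<noteq> 0" "\<bar>\<gamma>\<bar> < d3" for \<gamma>
  proof -
    have "0 < \<tau> * (z \<bullet> nv (pe \<gamma>))" by (rule d3(2)[OF pe_close[OF that(2)]])
    moreover have "0 < 2 * (\<gamma> * \<gamma>)" using that(1) by (auto simp: zero_less_mult_iff linorder_neq_iff)
    ultimately have "0 < (2 * (\<gamma> * \<gamma>)) * (\<tau> * (z \<bullet> nv (pe \<gamma>)))" by (rule mult_pos_pos[rotated])
    then show ?thesis unfolding vol_def ev_pe by (simp add: mult_ac)
  qed
  have tie3: "card (tie (lab k I x0 p)) \<le> 3 \<or> p = z \<and> card U < k \<and> k < card U + 4 \<or> p = - z \<and> card L < k \<and> k < card L + 4" if p: "p \<in> S2" for p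
  proof (cases "card (tie (lab k I x0 p)) \<le> 3")
    case False
    obtain S where S: "S \<subseteq> I" "S \<subseteq> tie (lab k I x0 p)" "card S = 4" "\<And>i j. i \<in> S \<Longrightarrow> j \<in> S \<Longrightarrow> p \<bullet> x0 i = p \<bullet> x0 j"
      using four_tied[OF finI False] by metis
    then have "in_plane x0 S" unfolding in_plane_def using p by blast
    then have SQ: "S = Q" using quad[OF S(1,3)] by blast
    have e: "p \<bullet> x0 a = p \<bullet> x0 c" "p \<bullet> x0 b = p \<bullet> x0 c" "z \<bullet> x0 a = z \<bullet> x0 c" "z \<bullet> x0 b = z \<bullet> x0 c"
      using S(4) in_Q z_x0 unfolding SQ by (metis, metis, metis, metis)
    have "p = z \<or> p = - z"
    proof (rule ortho_noncollinear)
      show "cross3 (x0 a - x0 c) (x0 b - x0 c) \<noteq> 0" using nv_nz[OF nc] unfolding nv_def .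
    qed (use e z1 p in \<open>simp_all add: inner_diff\<close>)
    then show ?thesis using tie_visible[of k p] S(2) SQ in_Q by blast
  qed simp
  have reg: "\<exists>g>0. \<forall>\<gamma>. 0 < \<bar>\<gamma>\<bar> \<longrightarrow> \<bar>\<gamma>\<bar> < g \<longrightarrow> regular k I (pe \<gamma>)"
  proof (intro exI[of _ "min \<delta> d3"] conjI allI impI)
    fix \<gamma> :: real assume "0 < \<bar>\<gamma>\<bar>" "\<bar>\<gamma>\<bar> < min \<delta> d3"
    then have "\<bar>\<gamma>\<bar> < \<delta>" "0 < (\<gamma> * \<tau>) * vol (pe \<gamma>)" using vpe[of \<gamma>] by auto
    then show "regular k I (pe \<gamma>)" by (intro g2 pe_close) (metis less_irrefl mult_zero_right)+
  qed (use \<delta>0 d3 in simp)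
  obtain e1 where e1: "e1 > 0" "\<And>\<gamma>. 0 < \<gamma> \<Longrightarrow> \<gamma> < e1 \<Longrightarrow> wall_moves k (pe \<gamma>) (pe (- \<gamma>))"
    using wall_crossing[OF nc tie3 kI reg] unfolding wall_moves_def by blast
  \<comment> \<open>The turned frame yields the crossing in the opposite direction.\<close>
  interpret R: cap_frame z w "- u" ws "- us" I x0 cc b c d a s2 s3 s4 s1 by (rule rotated)
  have Rpe: "R.pe \<gamma> = pe (- \<gamma>)" for \<gamma> by (rule pert_rotate[OF dis])
  have regR: "\<exists>g>0. \<forall>\<gamma>. 0 < \<bar>\<gamma>\<bar> \<longrightarrow> \<bar>\<gamma>\<bar> < g \<longrightarrow> regular k I (R.pe \<gamma>)"
    unfolding Rpe using reg by (metis abs_minus_cancel)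
  obtain e2 where e2: "e2 > 0" "\<And>\<gamma>. 0 < \<gamma> \<Longrightarrow> \<gamma> < e2 \<Longrightarrow> wall_moves k (pe (- \<gamma>)) (pe \<gamma>)"
    using R.wall_crossing[OF nc tie3 kI regR] unfolding wall_moves_def Rpe by auto
  have "\<exists>g>0. \<forall>y\<in>set [\<eta>, d3, e1, e2]. g \<le> y" by (rule small_common) (use \<eta>(1) d3(1) e1(1) e2(1) in auto)
  then obtain g where g: "g > 0" "g \<le> \<eta>" "g \<le> d3" "g \<le> e1" "g \<le> e2" by auto
  define \<gamma> where "\<gamma> = g / 2"
  have \<gamma>: "0 < \<gamma>" "\<gamma> < \<eta>" "\<gamma> < d3" "\<gamma> < e1" "\<gamma> < e2" unfolding \<gamma>_def using g by auto
  have pc: "close I x0 \<eta> (pe \<gamma>)" "close I x0 \<eta> (pe (- \<gamma>))" by (rule pe_close; use \<gamma> in simp)+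
  have vp: "0 < \<tau> * vol (pe \<gamma>)" "\<tau> * vol (pe (- \<gamma>)) < 0"
    using vpe[of \<gamma>] vpe[of "- \<gamma>"] \<gamma> by (auto simp: zero_less_mult_iff mult_less_0_iff mult.assoc)
  have "lab_isotopic k I x y \<or> wall_moves k x y"
    if x: "close I x0 \<eta> x" "vol x \<noteq> 0" and y: "close I x0 \<eta> y" "vol y \<noteq> 0" for x y
  proof (cases "0 < vol x * vol y")
    case True
    then show ?thesis using side[OF x(1) y(1)] by blast
  next
    case False
    then have "vol x * vol y < 0" using x(2) y(2) by (simp add: not_less order_le_less)
    then consider "0 < vol (pe \<gamma>) * vol x" "0 < vol (pe (- \<gamma>)) * vol y" | "0 < vol (pe (- \<gamma>)) * vol x" "0 < vol (pe \<gamma>) * vol y"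
      using vp by (auto simp: zero_less_mult_iff mult_less_0_iff)
    then show ?thesis
    proof cases
      case 1
      then show ?thesis
        using wall_moves_isotopic[OF e1(2)[OF \<gamma>(1,4)] side[OF pc(1) x(1)] side[OF pc(2) y(1)]] by blast
    next
      case 2
      then show ?thesis
        using wall_moves_isotopic[OF e2(2)[OF \<gamma>(1,5)] side[OF pc(2) x(1)] side[OF pc(1) y(1)]] by blast
    qed
  qed
  then show ?thesis using \<eta>(1) by blast
qed

end

section \<open>A frame for four cocircular dots\<close>

lemma not_in_hull_of_sphere:
  fixes p :: point
  assumes "p \<in> S2" "F \<subseteq> S2" "p \<notin> F"
  shows "p \<notin> convex hull F"
proof
  assume hull: "p \<in> convex hull F"
  \<comment> \<open>The tangent plane at \<open>p\<close> supports the ball and touches it at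
    \<open>p\<close> only.\<close>
  have "F \<subseteq> {y. p \<bullet> y < 1}"
  proof
    fix q assume "q \<in> F"
    then have q: "norm q = 1" "q \<noteq> p" using assms by auto
    have p: "norm p = 1" using assms by simp
    have "0 < (norm (q - p))\<^sup>2" using q by simp
    also have "(norm (q - p))\<^sup>2 = 2 - 2 * (p \<bullet> q)"
      using p q by (simp add: power2_norm_eq_inner inner_diff norm_eq_1 inner_commute)
    finally show "q \<in> {y. p \<bullet> y < 1}" by simp
  qed
  then have "convex hull F \<subseteq> {y. p \<bullet> y < 1}" by (intro hull_minimal convex_halfspace_lt)
  then show False using hull assms(1) by (auto simp: norm_eq_1)
qed

text \<open>Radon's theorem splits the coplanar points into two sets with intersecting hulls. Since
  no point of the sphere is in the hull of other points of it, neither set is a singleton, and only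
  a split into two crossing pairs is left.\<close>

lemma crossing_diagonals:
  fixes P :: "point set"
  assumes P: "P \<subseteq> S2" "card P = 4" and z: "z \<noteq> 0" "\<And>p. p \<in> P \<Longrightarrow> z \<bullet> p = v"
  obtains pa pb pc pd m r r' where "P = {pa, pb, pc, pd}" "0 < r" "r < 1" "0 < r'" "r' < 1"
    "m = (1 - r) *\<^sub>R pa + r *\<^sub>R pc" "m = (1 - r') *\<^sub>R pb + r' *\<^sub>R pd"
proof -
  have fin: "finite P" using P(2) by (metis card.infinite zero_neq_numeral)
  have "affine_dependent P"
  proof (rule ccontr)
    assume "\<not> affine_dependent P"
    then have "int (card P) = aff_dim P + 1" by (rule aff_dim_affine_independent)
    moreover have "aff_dim P \<le> aff_dim {p. z \<bullet> p = v}" by (rule aff_dim_subset) (use z(2) in auto)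
    moreover have "aff_dim {p. z \<bullet> p = v} = 2" using aff_dim_hyperplane[OF z(1)] by simp
    ultimately show False using P(2) by simp
  qed
  then obtain M N where MN: "M \<subseteq> P" "N \<subseteq> P" "M \<inter> N = {}" "(convex hull M) \<inter> (convex hull N) \<noteq> {}"
    by (rule Radon)
  then obtain m where m: "m \<in> convex hull M" "m \<in> convex hull N" by blast
  have finMN: "finite M" "finite N" using MN fin finite_subset by blast+
  have two: "2 \<le> card A" if A: "A \<subseteq> P" "B \<subseteq> P" "A \<inter> B = {}" "m \<in> convex hull A" "m \<in> convex hull B" for A B
  proof (rule ccontr)
    assume "\<not> 2 \<le> card A"
    then consider "card A = 0" | "card A = 1" by linarith
    then show False
    proof cases
      case 1
      then have "A = {}" using A(1) fin finite_subset by fastforce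
      then show False using A(4) by simp
    next
      case 2
      then obtain p where p: "A = {p}" by (rule card_1_singletonE)
      have "p \<in> S2" "B \<subseteq> S2" "p \<notin> B" "m = p" using A p P(1) by (blast, blast, blast, simp)
      then show False using A(5) not_in_hull_of_sphere[of p B] by blast
    qed
  qed
  have c: "2 \<le> card M" "2 \<le> card N" using two[of M N] two[of N M] MN m by auto
  have "card (M \<union> N) = card M + card N" by (rule card_Un_disjoint[OF finMN MN(3)])
  moreover have "card (M \<union> N) \<le> card P" using MN fin by (intro card_mono) auto
  ultimately have c2: "card M = 2" "card N = 2" "card (M \<union> N) = card P" using c P(2) by auto
  have PMN: "M \<union> N = P" by (rule card_subset_eq[OF fin _ c2(3)]) (use MN in auto)
  obtain pa pc where M: "M = {pa, pc}" using c2(1) by (auto simp: card_2_iff)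
  obtain pb pd where N: "N = {pb, pd}" using c2(2) by (auto simp: card_2_iff)
  have nm: "m \<notin> P"
  proof
    assume "m \<in> P"
    then have "m \<in> S2" "m \<in> M \<or> m \<in> N" using P(1) PMN by auto
    then show False using not_in_hull_of_sphere[of m M] not_in_hull_of_sphere[of m N] m MN P(1) by blast
  qed
  obtain r where r: "0 \<le> r" "r \<le> 1" "m = (1 - r) *\<^sub>R pa + r *\<^sub>R pc"
    using m(1) unfolding M segment_convex_hull[symmetric] in_segment by blast
  obtain r' where r': "0 \<le> r'" "r' \<le> 1" "m = (1 - r') *\<^sub>R pb + r' *\<^sub>R pd"
    using m(2) unfolding N segment_convex_hull[symmetric] in_segment by blast
  have "m \<noteq> pa" "m \<noteq> pb" "m \<noteq> pc" "m \<noteq> pd" using nm PMN M N by auto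
  then have "r \<noteq> 0" "r \<noteq> 1" "r' \<noteq> 0" "r' \<noteq> 1" using r(3) r'(3) by auto
  then show ?thesis using that[of pa pb pc pd r r' m] r r' PMN M N by auto
qed

lemma dual_basis:
  fixes u w z :: point
  assumes n: "cross3 u w \<noteq> 0" and z: "norm z = 1" "u \<bullet> z = 0" "w \<bullet> z = 0"
  obtains us ws where "cap_plane z u w us ws"
proof -
  define G where "G = (u \<bullet> u) * (w \<bullet> w) - (u \<bullet> w)\<^sup>2"
  have G: "G \<noteq> 0" unfolding G_def gram_cross3 using n by simp
  define us ws where "us = inverse G *\<^sub>R ((w \<bullet> w) *\<^sub>R u - (u \<bullet> w) *\<^sub>R w)" and "ws = inverse G *\<^sub>R ((u \<bullet> u) *\<^sub>R w - (u \<bullet> w) *\<^sub>R u)"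
  have usz: "us \<bullet> z = 0" "ws \<bullet> z = 0" unfolding us_def ws_def using z by (simp_all add: inner_diff)
  have d: "us \<bullet> u = inverse G * G" "ws \<bullet> w = inverse G * G" "us \<bullet> w = 0" "ws \<bullet> u = 0"
    unfolding us_def ws_def G_def by (simp_all add: inner_diff inner_commute power2_eq_square)
  then have dual: "us \<bullet> u = 1" "ws \<bullet> w = 1" "us \<bullet> w = 0" "ws \<bullet> u = 0" using G by auto
  have zz: "z \<bullet> z = 1" using z(1) by (simp add: norm_eq_1)
  have "p = (p \<bullet> z) *\<^sub>R z + (p \<bullet> u) *\<^sub>R us + (p \<bullet> w) *\<^sub>R ws" for p
  proof (rule ccontr)
    define r where "r = p - ((p \<bullet> z) *\<^sub>R z + (p \<bullet> u) *\<^sub>R us + (p \<bullet> w) *\<^sub>R ws)"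
    assume "p \<noteq> (p \<bullet> z) *\<^sub>R z + (p \<bullet> u) *\<^sub>R us + (p \<bullet> w) *\<^sub>R ws"
    then have r0: "r \<noteq> 0" unfolding r_def by simp
    have r: "r \<bullet> z = 0" "r \<bullet> u = 0" "r \<bullet> w = 0"
      unfolding r_def using zz usz dual z(2,3) by (simp_all add: inner_diff inner_add inner_commute)
    have "sgn r = z \<or> sgn r = - z"
      by (rule ortho_noncollinear[OF n]) (use z r r0 in \<open>simp_all add: sgn_div_norm inner_commute\<close>)
    moreover have "sgn r \<bullet> z = 0" using r(1) by (simp add: sgn_div_norm)
    ultimately show False using zz by auto
  qed
  then have "cap_plane z u w us ws" using z usz dual by (unfold_locales) auto
  then show ?thesis by (rule that)
qed

lemma frame_exists:
  fixes x :: "'i \<Rightarrow> point"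
  assumes I: "finite I" "inj_on x I" "x ` I \<subseteq> S2" and Q: "Q \<subseteq> I" "card Q = 4"
    and z: "norm z = 1" "\<And>i. i \<in> Q \<Longrightarrow> z \<bullet> x i = v" "\<And>i. i \<in> I - Q \<Longrightarrow> z \<bullet> x i \<noteq> v"
  obtains u w us ws cc a b c d s1 s2 s3 s4 where "cap_frame z u w us ws I x cc a b c d s1 s2 s3 s4" "{a, b, c, d} = Q"
proof -
  have injQ: "inj_on x Q" using I(2) Q(1) by (rule inj_on_subset)
  have c4: "card (x ` Q) = 4" using card_image[OF injQ] Q(2) by simp
  have z0: "z \<noteq> 0" using z(1) by auto
  have xQ: "x ` Q \<subseteq> S2" using I(3) Q(1) by blast
  have zv: "z \<bullet> p = v" if "p \<in> x ` Q" for p using that z(2) by blast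
  obtain pa pb pc pd m r r' where P: "x ` Q = {pa, pb, pc, pd}" "0 < r" "r < 1" "0 < r'" "r' < 1"
    "m = (1 - r) *\<^sub>R pa + r *\<^sub>R pc" "m = (1 - r') *\<^sub>R pb + r' *\<^sub>R pd"
    by (rule crossing_diagonals[OF xQ c4 z0 zv], assumption, rule that; assumption)
  have "pa \<in> x ` Q" "pb \<in> x ` Q" "pc \<in> x ` Q" "pd \<in> x ` Q" unfolding P(1) by auto
  then obtain a b c d where q: "a \<in> Q" "b \<in> Q" "c \<in> Q" "d \<in> Q" "x a = pa" "x b = pb" "x c = pc" "x d = pd"
    by (elim imageE) (rule that; simp)
  have "card {pa, pb, pc, pd} = 4" using c4 P(1) by simp
  then have dp: "distinct [pa, pb, pc, pd]" by (subst card_distinct) auto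
  then have dis: "distinct [a, b, c, d]" using q by auto
  have sub: "{a, b, c, d} \<subseteq> Q" using q by auto
  have "card {a, b, c, d} = 4" using dis by simp
  then have QE: "{a, b, c, d} = Q" using sub Q(2) by (metis card.infinite card_subset_eq zero_neq_numeral)
  \<comment> \<open>With the full diagonals as directions the scale factors of the frame are the
    coefficients of the crossing point: \<open>r\<close>, \<open>r'\<close>, \<open>1 - r\<close>
    and \<open>1 - r'\<close>.\<close>
  define u w where "u = pa - pc" and "w = pb - pd"
  have xs: "x a = m + r *\<^sub>R u" "x c = m - (1 - r) *\<^sub>R u" "x b = m + r' *\<^sub>R w" "x d = m - (1 - r') *\<^sub>R w"
  proof -
    show "x a = m + r *\<^sub>R u" "x c = m - (1 - r) *\<^sub>R u" unfolding q P(6) u_def by (simp_all add: algebra_simps)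
    show "x b = m + r' *\<^sub>R w" "x d = m - (1 - r') *\<^sub>R w" unfolding q P(7) w_def by (simp_all add: algebra_simps)
  qed
  have zm: "z \<bullet> x a = v" "z \<bullet> x b = v" "z \<bullet> x c = v" "z \<bullet> x d = v" using z(2) q by auto
  have zu: "u \<bullet> z = 0" "w \<bullet> z = 0" unfolding u_def w_def using zm q by (simp_all add: inner_diff inner_commute)
  have zcc: "z \<bullet> m = v" unfolding P(6) using zm q by (simp add: inner_add left_diff_distrib)
  have "noncollinear I x" by (rule noncollinear_sphere[OF I(2,3)])
  moreover have "a \<in> I" "b \<in> I" "c \<in> I" using q Q(1) by blast+
  ultimately have "cross3 (x a - x c) (x b - x c) \<noteq> 0" using dis unfolding noncollinear_def by auto
  moreover have "x a - x c = u" "x b - x c = r' *\<^sub>R w + (1 - r) *\<^sub>R u" unfolding xs by (simp_all add: algebra_simps)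
  ultimately have "r' *\<^sub>R cross3 u w \<noteq> 0" by (simp add: cross_add_right cross_mult_right cross_refl)
  then have n: "cross3 u w \<noteq> 0" by auto
  obtain us ws where pl: "cap_plane z u w us ws" using dual_basis[OF n z(1) zu] .
  have "cap_frame z u w us ws I x m a b c d r r' (1 - r) (1 - r')"
    unfolding cap_frame_def cap_frame_axioms_def
    using pl I(1) dis QE Q(1) P(2-5) xs z(3) zcc by auto
  then show ?thesis using QE by (rule that)
qed

lemma in_plane_cocircular:
  assumes "inj_on x I" "x ` I \<subseteq> S2" "S \<subseteq> I" "card S = 4" "in_plane x S"
  shows "x ` S \<in> cocircular_quadruples (x ` I)"
proof -
  have inj: "inj_on x S" using assms(1,3) by (rule inj_on_subset)
  have "S \<noteq> {}" using assms(4) by auto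
  then obtain i where i: "i \<in> S" by blast
  have "card (S - {i}) = 3" using assms(4) i by simp
  then have "S - {i} \<noteq> {}" by (metis card.empty zero_neq_numeral)
  then obtain j where j: "j \<in> S" "j \<noteq> i" by blast
  obtain p where p: "p \<in> S2" "\<And>l. l \<in> S \<Longrightarrow> p \<bullet> x l = p \<bullet> x i" using assms(5) i unfolding in_plane_def by blast
  let ?C = "{y \<in> S2. p \<bullet> y = p \<bullet> x i}"
  have "x ` S \<subseteq> S2" using assms(2,3) by blast
  then have sub: "x ` S \<subseteq> ?C" using p(2) by blast
  have "x i \<noteq> x j" using inj i j by (auto dest: inj_onD)
  then have "is_circle ?C" unfolding is_circle_def using p(1) sub i j
    by (intro exI[of _ p] exI[of _ "p \<bullet> x i"] conjI) auto
  then show ?thesis unfolding cocircular_quadruples_def cocircular_def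
    using sub card_image[OF inj] assms(3,4) by auto
qed

lemma regular_general_position:
  assumes "finite I" "inj_on x I" "x ` I \<subseteq> S2" "general_position (x ` I)"
  shows "regular k I x"
proof (rule regularI[OF assms(1) noncollinear_sphere[OF assms(2,3)]])
  fix S assume "S \<subseteq> I" "card S = 4"
  then show "\<not> in_plane x S" using in_plane_cocircular[OF assms(2,3)] assms(4) unfolding general_position_def by blast
qed

section \<open>Assembling the moves along the family\<close>

lemma isotopic_gr: "label_isotopic \<Lambda> \<Lambda>' \<Longrightarrow> isotopic (gr k \<Lambda>) (gr k \<Lambda>')"
  unfolding label_isotopic_def using gr_isotopic by metis

lemma lab_cong: "(\<And>i. i \<in> I \<Longrightarrow> x i = y i) \<Longrightarrow> lab k I x p = lab k I y p"
  unfolding lab_def using lo_cong[of I "\<lambda>i. p \<bullet> x i" "\<lambda>i. p \<bullet> y i"] hi_cong[of I "\<lambda>i. p \<bullet> x i" "\<lambda>i. p \<bullet> y i"] by simp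

lemma (in cap_frame) related_by_wall_moves:
  assumes "wall_moves k x y" and vis: "card U < k \<and> k < card U + 4 \<or> card L < k \<and> k < card L + 4"
  shows "related_by_one_move (gr k (lab k I x)) (gr k (lab k I y)) \<or> related_by_two_antipodal_moves (gr k (lab k I x)) (gr k (lab k I y))"
proof -
  obtain A C h and B :: "point \<Rightarrow> 'i labels" where W: "0 < h" "label_isotopic A (lab k I x)" "label_isotopic C (lab k I y)"
    "if card U < k \<and> k < card U + 4 then local_move z h (gr k A) (gr k B) else gr k A = gr k B"
    "if card L < k \<and> k < card L + 4 then local_move (- z) h (gr k B) (gr k C) else gr k B = gr k C"
    using assms(1) unfolding wall_moves_def by (elim exE conjE) (rule that)
  have iA: "isotopic (gr k (lab k I x)) (gr k A)" and iC: "isotopic (gr k C) (gr k (lab k I y))"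
    using isotopic_gr label_isotopic_sym W(2,3) by blast+
  show ?thesis
  proof (cases "card U < k \<and> k < card U + 4")
    case True
    then have AB: "local_move z h (gr k A) (gr k B)" using W(4) by simp
    show ?thesis
    proof (cases "card L < k \<and> k < card L + 4")
      case True
      then have "local_move (- z) h (gr k B) (gr k C)" using W(5) by simp
      then show ?thesis unfolding related_by_two_antipodal_moves_def using W(1) iA AB iC by blast
    next
      case False
      then have "gr k B = gr k C" using W(5) by simp
      then show ?thesis unfolding related_by_one_move_def using iA AB iC by metis
    qed
  next
    case False
    then have "gr k A = gr k B" using W(4) by simp
    moreover have "card L < k \<and> k < card L + 4" using vis False by blast
    then have "local_move (- z) h (gr k B) (gr k C)" using W(5) by simp
    ultimately show ?thesis unfolding related_by_one_move_def using iA iC by metis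
  qed
qed

theorem lemma20:
  fixes k n :: nat
    and D D' :: "point set"
    and F :: "real \<Rightarrow> point set"
  assumes "0 < k" and "k < n" and "3 < n"
    and "configuration n D" and "general_position D"
    and "configuration n D'" and "general_position D'"
    and "semigeneral_family n F D D'"
    and "\<exists>!t. t \<in> {0..1} \<and> \<not> general_position (F t)"
  shows "related_by_one_move (voronoi k D) (voronoi k D') \<or>
         related_by_two_antipodal_moves (voronoi k D) (voronoi k D') \<or>
         voronoi_unchanged_along k F"
proof -
  note k = assms(1-3) and gp = assms(5,7)
  have path: "configuration_path n F" and ends: "F 0 = D" "F 1 = D'"
    and one: "\<And>t Q Q'. t \<in> {0..1} \<Longrightarrow> Q \<in> cocircular_quadruples (F t) \<Longrightarrow> Q' \<in> cocircular_quadruples (F t) \<Longrightarrow> Q = Q'"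
    using assms(8) unfolding semigeneral_family_def by blast+
  have conf: "F t \<subseteq> S2" "finite (F t)" "card (F t) = n" if "t \<in> {0..1}" for t
    using path that unfolding configuration_path_def configuration_def by blast+
  obtain \<phi> where \<phi>: "\<And>d. d \<in> D \<Longrightarrow> \<phi> 0 d = d" "\<And>d. d \<in> D \<Longrightarrow> continuous_on {0..1} (\<lambda>t. \<phi> t d)"
    "\<And>t. t \<in> {0..1} \<Longrightarrow> bij_betw (\<phi> t) D (F t)"
    using configuration_path_lift[OF path] unfolding ends by blast
  have D: "finite D" "card D = n" "D \<subseteq> S2" using conf[of 0] ends by auto
  have kD: "k \<le> card D" "3 \<le> card D" "k < card D" "3 < card D" using D(2) k by auto
  have img: "\<phi> t ` D = F t" "inj_on (\<phi> t) D" "\<phi> t ` D \<subseteq> S2" if "t \<in> {0..1}" for t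
    using \<phi>(3)[OF that] conf(1)[OF that] unfolding bij_betw_def by auto
  obtain t0 where t0: "t0 \<in> {0..1}" "\<And>t. t \<in> {0..1} \<Longrightarrow> t \<noteq> t0 \<Longrightarrow> general_position (F t)"
    using assms(9) by blast
  have t01: "0 < t0" "t0 < 1"
  proof -
    have "\<not> general_position (F t0)" using assms(9) t0 by blast
    then have "t0 \<noteq> 0" "t0 \<noteq> 1" using ends gp by auto
    then show "0 < t0" "t0 < 1" using t0(1) by auto
  qed
  have reg: "regular k D (\<phi> t)" if "t \<in> {0..1}" "t \<noteq> t0" for t
    by (rule regular_general_position[OF D(1) img(2,3)[OF that(1)]]) (simp add: img(1)[OF that(1)] t0(2)[OF that])
  have iso: "lab_isotopic k D (\<phi> s) (\<phi> t)"
    if "0 \<le> s" "s \<le> t" "t \<le> 1" "\<And>r. r \<in> {s..t} \<Longrightarrow> regular k D (\<phi> r)" for s t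
  proof (rule lab_isotopic_path[OF D(1) kD(2,1) that(2)])
    show "continuous_on {s..t} (\<lambda>t. \<phi> t i)" if "i \<in> D" for i
      by (rule continuous_on_subset[OF \<phi>(2)[OF that]]) (use \<open>0 \<le> s\<close> \<open>t \<le> 1\<close> in auto)
  qed (rule that(4))
  have vor: "voronoi k (F t) = gr k (lab k D (\<phi> t))" if "t \<in> {0..1}" "t \<noteq> t0" for t
    using voronoi_eq_gr[OF conf(2,1)[OF that(1)] t0(2)[OF that] k(1)] conf(3)[OF that(1)] k gr_lab_image[OF img(2)[OF that(1)], of k]
    unfolding img(1)[OF that(1)] by simp
  have V: "voronoi k D = gr k (lab k D (\<phi> 0))" "voronoi k D' = gr k (lab k D (\<phi> 1))"
    using vor[of 0] vor[of 1] t01 ends by auto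
  have unchanged: "voronoi_unchanged_along k F" if ends_isotopic: "lab_isotopic k D (\<phi> 0) (\<phi> 1)"
  proof -
    obtain H where H: "isotopy_of_sphere H" "\<And>p. p \<in> S2 \<Longrightarrow> lab k D (\<phi> 1) (H 1 p) = lab k D (\<phi> 0) p"
      using ends_isotopic unfolding label_isotopic_def by blast
    have "D_minus k (F 1) (H 1 p) = \<phi> 1 ` D_minus k (F 0) p \<and> D_plus k (F 1) (H 1 p) = \<phi> 1 ` D_plus k (F 0) p" if p: "p \<in> S2" for p
    proof -
      have Hp: "H 1 p \<in> S2" using isotopy_maps(1)[OF H(1), of 1] p by auto
      have F1: "finite (F 1)" "F 1 \<subseteq> S2" "k < card (F 1)" using conf[of 1] k by auto
      have l0: "lab k D (\<phi> 0) p = lab k D (\<lambda>d. d) p" by (rule lab_cong) (rule \<phi>(1))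
      have m1: "fst (lab k (F 1) (\<lambda>d. d) q) = \<phi> 1 ` fst (lab k D (\<phi> 1) q)" "snd (lab k (F 1) (\<lambda>d. d) q) = \<phi> 1 ` snd (lab k D (\<phi> 1) q)" for q
        using lab_image[OF img(2), of 1 k q] img(1)[of 1] by auto
      show ?thesis
        unfolding D_minus_plus_lab[OF F1(1,2) Hp k(1) F1(3)] m1 H(2)[OF p] l0 ends(1)
        unfolding D_minus_plus_lab[OF D(1,3) p k(1) kD(3)] by simp
    qed
    then show ?thesis unfolding voronoi_unchanged_along_def ends(1) using \<phi> H(1) by blast
  qed
  show ?thesis
  \<comment> \<open>If the four cocircular dots are not tied at the k-th place from either center of
    their circle, even the exceptional configuration is regular and nothing happens at order
    k.\<close>
  proof (cases "regular k D (\<phi> t0)")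
    case True
    then have "lab_isotopic k D (\<phi> 0) (\<phi> 1)" by (intro iso) (use reg in \<open>force+\<close>)
    then show ?thesis using unchanged by blast
  next
    case False
    have nc: "noncollinear D (\<phi> t0)" by (rule noncollinear_sphere[OF img(2,3)[OF t0(1)]])
    then obtain z where z: "z \<in> S2" "\<not> card (tie (lab k D (\<phi> t0) z)) \<le> 3" using False unfolding regular_def by blast
    obtain Q where Q: "Q \<subseteq> D" "Q \<subseteq> tie (lab k D (\<phi> t0) z)" "card Q = 4" "\<And>i j. i \<in> Q \<Longrightarrow> j \<in> Q \<Longrightarrow> z \<bullet> \<phi> t0 i = z \<bullet> \<phi> t0 j"
      using four_tied[OF D(1) z(2)] by metis
    have uniq: "S = S'" if "S \<subseteq> D" "card S = 4" "in_plane (\<phi> t0) S" "S' \<subseteq> D" "card S' = 4" "in_plane (\<phi> t0) S'" for S S'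
    proof -
      have "\<phi> t0 ` S \<in> cocircular_quadruples (F t0)" "\<phi> t0 ` S' \<in> cocircular_quadruples (F t0)"
        using in_plane_cocircular[OF img(2,3)[OF t0(1)]] that unfolding img(1)[OF t0(1)] by auto
      then show ?thesis using one[OF t0(1)] inj_on_image_eq_iff[OF img(2)[OF t0(1)] that(1,4)] by blast
    qed
    have inQ: "in_plane (\<phi> t0) Q" unfolding in_plane_def using Q(4) z(1) by blast
    have quad: "S = Q" if "S \<subseteq> D" "card S = 4" "in_plane (\<phi> t0) S" for S
      by (rule uniq[OF that Q(1,3) inQ])
    have "Q \<noteq> {}" using Q(3) by auto
    then obtain a0 where a0: "a0 \<in> Q" by blast
    \<comment> \<open>A fifth dot on the circle could replace \<open>a0\<close> and would give a
      second cocircular quadruple.\<close>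
    have off: "z \<bullet> \<phi> t0 i \<noteq> z \<bullet> \<phi> t0 a0" if i: "i \<in> D - Q" for i
    proof
      assume eq: "z \<bullet> \<phi> t0 i = z \<bullet> \<phi> t0 a0"
      have finQ: "finite Q" using Q(1) D(1) finite_subset by blast
      have "card (insert i (Q - {a0})) = 4" using Q(3) a0 i finQ by simp
      moreover have "in_plane (\<phi> t0) (insert i (Q - {a0}))" unfolding in_plane_def
      proof (intro bexI[OF _ z(1)] ballI)
        have "z \<bullet> \<phi> t0 l = z \<bullet> \<phi> t0 a0" if "l \<in> insert i (Q - {a0})" for l using that eq Q(4)[OF _ a0] by auto
        then show "z \<bullet> \<phi> t0 l = z \<bullet> \<phi> t0 m" if "l \<in> insert i (Q - {a0})" "m \<in> insert i (Q - {a0})" for l m using that by metis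
      qed
      moreover have "insert i (Q - {a0}) \<subseteq> D" using Q(1) i by blast
      ultimately have "insert i (Q - {a0}) = Q" by (intro quad)
      then show False using i by blast
    qed
    have zQ: "z \<bullet> \<phi> t0 i = z \<bullet> \<phi> t0 a0" if "i \<in> Q" for i by (rule Q(4)[OF that a0])
    have z1: "norm z = 1" using z(1) by simp
    obtain u w us ws cc a b c d s1 s2 s3 s4 where fr: "cap_frame z u w us ws D (\<phi> t0) cc a b c d s1 s2 s3 s4" and abcd: "{a, b, c, d} = Q"
    proof (rule frame_exists[OF D(1) img(2,3)[OF t0(1)] Q(1,3) z1])
      show "z \<bullet> \<phi> t0 i = z \<bullet> \<phi> t0 a0" if "i \<in> Q" for i by (rule zQ[OF that])
      show "z \<bullet> \<phi> t0 i \<noteq> z \<bullet> \<phi> t0 a0" if "i \<in> D - Q" for i by (rule off[OF that])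
    qed (rule that)
    interpret C: cap_frame z u w us ws D "\<phi> t0" cc a b c d s1 s2 s3 s4 by (rule fr)
    have CQ: "C.Q = Q" unfolding C.Q_def by (rule abcd)
    have "a \<in> tie (lab k D (\<phi> t0) z)" using Q(2) abcd by blast
    then have vis: "card C.U < k \<and> k < card C.U + 4 \<or> card C.L < k \<and> k < card C.L + 4" using C.tie_visible[of k z] by blast
    have quadC: "S = C.Q" if "S \<subseteq> D" "card S = 4" "in_plane (\<phi> t0) S" for S unfolding CQ by (rule quad[OF that])
    obtain \<eta> where \<eta>: "\<eta> > 0" "\<And>x y. close D (\<phi> t0) \<eta> x \<Longrightarrow> close D (\<phi> t0) \<eta> y \<Longrightarrow> C.vol x \<noteq> 0 \<Longrightarrow> C.vol y \<noteq> 0 \<Longrightarrow>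
      lab_isotopic k D x y \<or> C.wall_moves k x y"
      using C.crossing[OF nc quadC kD(1)] by blast
    have "\<exists>e>0. \<forall>s\<in>{0..1}. \<bar>s - t0\<bar> < e \<longrightarrow> (\<forall>i\<in>D. norm (\<phi> s i - \<phi> t0 i) < \<eta>)"
      by (rule uniformly_near[OF D(1) _ t0(1) \<eta>(1)]) (rule \<phi>(2))
    then obtain e where e: "e > 0" "\<And>s. s \<in> {0..1} \<Longrightarrow> \<bar>s - t0\<bar> < e \<Longrightarrow> close D (\<phi> t0) \<eta> (\<phi> s)"
      unfolding close_def by blast
    \<comment> \<open>Times just before and just after the exceptional one, clamped to the unit
      interval, at which the dots are already within the range of \<open>crossing\<close>.\<close>
    define t1 t2 where "t1 = max 0 (t0 - e / 2)" and "t2 = min 1 (t0 + e / 2)"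
    have t12: "0 \<le> t1" "t1 < t0" "t0 < t2" "t2 \<le> 1" "\<bar>t1 - t0\<bar> < e" "\<bar>t2 - t0\<bar> < e" unfolding t1_def t2_def using t01 e(1) by auto
    have vol: "C.vol (\<phi> t) \<noteq> 0" if t: "t \<in> {0..1}" "t \<noteq> t0" for t
    proof
      assume 0: "C.vol (\<phi> t) = 0"
      have "noncollinear D (\<phi> t)" by (rule noncollinear_sphere[OF img(2,3)[OF t(1)]])
      then have "in_plane (\<phi> t) Q" using C.in_plane_vol[OF C.nv_nz] 0 CQ by metis
      then show False using in_plane_cocircular[OF img(2,3)[OF t(1)] Q(1,3)] t0(2)[OF t] unfolding img(1)[OF t(1)] general_position_def by blast
    qed
    have i1: "lab_isotopic k D (\<phi> 0) (\<phi> t1)" by (rule iso) (use t12 t01 reg in auto)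
    have i2: "lab_isotopic k D (\<phi> t2) (\<phi> 1)" by (rule iso) (use t12 t01 reg in auto)
    \<comment> \<open>The first alternative covers a family that touches the wall and retreats to
      the side it came from.\<close>
    have "lab_isotopic k D (\<phi> t1) (\<phi> t2) \<or> C.wall_moves k (\<phi> t1) (\<phi> t2)"
      by (rule \<eta>(2)[OF e(2) e(2) vol vol]) (use t12 t01 in auto)
    then show ?thesis
    proof
      assume "lab_isotopic k D (\<phi> t1) (\<phi> t2)"
      then have "lab_isotopic k D (\<phi> 0) (\<phi> 1)" using label_isotopic_trans[OF label_isotopic_trans[OF i1] i2] by blast
      then show ?thesis using unchanged by blast
    next
      assume "C.wall_moves k (\<phi> t1) (\<phi> t2)"
      then have "C.wall_moves k (\<phi> 0) (\<phi> 1)" by (rule C.wall_moves_isotopic[OF _ label_isotopic_sym[OF i1] i2])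
      then show ?thesis unfolding V using C.related_by_wall_moves[OF _ vis] by blast
    qed
  qed
qed

end
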